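(* Let $n\ge3$, let $\mathcal J_n$ be the Jones monoid of degree $n$, and let $z\in\{0,1\}$ with $z\equiv n\pmod2$. (i) The ideals of $\mathcal J_n$ are exactly the sets $I_q=\{\alpha\in\mathcal J_n:\operatorname{rank}(\alpha)\le q\}$ for $q=z,z+2,\dots,n$, yielding the Rees congruences $R_q=R_{I_q}$. (ii) For $n$ odd, the only retractable IN-pair $(I,M)$ of $\mathcal J_n$ with $M=\{\overline{\mathrm{id}}_q\}$ for some $q$ is $\mathscr C_1=(I_1,\{\overline{\mathrm{id}}_3\})$, yielding the congruences $\lambda_1,\rho_1,\mu_1$. (iii) For $n$ even, the retractable IN-pairs $(I,M)$ of $\mathcal J_n$ with $M=\{\overline{\mathrm{id}}_q\}$ for some $q$ are exactly $\mathscr C_0=(I_0,\{\overline{\mathrm{id}}_2\})$ and $\mathscr C_2=(I_2,\{\overline{\mathrm{id}}_4\})$, yielding the congruences $\lambda_0,\rho_0,\mu_0$ and $\lambda_2,\rho_2,\mu_2$, respectively. (iv) The congruences listed in (i)–(iii) (namely $R_z,R_{z+2},\dots,R_n$, together with $\lambda_1,\rho_1,\mu_1$ if $n$ is odd, or $\lambda_0,\rho_0,\mu_0,\lambda_2,\rho_2,\mu_2$ if $n$ is even) are pairwise distinct, and they are all the congruences of $\mathcal J_n$. (v) The order (inclusion) on $\operatorname{Cong}(\mathcal J_n)$ is as follows. For $n$ odd: $\mu_1=\Delta$ is the bottom, it is covered by $\lambda_1$ and $\rho_1$, which are incomparable and both covered by $R_1$, and the rest is the chain $R_1\subsetneq R_3\subsetneq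 R_5\subsetneq\cdots\subsetneq R_n=\nabla$. For $n$ even: the eight congruences $\xi_i$ with $\xi\in\{\mu,\lambda,\rho,R\}$ and $i\in\{0,2\}$ form the direct product of the four-element diamond $\mu<\lambda,\rho<R$ (with $\lambda,\rho$ incomparable) and the chain $0<2$ (that is, $\xi_i\subseteq\zeta_j$ iff $\xi\le\zeta$ in the diamond and $i\le j$), with bottom $\mu_0=\Delta$ and top $R_2$, and the rest is the chain $R_2\subsetneq R_4\subsetneq R_6\subsetneq\cdots\subsetneq R_n=\nabla$. (vi) The $*$-congruences of $\mathcal J_n$ are precisely all the congruences of $\mathcal J_n$ other than $\lambda_1,\rho_1$ (for $n$ odd), or other than $\lambda_0,\lambda_2,\rho_0,\rho_2$ (for $n$ even); that is, they are $R_z,R_{z+2},\dots,R_n$, together with $\mu_1$ if $n$ is odd, or $\mu_0,\mu_2$ if $n$ is even.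
   Context: **Jones monoid.** Let $\mathbf n=\{1,\dots,n\}$, $\mathbf n'=\{1',\dots,n'\}$. The partition monoid $\mathcal P_n$ is the set of all set partitions of $\mathbf n\cup\mathbf n'$. To form $\alpha\beta$: rename each lower point $i'$ of $\alpha$ to $i''$ and each upper point $i$ of $\beta$ to $i''$, and consider the graph on $\mathbf n\cup\mathbf n''\cup\mathbf n'$ whose edges join points lying in a common block of (renamed) $\alpha$ or of (renamed) $\beta$; two points of $\mathbf n\cup\mathbf n'$ lie in the same block of $\alpha\beta$ iff they are connected by a path in this graph. Draw the points $1,\dots,n$ in order on an upper row and $1',\dots,n'$ directly below on a lower row. $\mathcal J_n$ is the submonoid of all $\alpha\in\mathcal P_n$ all of whose blocks have size exactly $2$ and which are planar, i.e. the blocks, viewed as edges, can be drawn inside the rectangle spanned by the vertices without crossings. A block is a transversal if it meets both $\mathbf n$ and $\mathbf n'$; $\operatorname{rank}(\alpha)$ is the number of transversals of $\alpha$. The involution $\alpha\mapsto\alpha^*$ interchanges $i$ and $i'$ for every $i$; a $*$-congruence is a congruence $\xi$ such that $(\alpha,\beta)\in\xi$ implies $(\alpha^*,\beta^* )\in\xi$. The $\mathscr J$-classes of $\mathcal J_n$ are $J_q=\{\alpha:\operatorname{rank}(\alpha)=q\}$, $q=z,z+2,\dots,n$; all maximal subgroups are trivial; the minimal ideal is $I_z=J_z$. For $q\equiv n\pmod2$, $\overline{\mathrm{id}}_q\in J_q$ is the idempotent with transversals $\{i,i'\}$ ($1\le i\le q$), upper blocks $\{q+1,q+2\},\dots,\{n-1,n\}$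 and lower blocks $\{(q+1)',(q+2)'\},\dots,\{(n-1)',n'\}$. **General constructions**, for a finite semigroup $S$ with minimal ideal $M$. $S^1$ is $S$ with an identity adjoined if necessary; $\mathscr R,\mathscr L,\mathscr H,\mathscr J$ are Green's relations; the $\mathscr J$-classes are ordered by $J_a\le J_b$ iff $a\in S^1bS^1$. $\Delta=\{(a,a):a\in S\}$, $\nabla=S\times S$. Ideals are non-empty. The Rees congruence of an ideal $I$ is $R_I=\Delta\cup(I\times I)$. An ideal $I$ is retractable if there is a homomorphism $f:I\to M$ (a retraction) with $xf=x$ for all $x\in M$; such $f$ is then unique. An IN-pair is a pair $(I,N)$ where $I$ is an ideal and $N$ is a normal subgroup of a maximal subgroup of $S$ contained in some regular $\mathscr J$-class $J$ that is minimal among the $\mathscr J$-classes contained in $S\setminus I$. Put $\nu_N=\{(sxt,syt)\in J\times J: x,y\in N,\ s,t\in S^1\}$ (which is the equality relation on $J$ if $|N|=1$). The IN-pair is retractable if $I$ is retractable and $|xN|=|Nx|=1$ for all $x\in M$; then, with $f:I\to M$ the retraction, $\lambda_{I,N}=\Delta\cup\nu_N\cup\{(x,y)\in I\times I:xf\mathrel{\mathscr L}yf\}$, $\rho_{I,N}=\Delta\cup\nu_N\cup\{(x,y)\in I\times I:xf\mathrel{\mathscr R}yf\}$, $\mu_{I,N}=\Delta\cup\nu_N\cup\{(x,y)\in I\times I:xf\mathrel{\mathscr H}yf\}$. **Abbreviations.** $\lambda_i=\lambda_{\mathscr C_i}$, $\rho_i=\rho_{\mathscr C_i}$, $\mu_i=\mu_{\mathscr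 C_i}$. *)

theory Defs
  imports "HOL-Analysis.Analysis" "HOL-Library.Disjoint_Sets" "HOL-Algebra.Coset"
begin

section \<open>Congruences, ideals and IN-pairs\<close>

text \<open>
  The constructions below are stated for HOL-Algebra monoid records. The semigroup they are used
  for is a monoid, so \<open>S\<^sup>1 = S\<close> and \<open>s, t \<in> S\<^sup>1\<close> just means \<open>s, t \<in> carrier S\<close>.
\<close>

definition congruence :: "('a, 'b) monoid_scheme \<Rightarrow> 'a rel \<Rightarrow> bool" where
  "congruence S \<xi> \<longleftrightarrow> equiv (carrier S) \<xi> \<and>
     (\<forall>(a, b) \<in> \<xi>. \<forall>c \<in> carrier S.
        (c \<otimes>\<^bsub>S\<^esub> a, c \<otimes>\<^bsub>S\<^esub> b) \<in> \<xi> \<and> (a \<otimes>\<^bsub>S\<^esub> c, b \<otimes>\<^bsub>S\<^esub> c) \<in> \<xi>)"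

definition Cong :: "('a, 'b) monoid_scheme \<Rightarrow> 'a rel set" where
  "Cong S = {\<xi>. congruence S \<xi>}"

definition semigroup_ideal :: "('a, 'b) monoid_scheme \<Rightarrow> 'a set \<Rightarrow> bool" where
  "semigroup_ideal S I \<longleftrightarrow> I \<noteq> {} \<and> I \<subseteq> carrier S \<and>
     (\<forall>s \<in> carrier S. \<forall>x \<in> I. s \<otimes>\<^bsub>S\<^esub> x \<in> I \<and> x \<otimes>\<^bsub>S\<^esub> s \<in> I)"

definition minimal_ideal :: "('a, 'b) monoid_scheme \<Rightarrow> 'a set" where
  "minimal_ideal S = (THE M. semigroup_ideal S M \<and> (\<forall>I. semigroup_ideal S I \<longrightarrow> I \<subseteq> M \<longrightarrow> I = M))"

definition left_principal :: "('a, 'b) monoid_scheme \<Rightarrow> 'a \<Rightarrow> 'a set" where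
  "left_principal S a = {s \<otimes>\<^bsub>S\<^esub> a | s. s \<in> carrier S}"

definition right_principal :: "('a, 'b) monoid_scheme \<Rightarrow> 'a \<Rightarrow> 'a set" where
  "right_principal S a = {a \<otimes>\<^bsub>S\<^esub> s | s. s \<in> carrier S}"

definition principal :: "('a, 'b) monoid_scheme \<Rightarrow> 'a \<Rightarrow> 'a set" where
  "principal S a = {s \<otimes>\<^bsub>S\<^esub> a \<otimes>\<^bsub>S\<^esub> t | s t. s \<in> carrier S \<and> t \<in> carrier S}"

definition green_L :: "('a, 'b) monoid_scheme \<Rightarrow> 'a rel" where
  "green_L S = {(a, b) \<in> carrier S \<times> carrier S. left_principal S a = left_principal S b}"

definition green_R :: "('a, 'b) monoid_scheme \<Rightarrow> 'a rel" where
  "green_R S = {(a, b) \<in> carrier S \<times> carrier S. right_principal S a = right_principal S b}"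

definition green_H :: "('a, 'b) monoid_scheme \<Rightarrow> 'a rel" where
  "green_H S = green_L S \<inter> green_R S"

definition green_J :: "('a, 'b) monoid_scheme \<Rightarrow> 'a rel" where
  "green_J S = {(a, b) \<in> carrier S \<times> carrier S. principal S a = principal S b}"

definition J_classes :: "('a, 'b) monoid_scheme \<Rightarrow> 'a set set" where
  "J_classes S = carrier S // green_J S"

definition J_class_le :: "('a, 'b) monoid_scheme \<Rightarrow> 'a set \<Rightarrow> 'a set \<Rightarrow> bool" where
  "J_class_le S A B \<longleftrightarrow> (\<exists>a \<in> A. \<exists>b \<in> B. a \<in> principal S b)"

definition regular_subset :: "('a, 'b) monoid_scheme \<Rightarrow> 'a set \<Rightarrow> bool" where
  "regular_subset S A \<longleftrightarrow> (\<forall>a \<in> A. \<exists>x \<in> carrier S. a \<otimes>\<^bsub>S\<^esub> x \<otimes>\<^bsub>S\<^esub> a = a)"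

definition rees :: "('a, 'b) monoid_scheme \<Rightarrow> 'a set \<Rightarrow> 'a rel" where
  "rees S I = Id_on (carrier S) \<union> I \<times> I"

definition ideal_retraction :: "('a, 'b) monoid_scheme \<Rightarrow> 'a set \<Rightarrow> ('a \<Rightarrow> 'a) \<Rightarrow> bool" where
  "ideal_retraction S I f \<longleftrightarrow>
     f \<in> hom (S\<lparr>carrier := I\<rparr>) (S\<lparr>carrier := minimal_ideal S\<rparr>) \<and> (\<forall>x \<in> minimal_ideal S. f x = x)"

definition retractable_ideal :: "('a, 'b) monoid_scheme \<Rightarrow> 'a set \<Rightarrow> bool" where
  "retractable_ideal S I \<longleftrightarrow> semigroup_ideal S I \<and> (\<exists>f. ideal_retraction S I f)"

text \<open>
  A group inside a semigroup has its own identity \<open>e\<close>, usually different from \<open>\<one>\<close>.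
\<close>

definition group_within :: "('a, 'b) monoid_scheme \<Rightarrow> 'a set \<Rightarrow> 'a \<Rightarrow> bool" where
  "group_within S G e \<longleftrightarrow> G \<subseteq> carrier S \<and> group (S\<lparr>carrier := G, one := e\<rparr>)"

definition maximal_subgroup :: "('a, 'b) monoid_scheme \<Rightarrow> 'a set \<Rightarrow> 'a \<Rightarrow> bool" where
  "maximal_subgroup S G e \<longleftrightarrow> group_within S G e \<and>
     (\<forall>G' e'. group_within S G' e' \<longrightarrow> G \<subseteq> G' \<longrightarrow> G' = G)"

definition IN_pair :: "('a, 'b) monoid_scheme \<Rightarrow> 'a set \<Rightarrow> 'a set \<Rightarrow> bool" where
  "IN_pair S I N \<longleftrightarrow> semigroup_ideal S I \<and>
     (\<exists>J G e. J \<in> J_classes S \<and> regular_subset S J \<and> J \<subseteq> carrier S - I \<and>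
        (\<forall>K \<in> J_classes S. K \<subseteq> carrier S - I \<longrightarrow> J_class_le S K J \<longrightarrow> K = J) \<and>
        maximal_subgroup S G e \<and> G \<subseteq> J \<and> N \<lhd> S\<lparr>carrier := G, one := e\<rparr>)"

definition retractable_IN_pair :: "('a, 'b) monoid_scheme \<Rightarrow> 'a set \<Rightarrow> 'a set \<Rightarrow> bool" where
  "retractable_IN_pair S I N \<longleftrightarrow> IN_pair S I N \<and> retractable_ideal S I \<and>
     (\<forall>x \<in> minimal_ideal S. card (x <#\<^bsub>S\<^esub> N) = 1 \<and> card (N #>\<^bsub>S\<^esub> x) = 1)"

text \<open>
  In an IN-pair the set \<open>N\<close> is non-empty and lies in a single J-class, so \<open>green_J S `` N\<close> is the
  J-class containing \<open>N\<close>.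
\<close>

definition nu :: "('a, 'b) monoid_scheme \<Rightarrow> 'a set \<Rightarrow> 'a rel" where
  "nu S N = (let J = green_J S `` N in
     {(s \<otimes>\<^bsub>S\<^esub> x \<otimes>\<^bsub>S\<^esub> t, s \<otimes>\<^bsub>S\<^esub> y \<otimes>\<^bsub>S\<^esub> t) | s t x y.
        s \<in> carrier S \<and> t \<in> carrier S \<and> x \<in> N \<and> y \<in> N} \<inter> (J \<times> J))"

text \<open>
  A retraction is uniquely determined on \<open>I\<close> (as a HOL function it is arbitrary outside), and only
  its values on \<open>I\<close> are used below.
\<close>

definition the_retraction :: "('a, 'b) monoid_scheme \<Rightarrow> 'a set \<Rightarrow> 'a \<Rightarrow> 'a" where
  "the_retraction S I = (SOME f. ideal_retraction S I f)"

definition IN_cong :: "'a rel \<Rightarrow> ('a, 'b) monoid_scheme \<Rightarrow> 'a set \<Rightarrow> 'a set \<Rightarrow> 'a rel" where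
  "IN_cong K S I N = Id_on (carrier S) \<union> nu S N \<union>
     {(x, y) \<in> I \<times> I. (the_retraction S I x, the_retraction S I y) \<in> K}"

definition lambda_IN :: "('a, 'b) monoid_scheme \<Rightarrow> 'a set \<Rightarrow> 'a set \<Rightarrow> 'a rel" where
  "lambda_IN S = IN_cong (green_L S) S"

definition rho_IN :: "('a, 'b) monoid_scheme \<Rightarrow> 'a set \<Rightarrow> 'a set \<Rightarrow> 'a rel" where
  "rho_IN S = IN_cong (green_R S) S"

definition mu_IN :: "('a, 'b) monoid_scheme \<Rightarrow> 'a set \<Rightarrow> 'a set \<Rightarrow> 'a rel" where
  "mu_IN S = IN_cong (green_H S) S"


section \<open>The partition monoid\<close>

text \<open>\<open>Upper i\<close> is the point \<open>i\<close> and \<open>Lower i\<close> is the point \<open>i'\<close>.\<close>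

datatype vertex = Upper nat | Lower nat

definition vertices :: "nat \<Rightarrow> vertex set" where
  "vertices n = Upper ` {1..n} \<union> Lower ` {1..n}"

text \<open>
  The points of the product graph: \<open>Top i\<close>, \<open>Mid i\<close> and \<open>Bot i\<close> are \<open>i\<close>, \<open>i''\<close> and \<open>i'\<close>.
\<close>

datatype row_vertex = Top nat | Mid nat | Bot nat

fun first_factor :: "vertex \<Rightarrow> row_vertex" where
  "first_factor (Upper i) = Top i"
| "first_factor (Lower i) = Mid i"

fun second_factor :: "vertex \<Rightarrow> row_vertex" where
  "second_factor (Upper i) = Mid i"
| "second_factor (Lower i) = Bot i"

fun outer :: "vertex \<Rightarrow> row_vertex" where
  "outer (Upper i) = Top i"
| "outer (Lower i) = Bot i"

definition product_graph :: "vertex set set \<Rightarrow> vertex set set \<Rightarrow> row_vertex rel" where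
  "product_graph \<alpha> \<beta> =
     {(first_factor x, first_factor y) | x y. \<exists>B \<in> \<alpha>. x \<in> B \<and> y \<in> B} \<union>
     {(second_factor x, second_factor y) | x y. \<exists>B \<in> \<beta>. x \<in> B \<and> y \<in> B}"

definition partition_mult :: "nat \<Rightarrow> vertex set set \<Rightarrow> vertex set set \<Rightarrow> vertex set set" where
  "partition_mult n \<alpha> \<beta> = vertices n //
     {(x, y) \<in> vertices n \<times> vertices n. (outer x, outer y) \<in> (product_graph \<alpha> \<beta>)\<^sup>*}"

definition partition_monoid :: "nat \<Rightarrow> vertex set set monoid" where
  "partition_monoid n =
     \<lparr>carrier = {\<alpha>. partition_on (vertices n) \<alpha>},
      mult = partition_mult n,
      one = {{Upper i, Lower i} | i. i \<in> {1..n}}\<rparr>"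


section \<open>The Jones monoid\<close>

fun position :: "vertex \<Rightarrow> real^2" where
  "position (Upper i) = vector [real i, 1]"
| "position (Lower i) = vector [real i, 0]"

text \<open>
  For a partition all of whose blocks have size 2: the blocks can be drawn as pairwise disjoint
  arcs inside the rectangle spanned by the vertices.
\<close>

definition planar_pairing :: "nat \<Rightarrow> vertex set set \<Rightarrow> bool" where
  "planar_pairing n \<alpha> \<longleftrightarrow> (\<exists>\<gamma> :: vertex set \<Rightarrow> real \<Rightarrow> real^2.
     (\<forall>B \<in> \<alpha>. arc (\<gamma> B) \<and> {pathstart (\<gamma> B), pathfinish (\<gamma> B)} = position ` B \<and>
        path_image (\<gamma> B) \<subseteq> cbox (vector [1, 0]) (vector [real n, 1])) \<and>
     pairwise (\<lambda>B C. disjnt (path_image (\<gamma> B)) (path_image (\<gamma> C))) \<alpha>)"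

definition jones :: "nat \<Rightarrow> vertex set set monoid" where
  "jones n = (partition_monoid n)
     \<lparr>carrier := {\<alpha> \<in> carrier (partition_monoid n). (\<forall>B \<in> \<alpha>. card B = 2) \<and> planar_pairing n \<alpha>}\<rparr>"

definition transversal :: "vertex set \<Rightarrow> bool" where
  "transversal B \<longleftrightarrow> B \<inter> range Upper \<noteq> {} \<and> B \<inter> range Lower \<noteq> {}"

definition pt_rank :: "vertex set set \<Rightarrow> nat" where
  "pt_rank \<alpha> = card {B \<in> \<alpha>. transversal B}"

fun flip :: "vertex \<Rightarrow> vertex" where
  "flip (Upper i) = Lower i"
| "flip (Lower i) = Upper i"

definition star :: "vertex set set \<Rightarrow> vertex set set" where
  "star \<alpha> = (\<lambda>B. flip ` B) ` \<alpha>"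

definition star_congruence :: "nat \<Rightarrow> vertex set set rel \<Rightarrow> bool" where
  "star_congruence n \<xi> \<longleftrightarrow> congruence (jones n) \<xi> \<and> (\<forall>(\<alpha>, \<beta>) \<in> \<xi>. (star \<alpha>, star \<beta>) \<in> \<xi>)"

definition id_bar :: "nat \<Rightarrow> nat \<Rightarrow> vertex set set" where
  "id_bar n q =
     {{Upper i, Lower i} | i. i \<in> {1..q}} \<union>
     {{Upper (q + 2*k + 1), Upper (q + 2*k + 2)} | k. q + 2*k + 2 \<le> n} \<union>
     {{Lower (q + 2*k + 1), Lower (q + 2*k + 2)} | k. q + 2*k + 2 \<le> n}"

definition rank_ideal :: "nat \<Rightarrow> nat \<Rightarrow> vertex set set set" where
  "rank_ideal n q = {\<alpha> \<in> carrier (jones n). pt_rank \<alpha> \<le> q}"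

text \<open>The list \<open>q, q + 2, q + 4, \<dots>\<close> of numbers up to \<open>n\<close>.\<close>

definition ranks_from :: "nat \<Rightarrow> nat \<Rightarrow> nat list" where
  "ranks_from q n = filter (\<lambda>r. even (r - q)) [q..<Suc n]"

definition R_cong :: "nat \<Rightarrow> nat \<Rightarrow> vertex set set rel" where
  "R_cong n q = rees (jones n) (rank_ideal n q)"

definition C_pair :: "nat \<Rightarrow> nat \<Rightarrow> vertex set set set \<times> vertex set set set" where
  "C_pair n i = (rank_ideal n i, {id_bar n (i + 2)})"

definition lambda_cong :: "nat \<Rightarrow> nat \<Rightarrow> vertex set set rel" where
  "lambda_cong n i = case_prod (lambda_IN (jones n)) (C_pair n i)"

definition rho_cong :: "nat \<Rightarrow> nat \<Rightarrow> vertex set set rel" where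
  "rho_cong n i = case_prod (rho_IN (jones n)) (C_pair n i)"

definition mu_cong :: "nat \<Rightarrow> nat \<Rightarrow> vertex set set rel" where
  "mu_cong n i = case_prod (mu_IN (jones n)) (C_pair n i)"


section \<open>Describing the inclusion order\<close>

definition covered_in :: "'a set set \<Rightarrow> 'a set \<Rightarrow> 'a set \<Rightarrow> bool" where
  "covered_in P x y \<longleftrightarrow> x \<in> P \<and> y \<in> P \<and> x \<subset> y \<and> \<not> (\<exists>w \<in> P. x \<subset> w \<and> w \<subset> y)"

datatype diamond = Dmu | Dlambda | Drho | DR

definition diamond_le :: "diamond \<Rightarrow> diamond \<Rightarrow> bool" where
  "diamond_le x y \<longleftrightarrow> x = y \<or> x = Dmu \<or> y = DR"

fun diamond_cong :: "nat \<Rightarrow> diamond \<Rightarrow> nat \<Rightarrow> vertex set set rel" where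
  "diamond_cong n Dmu i = mu_cong n i"
| "diamond_cong n Dlambda i = lambda_cong n i"
| "diamond_cong n Drho i = rho_cong n i"
| "diamond_cong n DR i = R_cong n i"

end

theory Submission
  imports Defs
begin

text \<open>
  A partition is encoded by the relation between two-colourings of its upper and of its lower points
  that are constant on the blocks; multiplication becomes relational composition. Numbering the
  boundary of the rectangle cyclically, an element of the Jones monoid is a noncrossing fixed point
  free involution: crossing arcs meet by Fashoda's theorem, while for noncrossing pairings flat
  parabolas and line segments are disjoint. Multiplying by a hook generator \<open>E\<^sub>i\<close> only reconnects the
  points \<open>i\<close> and \<open>i + 1\<close>. A cap \<open>{i, i + 1}\<close> can be moved to the right end by hooks, reversibly, so every
  element factors through some \<open>id_bar n q\<close>; hence the hooks generate the monoid and Green's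
  relations are given by ranks, caps and cups.

  Let \<open>\<omega> = id_bar n z\<close>. Elements \<open>x\<close> of rank at most \<open>2 - z\<close> act on the minimal ideal by constant maps,
  so \<open>x \<mapsto> x \<omega> x\<close> is the retraction, and \<open>\<lambda>\<^sub>i\<close>, \<open>\<rho>\<^sub>i\<close> compare \<open>\<omega> x\<close> with \<open>\<omega> y\<close> and \<open>x \<omega>\<close> with \<open>y \<omega>\<close>. Given a
  non-trivial congruence, let \<open>q\<close> be the largest rank of an element of a non-diagonal pair. Hooks turn such
  a pair into one with different ranks if \<open>q > z\<close>, or into the pair \<open>(\<omega>, E\<^sub>k \<omega>)\<close>, \<open>k = 2 - z\<close>, or its mirror
  image, if \<open>q = z\<close>. For \<open>q \<ge> 3\<close> the Temperley-Lieb relations then collapse the whole ideal of rank \<open>q\<close>;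
  for \<open>q \<le> 2\<close> the congruence contains \<open>\<mu>\<^sub>q\<close> and is determined by its restriction to the minimal ideal,
  a rectangular band.
\<close>

section \<open>Partitions as relations between colourings\<close>

text \<open>Products are defined by paths in a three-row graph and planarity by arcs in the real
  plane. Colourings remove the paths: two points are connected iff every colouring that is constant
  along edges gives them the same colour. Involutions remove the topology. That planar diagrams are
  closed under products is not shown by drawing the composite; it follows from generation by hooks.

  The number \<open>2 - z\<close> has two roles. It bounds the ranks of the retractable ideals: if
  \<open>x\<close> has at most \<open>2 - z\<close> transversals, a product of minimal rank that
  contains all cups of \<open>x\<close> has only one way to join the remaining lower points. It is
  also the smallest index of a hook that moves \<open>\<omega>\<close>, which gives the element
  \<open>\<kappa> = E (2 - z) \<cdot> \<omega>\<close>. Similarly \<open>4 - z\<close> is the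
  smallest number of points that carry two cap patterns of rank \<open>z\<close>, and these patterns
  are those of \<open>\<omega>\<close> and \<open>\<kappa>\<close>. Telling two elements apart by
  hooks therefore ends at this one pair.

  One-sided facts are mostly proved for left multiplication and carried over by
  \<open>star\<close>.\<close>

definition colouring :: "(nat \<Rightarrow> bool) \<Rightarrow> (nat \<Rightarrow> bool) \<Rightarrow> vertex \<Rightarrow> bool" where
  "colouring u w x = (case x of Upper i \<Rightarrow> u i | Lower i \<Rightarrow> w i)"

lemma colouring_simps [simp]:
  "colouring u w (Upper i) = u i" "colouring u w (Lower i) = w i"
  by (simp_all add: colouring_def)

text \<open>Colourings are total on \<open>nat\<close>, and their values outside
  \<open>{1..n}\<close> are unconstrained. So the relation of the identity element is strictly
  larger than equality.\<close>

definition colour_rel :: "vertex set set \<Rightarrow> ((nat \<Rightarrow> bool) \<times> (nat \<Rightarrow> bool)) set" where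
  "colour_rel \<alpha> = {(u, w). \<forall>B\<in>\<alpha>. \<forall>x\<in>B. \<forall>y\<in>B. colouring u w x = colouring u w y}"

lemma colour_relD:
  "(u, w) \<in> colour_rel \<alpha> \<Longrightarrow> B \<in> \<alpha> \<Longrightarrow> x \<in> B \<Longrightarrow> y \<in> B \<Longrightarrow> colouring u w x = colouring u w y"
  unfolding colour_rel_def by blast

lemma colour_relI:
  "(\<And>B x y. B \<in> \<alpha> \<Longrightarrow> x \<in> B \<Longrightarrow> y \<in> B \<Longrightarrow> colouring u w x = colouring u w y) \<Longrightarrow> (u, w) \<in> colour_rel \<alpha>"
  unfolding colour_rel_def by blast

lemma product_graph_sym: "(x, y) \<in> (product_graph \<alpha> \<beta>)\<^sup>* \<Longrightarrow> (y, x) \<in> (product_graph \<alpha> \<beta>)\<^sup>*"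
proof -
  have "sym (product_graph \<alpha> \<beta>)"
    unfolding product_graph_def by (rule symI) blast
  then show "(x, y) \<in> (product_graph \<alpha> \<beta>)\<^sup>* \<Longrightarrow> (y, x) \<in> (product_graph \<alpha> \<beta>)\<^sup>*"
    by (meson symD sym_rtrancl)
qed

lemma equiv_product_graph:
  "equiv (vertices n) {(x, y) \<in> vertices n \<times> vertices n. (outer x, outer y) \<in> (product_graph \<alpha> \<beta>)\<^sup>*}"
proof (rule equivI)
  show "sym {(x, y) \<in> vertices n \<times> vertices n. (outer x, outer y) \<in> (product_graph \<alpha> \<beta>)\<^sup>*}"
    by (rule symI) (blast intro: product_graph_sym)
  show "trans {(x, y) \<in> vertices n \<times> vertices n. (outer x, outer y) \<in> (product_graph \<alpha> \<beta>)\<^sup>*}"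
    by (rule transI) (clarsimp, erule (1) rtrancl_trans)
qed (auto intro!: refl_onI)

lemma partition_on_mult: "partition_on (vertices n) (partition_mult n \<alpha> \<beta>)"
  unfolding partition_mult_def by (rule partition_on_quotient[OF equiv_product_graph])

lemma same_block_mult:
  assumes "x \<in> vertices n" "y \<in> vertices n"
  shows "(\<exists>B\<in>partition_mult n \<alpha> \<beta>. x \<in> B \<and> y \<in> B) \<longleftrightarrow>
    (outer x, outer y) \<in> (product_graph \<alpha> \<beta>)\<^sup>*"
proof -
  let ?E = "{(x, y) \<in> vertices n \<times> vertices n. (outer x, outer y) \<in> (product_graph \<alpha> \<beta>)\<^sup>*}"
  have eq: "equiv (vertices n) ?E" by (rule equiv_product_graph)
  show ?thesis
  proof
    assume "\<exists>B\<in>partition_mult n \<alpha> \<beta>. x \<in> B \<and> y \<in> B"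
    then obtain B where B: "B \<in> vertices n // ?E" "x \<in> B" "y \<in> B"
      unfolding partition_mult_def by (elim bexE conjE)
    then show "(outer x, outer y) \<in> (product_graph \<alpha> \<beta>)\<^sup>*"
      using quotient_eq_iff[OF eq B(1) B(1) B(2) B(3)] by simp
  next
    assume "(outer x, outer y) \<in> (product_graph \<alpha> \<beta>)\<^sup>*"
    then have "x \<in> ?E `` {x}" "y \<in> ?E `` {x}" using assms by auto
    moreover have "?E `` {x} \<in> vertices n // ?E" using assms by (intro quotientI)
    ultimately show "\<exists>B\<in>partition_mult n \<alpha> \<beta>. x \<in> B \<and> y \<in> B"
      unfolding partition_mult_def by (intro bexI[where x = "?E `` {x}"] conjI)
  qed
qed

definition row_colouring :: "(nat \<Rightarrow> bool) \<Rightarrow> (nat \<Rightarrow> bool) \<Rightarrow> (nat \<Rightarrow> bool) \<Rightarrow> row_vertex \<Rightarrow> bool" where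
  "row_colouring u m w x = (case x of Top i \<Rightarrow> u i | Mid i \<Rightarrow> m i | Bot i \<Rightarrow> w i)"

lemma row_colouring_simps [simp]:
  "row_colouring u m w (first_factor x) = colouring u m x"
  "row_colouring u m w (second_factor x) = colouring m w x"
  "row_colouring u m w (outer x) = colouring u w x"
  by (cases x; simp add: row_colouring_def)+

text \<open>Colourings of the outer rows extend to the middle row exactly when they are constant on
  the components of the product graph. In one direction the middle colours are read off from the
  components; in the other the glued colouring is constant along edges, hence along paths.\<close>

lemma colour_rel_mult:
  assumes \<alpha>: "partition_on (vertices n) \<alpha>" and \<beta>: "partition_on (vertices n) \<beta>"
  shows "colour_rel (partition_mult n \<alpha> \<beta>) = colour_rel \<alpha> O colour_rel \<beta>"
proof (rule equalityI; rule subrelI)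
  fix u w assume uw: "(u, w) \<in> colour_rel (partition_mult n \<alpha> \<beta>)"
  let ?G = "product_graph \<alpha> \<beta>"
  have const: "colouring u w x = colouring u w y"
    if xy: "x \<in> vertices n" "y \<in> vertices n" "(outer x, outer y) \<in> ?G\<^sup>*" for x y
  proof -
    have "\<exists>B\<in>partition_mult n \<alpha> \<beta>. x \<in> B \<and> y \<in> B"
      using xy(3) by (subst same_block_mult[OF xy(1,2)])
    then obtain B where "B \<in> partition_mult n \<alpha> \<beta>" "x \<in> B" "y \<in> B"
      by (elim bexE conjE)
    then show ?thesis by (rule colour_relD[OF uw])
  qed
  \<comment> \<open>The colour of a component: true iff a true outer point is reachable. Components
    lying wholly in the middle row become false, which violates no edge.\<close>
  define C where "C v \<longleftrightarrow> (\<exists>x\<in>vertices n. (outer x, v) \<in> ?G\<^sup>* \<and> colouring u w x)" for v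
  have C_outer: "C (outer x) = colouring u w x" if "x \<in> vertices n" for x
    using const that unfolding C_def by blast
  have C_path: "C v'" if "C v" "(v, v') \<in> ?G\<^sup>*" for v v'
  proof -
    obtain x where "x \<in> vertices n" "(outer x, v) \<in> ?G\<^sup>*" "colouring u w x"
      using \<open>C v\<close> unfolding C_def by blast
    then show ?thesis using rtrancl_trans[OF _ that(2)] unfolding C_def by blast
  qed
  have C_edge: "C v = C v'" if "(v, v') \<in> ?G" for v v'
    using C_path[of v v'] C_path[of v' v] product_graph_sym[of v v' \<alpha> \<beta>] r_into_rtrancl[OF that] by blast
  define m where "m i = C (Mid i)" for i
  have first: "C (first_factor x) = colouring u m x" if "x \<in> vertices n" for x
    using C_outer[of x] that by (cases x) (auto simp: m_def)
  have second: "C (second_factor x) = colouring m w x" if "x \<in> vertices n" for x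
    using C_outer[of x] that by (cases x) (auto simp: m_def)
  have "(u, m) \<in> colour_rel \<alpha>"
  proof (rule colour_relI)
    fix B x y assume B: "B \<in> \<alpha>" "x \<in> B" "y \<in> B"
    then have "x \<in> vertices n" "y \<in> vertices n" using \<alpha> by (auto simp: partition_on_def)
    moreover have "(first_factor x, first_factor y) \<in> ?G"
      unfolding product_graph_def using B by blast
    ultimately show "colouring u m x = colouring u m y" using C_edge first by metis
  qed
  moreover have "(m, w) \<in> colour_rel \<beta>"
  proof (rule colour_relI)
    fix B x y assume B: "B \<in> \<beta>" "x \<in> B" "y \<in> B"
    then have "x \<in> vertices n" "y \<in> vertices n" using \<beta> by (auto simp: partition_on_def)
    moreover have "(second_factor x, second_factor y) \<in> ?G"
      unfolding product_graph_def using B by blast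
    ultimately show "colouring m w x = colouring m w y" using C_edge second by metis
  qed
  ultimately show "(u, w) \<in> colour_rel \<alpha> O colour_rel \<beta>" by blast
next
  fix u w assume "(u, w) \<in> colour_rel \<alpha> O colour_rel \<beta>"
  then obtain m where um: "(u, m) \<in> colour_rel \<alpha>" and mw: "(m, w) \<in> colour_rel \<beta>"
    by blast
  have edge: "row_colouring u m w v = row_colouring u m w v'" if vv: "(v, v') \<in> product_graph \<alpha> \<beta>" for v v'
  proof -
    consider x y B where "v = first_factor x" "v' = first_factor y" "B \<in> \<alpha>" "x \<in> B" "y \<in> B"
      | x y B where "v = second_factor x" "v' = second_factor y" "B \<in> \<beta>" "x \<in> B" "y \<in> B"
      using vv unfolding product_graph_def by blast
    then show ?thesis
    proof cases
      case 1
      then show ?thesis using colour_relD[OF um, of B x y] by simp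
    next
      case 2
      then show ?thesis using colour_relD[OF mw, of B x y] by simp
    qed
  qed
  have path: "row_colouring u m w v = row_colouring u m w v'"
    if "(v, v') \<in> (product_graph \<alpha> \<beta>)\<^sup>*" for v v'
    using that by (induction rule: rtrancl_induct) (auto dest: edge)
  show "(u, w) \<in> colour_rel (partition_mult n \<alpha> \<beta>)"
  proof (rule colour_relI)
    fix B x y assume B: "B \<in> partition_mult n \<alpha> \<beta>" "x \<in> B" "y \<in> B"
    then have "x \<in> vertices n" "y \<in> vertices n"
      using partition_on_mult[of n \<alpha> \<beta>] by (auto simp: partition_on_def)
    then have "(outer x, outer y) \<in> (product_graph \<alpha> \<beta>)\<^sup>*" using B same_block_mult by blast
    from path[OF this] show "colouring u w x = colouring u w y" by simp
  qed
qed

lemma partition_on_eqI: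
  assumes P: "partition_on V P" and Q: "partition_on V Q"
    and "\<And>x y. x \<in> V \<Longrightarrow> y \<in> V \<Longrightarrow> (\<exists>B\<in>P. x \<in> B \<and> y \<in> B) \<longleftrightarrow> (\<exists>B\<in>Q. x \<in> B \<and> y \<in> B)"
  shows "P = Q"
proof -
  have sub: "P \<subseteq> Q" if P: "partition_on V P" and Q: "partition_on V Q"
    and eq: "\<And>x y. x \<in> V \<Longrightarrow> y \<in> V \<Longrightarrow> (\<exists>B\<in>P. x \<in> B \<and> y \<in> B) \<longleftrightarrow> (\<exists>B\<in>Q. x \<in> B \<and> y \<in> B)"
    for P Q :: "'a set set"
  proof
    fix B assume B: "B \<in> P"
    then obtain x where x: "x \<in> B" using partition_onD3[OF P] by (metis ex_in_conv)
    have xV: "x \<in> V" "B \<subseteq> V" using B x partition_onD1[OF P] by auto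
    then obtain C where C: "C \<in> Q" "x \<in> C" using eq[of x x] B x by blast
    have CV: "C \<subseteq> V" using C partition_onD1[OF Q] by auto
    have uniqP: "B' = B" if "B' \<in> P" "x \<in> B'" for B'
      using that B x partition_onD2[OF P] by (meson disjointD disjoint_iff)
    have uniqQ: "C' = C" if "C' \<in> Q" "x \<in> C'" for C'
      using that C partition_onD2[OF Q] by (meson disjointD disjoint_iff)
    have "y \<in> B \<longleftrightarrow> y \<in> C" for y
      using eq[OF xV(1), of y] uniqP uniqQ B x C xV CV by (metis subset_iff)
    then have "B = C" by blast
    then show "B \<in> Q" using C(1) by simp
  qed
  show ?thesis
    by (rule equalityI; rule sub) (use assms in auto)
qed

text \<open>The indicator of the block of \<open>x\<close> is itself an admissible colouring, and it
  separates \<open>x\<close> from every point outside that block.\<close>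

lemma same_block_iff_colour:
  assumes \<alpha>: "partition_on (vertices n) \<alpha>" and "x \<in> vertices n" "y \<in> vertices n"
  shows "(\<exists>B\<in>\<alpha>. x \<in> B \<and> y \<in> B) \<longleftrightarrow> (\<forall>(u, w)\<in>colour_rel \<alpha>. colouring u w x = colouring u w y)"
proof
  show "\<forall>(u, w)\<in>colour_rel \<alpha>. colouring u w x = colouring u w y" if "\<exists>B\<in>\<alpha>. x \<in> B \<and> y \<in> B"
    using that colour_relD by blast
next
  assume R: "\<forall>(u, w)\<in>colour_rel \<alpha>. colouring u w x = colouring u w y"
  obtain B where B: "B \<in> \<alpha>" "x \<in> B" using assms partition_onD1[OF \<alpha>] by blast
  define u w where "u i \<longleftrightarrow> Upper i \<in> B" and "w i \<longleftrightarrow> Lower i \<in> B" for i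
  have col: "colouring u w v \<longleftrightarrow> v \<in> B" for v
    by (cases v) (auto simp: u_def w_def)
  have "(u, w) \<in> colour_rel \<alpha>"
  proof (rule colour_relI)
    fix C x y assume "C \<in> \<alpha>" "x \<in> C" "y \<in> C"
    then show "colouring u w x = colouring u w y"
      using B(1) partition_onD2[OF \<alpha>] disjointD[of \<alpha> B C] col by blast
  qed
  then have "y \<in> B" using R B(2) col by blast
  then show "\<exists>B\<in>\<alpha>. x \<in> B \<and> y \<in> B" using B by blast
qed

text \<open>Identities between products can now be checked between relations: associativity becomes
  that of \<open>O\<close>, and \<open>star\<close> becomes the converse.\<close>

lemma colour_rel_inject:
  assumes "partition_on (vertices n) \<alpha>" "partition_on (vertices n) \<beta>" "colour_rel \<alpha> = colour_rel \<beta>"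
  shows "\<alpha> = \<beta>"
  using assms by (intro partition_on_eqI[of "vertices n"]) (auto simp: same_block_iff_colour)

lemma partition_mult_assoc:
  assumes "partition_on (vertices n) \<alpha>" "partition_on (vertices n) \<beta>" "partition_on (vertices n) \<gamma>"
  shows "partition_mult n (partition_mult n \<alpha> \<beta>) \<gamma> = partition_mult n \<alpha> (partition_mult n \<beta> \<gamma>)"
  by (rule colour_rel_inject[of n])
    (simp_all add: assms partition_on_mult colour_rel_mult O_assoc)

section \<open>The involution exchanging the two rows\<close>

lemma flip_flip [simp]: "flip (flip x) = x"
  by (cases x) auto

lemma flip_in_vertices [simp]: "flip x \<in> vertices n \<longleftrightarrow> x \<in> vertices n"
  by (cases x) (auto simp: vertices_def)

lemma star_star [simp]: "star (star \<alpha>) = \<alpha>"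
  by (simp add: star_def image_image)

lemma partition_on_star:
  assumes "partition_on (vertices n) \<alpha>"
  shows "partition_on (vertices n) (star \<alpha>)"
proof -
  have inj: "inj_on flip (vertices n)" by (rule inj_onI) (metis flip_flip)
  have im: "flip ` vertices n = vertices n"
    by (auto simp: image_iff) (metis flip_flip flip_in_vertices)
  have "(`) flip ` \<alpha> - {{}} = (`) flip ` \<alpha>" using assms by (auto simp: partition_on_def)
  then show ?thesis
    using partition_on_inj_image[OF assms inj] im unfolding star_def by simp
qed

lemma colouring_flip: "colouring u w (flip x) = colouring w u x"
  by (cases x) auto

lemma colour_rel_star: "colour_rel (star \<alpha>) = (colour_rel \<alpha>)\<inverse>"
  unfolding colour_rel_def star_def by (auto simp: colouring_flip)

lemma star_partition_mult:
  assumes "partition_on (vertices n) \<alpha>" "partition_on (vertices n) \<beta>"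
  shows "star (partition_mult n \<alpha> \<beta>) = partition_mult n (star \<beta>) (star \<alpha>)"
  by (rule colour_rel_inject[of n])
    (simp_all add: assms partition_on_mult partition_on_star colour_rel_mult colour_rel_star converse_relcomp)

section \<open>Pairings as involutions of the boundary points\<close>

text \<open>The boundary of the rectangle is numbered \<open>1, \<dots>, 2n\<close> clockwise, from the upper left corner.\<close>

definition vertex_at :: "nat \<Rightarrow> nat \<Rightarrow> vertex" where
  "vertex_at n p = (if p \<le> n then Upper p else Lower (2 * n + 1 - p))"

text \<open>Fixing the points outside \<open>{1..2 * n}\<close> makes the whole function determined
  by its diagram, so equality of functions can replace equality of diagrams.\<close>

definition pairing :: "nat \<Rightarrow> (nat \<Rightarrow> nat) \<Rightarrow> bool" where
  "pairing n f \<longleftrightarrow> (\<forall>x. f (f x) = x) \<and> (\<forall>x. f x = x \<longleftrightarrow> x \<notin> {1..2 * n})"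

text \<open>One inequality is enough: for an involution the bound \<open>x < f y\<close> follows by
  applying the condition with \<open>f y\<close> in the place of \<open>x\<close>.\<close>

definition noncrossing :: "(nat \<Rightarrow> nat) \<Rightarrow> bool" where
  "noncrossing f \<longleftrightarrow> (\<forall>x y. x < y \<longrightarrow> y < f x \<longrightarrow> f y < f x)"

definition diagram :: "nat \<Rightarrow> (nat \<Rightarrow> nat) \<Rightarrow> vertex set set" where
  "diagram n f = (\<lambda>x. {vertex_at n x, vertex_at n (f x)}) ` {1..2 * n}"

lemma inj_on_vertex_at: "inj_on (vertex_at n) {1..2 * n}"
  by (rule inj_onI) (auto simp: vertex_at_def split: if_splits)

lemma vertex_at_image: "vertex_at n ` {1..2 * n} = vertices n"
proof
  show "vertex_at n ` {1..2 * n} \<subseteq> vertices n"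
  proof (rule image_subsetI)
    fix x assume "x \<in> {1..2 * n}"
    then show "vertex_at n x \<in> vertices n"
      by (cases "x \<le> n") (simp_all add: vertex_at_def vertices_def image_iff Suc_le_eq)
  qed
  show "vertices n \<subseteq> vertex_at n ` {1..2 * n}"
  proof
    fix v assume "v \<in> vertices n"
    then consider i where "v = Upper i" "1 \<le> i" "i \<le> n" | i where "v = Lower i" "1 \<le> i" "i \<le> n"
      by (auto simp: vertices_def)
    then show "v \<in> vertex_at n ` {1..2 * n}"
    proof cases
      case (1 i)
      then show ?thesis by (intro image_eqI[of _ _ i]) (auto simp: vertex_at_def)
    next
      case (2 i)
      then show ?thesis by (intro image_eqI[of _ _ "2 * n + 1 - i"]) (auto simp: vertex_at_def)
    qed
  qed
qed

lemma vertex_at_eq_iff: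
  "x \<in> {1..2 * n} \<Longrightarrow> y \<in> {1..2 * n} \<Longrightarrow> vertex_at n x = vertex_at n y \<longleftrightarrow> x = y"
  by (rule inj_on_eq_iff[OF inj_on_vertex_at])

lemma pairing_in: "pairing n f \<Longrightarrow> f x \<in> {1..2 * n} \<longleftrightarrow> x \<in> {1..2 * n}"
  unfolding pairing_def by metis

lemma pairing_invol [simp]: "pairing n f \<Longrightarrow> f (f x) = x"
  unfolding pairing_def by metis

lemma pairing_neq: "pairing n f \<Longrightarrow> x \<in> {1..2 * n} \<Longrightarrow> f x \<noteq> x"
  unfolding pairing_def by metis

lemma pairing_outside: "pairing n f \<Longrightarrow> x \<notin> {1..2 * n} \<Longrightarrow> f x = x"
  unfolding pairing_def by metis

lemma diagram_blockE:
  assumes "pairing n f" "B \<in> diagram n f"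
  obtains x where "x \<in> {1..2 * n}" "f x \<in> {1..2 * n}" "x < f x" "B = {vertex_at n x, vertex_at n (f x)}"
proof -
  obtain x where x: "x \<in> {1..2 * n}" "B = {vertex_at n x, vertex_at n (f x)}"
    using assms(2) unfolding diagram_def by blast
  have fx: "f x \<in> {1..2 * n}" using assms(1) x(1) pairing_in by blast
  show thesis
  proof (cases "x < f x")
    case True
    then show thesis using that x fx by blast
  next
    case False
    then have "f x < f (f x)" using pairing_neq[OF assms(1) x(1)] assms(1) by simp
    then show thesis using that[of "f x"] x fx assms(1) by (auto simp: insert_commute)
  qed
qed

lemma same_block_diagram:
  assumes f: "pairing n f" and "x \<in> {1..2 * n}" "y \<in> {1..2 * n}"
  shows "(\<exists>B\<in>diagram n f. vertex_at n x \<in> B \<and> vertex_at n y \<in> B) \<longleftrightarrow> x = y \<or> f x = y"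
proof
  assume "\<exists>B\<in>diagram n f. vertex_at n x \<in> B \<and> vertex_at n y \<in> B"
  then obtain B where "B \<in> diagram n f" "vertex_at n x \<in> B" "vertex_at n y \<in> B" by blast
  then obtain a where "a \<in> {1..2 * n}" "f a \<in> {1..2 * n}"
    "vertex_at n x \<in> {vertex_at n a, vertex_at n (f a)}" "vertex_at n y \<in> {vertex_at n a, vertex_at n (f a)}"
    by (metis diagram_blockE[OF f])
  then show "x = y \<or> f x = y" using assms by (auto simp: vertex_at_eq_iff)
next
  assume "x = y \<or> f x = y"
  then show "\<exists>B\<in>diagram n f. vertex_at n x \<in> B \<and> vertex_at n y \<in> B"
    using assms(2) unfolding diagram_def by blast
qed

lemma block_mem_diagram:
  assumes f: "pairing n f" and "x \<in> {1..2 * n}" "y \<in> {1..2 * n}" "x \<noteq> y"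
  shows "{vertex_at n x, vertex_at n y} \<in> diagram n f \<longleftrightarrow> f x = y"
  using same_block_diagram[OF assms(1-3)] assms(2,4) unfolding diagram_def by blast

lemma partition_on_diagram:
  assumes f: "pairing n f"
  shows "partition_on (vertices n) (diagram n f)"
proof (rule partition_onI)
  show "\<Union> (diagram n f) = vertices n"
    using pairing_in[OF f] unfolding diagram_def vertex_at_image[symmetric] by auto
  fix p q assume "p \<in> diagram n f" "q \<in> diagram n f" "p \<noteq> q"
  then obtain x y where xy: "x \<in> {1..2 * n}" "f x \<in> {1..2 * n}" "p = {vertex_at n x, vertex_at n (f x)}"
    "y \<in> {1..2 * n}" "f y \<in> {1..2 * n}" "q = {vertex_at n y, vertex_at n (f y)}"
    by (metis diagram_blockE[OF f])
  then have "x \<noteq> y" "f x \<noteq> y" using \<open>p \<noteq> q\<close> f by auto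
  then have "x \<noteq> f y" "f x \<noteq> f y" using f by (metis pairing_invol)+
  then show "disjnt p q" using xy \<open>x \<noteq> y\<close> \<open>f x \<noteq> y\<close> by (auto simp: disjnt_def vertex_at_eq_iff)
next
  show "{} \<notin> diagram n f" unfolding diagram_def by blast
qed

lemma card_diagram_block:
  assumes "pairing n f" "B \<in> diagram n f"
  shows "card B = 2"
proof -
  obtain x where "x \<in> {1..2 * n}" "f x \<in> {1..2 * n}" "x < f x" "B = {vertex_at n x, vertex_at n (f x)}"
    by (rule diagram_blockE[OF assms])
  moreover from this have "vertex_at n x \<noteq> vertex_at n (f x)"
    using vertex_at_eq_iff[of x n "f x"] by simp
  ultimately show ?thesis by simp
qed

lemma diagram_inject:
  assumes "pairing n f" "pairing n g" "diagram n f = diagram n g"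
  shows "f = g"
proof
  fix x show "f x = g x"
  proof (cases "x \<in> {1..2 * n}")
    case True
    then have "{vertex_at n x, vertex_at n (f x)} \<in> diagram n g"
      using assms(3) unfolding diagram_def by blast
    then show ?thesis
      using block_mem_diagram[OF assms(2) True, of "f x"] pairing_in[OF assms(1), of x]
        pairing_neq[OF assms(1) True] True by force
  next
    case False
    then show ?thesis using assms(1,2) pairing_outside by metis
  qed
qed

lemma ex_pairing:
  assumes \<alpha>: "partition_on (vertices n) \<alpha>" and two: "\<forall>B\<in>\<alpha>. card B = 2"
  shows "\<exists>f. pairing n f \<and> \<alpha> = diagram n f"
proof -
  have ex1: "\<exists>!y. y \<in> {1..2 * n} \<and> {vertex_at n x, vertex_at n y} \<in> \<alpha>" if x: "x \<in> {1..2 * n}" for x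
  proof -
    have "vertex_at n x \<in> vertices n" using x vertex_at_image by blast
    then obtain B where B: "B \<in> \<alpha>" "vertex_at n x \<in> B" using partition_onD1[OF \<alpha>] by blast
    have "card B = 2" using B two by blast
    then obtain b where b: "B = {vertex_at n x, b}" "b \<noteq> vertex_at n x"
      using B(2) unfolding card_2_iff by blast
    then have "b \<in> vertices n" using B partition_onD1[OF \<alpha>] by blast
    then obtain y where y: "y \<in> {1..2 * n}" "b = vertex_at n y" using vertex_at_image by blast
    have "y' = y" if y': "y' \<in> {1..2 * n}" "{vertex_at n x, vertex_at n y'} \<in> \<alpha>" for y'
    proof -
      have "{vertex_at n x, vertex_at n y'} = B"
        using disjointD[OF partition_onD2[OF \<alpha>] y'(2) B(1)] B(2) by blast
      then have "vertex_at n y' = b" using b by blast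
      then show ?thesis using y y' vertex_at_eq_iff by blast
    qed
    then show ?thesis using B b y by blast
  qed
  define f where "f x = (if x \<in> {1..2 * n} then THE y. y \<in> {1..2 * n} \<and> {vertex_at n x, vertex_at n y} \<in> \<alpha> else x)" for x
  have f1: "f x \<in> {1..2 * n} \<and> {vertex_at n x, vertex_at n (f x)} \<in> \<alpha>" if "x \<in> {1..2 * n}" for x
    using theI'[OF ex1[OF that]] that by (simp add: f_def)
  have f2: "f x = y" if "x \<in> {1..2 * n}" "y \<in> {1..2 * n}" "{vertex_at n x, vertex_at n y} \<in> \<alpha>" for x y
    using ex1[OF that(1)] f1[OF that(1)] that by blast
  have f3: "f x = x" if "x \<notin> {1..2 * n}" for x
    using that unfolding f_def by (rule if_not_P)
  have invol: "f (f x) = x" for x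
  proof (cases "x \<in> {1..2 * n}")
    case True
    then show ?thesis using f2[of "f x" x] f1[OF True] by (simp add: insert_commute)
  next
    case False
    then show ?thesis using f3[OF False] by metis
  qed
  have neq: "f x \<noteq> x" if "x \<in> {1..2 * n}" for x
    using f1[OF that] two by fastforce
  have "pairing n f"
    unfolding pairing_def using invol neq f3 by blast
  moreover have "\<alpha> = diagram n f"
  proof
    show "diagram n f \<subseteq> \<alpha>" using f1 unfolding diagram_def by blast
    show "\<alpha> \<subseteq> diagram n f"
    proof
      fix B assume B: "B \<in> \<alpha>"
      then obtain a where "a \<in> B" using partition_onD3[OF \<alpha>] by (metis ex_in_conv)
      moreover have "a \<in> vertices n" using B \<open>a \<in> B\<close> partition_onD1[OF \<alpha>] by blast
      then obtain x where x: "x \<in> {1..2 * n}" "a = vertex_at n x" using vertex_at_image by blast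
      ultimately have "{vertex_at n x, vertex_at n (f x)} = B"
        using disjointD[OF partition_onD2[OF \<alpha>], of "{vertex_at n x, vertex_at n (f x)}" B] f1[OF x(1)] B by blast
      then show "B \<in> diagram n f" using x unfolding diagram_def by blast
    qed
  qed
  ultimately show ?thesis by blast
qed

section \<open>Planarity\<close>

lemma vec2_eq_iff: "(p :: real^2) = q \<longleftrightarrow> p $ 1 = q $ 1 \<and> p $ 2 = q $ 2"
  by (auto simp: vec_eq_iff forall_2)

lemma mem_cbox_vec2:
  "(p :: real^2) \<in> cbox (vector [a, b]) (vector [c, d]) \<longleftrightarrow>
     a \<le> p $ 1 \<and> p $ 1 \<le> c \<and> b \<le> p $ 2 \<and> p $ 2 \<le> d"
  by (auto simp: mem_box_cart forall_2 vector_2)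

lemma position_vertex_at:
  "position (vertex_at n p) =
     (if p \<le> n then vector [real p, 1] else vector [real (2 * n + 1 - p), 0])"
  by (simp add: vertex_at_def)

lemma segment_vec2_bounds:
  fixes p q :: "real^2"
  assumes "z \<in> closed_segment p q"
  shows "min (p $ i) (q $ i) \<le> z $ i" "z $ i \<le> max (p $ i) (q $ i)"
proof -
  obtain u where u: "0 \<le> u" "u \<le> 1" "z = (1 - u) *\<^sub>R p + u *\<^sub>R q"
    using assms by (auto simp: in_segment)
  then have z: "z $ i = (1 - u) * p $ i + u * q $ i" by simp
  have "(1 - u) * min (p $ i) (q $ i) + u * min (p $ i) (q $ i) \<le> z $ i"
    unfolding z using u by (intro add_mono mult_left_mono) auto
  then show "min (p $ i) (q $ i) \<le> z $ i" by (simp add: algebra_simps)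
  have "z $ i \<le> (1 - u) * max (p $ i) (q $ i) + u * max (p $ i) (q $ i)"
    unfolding z using u by (intro add_mono mult_left_mono) auto
  then show "z $ i \<le> max (p $ i) (q $ i)" by (simp add: algebra_simps)
qed

text \<open>
  Extending both paths outside the unit strip, \<open>f\<close> to the left and to the right and \<open>g\<close> straight
  down and up, creates no new intersections, so Fashoda's theorem applies.
\<close>

lemma crossing_transversal:
  fixes f g :: "real \<Rightarrow> real^2"
  assumes "path f" "path g"
    and fb: "path_image f \<subseteq> cbox (vector [1, 0]) (vector [m, 1])"
    and gb: "path_image g \<subseteq> cbox (vector [1, 0]) (vector [m, 1])"
    and f0: "pathstart f = vector [a, ya]" and f1: "pathfinish f = vector [b, yb]"
    and g0: "pathstart g = vector [d, 0]" and g1: "pathfinish g = vector [c, 1]"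
    and ya: "ya = 1 \<and> a < c \<or> ya = 0 \<and> a < d" and yb: "yb = 1 \<and> c < b \<or> yb = 0 \<and> d < b"
  shows "path_image f \<inter> path_image g \<noteq> {}"
proof -
  \<comment> \<open>\<open>3 * ya - 1\<close> is 2 for \<open>ya = 1\<close> and -1 for
    \<open>ya = 0\<close>. So the extensions of \<open>f\<close> leave the strip on the row where
    \<open>f\<close> ends, and they reach the vertical sides \<open>0\<close> and
    \<open>m + 1\<close> of the enlarged box, as Fashoda's theorem demands.\<close>
  let ?lf = "linepath (vector [0, 3 * ya - 1]) (vector [a, ya]) :: real \<Rightarrow> real^2"
  let ?rf = "linepath (vector [b, yb]) (vector [m + 1, 3 * yb - 1]) :: real \<Rightarrow> real^2"
  let ?lg = "linepath (vector [d, -1]) (vector [d, 0]) :: real \<Rightarrow> real^2"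
  let ?rg = "linepath (vector [c, 1]) (vector [c, 2]) :: real \<Rightarrow> real^2"
  have ends: "vector [a, ya] \<in> path_image f" "vector [b, yb] \<in> path_image f"
    "vector [d, 0] \<in> path_image g" "vector [c, 1] \<in> path_image g"
    using f0 f1 g0 g1 by (metis pathstart_in_path_image pathfinish_in_path_image)+
  have "(vector [a, ya] :: real^2) \<in> cbox (vector [1, 0]) (vector [m, 1])"
    "(vector [b, yb] :: real^2) \<in> cbox (vector [1, 0]) (vector [m, 1])"
    "(vector [d, 0] :: real^2) \<in> cbox (vector [1, 0]) (vector [m, 1])"
    "(vector [c, 1] :: real^2) \<in> cbox (vector [1, 0]) (vector [m, 1])"
    using ends fb gb by blast+
  then have bounds: "1 \<le> a" "a \<le> m" "1 \<le> b" "b \<le> m" "1 \<le> c" "c \<le> m" "1 \<le> d" "d \<le> m"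
    by (simp_all add: mem_cbox_vec2 vector_2)
  let ?B = "cbox (vector [0, -1]) (vector [m + 1, 2]) :: (real^2) set"
  have lf: "0 \<le> z $ 1 \<and> z $ 1 \<le> a \<and> (ya = 1 \<longrightarrow> 1 \<le> z $ 2 \<and> z $ 2 \<le> 2) \<and> (ya = 0 \<longrightarrow> -1 \<le> z $ 2 \<and> z $ 2 \<le> 0)"
    if "z \<in> path_image ?lf" for z
    using segment_vec2_bounds[OF that[unfolded path_image_linepath], of 1]
      segment_vec2_bounds[OF that[unfolded path_image_linepath], of 2] bounds
    by (auto simp: vector_2)
  have rf: "b \<le> z $ 1 \<and> z $ 1 \<le> m + 1 \<and> (yb = 1 \<longrightarrow> 1 \<le> z $ 2 \<and> z $ 2 \<le> 2) \<and> (yb = 0 \<longrightarrow> -1 \<le> z $ 2 \<and> z $ 2 \<le> 0)"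
    if "z \<in> path_image ?rf" for z
    using segment_vec2_bounds[OF that[unfolded path_image_linepath], of 1]
      segment_vec2_bounds[OF that[unfolded path_image_linepath], of 2] bounds
    by (auto simp: vector_2)
  have lg: "z $ 1 = d \<and> -1 \<le> z $ 2 \<and> z $ 2 \<le> 0" if "z \<in> path_image ?lg" for z
    using segment_vec2_bounds[OF that[unfolded path_image_linepath], of 1]
      segment_vec2_bounds[OF that[unfolded path_image_linepath], of 2] bounds
    by (auto simp: vector_2)
  have rg: "z $ 1 = c \<and> 1 \<le> z $ 2 \<and> z $ 2 \<le> 2" if "z \<in> path_image ?rg" for z
    using segment_vec2_bounds[OF that[unfolded path_image_linepath], of 1]
      segment_vec2_bounds[OF that[unfolded path_image_linepath], of 2] bounds
    by (auto simp: vector_2)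
  have inf: "1 \<le> z $ 1 \<and> z $ 1 \<le> m \<and> 0 \<le> z $ 2 \<and> z $ 2 \<le> 1" if "z \<in> path_image f" for z
    using that fb mem_cbox_vec2 by blast
  have ing: "1 \<le> z $ 1 \<and> z $ 1 \<le> m \<and> 0 \<le> z $ 2 \<and> z $ 2 \<le> 1" if "z \<in> path_image g" for z
    using that gb mem_cbox_vec2 by blast
  let ?F = "?lf +++ f +++ ?rf" and ?G = "?lg +++ g +++ ?rg"
  have imF: "path_image ?F = path_image ?lf \<union> path_image f \<union> path_image ?rf"
    using f0 f1 by (simp add: path_image_join Un_assoc)
  have imG: "path_image ?G = path_image ?lg \<union> path_image g \<union> path_image ?rg"
    using g0 g1 by (simp add: path_image_join Un_assoc)
  obtain z where z: "z \<in> path_image ?F" "z \<in> path_image ?G"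
  proof (rule fashoda)
    show "path ?F" "path ?G" using assms f0 f1 g0 g1 by simp_all
    have "z \<in> ?B" if "z \<in> path_image ?lf" for z using lf[OF that] ya bounds by (auto simp: mem_cbox_vec2)
    moreover have "z \<in> ?B" if "z \<in> path_image ?rf" for z using rf[OF that] yb bounds by (auto simp: mem_cbox_vec2)
    moreover have "z \<in> ?B" if "z \<in> path_image f" for z using inf[OF that] by (simp add: mem_cbox_vec2)
    ultimately show "path_image ?F \<subseteq> ?B" unfolding imF by blast
    have "z \<in> ?B" if "z \<in> path_image ?lg" for z using lg[OF that] bounds by (simp add: mem_cbox_vec2)
    moreover have "z \<in> ?B" if "z \<in> path_image ?rg" for z using rg[OF that] bounds by (simp add: mem_cbox_vec2)
    moreover have "z \<in> ?B" if "z \<in> path_image g" for z using ing[OF that] by (simp add: mem_cbox_vec2)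
    ultimately show "path_image ?G \<subseteq> ?B" unfolding imG by blast
    show "pathstart ?F $ 1 = vector [0, -1] $ (1 :: 2)" "pathfinish ?F $ 1 = vector [m + 1, 2] $ (1 :: 2)"
      "pathstart ?G $ 2 = vector [0, -1] $ (2 :: 2)" "pathfinish ?G $ 2 = vector [m + 1, 2] $ (2 :: 2)"
      by (simp_all add: vector_2)
  qed (use that in blast)
  have low: "z = vector [d, 0]" if "z $ 1 = d" "z $ 2 = 0" for z :: "real^2"
    using that by (simp add: vec2_eq_iff vector_2)
  have upp: "z = vector [c, 1]" if "z $ 1 = c" "z $ 2 = 1" for z :: "real^2"
    using that by (simp add: vec2_eq_iff vector_2)
  show ?thesis
  proof -
    consider "z \<in> path_image f" | "z \<in> path_image ?lf" | "z \<in> path_image ?rf" using z(1) imF by blast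
    then show ?thesis
    proof cases
      case 1
      consider "z \<in> path_image g" | "z \<in> path_image ?lg" | "z \<in> path_image ?rg" using z(2) imG by blast
      then have "z \<in> path_image g"
      proof cases
        case 2
        then have "z = vector [d, 0]" using lg[OF 2] inf[OF 1] by (intro low) auto
        then show ?thesis using ends by blast
      next
        case 3
        then have "z = vector [c, 1]" using rg[OF 3] inf[OF 1] by (intro upp) auto
        then show ?thesis using ends by blast
      qed
      then show ?thesis using 1 by blast
    next
      case 2
      consider "z \<in> path_image g" | "z \<in> path_image ?lg" | "z \<in> path_image ?rg" using z(2) imG by blast
      then show ?thesis
      proof cases
        case a: 1
        obtain u where u: "0 \<le> u" "u \<le> 1" "z = (1 - u) *\<^sub>R vector [0, 3 * ya - 1] + u *\<^sub>R vector [a, ya]"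
          using 2 by (auto simp: in_segment)
        \<comment> \<open>A point of \<open>g\<close> lies in the strip, so it can meet the
          extension only at height \<open>ya\<close>. The height along the extension is
          \<open>(1 - u) * (3 * ya - 1) + u * ya\<close>, which equals \<open>ya\<close> only at its
          end \<open>u = 1\<close>.\<close>
        have "z $ 2 = ya" using ya lf[OF 2] ing[OF a] by auto
        then have "(1 - u) * (2 * ya - 1) = 0" using u(3) by (simp add: vector_2 algebra_simps)
        then have "u = 1" using ya by auto
        then have "z = vector [a, ya]" using u by simp
        then show ?thesis using ends a by blast
      next
        \<comment> \<open>Two extensions stay apart: on different rows by their heights, on the same
          row because \<open>a\<close> lies to the left of \<open>d\<close> or of
          \<open>c\<close>.\<close>
        case b: 2
        then show ?thesis using lf[OF 2] lg[OF b] ya yb bounds by auto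
      next
        case c: 3
        then show ?thesis using lf[OF 2] rg[OF c] ya yb bounds by auto
      qed
    next
      case 3
      consider "z \<in> path_image g" | "z \<in> path_image ?lg" | "z \<in> path_image ?rg" using z(2) imG by blast
      then show ?thesis
      proof cases
        case a: 1
        obtain u where u: "0 \<le> u" "u \<le> 1" "z = (1 - u) *\<^sub>R vector [b, yb] + u *\<^sub>R vector [m + 1, 3 * yb - 1]"
          using 3 by (auto simp: in_segment)
        have "z $ 2 = yb" using yb rf[OF 3] ing[OF a] by auto
        then have "u * (2 * yb - 1) = 0" using u(3) by (simp add: vector_2 algebra_simps)
        then have "u = 0" using yb by auto
        then have "z = vector [b, yb]" using u by simp
        then show ?thesis using ends a by blast
      next
        case b: 2
        then show ?thesis using rf[OF 3] lg[OF b] ya yb bounds by auto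
      next
        case c: 3
        then show ?thesis using rf[OF 3] rg[OF c] ya yb bounds by auto
      qed
    qed
  qed
qed

definition mirror :: "real^2 \<Rightarrow> real^2" where
  "mirror p = vector [p $ 1, 1 - p $ 2]"

lemma mirror_nth [simp]: "mirror p $ 1 = p $ 1" "mirror p $ 2 = 1 - p $ 2"
  by (simp_all add: mirror_def vector_2)

lemma mirror_mirror [simp]: "mirror (mirror p) = p"
  by (simp add: vec2_eq_iff)

lemma continuous_on_vec2:
  fixes u v :: "'a::topological_space \<Rightarrow> real"
  assumes "continuous_on A u" "continuous_on A v"
  shows "continuous_on A (\<lambda>t. vector [u t, v t] :: real^2)"
proof (rule continuous_on_eq)
  show "continuous_on A (\<lambda>t. (\<chi> i. if i = 1 then u t else v t) :: real^2)"
    by (intro continuous_on_vec_lambda, case_tac "i = 1") (simp_all add: assms)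
qed (simp add: vec2_eq_iff vector_2)

lemma continuous_mirror: "continuous_on A mirror"
  unfolding mirror_def by (intro continuous_on_vec2 continuous_intros)

text \<open>The lower row is the interlacing form of Fashoda's theorem; the upper row is carried to
  it by \<open>mirror\<close>.\<close>

lemma crossing_one_side:
  fixes f g :: "real \<Rightarrow> real^2"
  assumes "path f" "path g"
    and fb: "path_image f \<subseteq> cbox (vector [1, 0]) (vector [m, 1])"
    and gb: "path_image g \<subseteq> cbox (vector [1, 0]) (vector [m, 1])"
    and f0: "pathstart f = vector [a, y]" and f1: "pathfinish f = vector [c, y]"
    and g0: "pathstart g = vector [b, y]" and g1: "pathfinish g = vector [d, y]"
    and y: "y = 0 \<or> y = 1" and ord: "a < b" "b < c" "c < d"
  shows "path_image f \<inter> path_image g \<noteq> {}"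
proof -
  have bottom: "path_image f \<inter> path_image g \<noteq> {}"
    if "path f" "path g"
      "path_image f \<subseteq> cbox (vector [1, 0]) (vector [m, 1])"
      "path_image g \<subseteq> cbox (vector [1, 0]) (vector [m, 1])"
      "pathstart f = vector [a, 0]" "pathfinish f = vector [c, 0]"
      "pathstart g = vector [b, 0]" "pathfinish g = vector [d, 0]"
    for f g :: "real \<Rightarrow> real^2"
    by (rule fashoda_interlace[OF that(1-4)]) (use that ord in \<open>auto simp: vector_2\<close>)
  show ?thesis
  proof (cases "y = 0")
    case True
    then show ?thesis using bottom assms by simp
  next
    case False
    then have y1: "y = 1" using y by simp
    have "path_image (mirror \<circ> f) \<inter> path_image (mirror \<circ> g) \<noteq> {}"
    proof (rule bottom)
      show "path (mirror \<circ> f)" "path (mirror \<circ> g)"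
        using assms by (intro path_continuous_image continuous_mirror; simp)+
      show "path_image (mirror \<circ> f) \<subseteq> cbox (vector [1, 0]) (vector [m, 1])"
        "path_image (mirror \<circ> g) \<subseteq> cbox (vector [1, 0]) (vector [m, 1])"
        using fb gb by (auto simp: path_image_compose subset_iff mem_cbox_vec2)
    qed (simp_all add: pathstart_compose pathfinish_compose f0 f1 g0 g1 y1 vec2_eq_iff vector_2)
    then obtain z where z: "z \<in> mirror ` path_image f" "z \<in> mirror ` path_image g"
      unfolding path_image_compose by blast
    have "mirror z \<in> path_image f" using z(1) by auto
    moreover have "mirror z \<in> path_image g" using z(2) by auto
    ultimately show ?thesis by blast
  qed
qed

text \<open>Either all four ends lie on one row, or one of the two arcs is a transversal that the
  other has to pass. On the lower row the numbering runs from right to left, so arcs there are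
  traversed backwards and the two may exchange roles.\<close>

lemma crossing_arcs:
  fixes f g :: "real \<Rightarrow> real^2"
  assumes "path f" "path g"
    and "path_image f \<subseteq> cbox (vector [1, 0]) (vector [real n, 1])"
    and "path_image g \<subseteq> cbox (vector [1, 0]) (vector [real n, 1])"
    and f: "{pathstart f, pathfinish f} = {position (vertex_at n p), position (vertex_at n r)}"
    and g: "{pathstart g, pathfinish g} = {position (vertex_at n q), position (vertex_at n s)}"
    and ord: "p < q" "q < r" "r < s" "s \<le> 2 * n"
  shows "path_image f \<inter> path_image g \<noteq> {}"
proof -
  have orient: "\<exists>h. path h \<and> path_image h = path_image k \<and> pathstart h = a \<and> pathfinish h = b"
    if "path k" "{pathstart k, pathfinish k} = {a, b}" for k :: "real \<Rightarrow> real^2" and a b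
  proof (cases "pathstart k = a")
    case True
    then show ?thesis using that by (metis doubleton_eq_iff)
  next
    case False
    then have "pathstart (reversepath k) = a" "pathfinish (reversepath k) = b"
      using that(2) by (auto simp: doubleton_eq_iff)
    then show ?thesis using that(1) path_image_reversepath by (metis path_reversepath)
  qed
  obtain f' where f': "path f'" "path_image f' = path_image f"
    "pathstart f' = position (vertex_at n p)" "pathfinish f' = position (vertex_at n r)"
    using orient[OF assms(1) f] by blast
  obtain f'' where f'': "path f''" "path_image f'' = path_image f"
    "pathstart f'' = position (vertex_at n r)" "pathfinish f'' = position (vertex_at n p)"
    using orient[OF assms(1), of "position (vertex_at n r)" "position (vertex_at n p)"] f by (auto simp: insert_commute)
  obtain g' where g': "path g'" "path_image g' = path_image g"
    "pathstart g' = position (vertex_at n q)" "pathfinish g' = position (vertex_at n s)"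
    using orient[OF assms(2) g] by blast
  obtain g'' where g'': "path g''" "path_image g'' = path_image g"
    "pathstart g'' = position (vertex_at n s)" "pathfinish g'' = position (vertex_at n q)"
    using orient[OF assms(2), of "position (vertex_at n s)" "position (vertex_at n q)"] g by (auto simp: insert_commute)
  consider "s \<le> n" | "n < p" | "q \<le> n" "n < s" | "p \<le> n" "n < q" using ord by linarith
  then show ?thesis
  proof cases
    case 1
    then show ?thesis
      using crossing_one_side[of f' g' n p 1 r q s] f' g' assms by (simp add: position_vertex_at)
  next
    case 2
    have "path_image g'' \<inter> path_image f'' \<noteq> {}"
      using 2 g'' f'' assms
      by (intro crossing_one_side[of g'' f'' n "2 * n + 1 - s" 0 "2 * n + 1 - q" "2 * n + 1 - r" "2 * n + 1 - p"])
        (simp_all add: position_vertex_at of_nat_diff)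
    then show ?thesis using f'' g'' by blast
  next
    case 3
    have "path_image f' \<inter> path_image g'' \<noteq> {}"
      using 3 g'' f' assms
      by (intro crossing_transversal[of f' g'' n p 1 "if r \<le> n then r else 2 * n + 1 - r" "if r \<le> n then 1 else 0"
            "2 * n + 1 - s" q]) (auto simp: position_vertex_at of_nat_diff)
    then show ?thesis using f' g'' by blast
  next
    case 4
    have "path_image g'' \<inter> path_image f'' \<noteq> {}"
      using 4 g'' f'' assms
      by (intro crossing_transversal[of g'' f'' n "2 * n + 1 - s" 0 "2 * n + 1 - q" 0 "2 * n + 1 - r" p])
        (simp_all add: position_vertex_at of_nat_diff)
    then show ?thesis using f'' g'' by blast
  qed
qed


section \<open>Disjoint arcs for a noncrossing pairing\<close>

text \<open>Over a width of at most \<open>n\<close> the product of the distances to the two ends is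
  at most \<open>n^2\<close>, so a cap or cup departs from its row by at most
  \<open>1 / (2 * n)\<close>. This is below \<open>1 / 2\<close>, which keeps caps off cups, and
  below \<open>1 / n\<close>, the least depth at which a transversal ending beside a cap can be
  found under it.\<close>

definition depth :: "nat \<Rightarrow> real" where
  "depth n = 1 / (2 * real n ^ 3)"

text \<open>A transversal is parametrised by its height. For caps and cups the factor
  \<open>(q - p)^2\<close> turns \<open>t * (1 - t)\<close> into the product of the distances to the
  two ends.\<close>

definition curve :: "nat \<Rightarrow> nat \<Rightarrow> nat \<Rightarrow> real \<Rightarrow> real^2" where
  "curve n p q t =
    (if q \<le> n then vector [real p + t * (real q - real p), 1 - depth n * (t * (1 - t) * (real q - real p)\<^sup>2)]
     else if n < p then
       vector [(2 * real n + 1 - real q) + t * (real q - real p), depth n * (t * (1 - t) * (real q - real p)\<^sup>2)]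
     else vector [(1 - t) * (2 * real n + 1 - real q) + t * real p, t])"

text \<open>The equations left after eliminating the parameter; disjointness is argued from them
  alone.\<close>

definition on_curve :: "nat \<Rightarrow> nat \<Rightarrow> nat \<Rightarrow> real \<Rightarrow> real \<Rightarrow> bool" where
  "on_curve n p q x y \<longleftrightarrow>
    (if q \<le> n then real p \<le> x \<and> x \<le> real q \<and> 1 - y = depth n * ((x - real p) * (real q - x))
     else if n < p then 2 * real n + 1 - real q \<le> x \<and> x \<le> 2 * real n + 1 - real p \<and>
       y = depth n * ((x - (2 * real n + 1 - real q)) * ((2 * real n + 1 - real p) - x))
     else 0 \<le> y \<and> y \<le> 1 \<and> x = (1 - y) * (2 * real n + 1 - real q) + y * real p)"

lemma curve_on_curve:
  assumes "p < q" "t \<in> {0..1}"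
  shows "on_curve n p q (curve n p q t $ 1) (curve n p q t $ 2)"
proof -
  let ?d = "real q - real p"
  have "0 \<le> t * ?d" "t * ?d \<le> 1 * ?d"
    using assms by (auto intro: mult_right_mono)
  then show ?thesis
    using assms unfolding on_curve_def curve_def
    by (auto simp: vector_2 power2_eq_square algebra_simps)
qed

lemma arc_curve:
  assumes "p < q"
  shows "arc (curve n p q)"
proof -
  have "inj (\<lambda>t. curve n p q t)"
    using assms by (intro injI) (auto simp: curve_def vec2_eq_iff vector_2 split: if_splits)
  moreover have "path (curve n p q)"
  proof -
    consider "q \<le> n" | "n < p" | "p \<le> n" "n < q" using assms by linarith
    then show ?thesis
    proof cases
      case 1
      then have "curve n p q = (\<lambda>t. vector [real p + t * (real q - real p), 1 - depth n * (t * (1 - t) * (real q - real p)\<^sup>2)])"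
        by (auto simp: curve_def)
      then show ?thesis unfolding path_def by (auto intro!: continuous_on_vec2 continuous_intros)
    next
      case 2
      then have "curve n p q = (\<lambda>t. vector [(2 * real n + 1 - real q) + t * (real q - real p), depth n * (t * (1 - t) * (real q - real p)\<^sup>2)])"
        using assms by (auto simp: curve_def)
      then show ?thesis unfolding path_def by (auto intro!: continuous_on_vec2 continuous_intros)
    next
      case 3
      then have "curve n p q = (\<lambda>t. vector [(1 - t) * (2 * real n + 1 - real q) + t * real p, t])"
        by (auto simp: curve_def)
      then show ?thesis unfolding path_def by (auto intro!: continuous_on_vec2 continuous_intros)
    qed
  qed
  ultimately show ?thesis unfolding arc_def by (auto intro: inj_on_subset)
qed

lemma curve_ends:
  assumes "p < q" "q \<le> 2 * n"
  shows "{pathstart (curve n p q), pathfinish (curve n p q)} = position ` {vertex_at n p, vertex_at n q}"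
  using assms
  by (auto simp: pathstart_def pathfinish_def curve_def position_vertex_at of_nat_diff insert_commute vec2_eq_iff vector_2)

lemma depth_pos: "0 < n \<Longrightarrow> 0 < depth n"
  by (simp add: depth_def)

text \<open>Caps and cups are flatter than every transversal passing beside them.\<close>

lemma depth_bound:
  assumes "2 \<le> n" "0 \<le> a" "0 \<le> b" "a + b \<le> real n"
  shows "0 \<le> depth n * (a * b)" "depth n * (a * b) < 1 / 2" "depth n * (a * b) * real n < 1"
proof -
  have n: "real n > 0" using assms by simp
  have "a * b \<le> real n * real n" using assms by (intro mult_mono) auto
  then have "depth n * (a * b) \<le> depth n * (real n * real n)"
    using depth_pos[of n] assms by (intro mult_left_mono) auto
  also have "\<dots> = 1 / (2 * real n)" using n by (simp add: depth_def power3_eq_cube)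
  finally have *: "depth n * (a * b) \<le> 1 / (2 * real n)" .
  show "0 \<le> depth n * (a * b)" using assms depth_pos[of n] by simp
  have "1 / (2 * real n) < 1 / 2" using assms by (simp add: divide_simps)
  then show "depth n * (a * b) < 1 / 2" using * by linarith
  have "depth n * (a * b) * real n \<le> 1 / (2 * real n) * real n" using * n by (intro mult_right_mono) auto
  then show "depth n * (a * b) * real n < 1" using n by simp
qed

lemma nested_product_less:
  assumes "a < b" "d < e" "b \<le> x" "x \<le> (d :: real)"
  shows "(x - b) * (d - x) < (x - a) * (e - x)"
proof -
  have "(x - b) * (d - x) \<le> (x - b) * (e - x)" using assms by (intro mult_left_mono) auto
  also have "\<dots> < (x - a) * (e - x)" using assms by (intro mult_strict_right_mono) auto
  finally show ?thesis .
qed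

text \<open>A descent by \<open>1 - y\<close> moves the line sideways by at most
  \<open>(1 - y) * n\<close>, so a point at horizontal distance at least 1 from the upper end lies
  at least \<open>1 / n\<close> below it.\<close>

lemma line_gap:
  fixes k l x y n i :: real
  assumes "x = (1 - y) * l + y * k" "0 \<le> y" "y \<le> 1" "1 \<le> l" "l \<le> n" "1 \<le> k" "k \<le> n" "k + 1 \<le> i" "i \<le> x"
  shows "1 \<le> (1 - y) * n"
proof -
  have "1 \<le> x - k" using assms by linarith
  also have "x - k = (1 - y) * (l - k)" using assms(1) by (simp add: algebra_simps)
  also have "\<dots> \<le> (1 - y) * n" using assms by (intro mult_left_mono) auto
  finally show ?thesis .
qed

lemma line_gap':
  fixes k l x y n i :: real
  assumes "x = (1 - y) * l + y * k" "0 \<le> y" "y \<le> 1" "1 \<le> l" "l \<le> n" "1 \<le> k" "k \<le> n" "x \<le> i" "i + 1 \<le> k"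
  shows "1 \<le> (1 - y) * n"
  using line_gap[of "n + 1 - x" y "n + 1 - l" "n + 1 - k" n "n + 1 - i"] assms
  by (simp add: algebra_simps)

text \<open>Two arcs on one row have disjoint ranges of abscissae, a cap and a cup stay in different
  halves of the strip, and a transversal that has come under a cap is already deeper than the cap,
  likewise for cups.\<close>

lemma curves_disjoint_side:
  assumes n: "2 \<le> n" and ord: "1 \<le> p" "p < q" "q < p'" "p' < q'" "q' \<le> 2 * n"
    and on: "on_curve n p q x y" "on_curve n p' q' x y"
  shows False
proof -
  define r where "r m = 2 * real n + 1 - real m" for m
  have ro: "real p < real q" "real q < real p'" "real p' < real q'" "1 \<le> real p" "real q' \<le> 2 * real n"
    using ord by linarith+
  have rr: "r q < r p" "r p' < r q" "r q' < r p'" "1 \<le> r q'" using ro by (simp_all add: r_def)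
  consider "q' \<le> n" | "q \<le> n" "p' \<le> n" "n < q'" | "q \<le> n" "n < p'" | "p \<le> n" "n < q" | "n < p"
    using ord by linarith
  then show False
  proof cases
    case 1
    then show False using on ord by (simp add: on_curve_def)
  next
    case 2
    have c: "real p \<le> x" "x \<le> real q" "1 - y = depth n * ((x - real p) * (real q - x))"
      using on(1) 2 by (simp_all add: on_curve_def)
    have t: "0 \<le> y" "y \<le> 1" "x = (1 - y) * r q' + y * real p'"
      using on(2) 2 ord by (simp_all add: on_curve_def r_def)
    have "1 \<le> (1 - y) * real n"
    proof (rule line_gap'[OF t(3,1,2)])
      have "real n + 1 \<le> real q'" using 2 by linarith
      then show "r q' \<le> real n" by (simp add: r_def)
      show "x \<le> real q" by (rule c)
      have "q + 1 \<le> p'" using ord by simp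
      then show "real q + 1 \<le> real p'" by linarith
    qed (use 2 ord rr in auto)
    moreover have "real q \<le> real n" using 2 by simp
    then have "depth n * ((x - real p) * (real q - x)) * real n < 1"
      using depth_bound(3)[of n "x - real p" "real q - x"] n c ro by simp
    ultimately show False using c(3) by simp
  next
    case 3
    have c: "real p \<le> x" "x \<le> real q" "1 - y = depth n * ((x - real p) * (real q - x))"
      using on(1) 3 by (simp_all add: on_curve_def)
    have u: "r q' \<le> x" "x \<le> r p'" "y = depth n * ((x - r q') * (r p' - x))"
      using on(2) 3 ord by (simp_all add: on_curve_def r_def)
    have "real n + 1 \<le> real p'" using 3 by linarith
    then have "r p' \<le> real n" by (simp add: r_def)
    moreover have "real q \<le> real n" using 3 by simp
    ultimately have "1 - y < 1 / 2" "y < 1 / 2"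
      using depth_bound(2)[of n "x - real p" "real q - x"] depth_bound(2)[of n "x - r q'" "r p' - x"]
        n c u ro rr by simp_all
    then show False by simp
  next
    case 4
    have t: "0 \<le> y" "y \<le> 1" "x = (1 - y) * r q + y * real p"
      using on(1) 4 by (simp_all add: on_curve_def r_def)
    have u: "r q' \<le> x" "x \<le> r p'" "y = depth n * ((x - r q') * (r p' - x))"
      using on(2) 4 ord by (simp_all add: on_curve_def r_def)
    have rp: "r p' \<le> real n" using 4 ord by (simp add: r_def)
    \<comment> \<open>For a cup the height \<open>y\<close> plays the part of the depth, so the two
      ends of the line exchange roles.\<close>
    have "1 \<le> (1 - (1 - y)) * real n"
    proof (rule line_gap')
      show "x = (1 - (1 - y)) * real p + (1 - y) * r q" using t(3) by simp
      show "x \<le> r p'" by (rule u)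
      have "q + 1 \<le> p'" using ord by simp
      then show "r p' + 1 \<le> r q" unfolding r_def by linarith
      have "real n + 1 \<le> real q" using 4 by linarith
      then show "r q \<le> real n" by (simp add: r_def)
    qed (use 4 ord rr t in auto)
    moreover have "depth n * ((x - r q') * (r p' - x)) * real n < 1"
      using depth_bound(3)[of n "x - r q'" "r p' - x"] n u rr rp by simp
    ultimately show False using u(3) by simp
  next
    case 5
    then show False using on ord by (simp add: on_curve_def)
  qed
qed

text \<open>Nested arcs on one row are parabolas with the same leading coefficient, and the wider
  pair of roots gives the strictly larger product. Two transversals could meet only where a convex
  combination of two positive gaps vanishes.\<close>

lemma curves_disjoint_nested:
  assumes n: "2 \<le> n" and ord: "1 \<le> p" "p < p'" "p' < q'" "q' < q" "q \<le> 2 * n"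
    and on: "on_curve n p q x y" "on_curve n p' q' x y"
  shows False
proof -
  define r where "r m = 2 * real n + 1 - real m" for m
  have ro: "real p < real p'" "real p' < real q'" "real q' < real q" "1 \<le> real p" "real q \<le> 2 * real n"
    using ord by linarith+
  have rr: "r q < r q'" "r q' < r p'" "r p' < r p" "1 \<le> r q" using ro by (simp_all add: r_def)
  have d: "0 < depth n" using depth_pos n by simp
  consider "q \<le> n" | "p \<le> n" "n < q" "q' \<le> n" | "p \<le> n" "n < q" "n < p'" | "p' \<le> n" "n < q'" | "n < p"
    using ord by linarith
  then show False
  proof cases
    case 1
    have "(x - real p') * (real q' - x) < (x - real p) * (real q - x)"
      using on(2) 1 ord by (intro nested_product_less) (auto simp: on_curve_def)
    then have "depth n * ((x - real p') * (real q' - x)) < depth n * ((x - real p) * (real q - x))"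
      using d by (rule mult_strict_left_mono)
    moreover have "1 - y = depth n * ((x - real p) * (real q - x))" "1 - y = depth n * ((x - real p') * (real q' - x))"
      using on 1 ord by (simp_all add: on_curve_def)
    ultimately show False by linarith
  next
    case 2
    have t: "0 \<le> y" "y \<le> 1" "x = (1 - y) * r q + y * real p"
      using on(1) 2 by (simp_all add: on_curve_def r_def)
    have c: "real p' \<le> x" "x \<le> real q'" "1 - y = depth n * ((x - real p') * (real q' - x))"
      using on(2) 2 by (simp_all add: on_curve_def)
    have "1 \<le> (1 - y) * real n"
    proof (rule line_gap[OF t(3,1,2)])
      have "real n + 1 \<le> real q" using 2 by linarith
      then show "r q \<le> real n" by (simp add: r_def)
      show "real p' \<le> x" by (rule c)
      have "p + 1 \<le> p'" using ord by simp
      then show "real p + 1 \<le> real p'" by linarith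
    qed (use 2 ord rr in auto)
    moreover have "depth n * ((x - real p') * (real q' - x)) * real n < 1"
      using depth_bound(3)[of n "x - real p'" "real q' - x"] n c ro 2 by simp
    ultimately show False using c(3) by simp
  next
    case 3
    have t: "0 \<le> y" "y \<le> 1" "x = (1 - y) * r q + y * real p"
      using on(1) 3 by (simp_all add: on_curve_def r_def)
    have u: "r q' \<le> x" "x \<le> r p'" "y = depth n * ((x - r q') * (r p' - x))"
      using on(2) 3 ord by (simp_all add: on_curve_def r_def)
    have rp: "r p' \<le> real n" using 3 ord by (simp add: r_def)
    have "1 \<le> (1 - (1 - y)) * real n"
    proof (rule line_gap)
      show "x = (1 - (1 - y)) * real p + (1 - y) * r q" using t(3) by simp
      show "r q' \<le> x" by (rule u)
      have "q' + 1 \<le> q" using ord by simp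
      then show "r q + 1 \<le> r q'" unfolding r_def by linarith
      have "real n + 1 \<le> real q" using 3 by linarith
      then show "r q \<le> real n" by (simp add: r_def)
    qed (use 3 ord rr t in auto)
    moreover have "depth n * ((x - r q') * (r p' - x)) * real n < 1"
      using depth_bound(3)[of n "x - r q'" "r p' - x"] n u rr rp by simp
    ultimately show False using u(3) by simp
  next
    case 4
    have t: "0 \<le> y" "y \<le> 1" "x = (1 - y) * r q + y * real p"
      using on(1) 4 ord by (simp_all add: on_curve_def r_def)
    have t': "x = (1 - y) * r q' + y * real p'"
      using on(2) 4 ord by (simp_all add: on_curve_def r_def)
    have "(1 - y) * (r q' - r q) + y * (real p' - real p) = 0"
      using t(3) t' by (simp add: algebra_simps)
    moreover have "0 \<le> (1 - y) * (r q' - r q)" "0 \<le> y * (real p' - real p)" using t rr ro by simp_all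
    ultimately have "(1 - y) * (r q' - r q) = 0" "y * (real p' - real p) = 0" by linarith+
    then show False using rr ro by auto
  next
    case 5
    have "(x - r q') * (r p' - x) < (x - r q) * (r p - x)"
      using on(2) 5 ord rr by (intro nested_product_less) (auto simp: on_curve_def r_def)
    then have "depth n * ((x - r q') * (r p' - x)) < depth n * ((x - r q) * (r p - x))"
      using d by (rule mult_strict_left_mono)
    moreover have "y = depth n * ((x - r q) * (r p - x))" "y = depth n * ((x - r q') * (r p' - x))"
      using on 5 ord by (simp_all add: on_curve_def r_def)
    ultimately show False by linarith
  qed
qed

lemma curve_in_box:
  assumes n: "2 \<le> n" and ord: "1 \<le> p" "p < q" "q \<le> 2 * n" and t: "t \<in> {0..1}"
  shows "curve n p q t \<in> cbox (vector [1, 0]) (vector [real n, 1])"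
proof -
  define x y where "x = curve n p q t $ 1" and "y = curve n p q t $ 2"
  have on: "on_curve n p q x y" using curve_on_curve[OF ord(2) t] by (simp add: x_def y_def)
  have ro: "real p < real q" "1 \<le> real p" "real q \<le> 2 * real n" using ord by linarith+
  consider "q \<le> n" | "n < p" | "p \<le> n" "n < q" by linarith
  then have "1 \<le> x \<and> x \<le> real n \<and> 0 \<le> y \<and> y \<le> 1"
  proof cases
    case 1
    then have c: "real p \<le> x" "x \<le> real q" "1 - y = depth n * ((x - real p) * (real q - x))" "real q \<le> real n"
      using on by (simp_all add: on_curve_def)
    show ?thesis using depth_bound(1,2)[of n "x - real p" "real q - x"] c n ro by simp
  next
    case 2
    then have "real n + 1 \<le> real p" by linarith
    moreover have "2 * real n + 1 - real q \<le> x" "x \<le> 2 * real n + 1 - real p"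
       "y = depth n * ((x - (2 * real n + 1 - real q)) * ((2 * real n + 1 - real p) - x))"
      using on 2 ord by (simp_all add: on_curve_def)
    ultimately show ?thesis
      using depth_bound(1,2)[of n "x - (2 * real n + 1 - real q)" "(2 * real n + 1 - real p) - x"] n ro by simp
  next
    case 3
    then have tr: "0 \<le> y" "y \<le> 1" "x = (1 - y) * (2 * real n + 1 - real q) + y * real p"
      using on by (simp_all add: on_curve_def)
    have q: "real n + 1 \<le> real q" "real p \<le> real n" using 3 by linarith+
    have "(1 - y) * 1 + y * 1 \<le> x" unfolding tr(3) using tr ro by (intro add_mono mult_left_mono) auto
    moreover have "x \<le> (1 - y) * real n + y * real n" unfolding tr(3) using tr q by (intro add_mono mult_left_mono) auto
    ultimately show ?thesis using tr by (simp add: algebra_simps)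
  qed
  then show ?thesis by (simp add: mem_cbox_vec2 x_def y_def)
qed

lemma noncrossing_if_planar:
  assumes f: "pairing n f" and planar: "planar_pairing n (diagram n f)"
  shows "noncrossing f"
  unfolding noncrossing_def
proof (intro allI impI, rule ccontr)
  fix x y assume xy: "x < y" "y < f x" "\<not> f y < f x"
  obtain \<gamma> :: "vertex set \<Rightarrow> real \<Rightarrow> real^2" where
    \<gamma>: "\<And>B. B \<in> diagram n f \<Longrightarrow> arc (\<gamma> B) \<and> {pathstart (\<gamma> B), pathfinish (\<gamma> B)} = position ` B \<and>
        path_image (\<gamma> B) \<subseteq> cbox (vector [1, 0]) (vector [real n, 1])"
    and disj: "pairwise (\<lambda>B C. disjnt (path_image (\<gamma> B)) (path_image (\<gamma> C))) (diagram n f)"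
    using planar unfolding planar_pairing_def by blast
  have x: "x \<in> {1..2 * n}" using xy(1,2) pairing_outside[OF f, of x] by (metis less_trans nat_neq_iff)
  then have fx: "f x \<in> {1..2 * n}" using f pairing_in by blast
  have y: "y \<in> {1..2 * n}" using x fx xy by simp
  have "f y \<noteq> f x" using xy f by (metis pairing_invol nat_neq_iff)
  then have ord: "x < y" "y < f x" "f x < f y" using xy by auto
  have fy: "f y \<in> {1..2 * n}" using f y pairing_in by blast
  let ?B = "{vertex_at n x, vertex_at n (f x)}" and ?C = "{vertex_at n y, vertex_at n (f y)}"
  have B: "?B \<in> diagram n f" and C: "?C \<in> diagram n f" using x y unfolding diagram_def by blast+
  have "vertex_at n x \<noteq> vertex_at n y" "vertex_at n x \<noteq> vertex_at n (f y)"
    using x y fy ord vertex_at_eq_iff by (metis less_irrefl less_trans)+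
  then have "?B \<noteq> ?C" by auto
  then have "path_image (\<gamma> ?B) \<inter> path_image (\<gamma> ?C) = {}"
    using pairwiseD[OF disj B C] by (simp add: disjnt_def)
  moreover have "path_image (\<gamma> ?B) \<inter> path_image (\<gamma> ?C) \<noteq> {}"
    by (rule crossing_arcs[of _ _ n x "f x" y "f y"]) (use \<gamma>[OF B] \<gamma>[OF C] ord fy in \<open>auto simp: arc_imp_path\<close>)
  ultimately show False by blast
qed

lemma planar_if_noncrossing:
  assumes n: "2 \<le> n" and f: "pairing n f" and nc: "noncrossing f"
  shows "planar_pairing n (diagram n f)"
proof -
  have ex: "\<exists>x. x \<in> {1..2 * n} \<and> f x \<in> {1..2 * n} \<and> x < f x \<and> B = {vertex_at n x, vertex_at n (f x)}"
    if "B \<in> diagram n f" for B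
    by (rule diagram_blockE[OF f that]) blast
  \<comment> \<open>\<open>s B\<close> is the smaller end of the block, so that every arc is drawn
    as a \<open>curve\<close> with ordered ends.\<close>
  define s where "s B = (SOME x. x \<in> {1..2 * n} \<and> f x \<in> {1..2 * n} \<and> x < f x \<and> B = {vertex_at n x, vertex_at n (f x)})" for B
  have s: "s B \<in> {1..2 * n} \<and> f (s B) \<in> {1..2 * n} \<and> s B < f (s B) \<and> B = {vertex_at n (s B), vertex_at n (f (s B))}"
    if "B \<in> diagram n f" for B
    unfolding s_def by (rule someI_ex[OF ex[OF that]])
  define \<gamma> where "\<gamma> B = curve n (s B) (f (s B))" for B
  show ?thesis
    unfolding planar_pairing_def
  proof (intro exI[of _ \<gamma>] conjI ballI)
    fix B assume "B \<in> diagram n f"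
    note sB = s[OF this]
    show "arc (\<gamma> B)" unfolding \<gamma>_def using sB by (intro arc_curve) simp
    show "{pathstart (\<gamma> B), pathfinish (\<gamma> B)} = position ` B"
      unfolding \<gamma>_def using curve_ends[of "s B" "f (s B)" n] sB by simp
    show "path_image (\<gamma> B) \<subseteq> cbox (vector [1, 0]) (vector [real n, 1])"
      unfolding \<gamma>_def path_image_def using sB curve_in_box[OF n] by auto
  next
    have disj: False
      if B: "B \<in> diagram n f" and C: "C \<in> diagram n f" and lt: "s B < s C"
        and z: "z \<in> path_image (\<gamma> B)" "z \<in> path_image (\<gamma> C)" for B C z
    proof -
      note sB = s[OF B] and sC = s[OF C]
      have "on_curve n p q (z $ 1) (z $ 2)" if "z \<in> path_image (curve n p q)" "p < q" for p q
        using that(1) curve_on_curve[OF that(2)] unfolding path_image_def by (elim imageE) simp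
      then have on: "on_curve n (s B) (f (s B)) (z $ 1) (z $ 2)" "on_curve n (s C) (f (s C)) (z $ 1) (z $ 2)"
        using z sB sC unfolding \<gamma>_def by auto
      have "f (s B) \<noteq> s C" using sB sC lt f by (metis pairing_invol less_asym)
      then consider "f (s B) < s C" | "s C < f (s B)" by linarith
      then show False
      proof cases
        case 1
        then show False using curves_disjoint_side[OF n _ _ _ _ _ on] sB sC by auto
      next
        case 2
        then have "f (s C) < f (s B)" using nc lt unfolding noncrossing_def by blast
        then show False using curves_disjoint_nested[OF n _ _ _ _ _ on] sB sC lt by auto
      qed
    qed
    show "pairwise (\<lambda>B C. disjnt (path_image (\<gamma> B)) (path_image (\<gamma> C))) (diagram n f)"
    proof (rule pairwiseI)
      fix B C assume B: "B \<in> diagram n f" and C: "C \<in> diagram n f" and "B \<noteq> C"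
      then have "s B \<noteq> s C" using s[OF B] s[OF C] by metis
      then consider "s B < s C" | "s C < s B" by linarith
      then show "disjnt (path_image (\<gamma> B)) (path_image (\<gamma> C))"
        unfolding disjnt_def using disj[OF B C] disj[OF C B] by cases blast+
    qed
  qed
qed

section \<open>Hooks\<close>

definition matching :: "nat \<Rightarrow> (nat \<Rightarrow> nat) \<Rightarrow> bool" where
  "matching n f \<longleftrightarrow> pairing n f \<and> noncrossing f"

lemma matching_pairing: "matching n f \<Longrightarrow> pairing n f"
  by (simp add: matching_def)

lemma matching_between:
  assumes f: "matching n f" and "x < y" "y < f x"
  shows "x < f y" "f y < f x"
proof -
  have nc: "\<And>x y. x < y \<Longrightarrow> y < f x \<Longrightarrow> f y < f x" and p: "pairing n f"
    using f unfolding matching_def noncrossing_def by blast+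
  show "f y < f x" using nc assms by blast
  have "f y \<noteq> x" using assms(3) p by (metis pairing_invol less_irrefl)
  moreover have "\<not> f y < x"
    using nc[of "f y" x] assms p by (auto dest: less_trans)
  ultimately show "x < f y" by linarith
qed

text \<open>The single place where both directions of the planarity criterion are used. From here on
  the elements are noncrossing involutions and no topology is involved.\<close>

lemma carrier_jones:
  assumes "2 \<le> n"
  shows "carrier (jones n) = diagram n ` {f. matching n f}"
proof
  show "carrier (jones n) \<subseteq> diagram n ` {f. matching n f}"
  proof
    fix \<alpha> assume "\<alpha> \<in> carrier (jones n)"
    then have \<alpha>: "partition_on (vertices n) \<alpha>" "\<forall>B\<in>\<alpha>. card B = 2" "planar_pairing n \<alpha>"
      by (simp_all add: jones_def partition_monoid_def)
    then obtain f where "pairing n f" "\<alpha> = diagram n f" using ex_pairing by blast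
    then show "\<alpha> \<in> diagram n ` {f. matching n f}"
      using \<alpha>(3) noncrossing_if_planar by (auto simp: matching_def)
  qed
  show "diagram n ` {f. matching n f} \<subseteq> carrier (jones n)"
    using assms
    by (auto simp: jones_def partition_monoid_def matching_def partition_on_diagram
        card_diagram_block planar_if_noncrossing)
qed

text \<open>Joins \<open>i\<close> to \<open>i + 1\<close> and their former partners to each other.
  If \<open>i\<close> and \<open>i + 1\<close> were partners already, the first two clauses cover
  all four points and nothing changes: the closed loop of the product leaves no trace.\<close>

definition hook :: "nat \<Rightarrow> (nat \<Rightarrow> nat) \<Rightarrow> nat \<Rightarrow> nat" where
  "hook i f x = (if x = i then i + 1 else if x = i + 1 then i else
     if x = f i then f (i + 1) else if x = f (i + 1) then f i else f x)"

lemma hook_same: "pairing n f \<Longrightarrow> f i = i + 1 \<Longrightarrow> hook i f = f"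
  by (rule ext) (metis hook_def pairing_invol)

lemma hook_at [simp]: "hook i f i = i + 1" "hook i f (i + 1) = i" "hook i f (Suc i) = i"
  by (simp_all add: hook_def)

lemma hook_other: "x \<noteq> i \<Longrightarrow> x \<noteq> i + 1 \<Longrightarrow> x \<noteq> f i \<Longrightarrow> x \<noteq> f (i + 1) \<Longrightarrow> hook i f x = f x"
  by (simp add: hook_def)

lemma hook_distinct:
  assumes "pairing n f" "1 \<le> i" "i < 2 * n" "f i \<noteq> i + 1"
  shows "f i \<noteq> i" "f (i + 1) \<noteq> i" "f (i + 1) \<noteq> i + 1" "f i \<noteq> f (i + 1)"
  using assms pairing_neq[OF assms(1), of i] pairing_neq[OF assms(1), of "i + 1"]
  by (auto, metis pairing_invol, metis pairing_invol n_not_Suc_n)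

lemma pairing_hook:
  assumes f: "pairing n f" and i: "1 \<le> i" "i < 2 * n"
  shows "pairing n (hook i f)"
proof (cases "f i = i + 1")
  case True
  then show ?thesis using hook_same[OF f] f by simp
next
  case False
  note d = hook_distinct[OF f i False]
  have ff: "f (f x) = x" for x using f by simp
  have out: "f x = x \<longleftrightarrow> x \<notin> {1..2 * n}" for x using f unfolding pairing_def by blast
  have inv: "hook i f (hook i f x) = x" for x
  proof -
    consider "x = i" | "x = i + 1" | "x = f i" | "x = f (i + 1)" |
      "x \<noteq> i" "x \<noteq> i + 1" "x \<noteq> f i" "x \<noteq> f (i + 1)" by blast
    then show ?thesis
    proof cases
      case 5
      then have "f x \<noteq> i" "f x \<noteq> i + 1" "f x \<noteq> f i" "f x \<noteq> f (i + 1)" using ff by metis+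
      then show ?thesis using 5 by (simp add: hook_other ff)
    qed (use d False in \<open>auto simp: hook_def\<close>)
  qed
  have fixpt: "hook i f x = x \<longleftrightarrow> x \<notin> {1..2 * n}" for x
  proof -
    have mem: "i \<in> {1..2 * n}" "i + 1 \<in> {1..2 * n}" using i by auto
    then have mem': "f i \<in> {1..2 * n}" "f (i + 1) \<in> {1..2 * n}" using pairing_in[OF f] by blast+
    show ?thesis
    proof (cases "x = i \<or> x = i + 1 \<or> x = f i \<or> x = f (i + 1)")
      case True
      then have "hook i f x \<noteq> x" using d False by (auto simp: hook_def)
      then show ?thesis using True mem mem' by blast
    next
      case False
      then show ?thesis using out by (simp add: hook_other)
    qed
  qed
  show ?thesis unfolding pairing_def using inv fixpt by blast
qed

text \<open>No point lies between \<open>i\<close> and \<open>i + 1\<close>, so the new arc from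
  \<open>a\<close> to \<open>b\<close> can run along the two old arcs. In terms of inequalities, the
  conditions for \<open>f\<close> at \<open>i\<close>, \<open>i + 1\<close>, \<open>a\<close>,
  \<open>b\<close> and \<open>x\<close> decide every case.\<close>

lemma matching_hook:
  assumes f: "matching n f" and i: "1 \<le> i" "i < 2 * n"
  shows "matching n (hook i f)"
proof (cases "f i = i + 1")
  case True
  then show ?thesis using hook_same[OF matching_pairing[OF f]] f by simp
next
  case False
  have p: "pairing n f" by (rule matching_pairing[OF f])
  note d = hook_distinct[OF p i False]
  define a b where "a = f i" and "b = f (i + 1)"
  have ff: "f (f x) = x" for x using p by simp
  have fa: "f a = i" and fb: "f b = i + 1" by (simp_all add: a_def b_def ff)
  have ab: "a \<noteq> i" "a \<noteq> i + 1" "b \<noteq> i" "b \<noteq> i + 1" "a \<noteq> b"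
    using d False by (simp_all add: a_def b_def)
  have N: "u < v \<longrightarrow> v < f u \<longrightarrow> u < f v \<and> f v < f u" for u v
    using matching_between[OF f] by blast
  have "hook i f y < hook i f x" if xy: "x < y" "y < hook i f x" for x y
  proof -
    have Ni: "i < v \<longrightarrow> v < a \<longrightarrow> i < f v \<and> f v < a" for v using N[of i v] by (simp add: a_def)
    have Nj: "i + 1 < v \<longrightarrow> v < b \<longrightarrow> i + 1 < f v \<and> f v < b" for v using N[of "i + 1" v] by (simp add: b_def)
    have Na: "a < v \<longrightarrow> v < i \<longrightarrow> a < f v \<and> f v < i" for v using N[of a v] by (simp add: fa)
    have Nb: "b < v \<longrightarrow> v < i + 1 \<longrightarrow> b < f v \<and> f v < i + 1" for v using N[of b v] by (simp add: fb)
    have hy: "hook i f y = (if y = i then i + 1 else if y = i + 1 then i else if y = a then b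
        else if y = b then a else f y)" by (simp add: hook_def a_def b_def)
    have fy: "f y = i \<longleftrightarrow> y = a" "f y = i + 1 \<longleftrightarrow> y = b" "f y = a \<longleftrightarrow> y = i" "f y = b \<longleftrightarrow> y = i + 1"
      using ff a_def b_def by metis+
    have fx: "f x = i \<longleftrightarrow> x = a" "f x = i + 1 \<longleftrightarrow> x = b" "f x = a \<longleftrightarrow> x = i" "f x = b \<longleftrightarrow> x = i + 1"
      using ff a_def b_def by metis+
    consider "x = i" | "x = i + 1" | "x = a" | "x = b" |
      "x \<noteq> i" "x \<noteq> i + 1" "x \<noteq> a" "x \<noteq> b" by blast
    then show ?thesis
    proof cases
      case 1
      then show ?thesis using xy by simp
    next
      case 2
      then show ?thesis using xy by simp
    next
      case 3
      then have h: "hook i f x = b" using ab by (simp add: hook_def a_def b_def)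
      have "a < y" "y < b" using xy 3 h by auto
      then show ?thesis
        unfolding h hy using ab fy Nj[of y] Na[of y] Na[of b] fb by (smt (verit) Suc_eq_plus1 less_Suc_eq linorder_neqE_nat not_less_eq less_trans)
    next
      case 4
      then have h: "hook i f x = a" using ab by (simp add: hook_def a_def b_def)
      have "b < y" "y < a" using xy 4 h by auto
      then show ?thesis
        unfolding h hy using ab fy Ni[of y] Nb[of y] N[of y a] fa by (smt (verit) Suc_eq_plus1 less_Suc_eq linorder_neqE_nat not_less_eq less_trans)
    next
      case 5
      then have h: "hook i f x = f x" using ab by (simp add: hook_def a_def b_def)
      have "x < y" "y < f x" using xy h by auto
      then show ?thesis
        unfolding h hy using 5 fx N[of x y] N[of x a] N[of x b] N[of x i] N[of x "i + 1"] fa fb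
          a_def b_def by (smt (verit) Suc_eq_plus1 less_Suc_eq linorder_neqE_nat not_less_eq less_trans)
    qed
  qed
  then show ?thesis using pairing_hook[OF p i] unfolding matching_def noncrossing_def by blast
qed

section \<open>Exchange of the rows and the identity element as involutions\<close>

definition reflect :: "nat \<Rightarrow> (nat \<Rightarrow> nat) \<Rightarrow> nat \<Rightarrow> nat" where
  "reflect n f x = (if x \<in> {1..2 * n} then 2 * n + 1 - f (2 * n + 1 - x) else x)"

definition straight :: "nat \<Rightarrow> nat \<Rightarrow> nat" where
  "straight n x = (if x \<in> {1..2 * n} then 2 * n + 1 - x else x)"

lemma pairing_reflect:
  assumes f: "pairing n f"
  shows "pairing n (reflect n f)"
  unfolding pairing_def
proof (intro conjI allI)
  fix x
  show "reflect n f (reflect n f x) = x"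
  proof (cases "x \<in> {1..2 * n}")
    case True
    then have "2 * n + 1 - x \<in> {1..2 * n}" by auto
    then have *: "f (2 * n + 1 - x) \<in> {1..2 * n}" using pairing_in[OF f] by blast
    then have "2 * n + 1 - f (2 * n + 1 - x) \<in> {1..2 * n}"
      "2 * n + 1 - (2 * n + 1 - f (2 * n + 1 - x)) = f (2 * n + 1 - x)" by auto
    then show ?thesis using True f by (simp add: reflect_def)
  qed (auto simp: reflect_def)
  show "reflect n f x = x \<longleftrightarrow> x \<notin> {1..2 * n}"
  proof (cases "x \<in> {1..2 * n}")
    case True
    then have *: "2 * n + 1 - x \<in> {1..2 * n}" by auto
    then have "f (2 * n + 1 - x) \<noteq> 2 * n + 1 - x" "f (2 * n + 1 - x) \<in> {1..2 * n}"
      using pairing_neq[OF f] pairing_in[OF f] by blast+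
    then show ?thesis using True by (auto simp: reflect_def)
  qed (auto simp: reflect_def)
qed

lemma matching_reflect:
  assumes f: "matching n f"
  shows "matching n (reflect n f)"
proof -
  have p: "pairing n f" by (rule matching_pairing[OF f])
  have "reflect n f y < reflect n f x" if xy: "x < y" "y < reflect n f x" for x y
  proof -
    have x: "x \<in> {1..2 * n}" using xy unfolding reflect_def by (metis less_asym)
    then have x': "2 * n + 1 - x \<in> {1..2 * n}" by auto
    then have fx: "f (2 * n + 1 - x) \<in> {1..2 * n}" using pairing_in[OF p] by blast
    have y: "y \<in> {1..2 * n}" using xy x fx by (auto simp: reflect_def)
    then have y': "2 * n + 1 - y \<in> {1..2 * n}" by auto
    then have fy: "f (2 * n + 1 - y) \<in> {1..2 * n}" using pairing_in[OF p] by blast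
    have "f (2 * n + 1 - x) < 2 * n + 1 - y" "2 * n + 1 - y < f (f (2 * n + 1 - x))"
      using xy x y fx p by (auto simp: reflect_def)
    from matching_between[OF f this] have "2 * n + 1 - f (2 * n + 1 - y) < 2 * n + 1 - f (2 * n + 1 - x)"
      using fy by (intro diff_less_mono2) auto
    then show ?thesis using x y by (simp add: reflect_def)
  qed
  then show ?thesis using pairing_reflect[OF p] unfolding matching_def noncrossing_def by blast
qed

lemma flip_vertex_at: "x \<in> {1..2 * n} \<Longrightarrow> flip (vertex_at n x) = vertex_at n (2 * n + 1 - x)"
  by (auto simp: vertex_at_def)

lemma reflect_image: "(\<lambda>x. 2 * n + 1 - x) ` {1..2 * n} = {1..2 * (n :: nat)}"
proof
  show "{1..2 * n} \<subseteq> (\<lambda>x. 2 * n + 1 - x) ` {1..2 * n}"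
    by (rule subsetI, rule_tac x = "2 * n + 1 - x" in image_eqI) auto
qed auto

lemma star_diagram:
  assumes f: "pairing n f"
  shows "star (diagram n f) = diagram n (reflect n f)"
proof -
  have "flip ` {vertex_at n x, vertex_at n (f x)} =
      {vertex_at n (2 * n + 1 - x), vertex_at n (reflect n f (2 * n + 1 - x))}"
    if "x \<in> {1..2 * n}" for x
  proof -
    have "f x \<in> {1..2 * n}" using that pairing_in[OF f] by blast
    moreover have "2 * n + 1 - x \<in> {1..2 * n}" "2 * n + 1 - (2 * n + 1 - x) = x" using that by auto
    ultimately show ?thesis using that by (simp add: flip_vertex_at reflect_def)
  qed
  then have "star (diagram n f) = (\<lambda>x. {vertex_at n (2 * n + 1 - x), vertex_at n (reflect n f (2 * n + 1 - x))}) ` {1..2 * n}"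
    unfolding star_def diagram_def image_image by (intro image_cong) auto
  also have "\<dots> = (\<lambda>x. {vertex_at n x, vertex_at n (reflect n f x)}) ` (\<lambda>x. 2 * n + 1 - x) ` {1..2 * n}"
    by (simp only: image_image)
  finally show ?thesis unfolding reflect_image diagram_def .
qed

lemma matching_straight: "matching n (straight n)"
proof -
  have "straight n (straight n x) = x" for x by (auto simp: straight_def)
  moreover have "straight n x = x \<longleftrightarrow> x \<notin> {1..2 * n}" for x by (auto simp: straight_def) presburger+
  moreover have "straight n y < straight n x" if "x < y" "y < straight n x" for x y
    using that by (auto simp: straight_def split: if_splits)
  ultimately show ?thesis unfolding matching_def pairing_def noncrossing_def by blast
qed

section \<open>Left multiplication by a hook generator\<close>

lemma colour_rel_diagram:
  assumes f: "pairing n f"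
  shows "(u, w) \<in> colour_rel (diagram n f) \<longleftrightarrow>
    (\<forall>x\<in>{1..2 * n}. colouring u w (vertex_at n (f x)) = colouring u w (vertex_at n x))"
proof
  assume uw: "(u, w) \<in> colour_rel (diagram n f)"
  show "\<forall>x\<in>{1..2 * n}. colouring u w (vertex_at n (f x)) = colouring u w (vertex_at n x)"
  proof
    fix x assume "x \<in> {1..2 * n}"
    then have "{vertex_at n x, vertex_at n (f x)} \<in> diagram n f" unfolding diagram_def by blast
    then show "colouring u w (vertex_at n (f x)) = colouring u w (vertex_at n x)"
      by (rule colour_relD[OF uw]) simp_all
  qed
next
  assume *: "\<forall>x\<in>{1..2 * n}. colouring u w (vertex_at n (f x)) = colouring u w (vertex_at n x)"
  show "(u, w) \<in> colour_rel (diagram n f)"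
  proof (rule colour_relI)
    fix B x y assume "B \<in> diagram n f" "x \<in> B" "y \<in> B"
    then show "colouring u w x = colouring u w y" using * unfolding diagram_def by auto
  qed
qed

lemma vertex_at_upper: "x \<le> n \<Longrightarrow> vertex_at n x = Upper x"
  by (simp add: vertex_at_def)

lemma vertex_at_lower: "x \<le> n \<Longrightarrow> vertex_at n (2 * n + 1 - x) = Lower x"
  by (simp add: vertex_at_def)

lemma colour_rel_straight:
  "(u, w) \<in> colour_rel (diagram n (straight n)) \<longleftrightarrow> (\<forall>x\<in>{1..n}. u x = w x)"
proof -
  have "(\<forall>x\<in>{1..2 * n}. colouring u w (vertex_at n (straight n x)) = colouring u w (vertex_at n x)) \<longleftrightarrow>
      (\<forall>x\<in>{1..n}. u x = w x)" (is "?A \<longleftrightarrow> ?B")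
  proof
    assume A: ?A
    show ?B
    proof
      fix x assume "x \<in> {1..n}"
      then have "x \<in> {1..2 * n}" "x \<le> n" by auto
      then show "u x = w x" using A[rule_format, of x] vertex_at_upper[of x n] vertex_at_lower[of x n]
        by (simp add: straight_def)
    qed
  next
    assume B: ?B
    show ?A
    proof
      fix x assume x: "x \<in> {1..2 * n}"
      then show "colouring u w (vertex_at n (straight n x)) = colouring u w (vertex_at n x)"
      proof (cases "x \<le> n")
        case True
        then show ?thesis using B[rule_format, of x] x by (auto simp: straight_def vertex_at_def)
      next
        case False
        then have "2 * n + 1 - x \<in> {1..n}" using x by auto
        then show ?thesis using B[rule_format, of "2 * n + 1 - x"] x False by (auto simp: straight_def vertex_at_def)
      qed
    qed
  qed
  then show ?thesis using colour_rel_diagram[OF matching_pairing[OF matching_straight]] by simp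
qed

lemma colour_rel_hook_straight:
  assumes i: "1 \<le> i" "i < n"
  shows "(u, w) \<in> colour_rel (diagram n (hook i (straight n))) \<longleftrightarrow>
    u i = u (i + 1) \<and> w i = w (i + 1) \<and> (\<forall>x\<in>{1..n}. x \<noteq> i \<longrightarrow> x \<noteq> i + 1 \<longrightarrow> u x = w x)"
proof -
  let ?g = "hook i (straight n)"
  have g: "?g x = (if x = i then i + 1 else if x = i + 1 then i else if x = 2 * n + 1 - i then 2 * n - i
      else if x = 2 * n - i then 2 * n + 1 - i else 2 * n + 1 - x)" if "x \<in> {1..2 * n}" for x
    using that i by (auto simp: hook_def straight_def)
  have "(\<forall>x\<in>{1..2 * n}. colouring u w (vertex_at n (?g x)) = colouring u w (vertex_at n x)) \<longleftrightarrow>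
    u i = u (i + 1) \<and> w i = w (i + 1) \<and> (\<forall>x\<in>{1..n}. x \<noteq> i \<longrightarrow> x \<noteq> i + 1 \<longrightarrow> u x = w x)" (is "?A \<longleftrightarrow> ?B")
  proof
    assume A: ?A
    have "u i = u (i + 1)" using A[rule_format, of i] i by (auto simp: vertex_at_def)
    moreover have "w i = w (i + 1)"
    proof -
      have m: "2 * n - i \<in> {1..2 * n}" using i by auto
      have "?g (2 * n - i) = 2 * n + 1 - i" using g[OF m] i by auto
      moreover have "vertex_at n (2 * n - i) = Lower (i + 1)" using vertex_at_lower[of "i + 1" n] i by simp
      ultimately show ?thesis using A[rule_format, OF m] vertex_at_lower[of i n] i by simp
    qed
    moreover have "u x = w x" if "x \<in> {1..n}" "x \<noteq> i" "x \<noteq> i + 1" for x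
    proof -
      have x: "x \<in> {1..2 * n}" "x \<le> n" using that by auto
      have "?g x = 2 * n + 1 - x" using g[OF x(1)] x that i by auto
      then show ?thesis
        using A[rule_format, OF x(1)] vertex_at_upper[OF x(2)] vertex_at_lower[OF x(2)] by simp
    qed
    ultimately show ?B by blast
  next
    assume B: ?B
    show ?A
    proof
      fix x assume x: "x \<in> {1..2 * n}"
      consider "x = i" | "x = i + 1" | "x = 2 * n + 1 - i" | "x = 2 * n - i" |
        "x \<noteq> i" "x \<noteq> i + 1" "x \<noteq> 2 * n + 1 - i" "x \<noteq> 2 * n - i" by blast
      then show "colouring u w (vertex_at n (?g x)) = colouring u w (vertex_at n x)"
      proof cases
        case 5
        show ?thesis
        proof (cases "x \<le> n")
          case True
          then have "u x = w x" using B 5 x by auto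
          then show ?thesis using 5 True x g[OF x] by (auto simp: vertex_at_def)
        next
          case False
          then have "2 * n + 1 - x \<in> {1..n}" "2 * n + 1 - x \<noteq> i" "2 * n + 1 - x \<noteq> i + 1" using x 5 by auto
          then have "u (2 * n + 1 - x) = w (2 * n + 1 - x)" using B by blast
          then show ?thesis using 5 False x g[OF x] by (auto simp: vertex_at_def)
        qed
      next
        case 1
        then show ?thesis using B i by (simp add: vertex_at_upper)
      next
        case 2
        then show ?thesis using B i by (simp add: vertex_at_upper)
      next
        case 3
        then have "?g x = 2 * n - i" using g[OF x] i by auto
        then show ?thesis
          using B i 3 vertex_at_lower[of i n] vertex_at_lower[of "i + 1" n] by simp
      next
        case 4
        then have "?g x = 2 * n + 1 - i" using g[OF x] i by auto
        then show ?thesis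
          using B i 4 vertex_at_lower[of i n] vertex_at_lower[of "i + 1" n] by simp
      qed
    qed
  qed
  then show ?thesis
    using colour_rel_diagram[OF pairing_hook[OF matching_pairing[OF matching_straight]], of i n] i by simp
qed

text \<open>The relation of \<open>straight\<close> is equality on \<open>{1..n}\<close> only, so
  the argument is that a diagram sees no colours outside that range.\<close>

lemma straight_mult:
  assumes f: "pairing n f"
  shows "partition_mult n (diagram n (straight n)) (diagram n f) = diagram n f"
proof (rule colour_rel_inject[of n])
  have s: "pairing n (straight n)" by (rule matching_pairing[OF matching_straight])
  have "(u, w) \<in> colour_rel (diagram n f)" if "\<forall>x\<in>{1..n}. u x = m x" "(m, w) \<in> colour_rel (diagram n f)" for u m w
  proof -
    have "colouring u w (vertex_at n x) = colouring m w (vertex_at n x)" if "x \<in> {1..2 * n}" for x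
      using \<open>\<forall>x\<in>{1..n}. u x = m x\<close> that by (auto simp: vertex_at_def)
    then show ?thesis using that(2) pairing_in[OF f] unfolding colour_rel_diagram[OF f] by metis
  qed
  then show "colour_rel (partition_mult n (diagram n (straight n)) (diagram n f)) = colour_rel (diagram n f)"
    unfolding colour_rel_mult[OF partition_on_diagram[OF s] partition_on_diagram[OF f]]
    by (intro equalityI subrelI) (auto simp: colour_rel_straight intro!: relcompI)
qed (simp_all add: partition_on_mult partition_on_diagram f)

text \<open>A middle colouring that passes through \<open>E i\<close> agrees at \<open>i\<close> and
  \<open>i + 1\<close>, and this forces equal colours on their partners in \<open>f\<close>. The
  outer colours at \<open>i\<close> and \<open>i + 1\<close> are tied only to each other, as the new
  cap requires.\<close>

lemma hook_mult:
  assumes f: "pairing n f" and i: "1 \<le> i" "i < n"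
  shows "partition_mult n (diagram n (hook i (straight n))) (diagram n f) = diagram n (hook i f)"
proof (rule colour_rel_inject[of n])
  have i2: "i < 2 * n" using i by simp
  have e: "pairing n (hook i (straight n))" by (rule pairing_hook[OF matching_pairing[OF matching_straight] i(1) i2])
  have h: "pairing n (hook i f)" by (rule pairing_hook[OF f i(1) i2])
  have ff: "f (f x) = x" for x using f by simp
  have mem: "f x \<in> {1..2 * n} \<longleftrightarrow> x \<in> {1..2 * n}" for x by (rule pairing_in[OF f])
  have ii: "i \<in> {1..2 * n}" "i + 1 \<in> {1..2 * n}" using i by auto
  let ?c = "\<lambda>u w x. colouring u w (vertex_at n x)"
  have ci: "?c u w i = u i" "?c u w (i + 1) = u (i + 1)" for u w using i by (simp_all add: vertex_at_def)
  have "(u, w) \<in> colour_rel (diagram n (hook i f))"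
    if um: "(u, m) \<in> colour_rel (diagram n (hook i (straight n)))" and mw: "(m, w) \<in> colour_rel (diagram n f)" for u m w
  proof -
    have m: "u i = u (i + 1)" "m i = m (i + 1)" "\<And>x. x \<in> {1..n} \<Longrightarrow> x \<noteq> i \<Longrightarrow> x \<noteq> i + 1 \<Longrightarrow> u x = m x"
      using um unfolding colour_rel_hook_straight[OF i] by blast+
    have c: "?c u w x = ?c m w x" if "x \<in> {1..2 * n}" "x \<noteq> i" "x \<noteq> i + 1" for x
      using m(3)[of x] that by (auto simp: vertex_at_def)
    have mf: "?c m w (f x) = ?c m w x" if "x \<in> {1..2 * n}" for x
      using iffD1[OF colour_rel_diagram[OF f] mw] that by (rule bspec)
    have "?c u w (hook i f x) = ?c u w x" if x: "x \<in> {1..2 * n}" for x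
    proof (cases "f i = i + 1")
      case True
      then have f1: "f (i + 1) = i" using ff by metis
      show ?thesis
      proof (cases "x = i \<or> x = i + 1")
        case False
        then have "f x \<noteq> i" "f x \<noteq> i + 1" using True f1 ff by metis+
        then show ?thesis using c[of x] c[of "f x"] mf[of x] mem[of x] x False hook_same[OF f True] by metis
      qed (use m ci hook_at in auto)
    next
      case False
      note d = hook_distinct[OF f i(1) i2 False]
      have k: "?c u w (f i) = ?c u w (f (i + 1))"
        using c[of "f i"] c[of "f (i + 1)"] mf[OF ii(1)] mf[OF ii(2)] mem ii d False ci m(2) by metis
      consider "x = i" | "x = i + 1" | "x = f i" | "x = f (i + 1)" |
        "x \<noteq> i" "x \<noteq> i + 1" "x \<noteq> f i" "x \<noteq> f (i + 1)" by blast
      then show ?thesis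
      proof cases
        case 3
        then show ?thesis using d False k by (simp add: hook_def)
      next
        case 4
        then show ?thesis using d False k by (simp add: hook_def)
      next
        case 5
        then have "f x \<noteq> i" "f x \<noteq> i + 1" using ff by metis+
        then show ?thesis using c[of x] c[of "f x"] mf[of x] mem[of x] x 5 hook_other[of x i f] by metis
      qed (use m ci hook_at in auto)
    qed
    then show ?thesis by (intro iffD2[OF colour_rel_diagram[OF h]] ballI)
  qed
  moreover have "\<exists>m. (u, m) \<in> colour_rel (diagram n (hook i (straight n))) \<and> (m, w) \<in> colour_rel (diagram n f)"
    if uw: "(u, w) \<in> colour_rel (diagram n (hook i f))" for u w
  proof -
    have uh: "?c u w (hook i f x) = ?c u w x" if "x \<in> {1..2 * n}" for x
      using iffD1[OF colour_rel_diagram[OF h] uw] that by (rule bspec)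
    have ui: "u i = u (i + 1)" using uh[OF ii(1)] ci by simp
    \<comment> \<open>The middle points \<open>i\<close> and \<open>i + 1\<close> receive the colour
      of the partner of \<open>i\<close>. If \<open>f\<close> joins them to each other this is
      \<open>u (i + 1)\<close>, and any colour would serve.\<close>
    define t where "t = ?c u w (f i)"
    define m where "m x = (if x = i \<or> x = i + 1 then t else u x)" for x
    have mi: "?c m w i = t" "?c m w (i + 1) = t" using i by (simp_all add: vertex_at_def m_def)
    have c: "?c m w x = ?c u w x" if "x \<in> {1..2 * n}" "x \<noteq> i" "x \<noteq> i + 1" for x
      using that by (auto simp: vertex_at_def m_def)
    have "?c m w (f x) = ?c m w x" if x: "x \<in> {1..2 * n}" for x
    proof (cases "f i = i + 1")
      case True
      then have f1: "f (i + 1) = i" using ff by metis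
      show ?thesis
      proof (cases "x = i \<or> x = i + 1")
        case False
        then have "f x \<noteq> i" "f x \<noteq> i + 1" using True f1 ff by metis+
        then show ?thesis using c[of x] c[of "f x"] uh[of x] mem[of x] x False hook_same[OF f True] by metis
      qed (use mi True f1 in metis)
    next
      case False
      note d = hook_distinct[OF f i(1) i2 False]
      have "hook i f (f i) = f (i + 1)" using d False by (simp add: hook_def)
      then have k: "?c u w (f (i + 1)) = t" using uh[of "f i"] mem[of i] ii t_def by metis
      have k': "?c m w (f i) = t" "?c m w (f (i + 1)) = t"
        using c[of "f i"] c[of "f (i + 1)"] mem ii d False k t_def by metis+
      consider "x = i" | "x = i + 1" | "x = f i" | "x = f (i + 1)" |
        "x \<noteq> i" "x \<noteq> i + 1" "x \<noteq> f i" "x \<noteq> f (i + 1)" by blast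
      then show ?thesis
      proof cases
        case 5
        then have "f x \<noteq> i" "f x \<noteq> i + 1" using ff by metis+
        then show ?thesis using c[of x] c[of "f x"] uh[of x] mem[of x] x 5 hook_other[of x i f] by metis
      qed (use k' mi ff in metis)+
    qed
    then have "(m, w) \<in> colour_rel (diagram n f)" by (intro iffD2[OF colour_rel_diagram[OF f]] ballI)
    moreover have "(u, m) \<in> colour_rel (diagram n (hook i (straight n)))"
      unfolding colour_rel_hook_straight[OF i] using ui by (auto simp: m_def)
    ultimately show ?thesis by blast
  qed
  ultimately show "colour_rel (partition_mult n (diagram n (hook i (straight n))) (diagram n f)) =
      colour_rel (diagram n (hook i f))"
    unfolding colour_rel_mult[OF partition_on_diagram[OF e] partition_on_diagram[OF f]]
    by (intro equalityI subrelI) blast+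
qed (use assms in \<open>simp_all add: partition_on_mult partition_on_diagram pairing_hook\<close>)

section \<open>Cap patterns and ranks\<close>

definition rk :: "nat \<Rightarrow> (nat \<Rightarrow> nat) \<Rightarrow> nat" where
  "rk n f = card {x \<in> {1..n}. n < f x}"

text \<open>The value 0 marks the end of a transversal or a point outside the upper row. It is never
  a partner, since partners are at least 1, so for matchings equality of \<open>caps\<close> means
  equality of the upper blocks.\<close>

definition caps :: "nat \<Rightarrow> (nat \<Rightarrow> nat) \<Rightarrow> nat \<Rightarrow> nat" where
  "caps n f x = (if x \<in> {1..n} \<and> f x \<le> n then f x else 0)"

definition cups :: "nat \<Rightarrow> (nat \<Rightarrow> nat) \<Rightarrow> nat \<Rightarrow> nat" where
  "cups n f x = (if x \<in> {n + 1..2 * n} \<and> n < f x then f x else 0)"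

lemma caps_eq_iff:
  assumes "matching n f" "matching n g"
  shows "caps n f = caps n g \<longleftrightarrow> (\<forall>x\<in>{1..n}. (f x \<le> n \<or> g x \<le> n) \<longrightarrow> f x = g x)"
proof
  assume eq: "caps n f = caps n g"
  show "\<forall>x\<in>{1..n}. (f x \<le> n \<or> g x \<le> n) \<longrightarrow> f x = g x"
  proof (intro ballI impI)
    fix x assume x: "x \<in> {1..n}" "f x \<le> n \<or> g x \<le> n"
    have "f x \<noteq> 0" "g x \<noteq> 0"
      using x(1) pairing_in[OF matching_pairing[OF assms(1)], of x]
        pairing_in[OF matching_pairing[OF assms(2)], of x] by auto
    then show "f x = g x" using x fun_cong[OF eq, of x] by (simp add: caps_def split: if_splits)
  qed
next
  assume *: "\<forall>x\<in>{1..n}. (f x \<le> n \<or> g x \<le> n) \<longrightarrow> f x = g x"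
  show "caps n f = caps n g"
  proof
    fix x show "caps n f x = caps n g x"
    proof (cases "x \<in> {1..n} \<and> (f x \<le> n \<or> g x \<le> n)")
      case True
      then have "f x = g x" using * by blast
      then show ?thesis by (simp add: caps_def)
    next
      case False
      then show ?thesis by (auto simp: caps_def)
    qed
  qed
qed

lemma cups_eq_iff:
  "cups n f = cups n g \<longleftrightarrow> (\<forall>x\<in>{n + 1..2 * n}. (n < f x \<or> n < g x) \<longrightarrow> f x = g x)"
proof
  assume eq: "cups n f = cups n g"
  show "\<forall>x\<in>{n + 1..2 * n}. (n < f x \<or> n < g x) \<longrightarrow> f x = g x"
  proof (intro ballI impI)
    fix x assume x: "x \<in> {n + 1..2 * n}" "n < f x \<or> n < g x"
    then show "f x = g x" using fun_cong[OF eq, of x] by (simp add: cups_def split: if_splits)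
  qed
next
  assume *: "\<forall>x\<in>{n + 1..2 * n}. (n < f x \<or> n < g x) \<longrightarrow> f x = g x"
  show "cups n f = cups n g"
  proof
    fix x show "cups n f x = cups n g x"
    proof (cases "x \<in> {n + 1..2 * n} \<and> (n < f x \<or> n < g x)")
      case True
      then have "f x = g x" using * by blast
      then show ?thesis by (simp add: cups_def)
    next
      case False
      then show ?thesis by (auto simp: cups_def)
    qed
  qed
qed

lemma matching_range: "matching n f \<Longrightarrow> x \<in> {1..2 * n} \<Longrightarrow> f x \<in> {1..2 * n}"
  using pairing_in[OF matching_pairing] by blast

lemma matching_invol: "matching n f \<Longrightarrow> f (f x) = x"
  by (rule pairing_invol[OF matching_pairing])

lemma caps_reflect_eq_iff:
  assumes f: "matching n f" and g: "matching n g"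
  shows "caps n (reflect n f) = caps n (reflect n g) \<longleftrightarrow> cups n f = cups n g"
proof -
  have fx: "f x \<in> {1..2 * n}" "g x \<in> {1..2 * n}" if "x \<in> {1..2 * n}" for x
    using that f g matching_range by blast+
  have "(\<forall>x\<in>{1..n}. (reflect n f x \<le> n \<or> reflect n g x \<le> n) \<longrightarrow> reflect n f x = reflect n g x) \<longleftrightarrow>
      (\<forall>x\<in>{n + 1..2 * n}. (n < f x \<or> n < g x) \<longrightarrow> f x = g x)" (is "?A \<longleftrightarrow> ?B")
  proof
    assume A: ?A
    show ?B
    proof (intro ballI impI)
      fix x assume x: "x \<in> {n + 1..2 * n}" "n < f x \<or> n < g x"
      then have "2 * n + 1 - x \<in> {1..n}" "2 * n + 1 - (2 * n + 1 - x) = x" by auto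
      moreover from this x have r: "reflect n f (2 * n + 1 - x) = 2 * n + 1 - f x"
        "reflect n g (2 * n + 1 - x) = 2 * n + 1 - g x" by (simp_all add: reflect_def)
      moreover have "2 * n + 1 - f x \<le> n \<or> 2 * n + 1 - g x \<le> n" using x(2) by linarith
      ultimately have "2 * n + 1 - f x = 2 * n + 1 - g x" using A by metis
      then show "f x = g x" using fx[of x] x(1) by (simp, linarith)
    qed
  next
    assume B: ?B
    show ?A
    proof (intro ballI impI)
      fix x assume x: "x \<in> {1..n}" "reflect n f x \<le> n \<or> reflect n g x \<le> n"
      then have "2 * n + 1 - x \<in> {n + 1..2 * n}" by auto
      moreover from this have "n < f (2 * n + 1 - x) \<or> n < g (2 * n + 1 - x)"
        using x(2) fx[of "2 * n + 1 - x"] x(1) by (simp add: reflect_def) linarith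
      ultimately have "f (2 * n + 1 - x) = g (2 * n + 1 - x)" using B by blast
      then show "reflect n f x = reflect n g x" by (simp add: reflect_def)
    qed
  qed
  then show ?thesis
    unfolding caps_eq_iff[OF matching_reflect[OF f] matching_reflect[OF g]] cups_eq_iff .
qed

text \<open>The transversals of a noncrossing matching join their end points in order.\<close>

lemma matching_eqI:
  assumes f: "matching n f" and g: "matching n g"
    and caps: "caps n f = caps n g" and cups: "cups n f = cups n g"
  shows "f = g"
proof -
  have C: "f x = g x" if "x \<in> {1..n}" "f x \<le> n \<or> g x \<le> n" for x
    using caps that unfolding caps_eq_iff[OF f g] by blast
  have D: "f x = g x" if "x \<in> {n + 1..2 * n}" "n < f x \<or> n < g x" for x
    using cups that unfolding cups_eq_iff by blast
  have upper: "f x = g x" if "x \<in> {1..n}" for x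
    using that
  proof (induction x rule: less_induct)
    case (less x)
    show ?case
    proof (rule ccontr)
      assume ne: "f x \<noteq> g x"
      \<comment> \<open>At the least upper point \<open>x\<close> of disagreement both transversals
        go down. With \<open>f x < g x\<close>, the lower point \<open>g x\<close> must go up in
        \<open>f\<close>: a partner before \<open>x\<close> would be its partner in \<open>g\<close>
        as well, and a partner after \<open>x\<close> would give a crossing. The claim is stated for
        arbitrary \<open>f\<close> and \<open>g\<close> so that it can be used with the two
        exchanged.\<close>
      have key: False if f: "matching n f" and g: "matching n g" and lt: "f x < g x" and "n < f x"
        and C: "\<And>x. x \<in> {1..n} \<Longrightarrow> f x \<le> n \<or> g x \<le> n \<Longrightarrow> f x = g x"
        and D: "\<And>x. x \<in> {n + 1..2 * n} \<Longrightarrow> n < f x \<or> n < g x \<Longrightarrow> f x = g x"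
        and IH: "\<And>y. y < x \<Longrightarrow> y \<in> {1..n} \<Longrightarrow> f y = g y" for f g
      proof -
        let ?y = "g x"
        have gg: "g (g x) = x" "f (f ?y) = ?y" using f g matching_invol by blast+
        have y: "?y \<in> {n + 1..2 * n}" using matching_range[OF g, of x] less.prems lt \<open>n < f x\<close> by auto
        have "f ?y \<le> n" using D[OF y] gg less.prems by force
        moreover have "f ?y \<in> {1..2 * n}" using matching_range[OF f, of ?y] y by auto
        ultimately have fy: "f ?y \<in> {1..n}" by simp
        consider "f ?y < x" | "f ?y = x" | "x < f ?y" by linarith
        then show False
        proof cases
          case 1
          then have "g (f ?y) = ?y" using IH[OF 1 fy] gg by simp
          then have "f ?y = x" using g matching_invol by metis
          then show False using 1 by simp
        next
          case 2
          then show False using gg lt by simp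
        next
          case 3
          then show False
            using matching_between[OF f, of x "f ?y"] gg fy \<open>n < f x\<close> lt by auto
        qed
      qed
      have n: "n < f x" "n < g x" using C[OF less.prems] ne by force+
      consider "f x < g x" | "g x < f x" using ne by linarith
      then show False
      proof cases
        case 1
        show False
        proof (rule key[OF f g 1 n(1)])
          show "\<And>y. y < x \<Longrightarrow> y \<in> {1..n} \<Longrightarrow> f y = g y" by (rule less.IH)
        qed (erule (1) C, erule (1) D)
      next
        case 2
        show False
        proof (rule key[OF g f 2 n(2)])
          show "g y = f y" if "y < x" "y \<in> {1..n}" for y using less.IH[OF that] by simp
          show "g y = f y" if "y \<in> {1..n}" "g y \<le> n \<or> f y \<le> n" for y using C[of y] that by metis
          show "g y = f y" if "y \<in> {n + 1..2 * n}" "n < g y \<or> n < f y" for y using D[of y] that by metis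
        qed
      qed
    qed
  qed
  show ?thesis
  proof
    fix x
    consider "x \<in> {1..n}" | "x \<in> {n + 1..2 * n}" "n < f x" | "x \<in> {n + 1..2 * n}" "f x \<le> n" | "x \<notin> {1..2 * n}"
      by (metis Suc_eq_plus1 atLeastAtMost_iff not_less not_less_eq_eq)
    then show "f x = g x"
    proof cases
      case 3
      then have "f x \<in> {1..n}" using matching_range[OF f, of x] by auto
      then have "g (f x) = x" using upper matching_invol[OF f] by metis
      then show ?thesis using matching_invol[OF g] by metis
    next
      case 4
      then show ?thesis using pairing_outside[OF matching_pairing[OF f]] pairing_outside[OF matching_pairing[OF g]] by metis
    qed (use upper D in blast)+
  qed
qed

text \<open>Hooks with \<open>i < n\<close> leave all cups in place, so counting transversals at
  their lower ends turns the monotonicity of the rank into an inclusion of sets.\<close>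

lemma rk_lower:
  assumes f: "matching n f"
  shows "rk n f = card {x \<in> {n + 1..2 * n}. f x \<le> n}"
  unfolding rk_def
proof (rule bij_betw_same_card[of f])
  show "bij_betw f {x \<in> {1..n}. n < f x} {x \<in> {n + 1..2 * n}. f x \<le> n}"
  proof (rule bij_betw_byWitness[of _ f])
    have r: "f x \<in> {1..2 * n}" if "x \<in> {1..2 * n}" for x using matching_range[OF f that] .
    show "f ` {x \<in> {1..n}. n < f x} \<subseteq> {x \<in> {n + 1..2 * n}. f x \<le> n}"
    proof (rule image_subsetI)
      fix x assume "x \<in> {x \<in> {1..n}. n < f x}"
      then show "f x \<in> {x \<in> {n + 1..2 * n}. f x \<le> n}" using r[of x] matching_invol[OF f, of x] by simp
    qed
    show "f ` {x \<in> {n + 1..2 * n}. f x \<le> n} \<subseteq> {x \<in> {1..n}. n < f x}"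
    proof (rule image_subsetI)
      fix x assume "x \<in> {x \<in> {n + 1..2 * n}. f x \<le> n}"
      then show "f x \<in> {x \<in> {1..n}. n < f x}" using r[of x] matching_invol[OF f, of x] by simp
    qed
  qed (use matching_invol[OF f] in auto)
qed

lemma rk_reflect:
  assumes f: "matching n f"
  shows "rk n (reflect n f) = rk n f"
  unfolding rk_lower[OF f] unfolding rk_def
proof (rule bij_betw_same_card[of "\<lambda>x. 2 * n + 1 - x"])
  show "bij_betw (\<lambda>x. 2 * n + 1 - x) {x \<in> {1..n}. n < reflect n f x} {x \<in> {n + 1..2 * n}. f x \<le> n}"
  proof (rule bij_betw_byWitness[of _ "\<lambda>x. 2 * n + 1 - x"])
    have r: "f x \<in> {1..2 * n}" if "x \<in> {1..2 * n}" for x using that matching_range[OF f] by blast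
    show "(\<lambda>x. 2 * n + 1 - x) ` {x \<in> {1..n}. n < reflect n f x} \<subseteq> {x \<in> {n + 1..2 * n}. f x \<le> n}"
    proof (rule image_subsetI)
      fix x assume "x \<in> {x \<in> {1..n}. n < reflect n f x}"
      then show "2 * n + 1 - x \<in> {x \<in> {n + 1..2 * n}. f x \<le> n}" by (auto simp: reflect_def)
    qed
    show "(\<lambda>x. 2 * n + 1 - x) ` {x \<in> {n + 1..2 * n}. f x \<le> n} \<subseteq> {x \<in> {1..n}. n < reflect n f x}"
    proof (rule image_subsetI)
      fix x assume x: "x \<in> {x \<in> {n + 1..2 * n}. f x \<le> n}"
      then have "2 * n + 1 - (2 * n + 1 - x) = x" "2 * n + 1 - x \<in> {1..n}" by auto
      then show "2 * n + 1 - x \<in> {x \<in> {1..n}. n < reflect n f x}" using r[of x] x by (auto simp: reflect_def)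
    qed
  qed auto
qed

lemma pt_rank_diagram:
  assumes f: "matching n f"
  shows "pt_rank (diagram n f) = rk n f"
  unfolding pt_rank_def rk_def
proof (rule sym, rule bij_betw_same_card[of "\<lambda>x. {vertex_at n x, vertex_at n (f x)}"])
  have p: "pairing n f" by (rule matching_pairing[OF f])
  show "bij_betw (\<lambda>x. {vertex_at n x, vertex_at n (f x)}) {x \<in> {1..n}. n < f x} {B \<in> diagram n f. transversal B}"
    unfolding bij_betw_def
  proof
    show "inj_on (\<lambda>x. {vertex_at n x, vertex_at n (f x)}) {x \<in> {1..n}. n < f x}"
    proof (rule inj_onI)
      fix x y assume "x \<in> {x \<in> {1..n}. n < f x}" "y \<in> {x \<in> {1..n}. n < f x}"
        "{vertex_at n x, vertex_at n (f x)} = {vertex_at n y, vertex_at n (f y)}"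
      then show "x = y" by (simp add: vertex_at_def doubleton_eq_iff)
    qed
    show "(\<lambda>x. {vertex_at n x, vertex_at n (f x)}) ` {x \<in> {1..n}. n < f x} = {B \<in> diagram n f. transversal B}"
    proof
      show "(\<lambda>x. {vertex_at n x, vertex_at n (f x)}) ` {x \<in> {1..n}. n < f x} \<subseteq> {B \<in> diagram n f. transversal B}"
      proof (rule image_subsetI)
        fix x assume x: "x \<in> {x \<in> {1..n}. n < f x}"
        then have "{vertex_at n x, vertex_at n (f x)} \<in> diagram n f" unfolding diagram_def by simp
        moreover have "transversal {vertex_at n x, vertex_at n (f x)}"
          using x by (simp add: transversal_def vertex_at_def)
        ultimately show "{vertex_at n x, vertex_at n (f x)} \<in> {B \<in> diagram n f. transversal B}" by blast
      qed
      show "{B \<in> diagram n f. transversal B} \<subseteq> (\<lambda>x. {vertex_at n x, vertex_at n (f x)}) ` {x \<in> {1..n}. n < f x}"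
      proof
        fix B assume "B \<in> {B \<in> diagram n f. transversal B}"
        then have B: "B \<in> diagram n f" "transversal B" by auto
        obtain x where x: "x \<in> {1..2 * n}" "x < f x" "B = {vertex_at n x, vertex_at n (f x)}"
          by (rule diagram_blockE[OF p B(1)])
        have "x \<le> n" "n < f x" using B(2) x(2,3) by (auto simp: transversal_def vertex_at_def split: if_splits)
        then show "B \<in> (\<lambda>x. {vertex_at n x, vertex_at n (f x)}) ` {x \<in> {1..n}. n < f x}" using x by auto
      qed
    qed
  qed
qed

subsection \<open>The effect of a hook\<close>

lemma hook_lower:
  assumes f: "matching n f" and i: "i < n" and "n < x" "n < f x"
  shows "hook i f x = f x"
proof -
  have "x \<noteq> f i" "x \<noteq> f (i + 1)" using assms matching_invol[OF f] by (metis not_less_iff_gr_or_eq, metis Suc_eq_plus1 Suc_leI not_less)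
  then show ?thesis using assms by (intro hook_other) auto
qed

lemma hook_lower_set:
  assumes f: "matching n f" and i: "i < n"
  shows "{x \<in> {n + 1..2 * n}. hook i f x \<le> n} \<subseteq> {x \<in> {n + 1..2 * n}. f x \<le> n}"
proof
  fix x assume "x \<in> {x \<in> {n + 1..2 * n}. hook i f x \<le> n}"
  then show "x \<in> {x \<in> {n + 1..2 * n}. f x \<le> n}"
    using hook_lower[OF f i, of x] by (cases "f x \<le> n") auto
qed

lemma rk_hook_le:
  assumes f: "matching n f" and i: "1 \<le> i" "i < n"
  shows "rk n (hook i f) \<le> rk n f"
proof -
  have h: "matching n (hook i f)" using matching_hook[OF f] i by simp
  show ?thesis unfolding rk_lower[OF f] rk_lower[OF h]
    by (rule card_mono[OF _ hook_lower_set[OF f i(2)]]) simp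
qed

lemma cups_hook:
  assumes f: "matching n f" and i: "1 \<le> i" "i < n" and rk: "rk n (hook i f) = rk n f"
  shows "cups n (hook i f) = cups n f"
proof -
  have h: "matching n (hook i f)" using matching_hook[OF f] i by simp
  have "{x \<in> {n + 1..2 * n}. hook i f x \<le> n} = {x \<in> {n + 1..2 * n}. f x \<le> n}"
    by (rule card_subset_eq[OF _ hook_lower_set[OF f i(2)]]) (use rk rk_lower[OF f] rk_lower[OF h] in auto)
  then show ?thesis unfolding cups_eq_iff using hook_lower[OF f i(2)]
    by (metis (no_types, lifting) Suc_eq_plus1 Suc_le_eq atLeastAtMost_iff mem_Collect_eq not_less)
qed

text \<open>The rank drops exactly when the hook meets two transversals, which then become a cap and
  a cup. This is the test by which hooks tell diagrams apart.\<close>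

lemma rk_hook_iff:
  assumes f: "matching n f" and i: "1 \<le> i" "i < n"
  shows "rk n (hook i f) = rk n f \<longleftrightarrow> f i \<le> n \<or> f (i + 1) \<le> n"
proof
  have h: "matching n (hook i f)" using matching_hook[OF f] i by simp
  have ff: "f (f x) = x" for x by (rule matching_invol[OF f])
  have r: "f i \<in> {1..2 * n}" "f (i + 1) \<in> {1..2 * n}" using matching_range[OF f] i by auto
  show "f i \<le> n \<or> f (i + 1) \<le> n" if "rk n (hook i f) = rk n f"
  proof (rule ccontr)
    assume "\<not> (f i \<le> n \<or> f (i + 1) \<le> n)"
    then have l: "n < f i" "n < f (i + 1)" by auto
    have eq: "{x \<in> {n + 1..2 * n}. hook i f x \<le> n} = {x \<in> {n + 1..2 * n}. f x \<le> n}"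
      by (rule card_subset_eq[OF _ hook_lower_set[OF f i(2)]]) (use that rk_lower[OF f] rk_lower[OF h] in auto)
    have "f i \<in> {x \<in> {n + 1..2 * n}. f x \<le> n}" using l r ff i by auto
    then have "hook i f (f i) \<le> n" using eq by blast
    moreover have "hook i f (f i) = f (i + 1)" using l i by (simp add: hook_def)
    ultimately show False using l by simp
  qed
  show "rk n (hook i f) = rk n f" if "f i \<le> n \<or> f (i + 1) \<le> n"
  proof -
    have "hook i f x \<le> n" if "x \<in> {n + 1..2 * n}" "f x \<le> n" for x
    proof -
      have "x \<noteq> i" "x \<noteq> i + 1" using that i by auto
      then show ?thesis using that \<open>f i \<le> n \<or> f (i + 1) \<le> n\<close> i by (auto simp: hook_def ff)
    qed
    then have "{x \<in> {n + 1..2 * n}. hook i f x \<le> n} = {x \<in> {n + 1..2 * n}. f x \<le> n}"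
      using hook_lower_set[OF f i(2)] by blast
    then show ?thesis unfolding rk_lower[OF f] rk_lower[OF h] by simp
  qed
qed

text \<open>The relation \<open>E i \<cdot> E (i + 1) \<cdot> E i = E i\<close> on involutions:
  pushing the cap \<open>{i, i + 1}\<close> one place to the right is undone by
  \<open>hook i\<close>.\<close>

lemma hook_hook_down:
  assumes f: "pairing n f" and i: "1 \<le> i" "i + 1 < 2 * n" and fi: "f i = i + 1"
  shows "hook i (hook (i + 1) f) = f"
proof
  fix x
  have ff: "f (f x) = x" for x using f by simp
  have fi1: "f (i + 1) = i" using ff fi by metis
  have c: "f (i + 2) \<noteq> i + 2" using pairing_neq[OF f, of "i + 2"] i by auto
  have c': "f (i + 2) \<noteq> i" "f (i + 2) \<noteq> i + 1" using ff[of "i + 2"] fi fi1 by auto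
  have g: "hook (i + 1) f y = (if y = i + 1 then i + 2 else if y = i + 2 then i + 1 else if y = i then f (i + 2)
      else if y = f (i + 2) then i else f y)" for y
    by (simp add: hook_def fi1[simplified])
  show "hook i (hook (i + 1) f) x = f x"
    unfolding hook_def[of i] g using c c' fi fi1 ff by (auto simp: fi1[simplified])
qed

lemma hook_hook_up:
  assumes f: "pairing n f" and i: "1 \<le> i" "i + 1 < 2 * n" and fi: "f (i + 1) = i + 2"
  shows "hook (i + 1) (hook i f) = f"
proof
  fix x
  have ff: "f (f x) = x" for x using f by simp
  have fi2: "f (i + 2) = i + 1" using ff fi by metis
  have c: "f i \<noteq> i" using pairing_neq[OF f, of i] i by auto
  have c': "f i \<noteq> i + 1" "f i \<noteq> i + 2" using ff[of i] fi fi2 by auto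
  have g: "hook i f y = (if y = i then i + 1 else if y = i + 1 then i else if y = f i then i + 2
      else if y = i + 2 then f i else f y)" for y
    by (simp add: hook_def fi[simplified])
  have h: "hook (i + 1) h y = (if y = i + 1 then i + 2 else if y = i + 2 then i + 1 else if y = h (i + 1) then h (i + 2)
      else if y = h (i + 2) then h (i + 1) else h y)" for h y
    by (simp add: hook_def)
  show "hook (i + 1) (hook i f) x = f x"
    unfolding h g using c c' fi fi2 ff by auto
qed

text \<open>Descent to an innermost arc: unless the ends are neighbours, \<open>x + 1\<close> starts
  a shorter arc nested inside.\<close>

lemma ex_simple_cap:
  assumes f: "matching n f" and "x < f x"
  shows "\<exists>i. x \<le> i \<and> i + 1 \<le> f x \<and> f i = i + 1"
  using assms(2)
proof (induction "f x - x" arbitrary: x rule: less_induct)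
  case less
  show ?case
  proof (cases "f x = x + 1")
    case False
    then have lt: "x < x + 1" "x + 1 < f x" using less.prems by auto
    note b = matching_between[OF f lt]
    have "x + 1 \<in> {1..2 * n}"
      using lt pairing_outside[OF matching_pairing[OF f], of x] matching_range[OF f, of x] by force
    then have "f (x + 1) \<noteq> x + 1" using pairing_neq[OF matching_pairing[OF f]] by blast
    then have "x + 1 < f (x + 1)" using b by simp
    moreover from this have "f (x + 1) - (x + 1) < f x - x" using b by simp
    ultimately obtain i where "x + 1 \<le> i" "i + 1 \<le> f (x + 1)" "f i = i + 1" using less.hyps by blast
    then show ?thesis using b by (intro exI[of _ i]) auto
  qed auto
qed

subsection \<open>Standard tails\<close>

text \<open>\<open>tail n m f\<close> says that \<open>f\<close> contains the caps \<open>{m + 1, m + 2}, \<dots>, {n - 1, n}\<close>.\<close>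

definition mate :: "nat \<Rightarrow> nat \<Rightarrow> nat" where
  "mate n x = (if odd (n - x) then x + 1 else x - 1)"

definition tail :: "nat \<Rightarrow> nat \<Rightarrow> (nat \<Rightarrow> nat) \<Rightarrow> bool" where
  "tail n m f \<longleftrightarrow> m \<le> n \<and> even (n - m) \<and> (\<forall>x. m < x \<and> x \<le> n \<longrightarrow> f x = mate n x)"

lemma mate_range:
  assumes "m < x" "x \<le> n" "even (n - m)"
  shows "m < mate n x" "mate n x \<le> n"
proof -
  have "x \<noteq> n" if "odd (n - x)" using that by auto
  moreover have "x \<noteq> m + 1" if "\<not> odd (n - x)" using that assms by presburger
  ultimately show "m < mate n x" "mate n x \<le> n" using assms unfolding mate_def by auto
qed

lemma tail_below:
  assumes f: "matching n f" and t: "tail n m f" and "x \<le> m" "f x \<le> n"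
  shows "f x \<le> m"
proof (rule ccontr)
  assume "\<not> f x \<le> m"
  then have "f (f x) = mate n (f x)" "m < mate n (f x)"
    using t assms(4) mate_range[of m "f x" n] unfolding tail_def by auto
  then show False using matching_invol[OF f, of x] assms(3) by simp
qed

lemma rk_tail:
  assumes f: "matching n f" and t: "tail n m f"
  shows "rk n f = card {x \<in> {1..m}. n < f x}"
proof -
  have mn: "m \<le> n" using t by (simp add: tail_def)
  have "f x \<le> n" if "m < x" "x \<le> n" for x
    using t that mate_range(2)[of m x n] unfolding tail_def by metis
  then have "x \<in> {1..n} \<and> n < f x \<longleftrightarrow> x \<in> {1..m} \<and> n < f x" for x
    using mn by (cases "m < x") (auto simp: not_less[symmetric])
  then have "{x \<in> {1..n}. n < f x} = {x \<in> {1..m}. n < f x}" by simp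
  then show ?thesis by (simp add: rk_def)
qed

lemma rk_tail_le:
  assumes "matching n f" "tail n m f"
  shows "rk n f \<le> m"
proof -
  have "card {x \<in> {1..m}. n < f x} \<le> card {1..m}" by (rule card_mono) auto
  then show ?thesis using rk_tail[OF assms] by simp
qed

lemma full_rk_tail:
  assumes "matching n f" "tail n m f" "rk n f = m" "x \<in> {1..m}"
  shows "n < f x"
proof -
  have "{x \<in> {1..m}. n < f x} = {1..m}"
    by (rule card_subset_eq) (use assms rk_tail[OF assms(1,2)] in auto)
  then show ?thesis using assms(4) by blast
qed

text \<open>If the rank equals the number of points in front of the tail, all of them end
  transversals and no choice is left.\<close>

lemma caps_full_tail:
  assumes f: "matching n f" and g: "matching n g" and t: "tail n m f" "tail n m g" and r: "rk n f = m" "rk n g = m"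
  shows "caps n f = caps n g"
  unfolding caps_eq_iff[OF f g]
proof (intro ballI impI)
  fix x assume x: "x \<in> {1..n}" "f x \<le> n \<or> g x \<le> n"
  then have "x \<notin> {1..m}" using full_rk_tail[OF f t(1) r(1)] full_rk_tail[OF g t(2) r(2)] by (meson leD)
  then show "f x = g x" using t x unfolding tail_def by auto
qed

lemma tail_simple_cap:
  assumes f: "matching n f" and t: "tail n m f" and r: "rk n f < m"
  shows "\<exists>i\<ge>1. i + 1 \<le> m \<and> f i = i + 1"
proof -
  have "\<exists>x\<in>{1..m}. f x \<le> n"
  proof (rule ccontr)
    assume "\<not> ?thesis"
    then have "{x \<in> {1..m}. n < f x} = {1..m}" by auto
    then show False using rk_tail[OF f t] r by simp
  qed
  then obtain x where x: "x \<in> {1..m}" "f x \<le> n" by blast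
  have mn: "m \<le> n" using t by (simp add: tail_def)
  have fx: "f x \<le> m" "1 \<le> f x" "f x \<noteq> x"
    using tail_below[OF f t] x matching_range[OF f, of x] pairing_neq[OF matching_pairing[OF f], of x] mn by auto
  define y where "y = min x (f x)"
  have "y < f y" "f y \<le> m" "1 \<le> y" using fx x matching_invol[OF f, of x] by (auto simp: y_def min_def)
  then show ?thesis using ex_simple_cap[OF f, of y] by (meson le_trans)
qed

section \<open>Words of hooks and the normal form of caps\<close>

definition hooks :: "nat list \<Rightarrow> (nat \<Rightarrow> nat) \<Rightarrow> nat \<Rightarrow> nat" where
  "hooks ws f = foldr hook ws f"

lemma hooks_simps [simp]: "hooks [] f = f" "hooks (i # ws) f = hook i (hooks ws f)"
  by (simp_all add: hooks_def)

lemma hooks_append: "hooks (us @ vs) f = hooks us (hooks vs f)"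
  by (simp add: hooks_def)

lemma matching_hooks: "matching n f \<Longrightarrow> set ws \<subseteq> {1..<n} \<Longrightarrow> matching n (hooks ws f)"
  by (induction ws) (auto intro!: matching_hook)

lemma rk_hooks_le: "matching n f \<Longrightarrow> set ws \<subseteq> {1..<n} \<Longrightarrow> rk n (hooks ws f) \<le> rk n f"
  by (induction ws) (auto intro: le_trans[OF rk_hook_le] simp: matching_hooks)

text \<open>The words depend on \<open>i\<close> and \<open>m\<close> only:
  \<open>hook (i + 1)\<close>, \<open>hook (i + 2)\<close>, and so on carry the cap to the right,
  whatever the rest of \<open>f\<close> is. Hence two different elements with a common cap can be
  treated by the same words. On arrival at \<open>{m - 1, m}\<close> the cap lengthens the tail by
  two points.\<close>

lemma shift_cap:
  assumes "1 \<le> i" "i + 1 \<le> m"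
  shows "\<exists>us vs. set us \<subseteq> {1..<m} \<and> set vs \<subseteq> {1..<m} \<and>
    (\<forall>f. matching n f \<longrightarrow> tail n m f \<longrightarrow> f i = i + 1 \<longrightarrow> tail n (m - 2) (hooks us f) \<and> hooks vs (hooks us f) = f)"
  using assms
proof (induction "m - i" arbitrary: i rule: less_induct)
  case less
  show ?case
  proof (cases "i + 1 = m")
    case True
    have "tail n (m - 2) f" if f: "matching n f" and t: "tail n m f" and fi: "f i = i + 1" for f
      unfolding tail_def
    proof (intro conjI allI impI)
      have m: "m \<le> n" "even (n - m)" using t unfolding tail_def by blast+
      show "m - 2 \<le> n" using m by simp
      show "even (n - (m - 2))" using m less.prems True by presburger
      fix x assume x: "m - 2 < x \<and> x \<le> n"
      consider "x = i" | "x = m" | "m < x" using x True less.prems by linarith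
      then show "f x = mate n x"
      proof cases
        case 1
        then have "odd (n - x)" using m True by presburger
        then show ?thesis using 1 fi by (simp add: mate_def)
      next
        case 2
        then show ?thesis using m fi True matching_invol[OF f, of i] by (auto simp: mate_def)
      next
        case 3
        then show ?thesis using t x unfolding tail_def by blast
      qed
    qed
    then show ?thesis by (intro exI[of _ "[]"]) simp
  next
    case False
    then have im: "i + 2 \<le> m" using less.prems by simp
    have "\<exists>us vs. set us \<subseteq> {1..<m} \<and> set vs \<subseteq> {1..<m} \<and>
      (\<forall>f. matching n f \<longrightarrow> tail n m f \<longrightarrow> f (i + 1) = i + 1 + 1 \<longrightarrow>
        tail n (m - 2) (hooks us f) \<and> hooks vs (hooks us f) = f)"
      by (rule less.hyps) (use im less.prems in auto)
    then obtain us vs where uv: "set us \<subseteq> {1..<m}" "set vs \<subseteq> {1..<m}"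
      "\<And>f. matching n f \<Longrightarrow> tail n m f \<Longrightarrow> f (i + 1) = i + 1 + 1 \<Longrightarrow>
        tail n (m - 2) (hooks us f) \<and> hooks vs (hooks us f) = f"
      by (elim exE conjE) blast
    have "tail n (m - 2) (hooks (us @ [i + 1]) f) \<and> hooks (i # vs) (hooks (us @ [i + 1]) f) = f"
      if f: "matching n f" and t: "tail n m f" and fi: "f i = i + 1" for f
    proof -
      have mn: "m \<le> n" using t by (simp add: tail_def)
      let ?h = "hook (i + 1) f"
      have h: "matching n ?h" using matching_hook[OF f] im mn by simp
      have fi1: "f (i + 1) = i" using matching_invol[OF f] fi by metis
      have "?h x = f x" if x: "m < x" "x \<le> n" for x
      proof (rule hook_other)
        show "x \<noteq> f (i + 1 + 1)" using tail_below[OF f t, of "i + 2"] im x by auto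
      qed (use x im fi1 in auto)
      then have th: "tail n m ?h" using t unfolding tail_def by metis
      have "hook i ?h = f" using hook_hook_down[OF matching_pairing[OF f], of i] fi less.prems im mn by simp
      then show ?thesis using uv(3)[OF h th] by (simp add: hooks_append)
    qed
    moreover have "set (us @ [i + 1]) \<subseteq> {1..<m}" "set (i # vs) \<subseteq> {1..<m}" using uv im less.prems by auto
    ultimately show ?thesis by blast
  qed
qed

text \<open>As long as the rank is below \<open>m\<close> there is a cap in front of the tail to be
  moved. Neither direction of a reversible word can raise the rank, so it stays constant.\<close>

lemma normalize_caps:
  assumes "matching n f" "tail n m f"
  shows "\<exists>us vs. set us \<subseteq> {1..<n} \<and> set vs \<subseteq> {1..<n} \<and> tail n (rk n f) (hooks us f) \<and> hooks vs (hooks us f) = f"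
  using assms
proof (induction m arbitrary: f rule: less_induct)
  case (less m)
  note f = less.prems(1) and t = less.prems(2)
  have mn: "m \<le> n" using t by (simp add: tail_def)
  show ?case
  proof (cases "rk n f = m")
    case True
    then show ?thesis using t by (intro exI[of _ "[]"]) simp
  next
    case False
    then have "rk n f < m" using rk_tail_le[OF f t] by simp
    then obtain i where i: "1 \<le> i" "i + 1 \<le> m" "f i = i + 1" using tail_simple_cap[OF f t] by blast
    obtain us vs where uv: "set us \<subseteq> {1..<m}" "set vs \<subseteq> {1..<m}"
      "tail n (m - 2) (hooks us f)" "hooks vs (hooks us f) = f"
      using shift_cap[OF i(1,2), of n] f t i(3) by blast
    have uv': "set us \<subseteq> {1..<n}" "set vs \<subseteq> {1..<n}" using uv(1,2) mn by force+
    let ?g = "hooks us f"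
    have g: "matching n ?g" using matching_hooks[OF f] uv' by blast
    have rk: "rk n ?g = rk n f"
      using rk_hooks_le[OF f uv'(1)] rk_hooks_le[OF g uv'(2)] uv(4) by simp
    obtain us' vs' where uv2: "set us' \<subseteq> {1..<n}" "set vs' \<subseteq> {1..<n}"
      "tail n (rk n f) (hooks us' ?g)" "hooks vs' (hooks us' ?g) = ?g"
      using less.IH[OF _ g uv(3)] i rk by auto
    show ?thesis
      by (intro exI[of _ "us' @ us"] exI[of _ "vs @ vs'"]) (use uv uv' uv2 in \<open>simp add: hooks_append\<close>)
  qed
qed

section \<open>The idempotents \<open>id_bar\<close> as matchings\<close>

definition bar :: "nat \<Rightarrow> nat \<Rightarrow> nat \<Rightarrow> nat" where
  "bar n q x = (if q < x \<and> x \<le> n then mate n x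
     else if n < x \<and> x < 2 * n + 1 - q then 2 * n + 1 - mate n (2 * n + 1 - x)
     else straight n x)"

lemma bar_lower: "n < x \<Longrightarrow> x < 2 * n + 1 - q \<Longrightarrow> bar n q x = 2 * n + 1 - mate n (2 * n + 1 - x)"
  by (simp add: bar_def)

lemma bar_full: "bar n n = straight n"
  by (rule ext) (auto simp: bar_def)

text \<open>The hook at the last two transversals replaces them by the next cap and cup. That
  \<open>bar\<close> is noncrossing, its expression as a word and its absorption property are all
  obtained along this step.\<close>

lemma bar_step:
  assumes q: "2 \<le> q" "q \<le> n" "even (n - q)"
  shows "hook (q - 1) (bar n q) = bar n (q - 2)"
proof
  fix x
  have b: "bar n q (q - 1) = 2 * n + 2 - q" "bar n q q = 2 * n + 1 - q"
    using q by (auto simp: bar_def straight_def)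
  have m: "mate n (q - 1) = q" "mate n q = q - 1"
    using q by (simp_all add: mate_def)
  consider "x = q - 1" | "x = q" | "x = 2 * n + 2 - q" | "x = 2 * n + 1 - q" |
    "x \<noteq> q - 1" "x \<noteq> q" "x \<noteq> 2 * n + 2 - q" "x \<noteq> 2 * n + 1 - q" by blast
  then show "hook (q - 1) (bar n q) x = bar n (q - 2) x"
  proof cases
    case 1
    have "bar n (q - 2) (q - 1) = mate n (q - 1)"
      unfolding bar_def by (rule if_P) (use q in auto)
    then show ?thesis using 1 q m by (simp add: hook_def)
  next
    case 2
    have "bar n (q - 2) q = mate n q"
      unfolding bar_def by (rule if_P) (use q in auto)
    then show ?thesis using 2 q m by (simp add: hook_def)
  next
    case 3
    have hk: "hook (q - 1) (bar n q) x = 2 * n + 1 - q"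
    proof -
      have "x \<noteq> q - 1" "x \<noteq> q - 1 + 1" "q - 1 + 1 = q" using 3 q by linarith+
      then show ?thesis using 3 b by (simp add: hook_def)
    qed
    have "2 * n + 1 - x = q - 1" using 3 q by simp
    moreover have "bar n (q - 2) x = 2 * n + 1 - mate n (2 * n + 1 - x)" using 3 q by (intro bar_lower) auto
    ultimately have "bar n (q - 2) x = 2 * n + 1 - q" using m by simp
    then show ?thesis using hk by simp
  next
    case 4
    have hk: "hook (q - 1) (bar n q) x = 2 * n + 2 - q"
    proof -
      have "x \<noteq> q - 1" "x \<noteq> q - 1 + 1" "q - 1 + 1 = q" "2 * n + 1 - q \<noteq> 2 * n + 2 - q" using 4 q by linarith+
      then show ?thesis using 4 b by (simp add: hook_def)
    qed
    have "2 * n + 1 - x = q" using 4 q by simp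
    moreover have "bar n (q - 2) x = 2 * n + 1 - mate n (2 * n + 1 - x)" using 4 q by (intro bar_lower) auto
    ultimately have "bar n (q - 2) x = 2 * n + 2 - q" using m q by simp
    then show ?thesis using hk by simp
  next
    case 5
    have "hook (q - 1) (bar n q) x = bar n q x"
      by (rule hook_other) (use 5 q b in auto)
    also have "\<dots> = bar n (q - 2) x"
    proof -
      have "q < x \<longleftrightarrow> q - 2 < x" using 5(1,2) q(1) by linarith
      moreover have "x < 2 * n + 1 - q \<longleftrightarrow> x < 2 * n + 1 - (q - 2)" using 5(3,4) q(1,2) by linarith
      ultimately show ?thesis by (simp only: bar_def)
    qed
    finally show ?thesis .
  qed
qed

lemma matching_bar:
  assumes "q \<le> n" "even (n - q)"
  shows "matching n (bar n q)"
  using assms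
proof (induction "n - q" arbitrary: q rule: less_induct)
  case less
  show ?case
  proof (cases "q = n")
    case True
    then show ?thesis using bar_full matching_straight by simp
  next
    case False
    then have q: "q + 2 \<le> n" "even (n - (q + 2))" using less.prems by presburger+
    then have "matching n (bar n (q + 2))" using less.hyps[of "q + 2"] by simp
    then have "matching n (hook (q + 2 - 1) (bar n (q + 2)))" using q by (intro matching_hook) auto
    then show ?thesis using bar_step[of "q + 2" n] q by simp
  qed
qed

lemma tail_bar: "q \<le> n \<Longrightarrow> even (n - q) \<Longrightarrow> tail n q (bar n q)"
  by (simp add: tail_def bar_def)

lemma rk_bar:
  assumes "q \<le> n" "even (n - q)"
  shows "rk n (bar n q) = q"
proof -
  have "{x \<in> {1..q}. n < bar n q x} = {1..q}" using assms(1) by (auto simp: bar_def straight_def)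
  then show ?thesis using rk_tail[OF matching_bar[OF assms] tail_bar[OF assms]] by simp
qed

lemma bar_outer: "\<not> (q < x \<and> x \<le> n) \<Longrightarrow> \<not> (n < x \<and> x < 2 * n + 1 - q) \<Longrightarrow> bar n q x = straight n x"
  by (simp only: bar_def if_False)

lemma straight_reflected: "x \<in> {1..2 * n} \<Longrightarrow> straight n (2 * n + 1 - x) = x"
  by (auto simp: straight_def)

lemma reflect_bar:
  assumes q: "q \<le> n" "even (n - q)"
  shows "reflect n (bar n q) = bar n q"
proof
  fix x
  consider "x \<notin> {1..2 * n}" | "x \<in> {1..q}" | "q < x" "x \<le> n" | "n < x" "x < 2 * n + 1 - q" |
    "2 * n + 1 - q \<le> x" "x \<le> 2 * n" "n < x" using q by fastforce
  then show "reflect n (bar n q) x = bar n q x"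
  proof cases
    case 3
    moreover have "mate n x \<le> n" using mate_range(2)[OF 3 q(2)] .
    ultimately show ?thesis by (auto simp: reflect_def bar_def)
  next
    case 4
    then have "q < 2 * n + 1 - x" "2 * n + 1 - x \<le> n" "1 \<le> x" "x \<le> 2 * n" by auto
    then show ?thesis using 4 by (auto simp: reflect_def bar_def)
  next
    case 1
    then have "x = 0 \<or> 2 * n < x" by auto
    then have "bar n q x = straight n x" by (intro bar_outer) auto
    moreover have "straight n x = x" using 1 unfolding straight_def by (rule if_not_P)
    moreover have "reflect n (bar n q) x = x" using 1 unfolding reflect_def by (rule if_not_P)
    ultimately show ?thesis by simp
  next
    case 2
    then have "bar n q x = 2 * n + 1 - x" using q by (simp add: bar_def straight_def)
    moreover have "bar n q (2 * n + 1 - x) = straight n (2 * n + 1 - x)" using 2 q by (intro bar_outer) auto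
    then have "bar n q (2 * n + 1 - x) = x" using straight_reflected[of x n] 2 q by simp
    ultimately show ?thesis using 2 q by (simp add: reflect_def)
  next
    case 5
    then have "bar n q x = 2 * n + 1 - x" using q by (simp add: bar_def straight_def)
    moreover have "bar n q (2 * n + 1 - x) = straight n (2 * n + 1 - x)" using 5 q by (intro bar_outer) auto
    then have "bar n q (2 * n + 1 - x) = x" using straight_reflected[of x n] 5 q by simp
    ultimately show ?thesis using 5 q by (simp add: reflect_def)
  qed
qed

lemma diagram_bar:
  assumes q: "q \<le> n" "even (n - q)"
  shows "diagram n (bar n q) = id_bar n q"
proof
  have m: "matching n (bar n q)" by (rule matching_bar[OF q])
  have block: "{vertex_at n x, vertex_at n (bar n q x)} \<in> diagram n (bar n q)" if "x \<in> {1..2 * n}" for x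
    using that unfolding diagram_def by blast
  show "diagram n (bar n q) \<subseteq> id_bar n q"
  proof
    fix B assume "B \<in> diagram n (bar n q)"
    then obtain x where x: "x \<in> {1..2 * n}" "bar n q x \<in> {1..2 * n}" "x < bar n q x" "B = {vertex_at n x, vertex_at n (bar n q x)}"
      by (rule diagram_blockE[OF matching_pairing[OF m]])
    consider "x \<le> q" | "q < x" "x \<le> n" | "n < x" "x < 2 * n + 1 - q" | "2 * n + 1 - q \<le> x" "n < x" by linarith
    then show "B \<in> id_bar n q"
    proof cases
      case 1
      then have "B = {Upper x, Lower x}" using x q by (auto simp: vertex_at_def bar_def straight_def)
      then show ?thesis using 1 x unfolding id_bar_def by auto
    next
      case 2
      then have o: "odd (n - x)" "bar n q x = x + 1" using x(3) by (auto simp: bar_def mate_def split: if_splits)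
      then have "x < n" using 2 by (cases "x = n") auto
      then have B: "B = {Upper x, Upper (x + 1)}" using x o 2 by (auto simp: vertex_at_def)
      have "odd (x - q)" using o(1) q 2 by presburger
      then obtain k where "x - q = 2 * k + 1" by (elim oddE)
      then have "x = q + 2 * k + 1" using 2 by simp
      then have "B = {Upper (q + 2 * k + 1), Upper (q + 2 * k + 2)} \<and> q + 2 * k + 2 \<le> n" using B \<open>x < n\<close> by simp
      then show ?thesis unfolding id_bar_def by blast
    next
      case 3
      define y where "y = 2 * n + 1 - x"
      have y: "q < y" "y \<le> n" "x = 2 * n + 1 - y" using 3 by (auto simp: y_def)
      have b: "bar n q x = 2 * n + 1 - mate n y" using 3 by (auto simp: bar_def y_def)
      then have "mate n y < y" using x(3) y by auto
      then have e: "even (n - y)" "mate n y = y - 1" by (auto simp: mate_def split: if_splits)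
      have "y - 1 > q" using mate_range(1)[OF y(1,2) q(2)] e by simp
      have B: "B = {Lower y, Lower (y - 1)}" using x(4) b e y \<open>y - 1 > q\<close> vertex_at_lower[of y n] vertex_at_lower[of "y - 1" n] by simp
      obtain k where k: "y = q + 2 * k + 2"
      proof -
        have "even (y - q)" using e(1) q y by presburger
        then obtain j where "y - q = 2 * j" by (elim evenE)
        then show thesis using that[of "j - 1"] y \<open>y - 1 > q\<close> by simp
      qed
      then have "B = {Lower (q + 2 * k + 1), Lower (q + 2 * k + 2)} \<and> q + 2 * k + 2 \<le> n" using B y by auto
      then show ?thesis unfolding id_bar_def by blast
    next
      case 4
      then show ?thesis using x by (auto simp: bar_def straight_def)
    qed
  qed
  show "id_bar n q \<subseteq> diagram n (bar n q)"
  proof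
    fix B assume "B \<in> id_bar n q"
    then consider i where "i \<in> {1..q}" "B = {Upper i, Lower i}" |
      k where "B = {Upper (q + 2 * k + 1), Upper (q + 2 * k + 2)}" "q + 2 * k + 2 \<le> n" |
      k where "B = {Lower (q + 2 * k + 1), Lower (q + 2 * k + 2)}" "q + 2 * k + 2 \<le> n"
      unfolding id_bar_def by blast
    then show "B \<in> diagram n (bar n q)"
    proof cases
      case (1 i)
      then have "B = {vertex_at n i, vertex_at n (bar n q i)}" using q by (auto simp: vertex_at_def bar_def straight_def)
      then show ?thesis using block[of i] 1 q by auto
    next
      case (2 k)
      have "mate n (q + 2 * k + 1) = q + 2 * k + 2" using 2 q by (simp add: mate_def)
      then have "B = {vertex_at n (q + 2 * k + 1), vertex_at n (bar n q (q + 2 * k + 1))}"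
        using 2 by (auto simp: vertex_at_def bar_def)
      then show ?thesis using block[of "q + 2 * k + 1"] 2 by auto
    next
      case (3 k)
      let ?y = "q + 2 * k + 1"
      have "mate n ?y = q + 2 * k + 2" using 3 q by (simp add: mate_def)
      moreover have "2 * n + 1 - (2 * n + 1 - ?y) = ?y" using 3 by simp
      ultimately have "bar n q (2 * n + 1 - ?y) = 2 * n + 1 - (q + 2 * k + 2)"
        using 3 by (auto simp: bar_def)
      then have "B = {vertex_at n (2 * n + 1 - ?y), vertex_at n (bar n q (2 * n + 1 - ?y))}"
        using 3 vertex_at_lower[of ?y n] vertex_at_lower[of "q + 2 * k + 2" n] by simp
      then show ?thesis using block[of "2 * n + 1 - ?y"] 3 by auto
    qed
  qed
qed

text \<open>Four points without a transversal, or three points with one, admit just two noncrossing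
  patterns, since \<open>f 1 = 3\<close> would trap the point 2. Beyond these points all three
  matchings have the same tail.\<close>

lemma caps_base:
  assumes f: "matching n f" and z: "z \<in> {0, 1}" and t: "tail n (4 - z) f" and r: "rk n f = z" and n: "3 \<le> n"
  shows "caps n f = caps n (bar n z) \<or> caps n f = caps n (hook (2 - z) (bar n z))"
proof -
  have mn: "4 - z \<le> n" "even (n - (4 - z))" using t unfolding tail_def by blast+
  have ez: "z \<le> n" "even (n - z)"
  proof -
    show "z \<le> n" using z n by auto
    show "even (n - z)" using mn z by (cases "z = 0") auto
  qed
  have g: "matching n (bar n z)" by (rule matching_bar[OF ez])
  have h: "matching n (hook (2 - z) (bar n z))" using matching_hook[OF g, of "2 - z"] z mn by auto
  have tailx: "f x = mate n x" "bar n z x = mate n x" "hook (2 - z) (bar n z) x = mate n x"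
    if x: "4 - z < x" "x \<le> n" for x
  proof -
    show "f x = mate n x" using t x unfolding tail_def by blast
    show b: "bar n z x = mate n x" using x z by (auto simp: bar_def)
    have "mate n x > 4 - z" by (rule mate_range(1)[OF x mn(2)])
    then have "bar n z x > 4 - z" using b by simp
    then have "x \<noteq> bar n z (2 - z)" "x \<noteq> bar n z (2 - z + 1)"
      using matching_invol[OF g, of "2 - z"] matching_invol[OF g, of "2 - z + 1"] z by auto
    then show "hook (2 - z) (bar n z) x = mate n x" using b hook_other[of x "2 - z" "bar n z"] x z by auto
  qed
  have ff: "f (f x) = x" for x by (rule matching_invol[OF f])
  have ne: "f x \<noteq> x" "1 \<le> f x" if "x \<in> {1..2 * n}" for x
    using pairing_neq[OF matching_pairing[OF f] that] matching_range[OF f that] by auto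
  have below: "f x \<le> 4 - z" if "x \<le> 4 - z" "f x \<le> n" for x by (rule tail_below[OF f t that])
  have card: "card {x \<in> {1..4 - z}. n < f x} = z" using rk_tail[OF f t] r by simp
  have key: "caps n f = caps n g'"
    if "\<And>x. x \<in> {1..n} \<Longrightarrow> f x = g' x \<or> n < f x \<and> n < g' x" "matching n g'" for g'
    unfolding caps_eq_iff[OF f that(2)] using that(1) by (meson leD)
  show ?thesis
  proof (cases "z = 0")
    case True
    have n4: "4 \<le> n" "even n" using mn True by auto
    have S: "{x \<in> {1..4}. n < f x} = {}" using card True by simp
    have up: "f x \<le> 4" if "x \<in> {1..4}" for x using S below[of x] that True by fastforce
    have m: "mate n 1 = 2" "mate n 2 = 1" "mate n 3 = 4" "mate n 4 = 3" using n4 by (simp_all add: mate_def)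
    have bar: "bar n 0 1 = 2" "bar n 0 2 = 1" "bar n 0 3 = 4" "bar n 0 4 = 3" using n4 m by (simp_all add: bar_def)
    have hk: "hook 2 (bar n 0) 1 = 4" "hook 2 (bar n 0) 2 = 3" "hook 2 (bar n 0) 3 = 2" "hook 2 (bar n 0) 4 = 1"
      using bar by (simp_all add: hook_def)
    have four: "x \<in> {1..4} \<longleftrightarrow> x = 1 \<or> x = 2 \<or> x = 3 \<or> x = (4::nat)" for x by auto
    have r1: "f 1 \<in> {1..4}" "f 2 \<in> {1..4}" "f 3 \<in> {1..4}" "f 4 \<in> {1..4}" using up ne n4 by auto
    have n1: "f 1 \<noteq> 1" "f 2 \<noteq> 2" "f 3 \<noteq> 3" "f 4 \<noteq> 4" using ne n4 by auto
    have "f 1 \<noteq> 3" using matching_between[OF f, of 1 2] n1 by auto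
    then consider "f 1 = 2" | "f 1 = 4" using r1 n1 four by auto
    then show ?thesis
    proof cases
      case 1
      then have f2: "f 2 = 1" using ff by metis
      then have "f 3 \<noteq> 1" "f 3 \<noteq> 2" using ff[of 3] 1 by auto
      then have f3: "f 3 = 4" using r1 n1 four by auto
      then have f4: "f 4 = 3" using ff by metis
      have "caps n f = caps n (bar n 0)"
      proof (rule key)
        fix x assume "x \<in> {1..n}"
        then consider "x = 1" | "x = 2" | "x = 3" | "x = 4" | "4 < x" "x \<le> n" by force
        then show "f x = bar n 0 x \<or> n < f x \<and> n < bar n 0 x"
        proof cases
          case 5
          then show ?thesis using tailx(1)[of x] tailx(2)[of x] True by simp
        qed (use \<open>f 1 = 2\<close> f2 f3 f4 bar in simp_all)
      qed (use g True in simp)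
      then show ?thesis using True by simp
    next
      case 2
      then have f4: "f 4 = 1" using ff by metis
      then have "f 2 \<noteq> 1" "f 2 \<noteq> 4" using ff[of 2] 2 by auto
      then have f2: "f 2 = 3" using r1 n1 four by auto
      then have f3: "f 3 = 2" using ff by metis
      have "caps n f = caps n (hook 2 (bar n 0))"
      proof (rule key)
        fix x assume "x \<in> {1..n}"
        then consider "x = 1" | "x = 2" | "x = 3" | "x = 4" | "4 < x" "x \<le> n" by force
        then show "f x = hook 2 (bar n 0) x \<or> n < f x \<and> n < hook 2 (bar n 0) x"
        proof cases
          case 5
          then show ?thesis using tailx(1)[of x] tailx(3)[of x] True by simp
        qed (use \<open>f 1 = 4\<close> f2 f3 f4 hk in simp_all)
      qed (use h True in simp)
      then show ?thesis using True by simp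
    qed
  next
    case False
    then have z1: "z = 1" using z by simp
    have n4: "3 \<le> n" "odd n" using ez mn z1 by auto
    have S: "card {x \<in> {1..3}. n < f x} = 1" using card z1 by simp
    obtain a where a: "{x \<in> {1..3}. n < f x} = {a}" using S by (auto simp: card_1_singleton_iff)
    have one: "x = y" if "x \<in> {1..3}" "n < f x" "y \<in> {1..3}" "n < f y" for x y
    proof -
      have "x \<in> {x \<in> {1..3}. n < f x}" "y \<in> {x \<in> {1..3}. n < f x}" using that by simp_all
      then show ?thesis unfolding a by simp
    qed
    have m: "mate n 2 = 3" "mate n 3 = 2" using n4 by (simp_all add: mate_def)
    have bar: "bar n 1 1 = 2 * n" "bar n 1 2 = 3" "bar n 1 3 = 2" using n4 m by (simp_all add: bar_def straight_def)
    have hk: "hook 1 (bar n 1) 1 = 2" "hook 1 (bar n 1) 2 = 1" "hook 1 (bar n 1) 3 = 2 * n"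
      unfolding hook_def one_add_one bar using n4 by simp_all
    have three: "x \<in> {1..3} \<longleftrightarrow> x = 1 \<or> x = 2 \<or> x = (3::nat)" for x by auto
    have n1: "f 1 \<noteq> 1" "f 2 \<noteq> 2" "f 3 \<noteq> 3" "1 \<le> f 1" "1 \<le> f 2" "1 \<le> f 3" using ne n4 by auto
    have "f 1 \<noteq> 3" using matching_between[OF f, of 1 2] n1 by auto
    then consider "f 1 = 2" | "n < f 1" using n1 below[of 1] z1 by fastforce
    then show ?thesis
    proof cases
      case 1
      then have f2: "f 2 = 1" using ff by metis
      then have "f 3 \<noteq> 1" "f 3 \<noteq> 2" using ff[of 3] 1 by auto
      then have f3: "n < f 3" using n1 below[of 3] z1 by fastforce
      have "caps n f = caps n (hook 1 (bar n 1))"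
      proof (rule key)
        fix x assume "x \<in> {1..n}"
        then consider "x = 1" | "x = 2" | "x = 3" | "3 < x" "x \<le> n" by force
        then show "f x = hook 1 (bar n 1) x \<or> n < f x \<and> n < hook 1 (bar n 1) x"
        proof cases
          case 4
          then show ?thesis using tailx(1)[of x] tailx(3)[of x] z1 by simp
        qed (use \<open>f 1 = 2\<close> f2 f3 hk n4 in simp_all)
      qed (use h z1 in simp)
      then show ?thesis using z1 by simp
    next
      case 2
      then have "f 2 \<le> n" using one[of 1 2] by fastforce
      then have "f 2 \<le> 3" using below[of 2] z1 by simp
      moreover have "f 2 \<noteq> 1" using ff[of 2] 2 n4 by auto
      ultimately have f2: "f 2 = 3" using n1 by linarith
      then have f3: "f 3 = 2" using ff by metis
      have "caps n f = caps n (bar n 1)"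
      proof (rule key)
        fix x assume "x \<in> {1..n}"
        then consider "x = 1" | "x = 2" | "x = 3" | "3 < x" "x \<le> n" by force
        then show "f x = bar n 1 x \<or> n < f x \<and> n < bar n 1 x"
        proof cases
          case 4
          then show ?thesis using tailx(1)[of x] tailx(2)[of x] z1 by simp
        qed (use \<open>n < f 1\<close> f2 f3 bar n4 in simp_all)
      qed (use g z1 in simp)
      then show ?thesis using z1 by simp
    qed
  qed
qed

text \<open>
  If no hook separated \<open>f\<close> from \<open>g\<close>, the hook at a simple cap of \<open>f\<close> would show that their caps
  differ on a set \<open>F\<close> of three or four points only. A hook at two neighbours of which exactly one
  lies in \<open>F\<close> does separate them, so \<open>F\<close> consists of all the points in front of the tail.
\<close>

lemma separating_hook:
  assumes f: "matching n f" and g: "matching n g" and tf: "tail n m f" and tg: "tail n m g"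
    and rf: "rk n f = q" and rg: "rk n g = q" and ne: "caps n f \<noteq> caps n g"
    and not3: "\<not> (m = 3 \<and> q = 1)" and not4: "\<not> (m = 4 \<and> q = 0)"
  shows "\<exists>l\<ge>1. l < m \<and> ((rk n (hook l f) = q) \<noteq> (rk n (hook l g) = q) \<or>
    rk n (hook l f) = q \<and> rk n (hook l g) = q \<and> caps n (hook l f) \<noteq> caps n (hook l g))"
proof (rule ccontr)
  assume contra: "\<not> ?thesis"
  have mn: "m \<le> n" using tf unfolding tail_def by blast
  have drop: "(f l \<le> n \<or> f (l + 1) \<le> n) \<longleftrightarrow> (g l \<le> n \<or> g (l + 1) \<le> n)" if "1 \<le> l" "l < m" for l
    using contra that rk_hook_iff[OF f, of l] rk_hook_iff[OF g, of l] mn rf rg by auto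
  have same: "hook l f x = hook l g x"
    if "1 \<le> l" "l < m" "f l \<le> n \<or> f (l + 1) \<le> n" "x \<in> {1..n}" "hook l f x \<le> n \<or> hook l g x \<le> n" for l x
  proof -
    have "rk n (hook l f) = q" "rk n (hook l g) = q"
      using drop[OF that(1,2)] that rk_hook_iff[OF f, of l] rk_hook_iff[OF g, of l] mn rf rg by auto
    then have "caps n (hook l f) = caps n (hook l g)" using contra that by blast
    moreover have "matching n (hook l f)" "matching n (hook l g)"
      using matching_hook[OF f] matching_hook[OF g] that mn by auto
    ultimately show ?thesis using that(4,5) caps_eq_iff by blast
  qed
  have ff: "f (f x) = x" "g (g x) = x" for x using matching_invol f g by blast+
  have "q \<noteq> m" using ne caps_full_tail[OF f g tf tg] rf rg by blast
  then have "rk n f < m" using rk_tail_le[OF f tf] rf by simp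
  then obtain i where i: "1 \<le> i" "i + 1 \<le> m" "f i = i + 1" using tail_simple_cap[OF f tf] by blast
  have fi: "f (i + 1) = i" using ff(1)[of i] i by simp
  \<comment> \<open>The hook at its own cap fixes \<open>f\<close>, so by assumption
    \<open>f\<close> and \<open>hook i g\<close> have the same caps.\<close>
  have hf: "hook i f = f" by (rule hook_same[OF matching_pairing[OF f] i(3)])
  have up: "f x = hook i g x" if "x \<in> {1..n}" "f x \<le> n \<or> hook i g x \<le> n" for x
    using same[of i x] that i mn hf by auto
  have gi: "g i \<noteq> i + 1"
  proof
    assume "g i = i + 1"
    then have "hook i g = g" by (rule hook_same[OF matching_pairing[OF g]])
    then have "caps n f = caps n g" using up unfolding caps_eq_iff[OF f g] by simp
    then show False using ne by simp
  qed
  define j k where "j = g i" and "k = g (i + 1)"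
  have gjk: "g j = i" "g k = i + 1" by (simp_all add: j_def k_def ff)
  have i2: "1 \<le> i" "i < 2 * n" using i mn by auto
  have dist: "j \<noteq> i" "k \<noteq> i" "k \<noteq> i + 1" "j \<noteq> k" "j \<noteq> i + 1"
    using hook_distinct[OF matching_pairing[OF g] i2 gi] gi by (auto simp: j_def k_def)
  have jk: "j \<in> {1..2 * n}" "k \<in> {1..2 * n}" unfolding j_def k_def using matching_range[OF g] i mn by auto
  have hj: "hook i g j = k" "hook i g k = j" using dist by (auto simp: hook_def j_def k_def)
  have notboth: "j \<le> n \<or> k \<le> n"
    using drop[of i] i mn fi unfolding j_def k_def by auto
  \<comment> \<open>The points touched by \<open>hook i\<close> on \<open>g\<close>. On the other
    upper points \<open>f\<close> and \<open>g\<close> agree as far as caps are concerned.\<close>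
  define F where "F = {i, i + 1, j, k}"
  have gF: "g x \<in> F \<longleftrightarrow> x \<in> F" for x
    using gjk ff unfolding F_def j_def k_def by (metis insert_iff empty_iff)
  have outF: "f x = g x \<or> n < f x \<and> n < g x" if "x \<in> {1..n}" "x \<notin> F" for x
  proof -
    have "hook i g x = g x" by (rule hook_other) (use that in \<open>auto simp: F_def j_def k_def\<close>)
    then show ?thesis using up[OF that(1)] by (metis not_le)
  qed
  have fj: "f j = k \<or> n < f j \<and> n < k" if "j \<le> n" using up[of j] hj jk that by (metis atLeastAtMost_iff not_le)
  have fk: "f k = j \<or> n < f k \<and> n < j" if "k \<le> n" using up[of k] hj jk that by (metis atLeastAtMost_iff not_le)
  have inF: "f y \<noteq> g y" "f y \<le> n \<or> g y \<le> n" "f y \<le> n \<Longrightarrow> f y \<in> F" if y: "y \<in> F" "y \<in> {1..n}" for y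
  proof -
    consider "y = i" | "y = i + 1" | "y = j" "j \<le> n" | "y = k" "k \<le> n" using y by (auto simp: F_def)
    then have "f y \<noteq> g y \<and> (f y \<le> n \<or> g y \<le> n) \<and> (f y \<le> n \<longrightarrow> f y \<in> F)"
    proof cases
      case 1
      then show ?thesis using i mn gi by (simp add: F_def)
    next
      case 2
      then show ?thesis using i mn fi dist by (simp add: F_def k_def)
    next
      case 3
      then have "g y = i" "f y = k \<or> n < f y" using fj gjk by auto
      then show ?thesis using \<open>k \<noteq> i\<close> i mn by (auto simp: F_def)
    next
      case 4
      then have "g y = i + 1" "f y = j \<or> n < f y" using fk gjk by auto
      then show ?thesis using \<open>j \<noteq> i + 1\<close> i mn by (auto simp: F_def)
    qed
    then show "f y \<noteq> g y" "f y \<le> n \<or> g y \<le> n" "f y \<le> n \<Longrightarrow> f y \<in> F" by blast+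
  qed
  \<comment> \<open>Let \<open>y\<close> in \<open>F\<close> and \<open>x\<close> outside
    \<open>F\<close> be neighbours; the hook joining them separates \<open>f\<close> from
    \<open>g\<close> after all.\<close>
  have noboundary: False
    if l: "1 \<le> l" "l < m" and yx: "y = l \<and> x = l + 1 \<or> y = l + 1 \<and> x = l" and F: "y \<in> F" "x \<notin> F" for l x y
  proof -
    have xy: "x \<in> {1..n}" "y \<in> {1..n}" using l yx mn by auto
    have hookf: "hook l h p = h v"
      if uv: "u = l \<and> v = l + 1 \<or> u = l + 1 \<and> v = l" and p: "h p = u" "p \<noteq> u" "p \<noteq> v"
        and inv: "\<And>w. h (h w) = w" for h p u v
    proof -
      have pu: "p = h u" using p inv by metis
      show ?thesis
      proof (cases "u = l")
        case True
        then show ?thesis using uv p pu by (simp add: hook_def)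
      next
        case False
        then have "p \<noteq> h l" using p inv by metis
        then show ?thesis using False uv p pu by (simp add: hook_def)
      qed
    qed
    have xy': "x = l \<and> y = l + 1 \<or> x = l + 1 \<and> y = l" using yx by auto
    note o = outF[OF xy(1) F(2)] and s = inF[OF F(1) xy(2)]
    show False
    proof (cases "f x \<le> n")
      case True
      \<comment> \<open>The common partner \<open>p\<close> of \<open>x\<close> is passed on to the
        partners of \<open>y\<close>, on which \<open>f\<close> and \<open>g\<close>
        disagree.\<close>
      then have fg: "f x = g x" using o by simp
      define p where "p = f x"
      have "g p = x" using fg ff by (simp add: p_def)
      then have pF: "p \<notin> F" using gF[of p] F by simp
      have p1: "p \<in> {1..n}" using matching_range[OF f, of x] xy True by (auto simp: p_def)
      have "p \<noteq> x" using pairing_neq[OF matching_pairing[OF f], of x] xy by (auto simp: p_def)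
      moreover have "p \<noteq> y" using pF F by blast
      ultimately have "hook l f p = f y" "hook l g p = g y"
        using hookf[OF xy', of f p] hookf[OF xy', of g p] ff \<open>g p = x\<close> by (simp_all add: p_def)
      moreover have "f l \<le> n \<or> f (l + 1) \<le> n" using True yx by auto
      ultimately show False using same[OF l _ p1] s by auto
    next
      case False
      \<comment> \<open>Now \<open>x\<close> ends a transversal in both, and by \<open>drop\<close>
        the point \<open>y\<close> lies in a cap \<open>{y, a}\<close> of \<open>f\<close> and a cap
        \<open>{y, b}\<close> of \<open>g\<close>. The hook joins \<open>a\<close> to the lower row
        in the image of \<open>f\<close>, hence \<open>g\<close> does so with \<open>a\<close>
        already; likewise \<open>f\<close> with \<open>b\<close>. No transversal ends under a cap:
        so \<open>x\<close> puts \<open>a\<close> and \<open>b\<close> on the same side of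
        \<open>y\<close>, and the nearer one lies under the cap of the other.\<close>
      then have fx: "n < f x" "n < g x" using o by auto
      have d: "f y \<le> n \<longleftrightarrow> g y \<le> n" using drop[OF l] fx yx by auto
      then have c: "f y \<le> n" "g y \<le> n" using s by auto
      define a b where "a = f y" and "b = g y"
      have ab: "a \<in> {1..n}" "b \<in> {1..n}" "a \<noteq> b"
        using c s matching_range[OF f, of y] matching_range[OF g, of y] xy by (auto simp: a_def b_def)
      have fa: "f a = y" "g b = y" by (simp_all add: a_def b_def ff)
      have neq: "a \<noteq> x" "b \<noteq> x" "a \<noteq> y" "b \<noteq> y"
        using fx xy fa pairing_neq[OF matching_pairing[OF f], of y] pairing_neq[OF matching_pairing[OF g], of y]
        by (auto simp: a_def b_def)
      have lf: "f l \<le> n \<or> f (l + 1) \<le> n" using c yx by auto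
      have ha: "hook l f a = f x" using hookf[OF yx, of f a] neq fa ff by simp
      have hb: "hook l g b = g x" using hookf[OF yx, of g b] neq fa ff by simp
      have "a \<noteq> g x" "b \<noteq> f x" using ab fx by auto
      then have hga: "hook l g a = g a" and hfb: "hook l f b = f b"
        using yx neq ab hook_other[of a l g] hook_other[of b l f] unfolding a_def[symmetric] b_def[symmetric]
        by (auto simp: a_def b_def)
      have ga: "n < g a" using same[OF l lf ab(1)] ha hga fx by (metis not_le)
      have fb: "n < f b" using same[OF l lf ab(2)] hb hfb fx by (metis not_le)
      have B1: "\<not> (min y a < w \<and> w < max y a)" if "n < f w" for w
        using matching_between[OF f, of "min y a" w] that fa a_def xy ab by (auto simp: min_def max_def split: if_splits)
      have B2: "\<not> (min y b < w \<and> w < max y b)" if "n < g w" for w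
        using matching_between[OF g, of "min y b" w] that fa b_def xy ab by (auto simp: min_def max_def split: if_splits)
      show False
        using B1[OF fb] B1[OF fx(1)] B2[OF ga] B2[OF fx(2)] neq ab yx by (auto simp: min_def max_def split: if_splits)
    qed
  qed
  have step: "x \<in> F \<longleftrightarrow> x + 1 \<in> F" if "1 \<le> x" "x < m" for x
    using noboundary[of x x "x + 1"] noboundary[of x "x + 1" x] that by blast
  \<comment> \<open>A set of points without a boundary in \<open>{1..m}\<close> that contains
    \<open>i\<close> contains the whole interval.\<close>
  have all: "x \<in> F" if "1 \<le> x" "x \<le> m" for x
  proof (cases "i \<le> x")
    case True
    then show ?thesis using that(2)
    proof (induction x rule: dec_induct)
      case base
      then show ?case by (simp add: F_def)
    next
      case (step w)
      then show ?case using \<open>\<And>x. 1 \<le> x \<Longrightarrow> x < m \<Longrightarrow> x \<in> F \<longleftrightarrow> x + 1 \<in> F\<close>[of w] i by simp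
    qed
  next
    case False
    then have "x \<le> i" by simp
    then show ?thesis using that(1)
    proof (induction x rule: inc_induct)
      case base
      then show ?case by (simp add: F_def)
    next
      case (step w)
      then show ?case using \<open>\<And>x. 1 \<le> x \<Longrightarrow> x < m \<Longrightarrow> x \<in> F \<longleftrightarrow> x + 1 \<in> F\<close>[of w] i by simp
    qed
  qed
  have jm: "j \<le> m" if "j \<le> n" using tail_below[OF g tg, of i] that i by (simp add: j_def)
  have km: "k \<le> m" if "k \<le> n" using tail_below[OF g tg, of "i + 1"] that i by (simp add: k_def)
  have rk: "q = card {x \<in> {1..m}. n < g x}" using rk_tail[OF g tg] rg by simp
  \<comment> \<open>Counting \<open>F\<close> gives four upper points and rank 0, or three upper
    points and rank 1: precisely the two excluded cases.\<close>
  consider "j \<le> n" "k \<le> n" | "n < j" "k \<le> n" | "j \<le> n" "n < k" using notboth by linarith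
  then show False
  proof cases
    case 1
    then have "F \<subseteq> {1..m}" using jm km i jk by (simp add: F_def)
    moreover have "{1..m} \<subseteq> F" using all by (simp add: subset_iff)
    ultimately have "{1..m} = {i, i + 1, j, k}" unfolding F_def by blast
    then have "card {1..m} = 4" using dist by (simp add: card_insert_if)
    then have "m = 4" by simp
    moreover have "g x \<le> n" if "x \<in> {1..m}" for x
      using all[of x] that 1 gjk i mn by (auto simp: F_def j_def k_def)
    then have "{x \<in> {1..m}. n < g x} = {}" by (auto simp: not_less[symmetric])
    then have "q = 0" using rk by simp
    ultimately show False using not4 by simp
  next
    case 2
    then have "{i, i + 1, k} \<subseteq> {1..m}" using jm km i jk by simp
    moreover have "x \<in> {i, i + 1, k}" if "x \<in> {1..m}" for x
      using all[of x] that 2 mn by (simp add: F_def)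
    ultimately have S: "{1..m} = {i, i + 1, k}" by blast
    then have "card {1..m} = 3" using dist by (simp add: card_insert_if)
    then have "m = 3" by simp
    moreover have "{x \<in> {1..m}. n < g x} = {i}"
      unfolding S using 2 gjk i mn dist j_def k_def by auto
    then have "q = 1" using rk by simp
    ultimately show False using not3 by simp
  next
    case 3
    then have "{i, i + 1, j} \<subseteq> {1..m}" using jm km i jk by simp
    moreover have "x \<in> {i, i + 1, j}" if "x \<in> {1..m}" for x
      using all[of x] that 3 mn by (simp add: F_def)
    ultimately have S: "{1..m} = {i, i + 1, j}" by blast
    then have "card {1..m} = 3" using dist by (simp add: card_insert_if)
    then have "m = 3" by simp
    moreover have "{x \<in> {1..m}. n < g x} = {i + 1}"
      unfolding S using 3 gjk i mn dist j_def k_def by auto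
    then have "q = 1" using rk by simp
    ultimately show False using not3 by simp
  qed
qed

section \<open>The Jones monoid\<close>

lemma tail_hook:
  assumes h: "matching n h" and t: "tail n q h" and q: "2 \<le> q"
  shows "tail n (q - 2) (hook (q - 1) h)"
  unfolding tail_def
proof (intro conjI allI impI)
  have qn: "q \<le> n" "even (n - q)" using t unfolding tail_def by blast+
  show "q - 2 \<le> n" using qn by simp
  show "even (n - (q - 2))" using qn q by presburger
  have qq: "q - 1 + 1 = q" using q by simp
  fix x assume x: "q - 2 < x \<and> x \<le> n"
  consider "x = q - 1" | "x = q" | "q < x" using x by linarith
  then show "hook (q - 1) h x = mate n x"
  proof cases
    case 1
    then have "odd (n - x)" using qn q by presburger
    then show ?thesis using 1 qq by (simp add: mate_def)
  next
    case 2
    then have "even (n - x)" using qn by simp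
    then show ?thesis using 2 hook_at(2)[of "q - 1" h] unfolding qq by (simp add: mate_def)
  next
    case 3
    then have "h x = mate n x" using t x unfolding tail_def by blast
    moreover have "hook (q - 1) h x = h x"
      by (rule hook_other) (use 3 x tail_below[OF h t, of "q - 1"] tail_below[OF h t, of q] qq in auto)
    ultimately show ?thesis by simp
  qed
qed

lemma hook_commute:
  assumes "{i, i + 1, f i, f (i + 1)} \<inter> {j, j + 1, f j, f (j + 1)} = {}"
  shows "hook i (hook j f) = hook j (hook i f)"
proof -
  have d: "a \<noteq> b" if "a \<in> {i, i + 1, f i, f (i + 1)}" "b \<in> {j, j + 1, f j, f (j + 1)}" for a b
    using assms that by blast
  have hj: "hook j f i = f i" "hook j f (i + 1) = f (i + 1)"
    by (rule hook_other; rule d; simp)+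
  have hi: "hook i f j = f j" "hook i f (j + 1) = f (j + 1)"
    by (rule hook_other; rule d[symmetric]; simp)+
  show ?thesis
  proof
    fix x
    have l: "hook i (hook j f) x = (if x = i then i + 1 else if x = i + 1 then i else
       if x = f i then f (i + 1) else if x = f (i + 1) then f i else hook j f x)"
      using hj by (simp add: hook_def[of i])
    have r: "hook j (hook i f) x = (if x = j then j + 1 else if x = j + 1 then j else
       if x = f j then f (j + 1) else if x = f (j + 1) then f j else hook i f x)"
      using hi by (simp add: hook_def[of j])
    show "hook i (hook j f) x = hook j (hook i f) x"
    proof (cases "x \<in> {i, i + 1, f i, f (i + 1)}")
      case True
      then have "x \<noteq> j" "x \<noteq> j + 1" "x \<noteq> f j" "x \<noteq> f (j + 1)"
        using d[OF True, of j] d[OF True, of "j + 1"] d[OF True, of "f j"] d[OF True, of "f (j + 1)"] by simp_all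
      then have "hook j (hook i f) x = hook i f x" unfolding r by (simp only: if_False)
      moreover have "hook i (hook j f) x = hook i f x"
        unfolding l hook_def[of i f] using True by (auto simp only: insert_iff empty_iff if_True if_False split: if_split)
      ultimately show ?thesis by simp
    next
      case False
      then have x: "x \<noteq> i" "x \<noteq> i + 1" "x \<noteq> f i" "x \<noteq> f (i + 1)" by auto
      then have "hook i f x = f x" by (rule hook_other)
      moreover have "hook i (hook j f) x = hook j f x" unfolding l using x by simp
      ultimately show ?thesis unfolding r by (simp only: hook_def[of j f])
    qed
  qed
qed

text \<open>Both \<open>f\<close> and \<open>g\<close> contain the cups of \<open>h\<close> and have
  no transversals, so each pairs off the lower ends of the transversals of \<open>h\<close>. With at
  most two such ends there is no choice. This is the source of the rank bound 2 for even
  \<open>n\<close>.\<close>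

lemma cups_forced:
  assumes f: "matching n f" and g: "matching n g" and h: "matching n h" and r: "rk n f = 0" "rk n g = 0" "rk n h \<le> 2"
    and fh: "\<And>x. x \<in> {n + 1..2 * n} \<Longrightarrow> n < h x \<Longrightarrow> f x = h x"
    and gh: "\<And>x. x \<in> {n + 1..2 * n} \<Longrightarrow> n < h x \<Longrightarrow> g x = h x"
  shows "cups n f = cups n g"
proof -
  define D where "D = {x \<in> {n + 1..2 * n}. h x \<le> n}"
  have D: "finite D" "card D \<le> 2" using r(3) rk_lower[OF h] by (simp_all add: D_def)
  have inD: "k x \<in> D \<and> k x \<noteq> x" if k: "matching n k" "rk n k = 0"
    and kh: "\<And>x. x \<in> {n + 1..2 * n} \<Longrightarrow> n < h x \<Longrightarrow> k x = h x" and x: "x \<in> D" for k x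
  proof -
    have "{x \<in> {n + 1..2 * n}. k x \<le> n} = {}" using k rk_lower[OF k(1)] by simp
    moreover have xr: "x \<in> {n + 1..2 * n}" using x by (simp add: D_def)
    ultimately have "n < k x" by fastforce
    then have kx: "k x \<in> {n + 1..2 * n}" using matching_range[OF k(1), of x] xr by auto
    have "h (k x) \<le> n"
    proof (rule ccontr)
      assume "\<not> h (k x) \<le> n"
      then have "h (k x) = x" using kh[OF kx] matching_invol[OF k(1), of x] by simp
      then have "h x = k x" using matching_invol[OF h] by metis
      then show False using x \<open>n < k x\<close> by (simp add: D_def)
    qed
    moreover have "k x \<noteq> x" using pairing_neq[OF matching_pairing[OF k(1)], of x] xr by auto
    ultimately show ?thesis using kx by (simp add: D_def)
  qed
  have "f x = g x" if x: "x \<in> {n + 1..2 * n}" for x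
  proof (cases "x \<in> D")
    case True
    show ?thesis
    proof (rule ccontr)
      assume ne: "f x \<noteq> g x"
      have fx: "f x \<in> D" "f x \<noteq> x" using inD[OF f r(1) fh True] by blast+
      have gx: "g x \<in> D" "g x \<noteq> x" using inD[OF g r(2) gh True] by blast+
      have "card {x, f x, g x} = 3" using ne fx(2) gx(2) by simp
      moreover have "{x, f x, g x} \<subseteq> D" using fx gx True by simp
      then have "card {x, f x, g x} \<le> card D" by (rule card_mono[OF D(1)])
      ultimately show False using D(2) by simp
    qed
  next
    case False
    then show ?thesis using fh[OF x] gh[OF x] x by (simp add: D_def)
  qed
  then show ?thesis unfolding cups_eq_iff by blast
qed

section \<open>The monoid of diagrams, its generators and factorisations\<close>

locale jones_degree =
  fixes n z :: nat
  assumes n3: "3 \<le> n" and z01: "z \<in> {0, 1}" and zn: "z mod 2 = n mod 2"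
begin

abbreviation S :: "vertex set set set" where
  "S \<equiv> carrier (jones n)"

abbreviation prod :: "vertex set set \<Rightarrow> vertex set set \<Rightarrow> vertex set set" (infixl "\<cdot>" 70) where
  "a \<cdot> b \<equiv> partition_mult n a b"

abbreviation E :: "nat \<Rightarrow> vertex set set" where
  "E i \<equiv> diagram n (hook i (straight n))"

abbreviation rank :: "vertex set set \<Rightarrow> nat" where
  "rank \<equiv> pt_rank"

abbreviation one :: "vertex set set" where
  "one \<equiv> diagram n (straight n)"

definition word :: "nat list \<Rightarrow> vertex set set" where
  "word ws = diagram n (hooks ws (straight n))"

definition mat :: "vertex set set \<Rightarrow> nat \<Rightarrow> nat" where
  "mat a = (THE f. matching n f \<and> diagram n f = a)"

abbreviation cap :: "vertex set set \<Rightarrow> nat \<Rightarrow> nat" where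
  "cap a \<equiv> caps n (mat a)"

abbreviation cup :: "vertex set set \<Rightarrow> nat \<Rightarrow> nat" where
  "cup a \<equiv> cups n (mat a)"

lemma mult_jones [simp]: "a \<otimes>\<^bsub>jones n\<^esub> b = a \<cdot> b"
  by (simp add: jones_def partition_monoid_def)

lemma carrier_eq: "S = diagram n ` {f. matching n f}"
  using carrier_jones n3 by simp

lemma matching_diagram_in [intro]: "matching n f \<Longrightarrow> diagram n f \<in> S"
  by (simp add: carrier_eq)

lemma mat_diagram [simp]: "matching n f \<Longrightarrow> mat (diagram n f) = f"
  unfolding mat_def by (rule the_equality) (auto intro: diagram_inject matching_pairing)

lemma S_cases:
  assumes "a \<in> S"
  obtains f where "matching n f" "a = diagram n f"
  using assms carrier_eq by auto

lemma matching_mat: "a \<in> S \<Longrightarrow> matching n (mat a)"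
  by (elim S_cases) simp

lemma diagram_mat: "a \<in> S \<Longrightarrow> diagram n (mat a) = a"
  by (elim S_cases) simp

lemma S_partition: "a \<in> S \<Longrightarrow> partition_on (vertices n) a"
  by (elim S_cases) (simp add: partition_on_diagram matching_pairing)

lemma one_in [simp]: "one \<in> S"
  using matching_straight by blast

lemma matching_E: "1 \<le> i \<Longrightarrow> i < n \<Longrightarrow> matching n (hook i (straight n))"
  using matching_hook[OF matching_straight] by simp

lemma E_in: "1 \<le> i \<Longrightarrow> i < n \<Longrightarrow> E i \<in> S"
  using matching_E by blast

lemma E_mult: "matching n f \<Longrightarrow> 1 \<le> i \<Longrightarrow> i < n \<Longrightarrow> E i \<cdot> diagram n f = diagram n (hook i f)"
  by (rule hook_mult[OF matching_pairing])

lemma one_mult: "a \<in> S \<Longrightarrow> one \<cdot> a = a"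
  by (elim S_cases) (simp add: straight_mult matching_pairing)

lemma assoc_partition:
  "a \<in> S \<Longrightarrow> b \<in> S \<Longrightarrow> c \<in> S \<Longrightarrow> a \<cdot> b \<cdot> c = a \<cdot> (b \<cdot> c)"
  by (rule partition_mult_assoc) (simp_all add: S_partition)

lemma matching_word: "set ws \<subseteq> {1..<n} \<Longrightarrow> matching n (hooks ws (straight n))"
  by (rule matching_hooks[OF matching_straight])

lemma word_in: "set ws \<subseteq> {1..<n} \<Longrightarrow> word ws \<in> S"
  unfolding word_def using matching_word by blast

lemma word_Cons: "i \<in> {1..<n} \<Longrightarrow> set ws \<subseteq> {1..<n} \<Longrightarrow> word (i # ws) = E i \<cdot> word ws"
  unfolding word_def using E_mult[OF matching_word, of ws i] by simp

lemma word_mult: "matching n f \<Longrightarrow> set ws \<subseteq> {1..<n} \<Longrightarrow> word ws \<cdot> diagram n f = diagram n (hooks ws f)"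
proof (induction ws)
  case Nil
  then show ?case using one_mult matching_diagram_in by (simp add: word_def)
next
  case (Cons i ws)
  then have "word (i # ws) \<cdot> diagram n f = E i \<cdot> (word ws \<cdot> diagram n f)"
    using word_Cons[of i ws] assoc_partition[OF E_in word_in matching_diagram_in, of i ws f] by auto
  then show ?case using Cons matching_hooks[of n f ws] E_mult[of "hooks ws f" i] by simp
qed

lemma word_append: "set us \<subseteq> {1..<n} \<Longrightarrow> set vs \<subseteq> {1..<n} \<Longrightarrow> word (us @ vs) = word us \<cdot> word vs"
  unfolding word_def[of "us @ vs"] word_def[of vs]
  using word_mult[OF matching_word, of vs us] by (simp add: hooks_append)

lemma star_in: "a \<in> S \<Longrightarrow> star a \<in> S"
  by (elim S_cases) (auto simp: star_diagram matching_pairing intro: matching_reflect)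

lemma star_mult: "a \<in> S \<Longrightarrow> b \<in> S \<Longrightarrow> star (a \<cdot> b) = star b \<cdot> star a"
  by (simp add: star_partition_mult S_partition)

lemma star_E: "1 \<le> i \<Longrightarrow> i < n \<Longrightarrow> star (E i) = E i"
proof (rule colour_rel_inject[of n])
  assume i: "1 \<le> i" "i < n"
  show "colour_rel (star (E i)) = colour_rel (E i)"
    unfolding colour_rel_star by (intro equalityI subrelI) (auto simp: colour_rel_hook_straight[OF i])
qed (simp_all add: S_partition E_in star_in)

lemma mat_star: "a \<in> S \<Longrightarrow> mat (star a) = reflect n (mat a)"
  by (elim S_cases) (simp add: star_diagram matching_pairing matching_reflect)

lemma bar_parity: "even (n - z)" "z \<le> n"
  using n3 z01 zn by (auto simp: mod_eq_dvd_iff_nat elim: oddE)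

lemma id_bar_eq: "q \<le> n \<Longrightarrow> even (n - q) \<Longrightarrow> id_bar n q = diagram n (bar n q)"
  by (simp add: diagram_bar)

lemma id_bar_in: "q \<le> n \<Longrightarrow> even (n - q) \<Longrightarrow> id_bar n q \<in> S"
  using matching_bar by (auto simp: id_bar_eq)

lemma id_bar_full: "id_bar n n = one"
  by (simp add: id_bar_eq bar_full)

lemma id_bar_step:
  assumes "2 \<le> q" "q \<le> n" "even (n - q)"
  shows "id_bar n (q - 2) = E (q - 1) \<cdot> id_bar n q"
proof -
  have "even (n - (q - 2))" using assms by presburger
  then show ?thesis
    using E_mult[OF matching_bar[OF assms(2,3)], of "q - 1"] bar_step[OF assms] assms
    by (simp add: id_bar_eq)
qed

lemma star_id_bar: "q \<le> n \<Longrightarrow> even (n - q) \<Longrightarrow> star (id_bar n q) = id_bar n q"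
  by (simp add: id_bar_eq star_diagram matching_pairing matching_bar reflect_bar)

text \<open>The bound on the letters is the point: they all exceed \<open>q\<close>, so each is at
  distance at least 2 from every \<open>i < q\<close>, and the idempotent commutes with these
  \<open>E i\<close>.\<close>

lemma id_bar_word: "q \<le> n \<Longrightarrow> even (n - q) \<Longrightarrow> \<exists>ws. set ws \<subseteq> {q + 1..<n} \<and> id_bar n q = word ws"
proof (induction "n - q" arbitrary: q rule: less_induct)
  case less
  show ?case
  proof (cases "q = n")
    case True
    then show ?thesis using id_bar_full by (intro exI[of _ "[]"]) (simp add: word_def)
  next
    case False
    then have q: "q + 2 \<le> n" "even (n - (q + 2))" using less.prems by presburger+
    have "\<exists>ws. set ws \<subseteq> {q + 2 + 1..<n} \<and> id_bar n (q + 2) = word ws"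
      by (rule less.hyps) (use q in auto)
    then obtain ws where ws: "set ws \<subseteq> {q + 2 + 1..<n}" "id_bar n (q + 2) = word ws" by blast
    then have "set ws \<subseteq> {1..<n}" by auto
    then have "id_bar n q = word ((q + 1) # ws)"
      using id_bar_step[of "q + 2"] q ws word_Cons[of "q + 1" ws] by simp
    then show ?thesis using ws q by (intro exI[of _ "(q + 1) # ws"]) auto
  qed
qed

lemma star_word: "set ws \<subseteq> {1..<n} \<Longrightarrow> star (word ws) = word (rev ws)"
proof (induction ws)
  case Nil
  have "star one = one"
    using star_id_bar[of n] id_bar_full by simp
  then show ?case by (simp add: word_def)
next
  case (Cons i ws)
  then have "star (word (i # ws)) = star (word ws) \<cdot> star (E i)"
    using word_Cons star_mult E_in word_in by auto
  also have "\<dots> = word (rev ws) \<cdot> word [i]"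
    using Cons star_E by (simp add: word_def)
  finally show ?case using Cons word_append[of "rev ws" "[i]"] by simp
qed

lemma rank_eq: "a \<in> S \<Longrightarrow> rank a = rk n (mat a)"
  by (elim S_cases) (simp add: pt_rank_diagram)

lemma rank_star: "a \<in> S \<Longrightarrow> rank (star a) = rank a"
  by (simp add: rank_eq mat_star star_in rk_reflect matching_mat)

lemma normalize_left:
  assumes a: "a \<in> S"
  shows "\<exists>us vs. set us \<subseteq> {1..<n} \<and> set vs \<subseteq> {1..<n} \<and> word vs \<cdot> (word us \<cdot> a) = a \<and>
    tail n (rank a) (mat (word us \<cdot> a)) \<and> word us \<cdot> a \<in> S \<and> rank (word us \<cdot> a) = rank a \<and> cup (word us \<cdot> a) = cup a"
proof -
  obtain f where f: "matching n f" "a = diagram n f" using a S_cases by blast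
  have tn: "tail n n f" by (simp add: tail_def)
  obtain us vs where uv: "set us \<subseteq> {1..<n}" "set vs \<subseteq> {1..<n}" "tail n (rk n f) (hooks us f)" "hooks vs (hooks us f) = f"
    using normalize_caps[OF f(1) tn] by blast
  have m: "matching n (hooks us f)" by (rule matching_hooks[OF f(1) uv(1)])
  have rk: "rk n (hooks us f) = rk n f"
    using rk_hooks_le[OF f(1) uv(1)] rk_hooks_le[OF m uv(2)] uv(4) by simp
  have cups: "cups n (hooks ws f) = cups n f" if "set ws \<subseteq> {1..<n}" "rk n (hooks ws f) = rk n f" for ws
    using that
  proof (induction ws)
    case (Cons i ws)
    have mw: "matching n (hooks ws f)" using matching_hooks[OF f(1)] Cons by simp
    have "rk n (hook i (hooks ws f)) \<le> rk n (hooks ws f)" "rk n (hooks ws f) \<le> rk n f"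
      using rk_hook_le[OF mw, of i] rk_hooks_le[OF f(1), of ws] Cons by auto
    then show ?case using Cons cups_hook[OF mw, of i] by simp
  qed simp
  show ?thesis
    by (intro exI[of _ us] exI[of _ vs])
      (use uv f m rk cups[OF uv(1)] word_mult[OF f(1) uv(1)] word_mult[OF m uv(2)] in \<open>auto simp: pt_rank_diagram\<close>)
qed

lemma cup_eq_iff_cap_star: "a \<in> S \<Longrightarrow> b \<in> S \<Longrightarrow> cap (star a) = cap (star b) \<longleftrightarrow> cup a = cup b"
  by (simp add: mat_star caps_reflect_eq_iff matching_mat)

lemma cap_eq_iff_cup_star: "a \<in> S \<Longrightarrow> b \<in> S \<Longrightarrow> cap a = cap b \<longleftrightarrow> cup (star a) = cup (star b)"
  using cup_eq_iff_cap_star[of "star a" "star b"] star_in by simp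

lemma eqI: "a \<in> S \<Longrightarrow> b \<in> S \<Longrightarrow> cap a = cap b \<Longrightarrow> cup a = cup b \<Longrightarrow> a = b"
  using matching_eqI[of n "mat a" "mat b"] matching_mat diagram_mat by metis

text \<open>A normal form has a tail of \<open>n - rank a\<close> points, and tails have even
  length.\<close>

lemma rank_parity:
  assumes "a \<in> S"
  shows "rank a \<le> n" "even (n - rank a)" "z \<le> rank a"
proof -
  obtain us where "tail n (rank a) (mat (word us \<cdot> a))" using normalize_left[OF assms] by blast
  then show *: "rank a \<le> n" "even (n - rank a)" unfolding tail_def by blast+
  show "z \<le> rank a"
  proof (rule ccontr)
    assume "\<not> z \<le> rank a"
    then have "z = 1" "rank a = 0" using z01 by auto
    then show False using * bar_parity n3 by auto
  qed
qed

text \<open>Words on the left normalise the caps; the same for the mirror image normalises the cups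
  by words on the right. What is left has the caps and cups of the idempotent and so is equal to it.
  Both processes are reversible, which gives the second equation.\<close>

lemma factor:
  assumes a: "a \<in> S"
  shows "\<exists>us vs us' vs'. set us \<subseteq> {1..<n} \<and> set vs \<subseteq> {1..<n} \<and> set us' \<subseteq> {1..<n} \<and> set vs' \<subseteq> {1..<n} \<and>
    word us \<cdot> a \<in> S \<and> word us \<cdot> a \<cdot> word us' = id_bar n (rank a) \<and>
    a = word vs \<cdot> (id_bar n (rank a) \<cdot> word vs')"
proof -
  let ?r = "rank a"
  note r = rank_parity(1,2)[OF a]
  obtain us vs where uv: "set us \<subseteq> {1..<n}" "set vs \<subseteq> {1..<n}" "word vs \<cdot> (word us \<cdot> a) = a"
    "tail n ?r (mat (word us \<cdot> a))" "word us \<cdot> a \<in> S" "rank (word us \<cdot> a) = ?r"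
    using normalize_left[OF a] by blast
  define g where "g = word us \<cdot> a"
  have g: "g \<in> S" "rank g = ?r" "tail n ?r (mat g)" using uv by (simp_all add: g_def)
  have bar: "id_bar n ?r \<in> S" "mat (id_bar n ?r) = bar n ?r"
    using id_bar_in[OF r] id_bar_eq[OF r] matching_bar[OF r] by simp_all
  have capg: "cap g = cap (id_bar n ?r)"
    unfolding bar by (rule caps_full_tail[OF matching_mat[OF g(1)] matching_bar[OF r] g(3) tail_bar[OF r]])
      (use g rank_eq rk_bar[OF r] in auto)
  obtain us' vs' where uv': "set us' \<subseteq> {1..<n}" "set vs' \<subseteq> {1..<n}" "word vs' \<cdot> (word us' \<cdot> star g) = star g"
    "tail n ?r (mat (word us' \<cdot> star g))" "word us' \<cdot> star g \<in> S" "rank (word us' \<cdot> star g) = ?r"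
    "cup (word us' \<cdot> star g) = cup (star g)"
    using normalize_left[OF star_in[OF g(1)]] rank_star[OF g(1)] g(2) by auto
  define h where "h = word us' \<cdot> star g"
  have h: "h \<in> S" "rank h = ?r" "tail n ?r (mat h)" using uv' by (simp_all add: h_def)
  have "h = id_bar n ?r"
  proof (rule eqI[OF h(1) bar(1)])
    show "cap h = cap (id_bar n ?r)"
      unfolding bar by (rule caps_full_tail[OF matching_mat[OF h(1)] matching_bar[OF r] h(3) tail_bar[OF r]])
        (use h rank_eq rk_bar[OF r] in auto)
    have "cup h = cup (star g)" using uv'(7) by (simp add: h_def)
    also have "\<dots> = cup (star (id_bar n ?r))" using capg cap_eq_iff_cup_star[OF g(1) bar(1)] by simp
    finally show "cup h = cup (id_bar n ?r)" using star_id_bar[OF r] by simp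
  qed
  then have 1: "word us' \<cdot> star g = id_bar n ?r" by (simp add: h_def)
  have "star (word us' \<cdot> star g) = g \<cdot> word (rev us')"
    using star_mult[OF word_in[OF uv'(1)] star_in[OF g(1)]] star_word[OF uv'(1)] by simp
  then have 2: "g \<cdot> word (rev us') = id_bar n ?r" using 1 star_id_bar[OF r] by simp
  have "star g = word vs' \<cdot> id_bar n ?r" using uv'(3) 1 by simp
  then have "g = star (word vs' \<cdot> id_bar n ?r)" by (metis star_star)
  then have 3: "g = id_bar n ?r \<cdot> word (rev vs')"
    using star_mult[OF word_in[OF uv'(2)] bar(1)] star_id_bar[OF r] star_word[OF uv'(2)] by simp
  have 4: "a = word vs \<cdot> (id_bar n ?r \<cdot> word (rev vs'))" using uv(3) unfolding g_def[symmetric] 3[symmetric] by simp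
  show ?thesis
    by (intro exI[of _ us] exI[of _ vs] exI[of _ "rev us'"] exI[of _ "rev vs'"] conjI)
      (use uv uv' 2[unfolded g_def] 4 in simp_all)
qed

lemma S_word:
  assumes a: "a \<in> S"
  shows "\<exists>ws. set ws \<subseteq> {1..<n} \<and> a = word ws"
proof -
  note r = rank_parity(1,2)[OF a]
  obtain vs vs' where v: "set vs \<subseteq> {1..<n}" "set vs' \<subseteq> {1..<n}"
    "a = word vs \<cdot> (id_bar n (rank a) \<cdot> word vs')" using factor[OF a] by blast
  obtain ws where ws: "set ws \<subseteq> {rank a + 1..<n}" "id_bar n (rank a) = word ws" using id_bar_word[OF r] by blast
  then have "set ws \<subseteq> {1..<n}" by auto
  then have "a = word (vs @ ws @ vs')" using v ws word_append[of ws vs'] word_append[of vs "ws @ vs'"] by simp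
  then show ?thesis using v \<open>set ws \<subseteq> {1..<n}\<close> by (intro exI[of _ "vs @ ws @ vs'"]) simp
qed

text \<open>Closure under products comes from concatenating words, since hooks keep an involution
  noncrossing.\<close>

lemma mult_in [simp]: "a \<in> S \<Longrightarrow> b \<in> S \<Longrightarrow> a \<cdot> b \<in> S"
proof -
  assume "a \<in> S" "b \<in> S"
  then obtain us vs where "set us \<subseteq> {1..<n}" "a = word us" "set vs \<subseteq> {1..<n}" "b = word vs" using S_word by meson
  then show "a \<cdot> b \<in> S" using word_append[of us vs] word_in[of "us @ vs"] by simp
qed

lemma S_induct [consumes 1, case_names one mult]:
  assumes a: "a \<in> S" and one: "P one" and step: "\<And>i a. 1 \<le> i \<Longrightarrow> i < n \<Longrightarrow> a \<in> S \<Longrightarrow> P a \<Longrightarrow> P (E i \<cdot> a)"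
  shows "P a"
proof -
  have "P (word ws)" if "set ws \<subseteq> {1..<n}" for ws
    using that
  proof (induction ws)
    case Nil
    then show ?case using one by (simp add: word_def)
  next
    case (Cons i ws)
    then show ?case using word_Cons[of i ws] step[of i "word ws"] word_in[of ws] by simp
  qed
  then show ?thesis using S_word[OF a] by blast
qed

lemma mult_one: "a \<in> S \<Longrightarrow> a \<cdot> one = a"
  using star_mult[of one "star a"] one_mult[of "star a"] star_in[of a] star_id_bar[of n] id_bar_full by simp

lemma assoc: "a \<in> S \<Longrightarrow> b \<in> S \<Longrightarrow> c \<in> S \<Longrightarrow> a \<cdot> b \<cdot> c = a \<cdot> (b \<cdot> c)"
  by (rule assoc_partition)

lemma mat_E_mult: "a \<in> S \<Longrightarrow> 1 \<le> i \<Longrightarrow> i < n \<Longrightarrow> mat (E i \<cdot> a) = hook i (mat a)"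
  by (elim S_cases) (simp add: E_mult matching_hook)

lemma rank_E_mult_le: "a \<in> S \<Longrightarrow> 1 \<le> i \<Longrightarrow> i < n \<Longrightarrow> rank (E i \<cdot> a) \<le> rank a"
  using rk_hook_le[OF matching_mat] by (simp add: rank_eq mat_E_mult E_in)

lemma rank_mult_right: "a \<in> S \<Longrightarrow> b \<in> S \<Longrightarrow> rank (a \<cdot> b) \<le> rank b"
proof (induction a rule: S_induct)
  case one
  then show ?case by (simp add: one_mult)
next
  case (mult i a)
  then show ?case using rank_E_mult_le[of "a \<cdot> b" i] by (simp add: assoc E_in)
qed

lemma rank_mult_left: "a \<in> S \<Longrightarrow> b \<in> S \<Longrightarrow> rank (a \<cdot> b) \<le> rank a"
  using rank_mult_right[of "star b" "star a"] star_in star_mult[of a b] rank_star[of "a \<cdot> b"] rank_star[of a] by simp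

text \<open>Along the generators of \<open>a\<close> the rank can only fall. If it is unchanged at
  the end it never fell, and a hook that keeps the rank keeps the cups.\<close>

lemma cup_mult:
  assumes "a \<in> S" "b \<in> S" "rank (a \<cdot> b) = rank b"
  shows "cup (a \<cdot> b) = cup b"
  using assms
proof (induction a rule: S_induct)
  case one
  then show ?case by (simp add: one_mult)
next
  case (mult i a)
  have eq: "E i \<cdot> a \<cdot> b = E i \<cdot> (a \<cdot> b)" using mult by (simp add: assoc E_in)
  have "rank (E i \<cdot> (a \<cdot> b)) \<le> rank (a \<cdot> b)" "rank (a \<cdot> b) \<le> rank b"
    using mult rank_E_mult_le rank_mult_right by simp_all
  then have r: "rank (a \<cdot> b) = rank b" "rank (E i \<cdot> (a \<cdot> b)) = rank (a \<cdot> b)" using mult eq by simp_all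
  have "cups n (hook i (mat (a \<cdot> b))) = cups n (mat (a \<cdot> b))"
    by (rule cups_hook) (use mult r in \<open>simp_all add: matching_mat rank_eq mat_E_mult E_in\<close>)
  then show ?case using mult r eq by (simp add: mat_E_mult)
qed

lemma cap_mult:
  assumes "a \<in> S" "b \<in> S" "rank (a \<cdot> b) = rank a"
  shows "cap (a \<cdot> b) = cap a"
proof -
  have "cup (star b \<cdot> star a) = cup (star a)"
    using assms star_in by (intro cup_mult) (auto simp: star_mult[symmetric] rank_star)
  then show ?thesis using assms by (simp add: cap_eq_iff_cup_star star_mult)
qed

lemma cup_mono:
  assumes "a \<in> S" "b \<in> S" "x \<in> {n + 1..2 * n}" "n < mat b x"
  shows "mat (a \<cdot> b) x = mat b x"
  using assms
proof (induction a rule: S_induct)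
  case one
  then show ?case by (simp add: one_mult)
next
  case (mult i a)
  have "E i \<cdot> a \<cdot> b = E i \<cdot> (a \<cdot> b)" using mult by (simp add: assoc E_in)
  then show ?case
    using mult hook_lower[OF matching_mat[of "a \<cdot> b"], of i x] by (simp add: mat_E_mult)
qed

lemma tail_id_bar_mult:
  assumes a: "a \<in> S" and q: "q \<le> n" "even (n - q)"
  shows "tail n q (mat (id_bar n q \<cdot> a))"
  using q
proof (induction "n - q" arbitrary: q rule: less_induct)
  case less
  show ?case
  proof (cases "q = n")
    case True
    then show ?thesis by (simp add: tail_def)
  next
    case False
    then have q: "q + 2 \<le> n" "even (n - (q + 2))" using less.prems by presburger+
    have b: "id_bar n (q + 2) \<in> S" using id_bar_in[OF q] .
    then have ba: "id_bar n (q + 2) \<cdot> a \<in> S" using a by simp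
    have t: "tail n (q + 2) (mat (id_bar n (q + 2) \<cdot> a))" using less.hyps[of "q + 2"] q by simp
    have e: "id_bar n q = E (q + 1) \<cdot> id_bar n (q + 2)" using id_bar_step[of "q + 2"] q by simp
    have "id_bar n q \<cdot> a = E (q + 1) \<cdot> (id_bar n (q + 2) \<cdot> a)"
      unfolding e by (rule assoc) (use a b q in \<open>auto intro: E_in\<close>)
    then have "mat (id_bar n q \<cdot> a) = hook (q + 1) (mat (id_bar n (q + 2) \<cdot> a))"
      using mat_E_mult[OF ba, of "q + 1"] q by simp
    then show ?thesis using tail_hook[OF matching_mat[OF ba] t] by simp
  qed
qed

text \<open>The reversibility of moving a cap, applied to the generator itself.\<close>

lemma E_braid_up: "1 \<le> i \<Longrightarrow> i + 1 < n \<Longrightarrow> E i \<cdot> (E (i + 1) \<cdot> E i) = E i"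
  using E_mult[OF matching_E, of i "i + 1"] E_mult[OF matching_hook[OF matching_E], of i "i + 1" i]
    hook_hook_down[OF matching_pairing[OF matching_E], of i i] by simp

lemma E_braid_down: "1 \<le> i \<Longrightarrow> i + 1 < n \<Longrightarrow> E (i + 1) \<cdot> (E i \<cdot> E (i + 1)) = E (i + 1)"
  using E_mult[OF matching_E, of "i + 1" i] E_mult[OF matching_hook[OF matching_E], of "i + 1" i "i + 1"]
    hook_hook_up[OF matching_pairing[OF matching_E], of "i + 1" i] hook_at(1)[of "i + 1" "straight n"] by simp

lemma E_commute: "1 \<le> i \<Longrightarrow> i + 2 \<le> j \<Longrightarrow> j < n \<Longrightarrow> E i \<cdot> E j = E j \<cdot> E i"
  using E_mult[OF matching_E, of j i] E_mult[OF matching_E, of i j] hook_commute[of i "straight n" j]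
  by (simp add: straight_def) fastforce


subsection \<open>The minimal ideal\<close>

definition \<omega> :: "vertex set set" where
  "\<omega> = id_bar n z"

lemma omega_in [simp]: "\<omega> \<in> S"
  unfolding \<omega>_def using id_bar_in bar_parity by blast

lemma rank_id_bar: "q \<le> n \<Longrightarrow> even (n - q) \<Longrightarrow> rank (id_bar n q) = q"
  by (simp add: id_bar_eq pt_rank_diagram matching_bar rk_bar)

lemma rank_omega [simp]: "rank \<omega> = z"
  unfolding \<omega>_def using rank_id_bar bar_parity by blast

lemma star_omega [simp]: "star \<omega> = \<omega>"
  unfolding \<omega>_def using star_id_bar bar_parity by blast

text \<open>The idempotent is a product of hooks at the caps of its tail, and each of them fixes an
  element that has these caps.\<close>

lemma id_bar_absorb:
  assumes a: "a \<in> S" and t: "tail n q (mat a)"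
  shows "id_bar n q \<cdot> a = a"
  using t
proof (induction "n - q" arbitrary: q rule: less_induct)
  case less
  have qn: "q \<le> n" "even (n - q)" using less.prems unfolding tail_def by blast+
  show ?case
  proof (cases "q = n")
    case True
    then show ?thesis using a id_bar_full one_mult by simp
  next
    case False
    then have q: "q + 2 \<le> n" "even (n - (q + 2))" using qn by presburger+
    then have "tail n (q + 2) (mat a)" using less.prems unfolding tail_def by auto
    then have IH: "id_bar n (q + 2) \<cdot> a = a" using less.hyps[of "q + 2"] q by simp
    have "odd (n - (q + 1))" using qn q(1) by presburger
    then have "mat a (q + 1) = q + 1 + 1" using less.prems q(1) unfolding tail_def by (simp add: mate_def)
    then have "hook (q + 1) (mat a) = mat a" by (rule hook_same[OF matching_pairing[OF matching_mat[OF a]]])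
    then have E: "E (q + 1) \<cdot> a = a" using E_mult[OF matching_mat[OF a], of "q + 1"] diagram_mat[OF a] q(1) by simp
    have "id_bar n q = E (q + 1) \<cdot> id_bar n (q + 2)" using id_bar_step[of "q + 2"] q by simp
    then show ?thesis using IH E a q id_bar_in[OF q] E_in[of "q + 1"] by (simp add: assoc)
  qed
qed

lemma id_bar_mult:
  assumes "p \<le> q" "q \<le> n" "even (n - p)" "even (n - q)"
  shows "id_bar n q \<cdot> id_bar n p = id_bar n p"
proof (rule id_bar_absorb)
  show "id_bar n p \<in> S" using assms id_bar_in by simp
  have "mat (id_bar n p) = bar n p" using assms id_bar_eq matching_bar by simp
  then show "tail n q (mat (id_bar n p))" using tail_bar[of p n] assms unfolding tail_def by auto
qed

lemma omega_omega [simp]: "\<omega> \<cdot> \<omega> = \<omega>"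
  unfolding \<omega>_def using id_bar_mult bar_parity by blast

lemma omega_omega_left [simp]: "a \<in> S \<Longrightarrow> \<omega> \<cdot> (\<omega> \<cdot> a) = \<omega> \<cdot> a"
  using assoc[OF omega_in omega_in, of a] by simp

lemma id_bar_E_commute:
  assumes "1 \<le> i" "i < q" "q \<le> n" "even (n - q)"
  shows "id_bar n q \<cdot> E i = E i \<cdot> id_bar n q"
proof -
  obtain ws where ws: "set ws \<subseteq> {q + 1..<n}" "id_bar n q = word ws" using id_bar_word[OF assms(3,4)] by blast
  have Ei: "E i \<in> S" using E_in assms by simp
  have "word ws \<cdot> E i = E i \<cdot> word ws" using ws(1)
  proof (induction ws)
    case Nil
    then show ?case using one_mult[OF Ei] mult_one[OF Ei] by (simp add: word_def)
  next
    case (Cons j ws)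
    have j: "i + 2 \<le> j" "j < n" using Cons.prems assms by auto
    have ws: "set ws \<subseteq> {1..<n}" using Cons.prems by auto
    have Ej: "E j \<in> S" using E_in j by simp
    have "word (j # ws) \<cdot> E i = E j \<cdot> (word ws \<cdot> E i)"
      using word_Cons[OF _ ws, of j] j assoc[OF Ej word_in[OF ws] Ei] by simp
    also have "\<dots> = E j \<cdot> (E i \<cdot> word ws)" using Cons by simp
    also have "\<dots> = E i \<cdot> (E j \<cdot> word ws)"
      using assoc[OF Ej Ei word_in[OF ws]] assoc[OF Ei Ej word_in[OF ws]] E_commute[OF assms(1) j] by simp
    finally show ?case using word_Cons[OF _ ws, of j] j by simp
  qed
  then show ?thesis using ws by simp
qed

lemma rank_min: "a \<in> S \<Longrightarrow> rank a \<le> z \<Longrightarrow> rank a = z"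
  using rank_parity(3) by (simp add: le_antisym)

text \<open>The rank cannot fall below \<open>z\<close>, so the product keeps the caps of its first
  factor and the cups of its last one. In particular the minimal ideal is a rectangular
  band.\<close>

lemma sandwich:
  assumes "a \<in> S" "rank a = z" "s \<in> S"
  shows "a \<cdot> (s \<cdot> a) = a"
proof -
  have r: "rank (a \<cdot> (s \<cdot> a)) = z" using assms rank_mult_left[of a "s \<cdot> a"] by (intro rank_min) auto
  show ?thesis
  proof (rule eqI)
    show "cap (a \<cdot> (s \<cdot> a)) = cap a" using r assms by (intro cap_mult) auto
    have "cup (a \<cdot> s \<cdot> a) = cup a" using r assms by (intro cup_mult) (auto simp: assoc)
    then show "cup (a \<cdot> (s \<cdot> a)) = cup a" using assms by (simp add: assoc)
  qed (use assms in auto)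
qed

lemma omega_sandwich [simp]: "s \<in> S \<Longrightarrow> \<omega> \<cdot> (s \<cdot> \<omega>) = \<omega>"
  by (rule sandwich) auto

lemma rank_omega_mult: "a \<in> S \<Longrightarrow> rank (\<omega> \<cdot> a) = z" "a \<in> S \<Longrightarrow> rank (a \<cdot> \<omega>) = z"
  using rank_mult_left[of \<omega> a] rank_mult_right[of a \<omega>] by (auto intro: rank_min)

text \<open>
  Elements of rank at most \<open>2 - z\<close> act on the minimal ideal by constant maps; this is what makes
  the ideals of small rank retractable.
\<close>

lemma omega_collapse:
  assumes x: "x \<in> S" "rank x \<le> 2 - z" and c: "c \<in> S"
  shows "\<omega> \<cdot> (c \<cdot> x) = \<omega> \<cdot> x"
proof -
  have r: "rank (\<omega> \<cdot> (c \<cdot> x)) = z" "rank (\<omega> \<cdot> x) = z" using x c rank_omega_mult by simp_all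
  show ?thesis
  proof (rule eqI)
    show "cap (\<omega> \<cdot> (c \<cdot> x)) = cap (\<omega> \<cdot> x)"
      using cap_mult[of \<omega> "c \<cdot> x"] cap_mult[of \<omega> x] r x c by simp
    show "cup (\<omega> \<cdot> (c \<cdot> x)) = cup (\<omega> \<cdot> x)"
    proof (cases "z = 1")
      case True
      \<comment> \<open>For odd \<open>n\<close> the bound \<open>2 - z\<close> is 1, so
        \<open>x\<close> itself lies in the minimal ideal.\<close>
      then have rx: "rank x = z" using x rank_min[of x] by simp
      have "cup (\<omega> \<cdot> c \<cdot> x) = cup x" using rx r x c by (intro cup_mult) (simp_all add: assoc)
      moreover have "cup (\<omega> \<cdot> x) = cup x" using rx r x by (intro cup_mult) simp_all
      ultimately show ?thesis using x c by (simp add: assoc)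
    next
      case False
      then have z0: "z = 0" using z01 by simp
      have m: "matching n (mat (\<omega> \<cdot> (c \<cdot> x)))" "matching n (mat (\<omega> \<cdot> x))" "matching n (mat x)"
        using matching_mat x c by simp_all
      show ?thesis
      \<comment> \<open>For even \<open>n\<close> the cups of \<open>x\<close> persist in both
        products, and at most two lower points remain to be joined.\<close>
      proof (rule cups_forced[OF m])
        have "rk n (mat (\<omega> \<cdot> (c \<cdot> x))) = z" "rk n (mat (\<omega> \<cdot> x)) = z" "rk n (mat x) \<le> 2 - z"
          using r x c rank_eq[of x] rank_eq[of "\<omega> \<cdot> x"] rank_eq[of "\<omega> \<cdot> (c \<cdot> x)"] by simp_all
        from trans[OF this(1) z0] trans[OF this(2) z0] le_trans[OF this(3) diff_le_self]
        show "rk n (mat (\<omega> \<cdot> (c \<cdot> x))) = 0" "rk n (mat (\<omega> \<cdot> x)) = 0" "rk n (mat x) \<le> 2" .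
        fix y assume y: "y \<in> {n + 1..2 * n}" "n < mat x y"
        show "mat (\<omega> \<cdot> x) y = mat x y" using cup_mono[OF omega_in x(1) y] .
        show "mat (\<omega> \<cdot> (c \<cdot> x)) y = mat x y"
          using cup_mono[OF mult_in[OF omega_in c] x(1) y] x c by (simp add: assoc)
      qed
    qed
  qed (use x c in auto)
qed

lemma omega_collapse':
  assumes x: "x \<in> S" "rank x \<le> 2 - z" and c: "c \<in> S"
  shows "x \<cdot> (c \<cdot> \<omega>) = x \<cdot> \<omega>"
proof -
  have "\<omega> \<cdot> (star c \<cdot> star x) = \<omega> \<cdot> star x"
    using x c by (intro omega_collapse) (auto simp: star_in rank_star)
  then have "star (\<omega> \<cdot> (star c \<cdot> star x)) = star (\<omega> \<cdot> star x)" by simp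
  then show ?thesis using x c by (simp add: star_mult star_in assoc)
qed

lemma z_le: "z \<le> 2 - z"
  using z01 by auto

lemma omega_mult_cancel:
  assumes "x \<in> S" "rank x = z"
  shows "x \<cdot> (\<omega> \<cdot> x) = x"
  using sandwich assms by simp

text \<open>\<open>x \<cdot> \<omega>\<close> and \<open>\<omega> \<cdot> x\<close> are the left and
  the right coordinate of \<open>x\<close> in the rectangular band.\<close>

lemma rank_z_eqI:
  assumes x: "x \<in> S" "rank x = z" and y: "y \<in> S" "rank y = z" and eq: "x \<cdot> \<omega> = y \<cdot> \<omega>" "\<omega> \<cdot> x = \<omega> \<cdot> y"
  shows "x = y"
proof -
  have "x = (x \<cdot> \<omega>) \<cdot> (\<omega> \<cdot> x)" using omega_mult_cancel[OF x] x by (simp add: assoc)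
  also have "\<dots> = (y \<cdot> \<omega>) \<cdot> (\<omega> \<cdot> y)" using eq by simp
  also have "\<dots> = y" using omega_mult_cancel[OF y] y by (simp add: assoc)
  finally show ?thesis .
qed

lemma cup_E_omega:
  assumes "1 \<le> i" "i < n"
  shows "cup (E i \<cdot> \<omega>) = cup \<omega>"
  using cup_mult[of "E i" \<omega>] E_in[OF assms] rank_omega_mult(2)[of "E i"] by simp

text \<open>The simple caps of \<open>\<omega>\<close> are the pairs \<open>{i, i + 1}\<close> with
  \<open>n - i\<close> odd; the hooks there change nothing, while the next lemma shows that all the
  others move \<open>\<omega>\<close>.\<close>

lemma E_omega_fix:
  assumes "1 \<le> i" "i < n" "odd (n - i)"
  shows "E i \<cdot> \<omega> = \<omega>"
proof -
  have "z < i" using assms bar_parity z01 by (cases "z = i") auto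
  then have "bar n z i = i + 1" using assms by (simp add: bar_def mate_def)
  then have "hook i (bar n z) = bar n z" using hook_same matching_pairing matching_bar bar_parity by metis
  then show ?thesis using E_mult[of "bar n z" i] matching_bar[of z n] bar_parity assms id_bar_eq[of z] unfolding \<omega>_def by simp
qed

lemma E_omega_neq:
  assumes "1 \<le> i" "i < n" "even (n - i)"
  shows "E i \<cdot> \<omega> \<noteq> \<omega>"
proof
  assume eq: "E i \<cdot> \<omega> = \<omega>"
  have "mat \<omega> = bar n z" unfolding \<omega>_def using id_bar_eq matching_bar bar_parity by simp
  moreover have "mat (E i \<cdot> \<omega>) i = i + 1" using mat_E_mult[of \<omega> i] assms by simp
  ultimately have b: "bar n z i = i + 1" using eq by simp
  show False
  proof (cases "z < i")
    case True
    then have "bar n z i = i - 1" using assms by (simp add: bar_def mate_def)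
    then show False using b by simp
  next
    case False
    then have "i = 1" using assms z01 by auto
    then show False using b False assms n3 by (simp add: bar_def straight_def)
  qed
qed

definition \<kappa> :: "vertex set set" where
  "\<kappa> = E (2 - z) \<cdot> \<omega>"

lemma two_minus_z: "1 \<le> 2 - z" "2 - z < n" "even (n - (2 - z))"
  using z01 n3 bar_parity by auto

lemma kappa_in [simp]: "\<kappa> \<in> S"
  unfolding \<kappa>_def using E_in two_minus_z by simp

lemma rank_kappa [simp]: "rank \<kappa> = z"
  unfolding \<kappa>_def using rank_omega_mult E_in two_minus_z by simp

lemma kappa_neq: "\<kappa> \<noteq> \<omega>"
  unfolding \<kappa>_def by (rule E_omega_neq[OF two_minus_z])

lemma kappa_omega [simp]: "\<kappa> \<cdot> \<omega> = \<kappa>" "\<omega> \<cdot> \<kappa> = \<omega>"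
  unfolding \<kappa>_def using E_in two_minus_z by (simp_all add: assoc)

lemma star_kappa_omega [simp]: "\<omega> \<cdot> star \<kappa> = star \<kappa>" "star \<kappa> \<cdot> \<omega> = \<omega>"
  using star_mult[of \<kappa> \<omega>] star_mult[of \<omega> \<kappa>] by simp_all

lemma star_kappa_neq: "star \<kappa> \<noteq> \<omega>"
  using kappa_neq by (metis star_omega star_star)

subsection \<open>Ideals and Green's relations\<close>

lemma ranks_set: "set (ranks_from z n) = {q. z \<le> q \<and> q \<le> n \<and> even (n - q)}"
  using bar_parity by (auto simp: ranks_from_def)

lemma rank_in_ranks: "a \<in> S \<Longrightarrow> rank a \<in> set (ranks_from z n)"
  unfolding ranks_set using rank_parity by simp

lemma mem_rank_ideal: "a \<in> rank_ideal n q \<longleftrightarrow> a \<in> S \<and> rank a \<le> q"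
  by (simp add: rank_ideal_def)

lemma ideal_rank_ideal:
  assumes "z \<le> q"
  shows "semigroup_ideal (jones n) (rank_ideal n q)"
  unfolding semigroup_ideal_def
proof (intro conjI ballI)
  have "\<omega> \<in> rank_ideal n q" using assms by (simp add: mem_rank_ideal)
  then show "rank_ideal n q \<noteq> {}" by blast
  show "rank_ideal n q \<subseteq> S" by (auto simp: mem_rank_ideal)
  fix s x assume "s \<in> S" "x \<in> rank_ideal n q"
  then show "s \<otimes>\<^bsub>jones n\<^esub> x \<in> rank_ideal n q" "x \<otimes>\<^bsub>jones n\<^esub> s \<in> rank_ideal n q"
    using rank_mult_left[of x s] rank_mult_right[of s x] by (auto simp: mem_rank_ideal)
qed

text \<open>\<open>a\<close> can be compressed to the idempotent of its rank, which acts as the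
  identity on the idempotent of any smaller rank, and \<open>b\<close> factors through the latter.
  So principal ideals are ordered by rank.\<close>

lemma factor_through:
  assumes a: "a \<in> S" and b: "b \<in> S" "rank b \<le> rank a"
  shows "\<exists>s\<in>S. \<exists>t\<in>S. b = s \<cdot> a \<cdot> t"
proof -
  obtain us us' where u: "set us \<subseteq> {1..<n}" "set us' \<subseteq> {1..<n}" "word us \<cdot> a \<cdot> word us' = id_bar n (rank a)"
    using factor[OF a] by blast
  obtain vs vs' where v: "set vs \<subseteq> {1..<n}" "set vs' \<subseteq> {1..<n}" "b = word vs \<cdot> (id_bar n (rank b) \<cdot> word vs')"
    using factor[OF b(1)] by blast
  have w: "word us \<in> S" "word us' \<in> S" "word vs \<in> S" "word vs' \<in> S"
    using word_in[OF u(1)] word_in[OF u(2)] word_in[OF v(1)] word_in[OF v(2)] by simp_all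
  define e where "e = id_bar n (rank b)"
  have e: "e \<in> S" unfolding e_def using id_bar_in rank_parity[OF b(1)] by blast
  have be: "b = word vs \<cdot> (e \<cdot> word vs')" unfolding e_def by (rule v(3))
  have "e = word us \<cdot> a \<cdot> word us' \<cdot> e"
    unfolding u(3) e_def
    by (rule id_bar_mult[OF b(2) rank_parity(1)[OF a] rank_parity(2)[OF b(1)] rank_parity(2)[OF a], symmetric])
  then have "word vs \<cdot> (e \<cdot> word vs') = word vs \<cdot> ((word us \<cdot> a \<cdot> word us' \<cdot> e) \<cdot> word vs')"
    by (rule arg_cong[where f = "\<lambda>w. word vs \<cdot> (w \<cdot> word vs')"])
  then have "b = (word vs \<cdot> word us) \<cdot> a \<cdot> (word us' \<cdot> e \<cdot> word vs')"
    unfolding be using w e a by (simp add: assoc)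
  moreover have "word vs \<cdot> word us \<in> S" "word us' \<cdot> e \<cdot> word vs' \<in> S" using w e by simp_all
  ultimately show ?thesis by blast
qed

text \<open>An element of the largest rank occurring in an ideal already generates everything of
  that rank or less.\<close>

lemma ideals: "{I. semigroup_ideal (jones n) I} = rank_ideal n ` set (ranks_from z n)"
proof
  show "rank_ideal n ` set (ranks_from z n) \<subseteq> {I. semigroup_ideal (jones n) I}"
    using ideal_rank_ideal by (auto simp: ranks_set)
  show "{I. semigroup_ideal (jones n) I} \<subseteq> rank_ideal n ` set (ranks_from z n)"
  proof
    fix I assume "I \<in> {I. semigroup_ideal (jones n) I}"
    then have I: "I \<noteq> {}" "I \<subseteq> S" "\<And>s x. s \<in> S \<Longrightarrow> x \<in> I \<Longrightarrow> s \<cdot> x \<in> I \<and> x \<cdot> s \<in> I"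
      by (auto simp: semigroup_ideal_def)
    have fin: "finite (rank ` I)"
      by (rule finite_subset[of _ "{..n}"]) (use I(2) rank_parity(1) in auto)
    define q where "q = Max (rank ` I)"
    obtain a where a: "a \<in> I" "rank a = q" using Max_in[OF fin] I(1) q_def by fastforce
    have "I = rank_ideal n q"
    proof
      show "I \<subseteq> rank_ideal n q" using I(2) fin by (auto simp: mem_rank_ideal q_def)
      show "rank_ideal n q \<subseteq> I"
      proof
        fix b assume "b \<in> rank_ideal n q"
        then obtain s t where "s \<in> S" "t \<in> S" "b = s \<cdot> a \<cdot> t"
          using factor_through[of a b] a I(2) by (auto simp: mem_rank_ideal)
        then show "b \<in> I" using I(3) a by simp
      qed
    qed
    then show "I \<in> rank_ideal n ` set (ranks_from z n)" using rank_in_ranks a I(2) by blast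
  qed
qed

lemma minimal_ideal_eq: "minimal_ideal (jones n) = rank_ideal n z"
  unfolding minimal_ideal_def
proof (rule the_equality)
  have sub: "rank_ideal n z \<subseteq> I" if "semigroup_ideal (jones n) I" for I
    using that ideals by (force simp: ranks_set mem_rank_ideal)
  show "semigroup_ideal (jones n) (rank_ideal n z) \<and>
      (\<forall>I. semigroup_ideal (jones n) I \<longrightarrow> I \<subseteq> rank_ideal n z \<longrightarrow> I = rank_ideal n z)"
    using ideal_rank_ideal[of z] sub by blast
  show "M = rank_ideal n z"
    if "semigroup_ideal (jones n) M \<and> (\<forall>I. semigroup_ideal (jones n) I \<longrightarrow> I \<subseteq> M \<longrightarrow> I = M)" for M
    using that sub ideal_rank_ideal[of z] by blast
qed

lemma mem_minimal_ideal: "a \<in> rank_ideal n z \<longleftrightarrow> a \<in> S \<and> rank a = z"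
  using rank_min by (auto simp: mem_rank_ideal)

lemma principal_eq:
  assumes "a \<in> S"
  shows "principal (jones n) a = rank_ideal n (rank a)"
proof
  show "principal (jones n) a \<subseteq> rank_ideal n (rank a)"
  proof
    fix b assume "b \<in> principal (jones n) a"
    then obtain s t where "s \<in> S" "t \<in> S" "b = s \<cdot> a \<cdot> t" by (auto simp: principal_def)
    then show "b \<in> rank_ideal n (rank a)"
      using assms rank_mult_left[of "s \<cdot> a" t] rank_mult_right[of s a] by (simp add: mem_rank_ideal)
  qed
  show "rank_ideal n (rank a) \<subseteq> principal (jones n) a"
    using factor_through[OF assms] unfolding principal_def mem_rank_ideal subset_iff by (simp, blast)
qed

lemma green_J_iff: "(a, b) \<in> green_J (jones n) \<longleftrightarrow> a \<in> S \<and> b \<in> S \<and> rank a = rank b"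
proof -
  have "rank_ideal n (rank a) = rank_ideal n (rank b) \<longleftrightarrow> rank a = rank b" if "a \<in> S" "b \<in> S"
    using that by (auto simp: mem_rank_ideal set_eq_iff intro: le_antisym)
  then show ?thesis unfolding green_J_def by (auto simp: principal_eq)
qed

lemma J_class_image: "a \<in> S \<Longrightarrow> green_J (jones n) `` {a} = {b \<in> S. rank b = rank a}"
  by (auto simp: green_J_iff)

lemma J_classes_eq: "J_classes (jones n) = (\<lambda>q. {b \<in> S. rank b = q}) ` set (ranks_from z n)"
proof
  show "J_classes (jones n) \<subseteq> (\<lambda>q. {b \<in> S. rank b = q}) ` set (ranks_from z n)"
  proof
    fix J assume "J \<in> J_classes (jones n)"
    then obtain a where "a \<in> S" "J = green_J (jones n) `` {a}" unfolding J_classes_def quotient_def by blast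
    then show "J \<in> (\<lambda>q. {b \<in> S. rank b = q}) ` set (ranks_from z n)"
      using J_class_image rank_in_ranks by auto
  qed
  show "(\<lambda>q. {b \<in> S. rank b = q}) ` set (ranks_from z n) \<subseteq> J_classes (jones n)"
  proof
    fix J assume "J \<in> (\<lambda>q. {b \<in> S. rank b = q}) ` set (ranks_from z n)"
    then obtain q where q: "q \<le> n" "even (n - q)" "J = {b \<in> S. rank b = q}" by (auto simp: ranks_set)
    then have "J = green_J (jones n) `` {id_bar n q}" using J_class_image[OF id_bar_in] rank_id_bar by simp
    then show "J \<in> J_classes (jones n)"
      unfolding J_classes_def using id_bar_in[OF q(1,2)] by (simp add: quotientI)
  qed
qed

text \<open>The inverse is the right compressing word followed by the left one. Compressing
  \<open>a \<cdot> x \<cdot> a\<close> gives the idempotent again, so no rank is lost, and then caps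
  and cups are those of \<open>a\<close>.\<close>

lemma regular:
  assumes a: "a \<in> S"
  shows "\<exists>x\<in>S. a \<cdot> x \<cdot> a = a"
proof -
  obtain us us' where u: "set us \<subseteq> {1..<n}" "set us' \<subseteq> {1..<n}" "word us \<cdot> a \<cdot> word us' = id_bar n (rank a)"
    using factor[OF a] by blast
  have w: "word us \<in> S" "word us' \<in> S" using word_in[OF u(1)] word_in[OF u(2)] by simp_all
  let ?e = "id_bar n (rank a)"
  let ?x = "word us' \<cdot> word us"
  have x: "?x \<in> S" using w by simp
  note r = rank_parity(1,2)[OF a]
  have "word us \<cdot> (a \<cdot> ?x \<cdot> a) \<cdot> word us' = (word us \<cdot> a \<cdot> word us') \<cdot> (word us \<cdot> a \<cdot> word us')"
    using w a by (simp add: assoc)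
  also have "\<dots> = ?e" unfolding u(3) by (rule id_bar_mult[OF order_refl r(1) r(2) r(2)])
  finally have "rank a \<le> rank (a \<cdot> ?x \<cdot> a)"
    using rank_mult_left[of "word us \<cdot> (a \<cdot> ?x \<cdot> a)" "word us'"] rank_mult_right[of "word us" "a \<cdot> ?x \<cdot> a"]
      rank_id_bar[OF r] w x a by simp
  then have rk: "rank (a \<cdot> ?x \<cdot> a) = rank a" using rank_mult_right[of "a \<cdot> ?x" a] x a by simp
  have "a \<cdot> ?x \<cdot> a = a"
  proof (rule eqI)
    have "cap (a \<cdot> (?x \<cdot> a)) = cap a" using rk x a by (intro cap_mult) (simp_all add: assoc)
    then show "cap (a \<cdot> ?x \<cdot> a) = cap a" using x a by (simp add: assoc)
    show "cup (a \<cdot> ?x \<cdot> a) = cup a" using rk x a by (intro cup_mult) simp_all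
  qed (use x a in simp_all)
  then show ?thesis using x by blast
qed

text \<open>A left factor in front of an element of minimal rank becomes invisible once
  \<open>\<omega>\<close> is multiplied from the left. Conversely
  \<open>x = x \<cdot> \<omega> \<cdot> y\<close> exhibits \<open>x\<close> as a left multiple of
  \<open>y\<close>.\<close>

lemma green_L_iff:
  assumes a: "a \<in> S" "rank a = z" and b: "b \<in> S" "rank b = z"
  shows "(a, b) \<in> green_L (jones n) \<longleftrightarrow> \<omega> \<cdot> a = \<omega> \<cdot> b"
proof
  assume "(a, b) \<in> green_L (jones n)"
  then have "left_principal (jones n) a = left_principal (jones n) b" by (simp add: green_L_def)
  moreover have "a \<in> left_principal (jones n) a"
    unfolding left_principal_def using one_mult[OF a(1)] one_in by (auto intro!: exI[of _ one])
  ultimately obtain s where "s \<in> S" "a = s \<cdot> b" by (auto simp: left_principal_def)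
  then show "\<omega> \<cdot> a = \<omega> \<cdot> b" using omega_collapse[of b s] b z_le by simp
next
  assume eq: "\<omega> \<cdot> a = \<omega> \<cdot> b"
  have sub: "left_principal (jones n) x \<subseteq> left_principal (jones n) y"
    if x: "x \<in> S" "rank x = z" and y: "y \<in> S" and "\<omega> \<cdot> x = \<omega> \<cdot> y" for x y
  proof
    fix w assume "w \<in> left_principal (jones n) x"
    then obtain s where s: "s \<in> S" "w = s \<cdot> x" by (auto simp: left_principal_def)
    have "x = x \<cdot> (\<omega> \<cdot> y)" using omega_mult_cancel[OF x] that(4) by simp
    then have "w = (s \<cdot> (x \<cdot> \<omega>)) \<cdot> y" using s x y by (simp add: assoc)
    moreover have "s \<cdot> (x \<cdot> \<omega>) \<in> S" using s x by simp
    ultimately show "w \<in> left_principal (jones n) y" by (auto simp: left_principal_def)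
  qed
  show "(a, b) \<in> green_L (jones n)"
    unfolding green_L_def using sub[OF a b(1) eq] sub[OF b a(1) eq[symmetric]] a b by auto
qed

lemma green_R_iff:
  assumes a: "a \<in> S" "rank a = z" and b: "b \<in> S" "rank b = z"
  shows "(a, b) \<in> green_R (jones n) \<longleftrightarrow> a \<cdot> \<omega> = b \<cdot> \<omega>"
proof
  assume "(a, b) \<in> green_R (jones n)"
  then have "right_principal (jones n) a = right_principal (jones n) b" by (simp add: green_R_def)
  moreover have "a \<in> right_principal (jones n) a"
    unfolding right_principal_def using mult_one[OF a(1)] one_in by (auto intro!: exI[of _ one])
  ultimately obtain s where "s \<in> S" "a = b \<cdot> s" by (auto simp: right_principal_def)
  then show "a \<cdot> \<omega> = b \<cdot> \<omega>" using omega_collapse'[of b s] b z_le by (simp add: assoc)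
next
  assume eq: "a \<cdot> \<omega> = b \<cdot> \<omega>"
  have sub: "right_principal (jones n) x \<subseteq> right_principal (jones n) y"
    if x: "x \<in> S" "rank x = z" and y: "y \<in> S" and "x \<cdot> \<omega> = y \<cdot> \<omega>" for x y
  proof
    fix w assume "w \<in> right_principal (jones n) x"
    then obtain s where s: "s \<in> S" "w = x \<cdot> s" by (auto simp: right_principal_def)
    have "x = x \<cdot> \<omega> \<cdot> x" using omega_mult_cancel[OF x] x by (simp add: assoc)
    also have "\<dots> = y \<cdot> \<omega> \<cdot> x" using that(4) by simp
    finally have "x \<cdot> s = y \<cdot> \<omega> \<cdot> x \<cdot> s" by (rule arg_cong)
    then have "w = y \<cdot> (\<omega> \<cdot> (x \<cdot> s))" using s x y by (simp add: assoc)
    moreover have "\<omega> \<cdot> (x \<cdot> s) \<in> S" using s x by simp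
    ultimately show "w \<in> right_principal (jones n) y" by (auto simp: right_principal_def)
  qed
  show "(a, b) \<in> green_R (jones n)"
    unfolding green_R_def using sub[OF a b(1) eq] sub[OF b a(1) eq[symmetric]] a b by auto
qed

subsection \<open>Retractions\<close>

text \<open>For \<open>b\<close> in the minimal ideal \<open>x \<cdot> b\<close> lies there too and
  is fixed by \<open>f\<close>. So \<open>f x\<close> multiplies the minimal ideal exactly as
  \<open>x\<close> does, which pins down every retraction.\<close>

lemma retraction_action:
  assumes f: "ideal_retraction (jones n) (rank_ideal n q) f" and q: "z \<le> q"
    and x: "x \<in> S" "rank x \<le> q" and b: "b \<in> S" "rank b = z"
  shows "f x \<in> S" "rank (f x) = z" "f x \<cdot> b = x \<cdot> b" "b \<cdot> f x = b \<cdot> x"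
proof -
  have hom: "\<And>x. x \<in> rank_ideal n q \<Longrightarrow> f x \<in> rank_ideal n z"
    "\<And>x y. x \<in> rank_ideal n q \<Longrightarrow> y \<in> rank_ideal n q \<Longrightarrow> f (x \<cdot> y) = f x \<cdot> f y"
    and fixed: "\<And>x. x \<in> rank_ideal n z \<Longrightarrow> f x = x"
    using f unfolding ideal_retraction_def hom_def minimal_ideal_eq by auto
  have xq: "x \<in> rank_ideal n q" and bq: "b \<in> rank_ideal n q" and bz: "b \<in> rank_ideal n z"
    using x b q by (simp_all add: mem_rank_ideal)
  show "f x \<in> S" "rank (f x) = z" using hom(1)[OF xq] by (simp_all add: mem_minimal_ideal)
  have "x \<cdot> b \<in> rank_ideal n z" "b \<cdot> x \<in> rank_ideal n z"
    using rank_mult_right[of x b] rank_mult_left[of b x] x b by (simp_all add: mem_rank_ideal)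
  then show "f x \<cdot> b = x \<cdot> b" "b \<cdot> f x = b \<cdot> x"
    using hom(2)[OF xq bq] hom(2)[OF bq xq] fixed bz by metis+
qed

text \<open>Both sides of the homomorphism law reduce to
  \<open>x \<cdot> \<omega> \<cdot> y\<close>: elements of small rank act by constants, and two
  copies of \<open>\<omega>\<close> swallow what stands between them.\<close>

lemma retraction_exists:
  assumes q: "z \<le> q" "q \<le> 2 - z"
  shows "ideal_retraction (jones n) (rank_ideal n q) (\<lambda>x. x \<cdot> (\<omega> \<cdot> x))"
  unfolding ideal_retraction_def hom_def minimal_ideal_eq
proof (intro conjI ballI CollectI funcsetI)
  fix x assume "x \<in> carrier (jones n\<lparr>carrier := rank_ideal n q\<rparr>)"
  then have x: "x \<in> S" "rank x \<le> 2 - z" using q by (auto simp: mem_rank_ideal)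
  show "x \<cdot> (\<omega> \<cdot> x) \<in> carrier (jones n\<lparr>carrier := rank_ideal n z\<rparr>)"
    using x rank_mult_right[of x "\<omega> \<cdot> x"] rank_omega_mult(1)[of x] by (simp add: mem_rank_ideal)
  fix y assume "y \<in> carrier (jones n\<lparr>carrier := rank_ideal n q\<rparr>)"
  then have y: "y \<in> S" "rank y \<le> 2 - z" using q by (auto simp: mem_rank_ideal)
  have "(x \<cdot> y) \<cdot> (\<omega> \<cdot> (x \<cdot> y)) = (x \<cdot> (y \<cdot> \<omega>)) \<cdot> y"
    using omega_collapse[OF y x(1)] x y by (simp add: assoc)
  also have "\<dots> = x \<cdot> (\<omega> \<cdot> y)" using omega_collapse'[OF x y(1)] x y by (simp add: assoc)
  finally have l: "(x \<cdot> y) \<cdot> (\<omega> \<cdot> (x \<cdot> y)) = x \<cdot> (\<omega> \<cdot> y)" .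
  have "(x \<cdot> (\<omega> \<cdot> x)) \<cdot> (y \<cdot> (\<omega> \<cdot> y)) = x \<cdot> ((\<omega> \<cdot> ((x \<cdot> y) \<cdot> \<omega>)) \<cdot> y)"
    using x y by (simp add: assoc)
  also have "\<dots> = x \<cdot> (\<omega> \<cdot> y)" using x y by (subst omega_sandwich) simp_all
  finally show "(x \<otimes>\<^bsub>jones n\<lparr>carrier := rank_ideal n q\<rparr>\<^esub> y) \<cdot> (\<omega> \<cdot> (x \<otimes>\<^bsub>jones n\<lparr>carrier := rank_ideal n q\<rparr>\<^esub> y)) =
      (x \<cdot> (\<omega> \<cdot> x)) \<otimes>\<^bsub>jones n\<lparr>carrier := rank_ideal n z\<rparr>\<^esub> (y \<cdot> (\<omega> \<cdot> y))" using l by simp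
next
  fix x assume "x \<in> rank_ideal n z"
  then show "x \<cdot> (\<omega> \<cdot> x) = x" using omega_mult_cancel by (simp add: mem_minimal_ideal)
qed

lemma the_retraction_eq:
  assumes q: "z \<le> q" "q \<le> 2 - z" and x: "x \<in> rank_ideal n q"
  shows "the_retraction (jones n) (rank_ideal n q) x \<in> S"
    "rank (the_retraction (jones n) (rank_ideal n q) x) = z"
    "the_retraction (jones n) (rank_ideal n q) x \<cdot> \<omega> = x \<cdot> \<omega>"
    "\<omega> \<cdot> the_retraction (jones n) (rank_ideal n q) x = \<omega> \<cdot> x"
proof -
  have "ideal_retraction (jones n) (rank_ideal n q) (the_retraction (jones n) (rank_ideal n q))"
    unfolding the_retraction_def by (rule someI[of _ "\<lambda>x. x \<cdot> (\<omega> \<cdot> x)"]) (rule retraction_exists[OF q])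
  from retraction_action[OF this q(1), of x \<omega>] x
  show "the_retraction (jones n) (rank_ideal n q) x \<in> S"
    "rank (the_retraction (jones n) (rank_ideal n q) x) = z"
    "the_retraction (jones n) (rank_ideal n q) x \<cdot> \<omega> = x \<cdot> \<omega>"
    "\<omega> \<cdot> the_retraction (jones n) (rank_ideal n q) x = \<omega> \<cdot> x"
    by (simp_all add: mem_rank_ideal)
qed

text \<open>The idempotent of rank \<open>q\<close> fixes \<open>\<omega>\<close> and
  \<open>E (q - 2) \<cdot> \<omega>\<close>, so its image under a retraction would fix both; but an
  element of the minimal ideal sends the two to the same element. The index \<open>q - 2\<close> is
  positive from rank 3 on, small enough for its hook to commute with the idempotent, and of the
  parity that moves \<open>\<omega>\<close>.\<close>

lemma not_retractable:
  assumes q: "3 \<le> q" "q \<le> n" "even (n - q)"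
  shows "\<not> retractable_ideal (jones n) (rank_ideal n q)"
proof
  assume "retractable_ideal (jones n) (rank_ideal n q)"
  then obtain f where f: "ideal_retraction (jones n) (rank_ideal n q) f" by (auto simp: retractable_ideal_def)
  have zq: "z \<le> q" using q z01 by auto
  have e: "id_bar n q \<in> S" "rank (id_bar n q) \<le> q" using id_bar_in rank_id_bar q by simp_all
  let ?F = "f (id_bar n q)" and ?b = "E (q - 2) \<cdot> \<omega>"
  have i: "1 \<le> q - 2" "q - 2 < n" "even (n - (q - 2))" using q by (simp, simp, presburger)
  have b: "?b \<in> S" "rank ?b = z" using E_in[OF i(1,2)] rank_omega_mult by simp_all
  note r1 = retraction_action[OF f zq e omega_in rank_omega]
  note r2 = retraction_action[OF f zq e b]
  have ew: "id_bar n q \<cdot> \<omega> = \<omega>" unfolding \<omega>_def using id_bar_mult zq q bar_parity by simp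
  have "id_bar n q \<cdot> ?b = (id_bar n q \<cdot> E (q - 2)) \<cdot> \<omega>" using e E_in[OF i(1,2)] by (simp add: assoc)
  also have "\<dots> = E (q - 2) \<cdot> (id_bar n q \<cdot> \<omega>)"
    using id_bar_E_commute[of "q - 2" q] i q e E_in[OF i(1,2)] by (simp add: assoc)
  finally have eb: "id_bar n q \<cdot> ?b = ?b" using ew by simp
  have "?F \<cdot> ?b = ?b" "?F \<cdot> \<omega> = \<omega>" using r1 r2 eb ew by simp_all
  moreover have "?F \<cdot> ?b = ?F \<cdot> \<omega>" using omega_collapse'[OF r1(1), of "E (q - 2)"] r1(2) z_le E_in[OF i(1,2)] by simp
  ultimately have "?b = \<omega>" by simp
  then show False using E_omega_neq[OF i] by simp
qed

subsection \<open>IN-pairs\<close>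

text \<open>An element of a group with this identity is fixed by it on both sides and divides it. So
  it has the same rank, and then the same caps and cups.\<close>

lemma subgroup_trivial:
  assumes q: "q \<le> n" "even (n - q)"
  shows "maximal_subgroup (jones n) {id_bar n q} (id_bar n q)"
proof -
  let ?e = "id_bar n q"
  have e: "?e \<in> S" "?e \<cdot> ?e = ?e" using id_bar_in id_bar_mult q by simp_all
  have grp: "group (jones n\<lparr>carrier := {?e}, one := ?e\<rparr>)"
    by (rule groupI) (use e in auto)
  show ?thesis
    unfolding maximal_subgroup_def group_within_def
  proof (intro conjI allI impI)
    show "{?e} \<subseteq> S" using e by simp
    show "group (jones n\<lparr>carrier := {?e}, one := ?e\<rparr>)" by (rule grp)
    fix G' e' assume G': "G' \<subseteq> S \<and> group (jones n\<lparr>carrier := G', one := e'\<rparr>)" and sub: "{?e} \<subseteq> G'"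
    interpret G: group "jones n\<lparr>carrier := G', one := e'\<rparr>" using G' by blast
    have "?e = e'" using G.r_cancel_one[of ?e ?e] sub e by simp
    then have unit: "?e \<cdot> a = a" "a \<cdot> ?e = a" if "a \<in> G'" for a
      using G.l_one[of a] G.r_one[of a] that by simp_all
    have "a = ?e" if a: "a \<in> G'" for a
    proof -
      obtain b where b: "b \<in> G'" "a \<cdot> b = ?e" using G.r_inv_ex[of a] a \<open>?e = e'\<close> by auto
      have ab: "a \<in> S" "b \<in> S" using a b G' by auto
      have "rank a = rank ?e"
        using rank_mult_left[OF ab] rank_mult_left[OF e(1) ab(1)] b(2) unit(1)[OF a] by simp
      then have "cap a = cap ?e" "cup a = cup ?e"
        using cap_mult[OF e(1) ab(1)] cup_mult[OF ab(1) e(1)] unfolding unit[OF a] by blast+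
      then show ?thesis by (rule eqI[OF ab(1) e(1)])
    qed
    then show "G' = {?e}" using sub by blast
  qed
qed

lemma retractable_IN_pair_iff:
  assumes q: "q \<in> set (ranks_from z n)"
  shows "retractable_IN_pair (jones n) I {id_bar n q} \<longleftrightarrow>
    (\<exists>p\<in>set (ranks_from z n). p \<le> 2 - z \<and> q = p + 2 \<and> I = rank_ideal n p)"
proof
  have q': "z \<le> q" "q \<le> n" "even (n - q)" using q unfolding ranks_set by blast+
  assume *: "retractable_IN_pair (jones n) I {id_bar n q}"
  then have ret: "retractable_ideal (jones n) I" and IN: "IN_pair (jones n) I {id_bar n q}"
    by (simp_all add: retractable_IN_pair_def)
  obtain J G e where JGe: "J \<in> J_classes (jones n) \<and> regular_subset (jones n) J \<and> J \<subseteq> S - I \<and>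
        (\<forall>K \<in> J_classes (jones n). K \<subseteq> S - I \<longrightarrow> J_class_le (jones n) K J \<longrightarrow> K = J) \<and>
        maximal_subgroup (jones n) G e \<and> G \<subseteq> J \<and> {id_bar n q} \<lhd> jones n\<lparr>carrier := G, one := e\<rparr>"
    using conjunct2[OF IN[unfolded IN_pair_def]] by (elim exE)
  have J: "J \<in> J_classes (jones n)" "J \<subseteq> S - I"
    "\<forall>K \<in> J_classes (jones n). K \<subseteq> S - I \<longrightarrow> J_class_le (jones n) K J \<longrightarrow> K = J"
    "G \<subseteq> J" "{id_bar n q} \<lhd> jones n\<lparr>carrier := G, one := e\<rparr>"
    using JGe by - (elim conjE, assumption)+
  have "semigroup_ideal (jones n) I" by (rule conjunct1[OF IN[unfolded IN_pair_def]])
  then obtain p where p: "p \<in> set (ranks_from z n)" "I = rank_ideal n p" using ideals by blast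
  have p': "z \<le> p" "p \<le> n" "even (n - p)" using p unfolding ranks_set by blast+
  have "{id_bar n q} \<subseteq> G" using normal_imp_subgroup[OF J(5)] subgroup.subset by fastforce
  then have eJ: "id_bar n q \<in> J" using J(4) by blast
  have "\<not> rank (id_bar n q) \<le> p" using eJ J(2) p(2) by (auto simp: mem_rank_ideal)
  then have "p < q" using rank_id_bar[OF q'(2,3)] by simp
  then have pq: "p + 2 \<le> q" "p + 2 \<le> n" "even (n - (p + 2))" using p'(3) q' by presburger+
  \<comment> \<open>The class of rank \<open>p + 2\<close> avoids \<open>I\<close> and lies below
    \<open>J\<close>, so minimality makes the two equal.\<close>
  let ?K = "{b \<in> S. rank b = p + 2}"
  have "?K = J"
  proof (rule J(3)[rule_format])
    show "?K \<in> J_classes (jones n)" unfolding J_classes_eq using pq p' by (auto simp: ranks_set)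
    show "?K \<subseteq> S - I" using p(2) by (auto simp: mem_rank_ideal)
    have "id_bar n (p + 2) \<in> ?K" using id_bar_in rank_id_bar pq by simp
    moreover have "id_bar n (p + 2) \<in> principal (jones n) (id_bar n q)"
      using principal_eq[OF id_bar_in[OF q'(2,3)]] rank_id_bar id_bar_in q' pq by (simp add: mem_rank_ideal)
    ultimately show "J_class_le (jones n) ?K J" unfolding J_class_le_def using eJ by blast
  qed
  then have "rank (id_bar n q) = p + 2" using eJ by blast
  then have "q = p + 2" using rank_id_bar[OF q'(2,3)] by simp
  moreover have "p \<le> 2 - z"
  proof (rule ccontr)
    assume np: "\<not> p \<le> 2 - z"
    have "3 \<le> p"
    proof (cases "z = 0")
      case False
      then have "z = 1" using z01 by simp
      moreover from this have "p \<noteq> 2" using p' bar_parity by auto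
      ultimately show ?thesis using np by simp
    qed (use np in simp)
    then show False using not_retractable[OF _ p'(2,3)] ret p(2) by blast
  qed
  ultimately show "\<exists>p\<in>set (ranks_from z n). p \<le> 2 - z \<and> q = p + 2 \<and> I = rank_ideal n p" using p by blast
next
  assume "\<exists>p\<in>set (ranks_from z n). p \<le> 2 - z \<and> q = p + 2 \<and> I = rank_ideal n p"
  then obtain p where p: "z \<le> p" "p \<le> 2 - z" "q = p + 2" "I = rank_ideal n p" "even (n - p)" by (auto simp: ranks_set)
  have q': "q \<le> n" "even (n - q)" using q unfolding ranks_set by blast+
  let ?J = "{b \<in> S. rank b = q}"
  have J: "?J \<in> J_classes (jones n)" unfolding J_classes_eq using q by blast
  have e: "id_bar n q \<in> ?J" using id_bar_in rank_id_bar q' by simp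
  have "IN_pair (jones n) I {id_bar n q}"
    unfolding IN_pair_def
  proof (rule conjI, use ideal_rank_ideal p in simp,
      rule exI[of _ ?J], rule exI[of _ "{id_bar n q}"], rule exI[of _ "id_bar n q"], intro conjI)
    show "?J \<in> J_classes (jones n)" by (rule J)
    show "regular_subset (jones n) ?J" unfolding regular_subset_def using regular by auto
    show "?J \<subseteq> S - I" using p by (auto simp: mem_rank_ideal)
    show "\<forall>K\<in>J_classes (jones n). K \<subseteq> S - I \<longrightarrow> J_class_le (jones n) K ?J \<longrightarrow> K = ?J"
    proof (intro ballI impI)
      fix K assume K: "K \<in> J_classes (jones n)" "K \<subseteq> S - I" "J_class_le (jones n) K ?J"
      obtain k where k: "K = {b \<in> S. rank b = k}" using K(1) unfolding J_classes_eq by blast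
      obtain a b where ab: "a \<in> K" "b \<in> ?J" "a \<in> principal (jones n) b" using K(3) unfolding J_class_le_def by blast
      have "k = rank a" "a \<in> S" using ab(1) k by auto
      moreover have "\<not> rank a \<le> p" using ab(1) K(2) p(4) by (auto simp: mem_rank_ideal)
      moreover have "rank a \<le> q" using ab(2,3) principal_eq[of b] by (simp add: mem_rank_ideal)
      moreover have "even (n - rank a)" "rank a \<le> n" using rank_parity[OF \<open>a \<in> S\<close>] by blast+
      ultimately have "k = q" using p(3,5) q' by presburger
      then show "K = ?J" using k by simp
    qed
    show "maximal_subgroup (jones n) {id_bar n q} (id_bar n q)" by (rule subgroup_trivial[OF q'])
    then have "group (jones n\<lparr>carrier := {id_bar n q}, one := id_bar n q\<rparr>)"
      by (simp add: maximal_subgroup_def group_within_def)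
    from group.one_is_normal[OF this]
    show "{id_bar n q} \<lhd> jones n\<lparr>carrier := {id_bar n q}, one := id_bar n q\<rparr>" by simp
    show "{id_bar n q} \<subseteq> ?J" using e by simp
  qed
  moreover have "retractable_ideal (jones n) I"
    unfolding retractable_ideal_def using p ideal_rank_ideal retraction_exists by blast
  ultimately show "retractable_IN_pair (jones n) I {id_bar n q}"
    by (simp add: retractable_IN_pair_def l_coset_def r_coset_def)
qed

text \<open>For a one-element subgroup \<open>nu\<close> is part of the diagonal. The retract of
  \<open>x\<close> has the same products with \<open>\<omega>\<close> as \<open>x\<close>, so a
  relation \<open>Q\<close> that depends only on these products can be evaluated without
  retracting.\<close>

lemma IN_cong_eq:
  assumes q: "z \<le> q" "q \<le> 2 - z"
    and K: "\<And>x y. x \<in> S \<Longrightarrow> rank x = z \<Longrightarrow> y \<in> S \<Longrightarrow> rank y = z \<Longrightarrow> (x, y) \<in> K \<longleftrightarrow> Q x y"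
    and Q: "\<And>x y x' y'. x \<cdot> \<omega> = x' \<cdot> \<omega> \<Longrightarrow> \<omega> \<cdot> x = \<omega> \<cdot> x' \<Longrightarrow> y \<cdot> \<omega> = y' \<cdot> \<omega> \<Longrightarrow> \<omega> \<cdot> y = \<omega> \<cdot> y' \<Longrightarrow> Q x y = Q x' y'"
  shows "IN_cong K (jones n) (rank_ideal n q) {a} =
    Id_on S \<union> {(x, y). x \<in> rank_ideal n q \<and> y \<in> rank_ideal n q \<and> Q x y}"
proof -
  let ?r = "the_retraction (jones n) (rank_ideal n q)"
  have "nu (jones n) {a} \<subseteq> Id_on S"
  proof
    fix p assume "p \<in> nu (jones n) {a}"
    then obtain w where "p = (w, w)" "w \<in> green_J (jones n) `` {a}" unfolding nu_def Let_def by auto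
    then show "p \<in> Id_on S" by (auto simp: green_J_iff)
  qed
  moreover have "(?r x, ?r y) \<in> K \<longleftrightarrow> Q x y" if "x \<in> rank_ideal n q" "y \<in> rank_ideal n q" for x y
    using K[OF the_retraction_eq(1,2)[OF q that(1)] the_retraction_eq(1,2)[OF q that(2)]]
      Q[OF the_retraction_eq(3,4)[OF q that(1)] the_retraction_eq(3,4)[OF q that(2)]] by simp
  ultimately show ?thesis unfolding IN_cong_def by auto
qed

end

section \<open>Congruences\<close>

text \<open>The caps after a hook depend only on the caps before it. Used in the contrapositive: a
  reversible word cannot make different cap patterns equal.\<close>

lemma caps_hook_cong:
  assumes f: "matching n f" and g: "matching n g" and eq: "caps n f = caps n g" and i: "1 \<le> i" "i < n"
  shows "caps n (hook i f) = caps n (hook i g)"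
proof -
  have d: "f y = g y \<or> n < f y \<and> n < g y" if "y \<in> {1..n}" for y
    using eq that unfolding caps_eq_iff[OF f g] by (metis not_le)
  have h: "matching n (hook i f)" "matching n (hook i g)"
    using matching_hook[OF f] matching_hook[OF g] i by simp_all
  have "hook i f x = hook i g x \<or> n < hook i f x \<and> n < hook i g x" if x: "x \<in> {1..n}" for x
  proof -
    have i1: "i \<in> {1..n}" "i + 1 \<in> {1..n}" using i by simp_all
    have fg: "x = f i \<longleftrightarrow> x = g i" "x = f (i + 1) \<longleftrightarrow> x = g (i + 1)"
      using d[OF i1(1)] d[OF i1(2)] x by auto
    consider "x = i \<or> x = i + 1" | "x \<noteq> i" "x \<noteq> i + 1" "x = f i" |
      "x \<noteq> i" "x \<noteq> i + 1" "x \<noteq> f i" "x = f (i + 1)" |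
      "x \<noteq> i" "x \<noteq> i + 1" "x \<noteq> f i" "x \<noteq> f (i + 1)" by blast
    then show ?thesis
    proof cases
      case 1
      then show ?thesis by auto
    next
      case 2
      then have "hook i f x = f (i + 1)" "hook i g x = g (i + 1)" using fg by (simp_all add: hook_def)
      then show ?thesis using d[OF i1(2)] by simp
    next
      case 3
      then have "x \<noteq> g i" "x = g (i + 1)" using fg by simp_all
      then have "hook i f x = f i" "hook i g x = g i" using 3 unfolding hook_def by (metis, metis)
      then show ?thesis using d[OF i1(1)] by simp
    next
      case 4
      then show ?thesis using hook_other[of x i f] hook_other[of x i g] fg d[OF x] by simp
    qed
  qed
  then show ?thesis unfolding caps_eq_iff[OF h] by (meson leD)
qed

lemma caps_hooks_cong:
  "matching n f \<Longrightarrow> matching n g \<Longrightarrow> caps n f = caps n g \<Longrightarrow> set ws \<subseteq> {1..<n} \<Longrightarrow>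
    caps n (hooks ws f) = caps n (hooks ws g)"
  by (induction ws) (auto intro!: caps_hook_cong matching_hooks)

lemma tail_hook_below:
  assumes f: "matching n f" and t: "tail n m f" and l: "1 \<le> l" "l < m"
  shows "tail n m (hook l f)"
proof -
  have "hook l f x = f x" if x: "m < x" "x \<le> n" for x
    by (rule hook_other)
      (use x l tail_below[OF f t, of l] tail_below[OF f t, of "l + 1"] in auto)
  then show ?thesis using t unfolding tail_def by metis
qed

text \<open>\<open>P\<close> is stable under hooks and never pairs rank \<open>q\<close> with a
  smaller rank. So a separating hook at \<open>l\<close> must leave both ranks at \<open>q\<close>
  and the caps different, while creating the cap \<open>{l, l + 1}\<close> on both sides. The common
  words of \<open>shift_cap\<close> move that cap to the end, and the tail grows by two points until
  only the exceptional cases of \<open>separating_hook\<close> remain.\<close>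

lemma tail_descent:
  assumes hookP: "\<And>f g i. P f g \<Longrightarrow> matching n f \<Longrightarrow> matching n g \<Longrightarrow> 1 \<le> i \<Longrightarrow> i < n \<Longrightarrow> P (hook i f) (hook i g)"
    and nosep: "\<And>f g. P f g \<Longrightarrow> matching n f \<Longrightarrow> matching n g \<Longrightarrow> rk n f \<le> q \<Longrightarrow> rk n g \<le> q \<Longrightarrow> rk n f = q \<longleftrightarrow> rk n g = q"
    and "P f g" "matching n f" "matching n g" "rk n f = q" "rk n g = q" "caps n f \<noteq> caps n g" "tail n m f" "tail n m g"
  shows "\<exists>f g m. P f g \<and> matching n f \<and> matching n g \<and> rk n f = q \<and> rk n g = q \<and> caps n f \<noteq> caps n g \<and>
    tail n m f \<and> tail n m g \<and> (m = 3 \<and> q = 1 \<or> m = 4 \<and> q = 0)"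
  using assms(3-)
proof (induction m arbitrary: f g rule: less_induct)
  case (less m)
  note f = less.prems(2) and g = less.prems(3) and rf = less.prems(4) and rg = less.prems(5)
    and tf = less.prems(7) and tg = less.prems(8)
  have mn: "m \<le> n" using tf unfolding tail_def by blast
  show ?case
  proof (cases "m = 3 \<and> q = 1 \<or> m = 4 \<and> q = 0")
    case True
    then show ?thesis using less.prems by blast
  next
    case False
    then obtain l where l: "1 \<le> l" "l < m" "(rk n (hook l f) = q) \<noteq> (rk n (hook l g) = q) \<or>
        rk n (hook l f) = q \<and> rk n (hook l g) = q \<and> caps n (hook l f) \<noteq> caps n (hook l g)"
      using separating_hook[OF f g tf tg rf rg less.prems(6)] by blast
    have ln: "l < n" using l mn by simp
    have P1: "P (hook l f) (hook l g)" by (rule hookP[OF less.prems(1) f g l(1) ln])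
    have m1: "matching n (hook l f)" "matching n (hook l g)"
      using matching_hook[OF f l(1)] matching_hook[OF g l(1)] ln by simp_all
    have r1: "rk n (hook l f) \<le> q" "rk n (hook l g) \<le> q"
      using rk_hook_le[OF f l(1) ln] rk_hook_le[OF g l(1) ln] rf rg by simp_all
    have d1: "rk n (hook l f) = q" "rk n (hook l g) = q" "caps n (hook l f) \<noteq> caps n (hook l g)"
      using l(3) nosep[OF P1 m1 r1] by blast+
    have t1: "tail n m (hook l f)" "tail n m (hook l g)"
      using tail_hook_below[OF f tf l(1,2)] tail_hook_below[OF g tg l(1,2)] by simp_all
    have lm: "l + 1 \<le> m" using l by simp
    obtain us vs where uv: "set us \<subseteq> {1..<m}" "set vs \<subseteq> {1..<m}"
      "\<And>f. matching n f \<Longrightarrow> tail n m f \<Longrightarrow> f l = l + 1 \<Longrightarrow> tail n (m - 2) (hooks us f) \<and> hooks vs (hooks us f) = f"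
      using shift_cap[OF l(1) lm, of n] by blast
    have uv': "set us \<subseteq> {1..<n}" "set vs \<subseteq> {1..<n}" using uv(1,2) mn by force+
    have F: "tail n (m - 2) (hooks us (hook l f))" "hooks vs (hooks us (hook l f)) = hook l f"
      "tail n (m - 2) (hooks us (hook l g))" "hooks vs (hooks us (hook l g)) = hook l g"
      using uv(3)[OF m1(1) t1(1)] uv(3)[OF m1(2) t1(2)] by simp_all
    have m2: "matching n (hooks us (hook l f))" "matching n (hooks us (hook l g))"
      using matching_hooks[OF m1(1) uv'(1)] matching_hooks[OF m1(2) uv'(1)] by simp_all
    have P2: "P (hooks ws (hook l f)) (hooks ws (hook l g))" if "set ws \<subseteq> {1..<n}" for ws
      using that
    proof (induction ws)
      case (Cons i ws)
      then show ?case using hookP[of "hooks ws (hook l f)" "hooks ws (hook l g)" i]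
          matching_hooks[OF m1(1)] matching_hooks[OF m1(2)] by simp
    qed (simp add: P1)
    have r2: "rk n (hooks us (hook l f)) = q" "rk n (hooks us (hook l g)) = q"
      using rk_hooks_le[OF m1(1) uv'(1)] rk_hooks_le[OF m2(1) uv'(2)]
        rk_hooks_le[OF m1(2) uv'(1)] rk_hooks_le[OF m2(2) uv'(2)] F d1 by simp_all
    have c2: "caps n (hooks us (hook l f)) \<noteq> caps n (hooks us (hook l g))"
      using caps_hooks_cong[OF m2 _ uv'(2)] F d1(3) by metis
    show ?thesis
      by (rule less.IH[OF _ P2[OF uv'(1)] m2 r2 c2 F(1) F(3)]) (use l in simp)
  qed
qed

context jones_degree
begin

section \<open>Congruences and their mirror images\<close>

lemma congruence_iff:
  "congruence (jones n) \<xi> \<longleftrightarrow> equiv S \<xi> \<and>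
     (\<forall>a b c. (a, b) \<in> \<xi> \<longrightarrow> c \<in> S \<longrightarrow> (c \<cdot> a, c \<cdot> b) \<in> \<xi> \<and> (a \<cdot> c, b \<cdot> c) \<in> \<xi>)"
  unfolding congruence_def by auto

lemma cong_in: "congruence (jones n) \<xi> \<Longrightarrow> (a, b) \<in> \<xi> \<Longrightarrow> a \<in> S \<and> b \<in> S"
  unfolding congruence_def equiv_def refl_on_def by blast

lemma cong_refl: "congruence (jones n) \<xi> \<Longrightarrow> a \<in> S \<Longrightarrow> (a, a) \<in> \<xi>"
  unfolding congruence_def equiv_def refl_on_def by blast

lemma cong_sym: "congruence (jones n) \<xi> \<Longrightarrow> (a, b) \<in> \<xi> \<Longrightarrow> (b, a) \<in> \<xi>"
  unfolding congruence_def equiv_def by (meson symD)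

lemma cong_trans: "congruence (jones n) \<xi> \<Longrightarrow> (a, b) \<in> \<xi> \<Longrightarrow> (b, c) \<in> \<xi> \<Longrightarrow> (a, c) \<in> \<xi>"
  unfolding congruence_def equiv_def by (meson transD)

lemma cong_left: "congruence (jones n) \<xi> \<Longrightarrow> (a, b) \<in> \<xi> \<Longrightarrow> c \<in> S \<Longrightarrow> (c \<cdot> a, c \<cdot> b) \<in> \<xi>"
  unfolding congruence_iff by blast

lemma cong_right: "congruence (jones n) \<xi> \<Longrightarrow> (a, b) \<in> \<xi> \<Longrightarrow> c \<in> S \<Longrightarrow> (a \<cdot> c, b \<cdot> c) \<in> \<xi>"
  unfolding congruence_iff by blast

text \<open>The mirror image of a congruence; a result about left multiplication applied to it
  becomes one about right multiplication.\<close>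

definition star_image :: "vertex set set rel \<Rightarrow> vertex set set rel" where
  "star_image \<xi> = {(a, b). (star a, star b) \<in> \<xi>}"

lemma star_image_iff [simp]: "(a, b) \<in> star_image \<xi> \<longleftrightarrow> (star a, star b) \<in> \<xi>"
  by (simp add: star_image_def)

lemma congruence_star_image:
  assumes \<xi>: "congruence (jones n) \<xi>"
  shows "congruence (jones n) (star_image \<xi>)"
proof -
  have in_S: "a \<in> S \<and> b \<in> S" if "(a, b) \<in> star_image \<xi>" for a b
    using cong_in[OF \<xi>, of "star a" "star b"] that star_in[of "star a"] star_in[of "star b"] by simp
  show ?thesis
    unfolding congruence_iff
  proof (intro conjI allI impI equivI)
    show "star_image \<xi> \<subseteq> S \<times> S" using in_S by auto
    show "refl_on S (star_image \<xi>)"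
      by (rule refl_onI) (use in_S cong_refl[OF \<xi>] star_in in auto)
    show "sym (star_image \<xi>)" by (rule symI) (use cong_sym[OF \<xi>] in auto)
    show "trans (star_image \<xi>)"
    proof (rule transI)
      fix a b c assume "(a, b) \<in> star_image \<xi>" "(b, c) \<in> star_image \<xi>"
      then show "(a, c) \<in> star_image \<xi>" using cong_trans[OF \<xi>] by simp
    qed
    fix a b c assume ab: "(a, b) \<in> star_image \<xi>" and c: "c \<in> S"
    then have "a \<in> S" "b \<in> S" "(star a, star b) \<in> \<xi>" "star c \<in> S" using in_S star_in by auto
    then show "(c \<cdot> a, c \<cdot> b) \<in> star_image \<xi>" "(a \<cdot> c, b \<cdot> c) \<in> star_image \<xi>"
      using c cong_left[OF \<xi>, of "star a" "star b" "star c"] cong_right[OF \<xi>, of "star a" "star b" "star c"]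
      by (simp_all add: star_mult)
  qed
qed

subsection \<open>The congruences of small rank\<close>

text \<open>This and the next two are the congruences of the IN-pairs with the retraction replaced
  by products with \<open>\<omega>\<close>; they agree with the originals for ranks from
  \<open>z\<close> to \<open>2 - z\<close>.\<close>

definition lam :: "nat \<Rightarrow> vertex set set rel" where
  "lam q = Id_on S \<union> {(x, y). x \<in> rank_ideal n q \<and> y \<in> rank_ideal n q \<and> \<omega> \<cdot> x = \<omega> \<cdot> y}"

definition rho :: "nat \<Rightarrow> vertex set set rel" where
  "rho q = Id_on S \<union> {(x, y). x \<in> rank_ideal n q \<and> y \<in> rank_ideal n q \<and> x \<cdot> \<omega> = y \<cdot> \<omega>}"

definition mu :: "nat \<Rightarrow> vertex set set rel" where
  "mu q = Id_on S \<union> {(x, y). x \<in> rank_ideal n q \<and> y \<in> rank_ideal n q \<and> \<omega> \<cdot> x = \<omega> \<cdot> y \<and> x \<cdot> \<omega> = y \<cdot> \<omega>}"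

lemma R_cong_iff: "(x, y) \<in> R_cong n q \<longleftrightarrow> x \<in> S \<and> y \<in> S \<and> (x = y \<or> rank x \<le> q \<and> rank y \<le> q)"
  by (auto simp: R_cong_def rees_def mem_rank_ideal)

lemma lam_iff: "(x, y) \<in> lam q \<longleftrightarrow> x \<in> S \<and> y \<in> S \<and> (x = y \<or> rank x \<le> q \<and> rank y \<le> q \<and> \<omega> \<cdot> x = \<omega> \<cdot> y)"
  by (auto simp: lam_def mem_rank_ideal)

lemma rho_iff: "(x, y) \<in> rho q \<longleftrightarrow> x \<in> S \<and> y \<in> S \<and> (x = y \<or> rank x \<le> q \<and> rank y \<le> q \<and> x \<cdot> \<omega> = y \<cdot> \<omega>)"
  by (auto simp: rho_def mem_rank_ideal)

lemma mu_iff: "(x, y) \<in> mu q \<longleftrightarrow> x \<in> S \<and> y \<in> S \<and>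
    (x = y \<or> rank x \<le> q \<and> rank y \<le> q \<and> \<omega> \<cdot> x = \<omega> \<cdot> y \<and> x \<cdot> \<omega> = y \<cdot> \<omega>)"
  by (auto simp: mu_def mem_rank_ideal)

lemma IN_congs:
  assumes q: "z \<le> q" "q \<le> 2 - z"
  shows "lambda_cong n q = lam q" "rho_cong n q = rho q" "mu_cong n q = mu q"
proof -
  show "lambda_cong n q = lam q"
    unfolding lambda_cong_def C_pair_def lambda_IN_def prod.case lam_def
    by (rule IN_cong_eq[OF q]) (simp_all add: green_L_iff)
  show "rho_cong n q = rho q"
    unfolding rho_cong_def C_pair_def rho_IN_def prod.case rho_def
    by (rule IN_cong_eq[OF q]) (simp_all add: green_R_iff)
  show "mu_cong n q = mu q"
    unfolding mu_cong_def C_pair_def mu_IN_def prod.case mu_def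
    by (rule IN_cong_eq[OF q]) (simp_all add: green_L_iff green_R_iff green_H_def)
qed

text \<open>\<open>F\<close> is an invariant compatible with multiplication on the ideal: a constant
  for the Rees congruences, the right coordinate for \<open>lam\<close>.\<close>

lemma congruence_on_ideal:
  assumes mem: "\<And>x y. (x, y) \<in> \<xi> \<longleftrightarrow> x \<in> S \<and> y \<in> S \<and> (x = y \<or> rank x \<le> q \<and> rank y \<le> q \<and> F x = F y)"
    and comp: "\<And>x y c. x \<in> S \<Longrightarrow> y \<in> S \<Longrightarrow> c \<in> S \<Longrightarrow> rank x \<le> q \<Longrightarrow> rank y \<le> q \<Longrightarrow> F x = F y \<Longrightarrow>
      F (c \<cdot> x) = F (c \<cdot> y) \<and> F (x \<cdot> c) = F (y \<cdot> c)"
  shows "congruence (jones n) \<xi>"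
  unfolding congruence_iff
proof (intro conjI allI impI equivI)
  show "\<xi> \<subseteq> S \<times> S" using mem by auto
  show "refl_on S \<xi>" by (rule refl_onI) (use mem in auto)
  show "sym \<xi>" by (rule symI) (use mem in auto)
  show "trans \<xi>"
  proof (rule transI)
    fix x y w assume "(x, y) \<in> \<xi>" "(y, w) \<in> \<xi>"
    then show "(x, w) \<in> \<xi>" unfolding mem by metis
  qed
  fix x y c assume xy: "(x, y) \<in> \<xi>" and c: "c \<in> S"
  have S: "x \<in> S" "y \<in> S" using xy mem by blast+
  have r: "rank (c \<cdot> x) \<le> rank x" "rank (x \<cdot> c) \<le> rank x" "rank (c \<cdot> y) \<le> rank y" "rank (y \<cdot> c) \<le> rank y"
    using rank_mult_right[OF c] rank_mult_left[OF _ c] S by simp_all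
  have m: "c \<cdot> x \<in> S" "c \<cdot> y \<in> S" "x \<cdot> c \<in> S" "y \<cdot> c \<in> S" using S c by simp_all
  show "(c \<cdot> x, c \<cdot> y) \<in> \<xi>" "(x \<cdot> c, y \<cdot> c) \<in> \<xi>"
    using xy comp[OF S c] r m unfolding mem by (metis le_trans)+
qed

lemma congruence_R: "congruence (jones n) (R_cong n q)"
  by (rule congruence_on_ideal[of _ q "\<lambda>x. ()"]) (simp_all add: R_cong_iff)

lemma congruence_lam:
  assumes "q \<le> 2 - z"
  shows "congruence (jones n) (lam q)"
proof (rule congruence_on_ideal[of _ q "\<lambda>x. \<omega> \<cdot> x"], rule lam_iff)
  fix x y c assume x: "x \<in> S" "rank x \<le> q" and y: "y \<in> S" "rank y \<le> q" and c: "c \<in> S" and eq: "\<omega> \<cdot> x = \<omega> \<cdot> y"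
  have "\<omega> \<cdot> (c \<cdot> x) = \<omega> \<cdot> (c \<cdot> y)"
    using omega_collapse[of x c] omega_collapse[of y c] x y c eq assms by simp
  moreover have "\<omega> \<cdot> (x \<cdot> c) = \<omega> \<cdot> (y \<cdot> c)"
    using assoc[OF omega_in x(1) c] assoc[OF omega_in y(1) c] eq by simp
  ultimately show "\<omega> \<cdot> (c \<cdot> x) = \<omega> \<cdot> (c \<cdot> y) \<and> \<omega> \<cdot> (x \<cdot> c) = \<omega> \<cdot> (y \<cdot> c)" by blast
qed

lemma star_swap:
  assumes "x \<in> S" "y \<in> S"
  shows "\<omega> \<cdot> star x = \<omega> \<cdot> star y \<longleftrightarrow> x \<cdot> \<omega> = y \<cdot> \<omega>" "star x \<cdot> \<omega> = star y \<cdot> \<omega> \<longleftrightarrow> \<omega> \<cdot> x = \<omega> \<cdot> y"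
proof -
  have "star (x \<cdot> \<omega>) = \<omega> \<cdot> star x" "star (y \<cdot> \<omega>) = \<omega> \<cdot> star y"
    "star (\<omega> \<cdot> x) = star x \<cdot> \<omega>" "star (\<omega> \<cdot> y) = star y \<cdot> \<omega>"
    using assms by (simp_all add: star_mult)
  then show "\<omega> \<cdot> star x = \<omega> \<cdot> star y \<longleftrightarrow> x \<cdot> \<omega> = y \<cdot> \<omega>" "star x \<cdot> \<omega> = star y \<cdot> \<omega> \<longleftrightarrow> \<omega> \<cdot> x = \<omega> \<cdot> y"
    by (metis star_star)+
qed

lemma star_in_iff: "star a \<in> S \<longleftrightarrow> a \<in> S"
  using star_in[of a] star_in[of "star a"] by auto

lemma star_eq_iff: "star a = star b \<longleftrightarrow> a = b"
  by (metis star_star)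

lemma star_image_R: "star_image (R_cong n q) = R_cong n q"
  by (intro equalityI subrelI) (auto simp: R_cong_iff star_in_iff star_eq_iff rank_star)

lemma star_image_lam: "star_image (lam q) = rho q"
  by (intro equalityI subrelI) (auto simp: lam_iff rho_iff star_in_iff star_eq_iff rank_star star_swap)

lemma star_image_rho: "star_image (rho q) = lam q"
  by (intro equalityI subrelI) (auto simp: lam_iff rho_iff star_in_iff star_eq_iff rank_star star_swap)

lemma star_image_mu: "star_image (mu q) = mu q"
  by (intro equalityI subrelI) (auto simp: mu_iff star_in_iff star_eq_iff rank_star star_swap)

lemma congruence_rho: "q \<le> 2 - z \<Longrightarrow> congruence (jones n) (rho q)"
  using congruence_star_image[OF congruence_lam[of q]] by (simp add: star_image_lam)

lemma mu_eq_inter: "mu q = lam q \<inter> rho q"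
  by (intro equalityI subrelI) (auto simp: mu_iff lam_iff rho_iff)

lemma congruence_mu: 
  assumes "q \<le> 2 - z"
  shows "congruence (jones n) (mu q)"
proof -
  note l = congruence_lam[OF assms] and r = congruence_rho[OF assms]
  show ?thesis
    unfolding congruence_iff
  proof (intro conjI allI impI equivI)
    show "mu q \<subseteq> S \<times> S" by (auto simp: mu_iff)
    show "refl_on S (mu q)" by (rule refl_onI) (auto simp: mu_iff)
    show "sym (mu q)" by (rule symI) (auto simp: mu_iff)
    show "trans (mu q)"
    proof (rule transI)
      fix x y w assume "(x, y) \<in> mu q" "(y, w) \<in> mu q"
      then show "(x, w) \<in> mu q" unfolding mu_eq_inter using cong_trans[OF l] cong_trans[OF r] by blast
    qed
    fix a b c assume "(a, b) \<in> mu q" "c \<in> S"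
    then show "(c \<cdot> a, c \<cdot> b) \<in> mu q" "(a \<cdot> c, b \<cdot> c) \<in> mu q"
      unfolding mu_eq_inter using cong_left[OF l] cong_left[OF r] cong_right[OF l] cong_right[OF r] by blast+
  qed
qed

lemma mu_z: "mu z = Id_on S"
proof -
  have "x = y" if "x \<in> S" "y \<in> S" "rank x \<le> z" "rank y \<le> z" "\<omega> \<cdot> x = \<omega> \<cdot> y" "x \<cdot> \<omega> = y \<cdot> \<omega>" for x y
    using rank_z_eqI[of x y] rank_min that by blast
  then have "(x, y) \<in> mu z \<longleftrightarrow> x \<in> S \<and> x = y" for x y unfolding mu_iff by blast
  then show ?thesis by (intro equalityI subrelI) auto
qed

subsection \<open>Generating congruences\<close>

text \<open>
  The Temperley-Lieb relations turn \<open>\<omega> \<sim> E\<^sub>i \<omega>\<close> into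
  \<open>E\<^sub>i \<omega> = E\<^sub>i E\<^bsub>i+1\<^esub> E\<^bsub>i+2\<^esub> \<omega> \<sim> E\<^sub>i E\<^bsub>i+1\<^esub> E\<^bsub>i+2\<^esub> E\<^sub>i \<omega> = E\<^bsub>i+2\<^esub> E\<^sub>i \<omega> \<sim> E\<^bsub>i+2\<^esub> \<omega>\<close>.
\<close>

lemma spread_step:
  assumes \<xi>: "congruence (jones n) \<xi>" and i: "1 \<le> i" "i + 2 < n" "even (n - i)" and rel: "(\<omega>, E i \<cdot> \<omega>) \<in> \<xi>"
  shows "(\<omega>, E (i + 2) \<cdot> \<omega>) \<in> \<xi>"
proof -
  have E: "E i \<in> S" "E (i + 1) \<in> S" "E (i + 2) \<in> S" using E_in i by simp_all
  have "odd (n - (i + 1))" using i by presburger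
  then have fixed: "E (i + 1) \<cdot> \<omega> = \<omega>" using E_omega_fix[of "i + 1"] i by simp
  have "E (i + 1) \<cdot> (E (i + 2) \<cdot> \<omega>) = E (i + 1) \<cdot> (E (i + 2) \<cdot> E (i + 1)) \<cdot> \<omega>"
    using E fixed by (simp add: assoc)
  also have "\<dots> = \<omega>" using E_braid_up[of "i + 1"] i fixed by simp
  finally have a: "E (i + 1) \<cdot> (E (i + 2) \<cdot> \<omega>) = \<omega>" .
  have com: "E (i + 2) \<cdot> E i = E i \<cdot> E (i + 2)" using E_commute[of i "i + 2"] i by simp
  have "E i \<cdot> (E (i + 1) \<cdot> (E (i + 2) \<cdot> (E i \<cdot> \<omega>))) = E i \<cdot> (E (i + 1) \<cdot> ((E (i + 2) \<cdot> E i) \<cdot> \<omega>))"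
    using E by (simp add: assoc)
  also have "\<dots> = (E i \<cdot> (E (i + 1) \<cdot> E i)) \<cdot> (E (i + 2) \<cdot> \<omega>)" unfolding com using E by (simp add: assoc)
  also have "\<dots> = E i \<cdot> (E (i + 2) \<cdot> \<omega>)" using E_braid_up[of i] i by simp
  also have "\<dots> = E (i + 2) \<cdot> (E i \<cdot> \<omega>)" using com E assoc[of "E i" "E (i + 2)" \<omega>] assoc[of "E (i + 2)" "E i" \<omega>] by simp
  finally have b: "E i \<cdot> (E (i + 1) \<cdot> (E (i + 2) \<cdot> (E i \<cdot> \<omega>))) = E (i + 2) \<cdot> (E i \<cdot> \<omega>)" .
  have "(E (i + 2) \<cdot> \<omega>, E (i + 2) \<cdot> (E i \<cdot> \<omega>)) \<in> \<xi>" using cong_left[OF \<xi> rel E(3)] .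
  moreover have "(E i \<cdot> (E (i + 1) \<cdot> (E (i + 2) \<cdot> \<omega>)), E i \<cdot> (E (i + 1) \<cdot> (E (i + 2) \<cdot> (E i \<cdot> \<omega>)))) \<in> \<xi>"
    by (intro cong_left[OF \<xi>] rel E)
  then have "(E i \<cdot> \<omega>, E (i + 2) \<cdot> (E i \<cdot> \<omega>)) \<in> \<xi>" unfolding a b .
  ultimately show ?thesis using rel cong_trans[OF \<xi>] cong_sym[OF \<xi>] by blast
qed

text \<open>Hooks that fix \<open>\<omega>\<close> need no argument, and the others are reached from
  the index \<open>2 - z\<close> in steps of two. As any \<open>x\<close> is a product of hooks,
  prefixing one hook at a time gives the rest.\<close>

lemma spread:
  assumes \<xi>: "congruence (jones n) \<xi>" and rel: "(\<omega>, \<kappa>) \<in> \<xi>" and x: "x \<in> S"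
  shows "(\<omega>, x \<cdot> \<omega>) \<in> \<xi>"
proof -
  have even: "(\<omega>, E i \<cdot> \<omega>) \<in> \<xi>" if "1 \<le> i" "i < n" "even (n - i)" for i
    using that
  proof (induction i rule: less_induct)
    case (less i)
    show ?case
    proof (cases "i \<le> 2 - z")
      case True
      then have "i = 2 - z" using less.prems bar_parity z01 by (cases "i = 1"; auto)
      then show ?thesis using rel by (simp add: \<kappa>_def)
    next
      case False
      then have i: "1 \<le> i - 2" "i - 2 < i" using z01 less.prems bar_parity by (auto, presburger)
      have "even (n - (i - 2))" "i - 2 < n" "i - 2 + 2 = i" using less.prems i(1) by presburger+
      then show ?thesis using spread_step[OF \<xi> i(1)] less.IH[OF i(2,1)] less.prems by simp
    qed
  qed
  have all: "(\<omega>, E i \<cdot> \<omega>) \<in> \<xi>" if "1 \<le> i" "i < n" for i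
    using even[OF that] E_omega_fix[OF that] cong_refl[OF \<xi> omega_in] by (cases "even (n - i)") auto
  show ?thesis using x
  proof (induction x rule: S_induct)
    case one
    then show ?case using one_mult[OF omega_in] cong_refl[OF \<xi> omega_in] by simp
  next
    case (mult i a)
    have Ei: "E i \<in> S" using E_in mult by simp
    have "(E i \<cdot> \<omega>, E i \<cdot> (a \<cdot> \<omega>)) \<in> \<xi>" using cong_left[OF \<xi> mult(4) Ei] .
    then show ?case using cong_trans[OF \<xi> all[OF mult(1,2)]] assoc[OF Ei mult(3) omega_in] by simp
  qed
qed

text \<open>Multiplying \<open>\<omega> \<sim> x \<cdot> \<omega>\<close> by \<open>x\<close> on the
  right gives \<open>\<omega> \<cdot> x \<sim> x \<cdot> \<omega> \<cdot> x = x\<close>, so elements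
  of minimal rank with the same right coordinate are identified.\<close>

lemma lam_z_sub:
  assumes \<xi>: "congruence (jones n) \<xi>" and rel: "(\<omega>, \<kappa>) \<in> \<xi>"
  shows "lam z \<subseteq> \<xi>"
proof (rule subrelI)
  have key: "(x, \<omega> \<cdot> x) \<in> \<xi>" if x: "x \<in> S" "rank x = z" for x
  proof -
    have "(\<omega> \<cdot> x, x \<cdot> \<omega> \<cdot> x) \<in> \<xi>" using cong_right[OF \<xi> spread[OF \<xi> rel x(1)] x(1)] .
    then have "(\<omega> \<cdot> x, x) \<in> \<xi>" using omega_mult_cancel[OF x] assoc[OF x(1) omega_in x(1)] by simp
    then show ?thesis by (rule cong_sym[OF \<xi>])
  qed
  fix x y assume "(x, y) \<in> lam z"
  then have xy: "x \<in> S" "y \<in> S" "x = y \<or> rank x \<le> z \<and> rank y \<le> z \<and> \<omega> \<cdot> x = \<omega> \<cdot> y" unfolding lam_iff by blast+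
  show "(x, y) \<in> \<xi>"
  proof (cases "x = y")
    case True
    then show ?thesis using cong_refl[OF \<xi>] xy by simp
  next
    case False
    then have "rank x = z" "rank y = z" "\<omega> \<cdot> x = \<omega> \<cdot> y" using xy rank_min by blast+
    then show ?thesis using key[OF xy(1)] key[OF xy(2)] cong_sym[OF \<xi>] cong_trans[OF \<xi>] by metis
  qed
qed

lemma rho_z_sub:
  assumes \<xi>: "congruence (jones n) \<xi>" and rel: "(\<omega>, star \<kappa>) \<in> \<xi>"
  shows "rho z \<subseteq> \<xi>"
proof -
  have "lam z \<subseteq> star_image \<xi>" using lam_z_sub[OF congruence_star_image[OF \<xi>]] rel by simp
  then have "star_image (lam z) \<subseteq> star_image (star_image \<xi>)" by (auto simp: star_image_def)
  then show ?thesis by (simp add: star_image_lam) (simp add: star_image_def)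
qed

text \<open>If rank \<open>q\<close> is never paired with a smaller rank, common hooks carry the
  difference in caps to the two patterns of \<open>caps_base\<close>. Multiplication by
  \<open>\<omega>\<close> on the right then equalises the cups, and the pair becomes
  \<open>\<omega>\<close> and \<open>\<kappa>\<close> in one order or the other.\<close>

lemma separate:
  assumes \<xi>: "congruence (jones n) \<xi>" and ab: "(a, b) \<in> \<xi>" "rank a = q" "rank b = q" and ne: "cap a \<noteq> cap b"
    and nosep: "\<And>c d. (c, d) \<in> \<xi> \<Longrightarrow> rank c = q \<Longrightarrow> \<not> rank d < q"
  shows "q = z \<and> (\<omega>, \<kappa>) \<in> \<xi>"
proof -
  have S: "a \<in> S" "b \<in> S" using cong_in[OF \<xi> ab(1)] by blast+
  define P where "P f g \<longleftrightarrow> (diagram n f, diagram n g) \<in> \<xi>" for f g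
  have hookP: "P (hook i f) (hook i g)" if "P f g" "matching n f" "matching n g" "1 \<le> i" "i < n" for f g i
  proof -
    have "(E i \<cdot> diagram n f, E i \<cdot> diagram n g) \<in> \<xi>"
      using cong_left[OF \<xi>] that E_in unfolding P_def by blast
    then show ?thesis unfolding P_def using that by (simp add: E_mult)
  qed
  have ns: "rk n f = q \<longleftrightarrow> rk n g = q"
    if "P f g" "matching n f" "matching n g" "rk n f \<le> q" "rk n g \<le> q" for f g
  proof -
    have r: "rank (diagram n f) = rk n f" "rank (diagram n g) = rk n g" using that pt_rank_diagram by blast+
    have fg: "(diagram n f, diagram n g) \<in> \<xi>" "(diagram n g, diagram n f) \<in> \<xi>"
      using that cong_sym[OF \<xi>] unfolding P_def by blast+
    show ?thesis using nosep[OF fg(1)] nosep[OF fg(2)] that(4,5) unfolding r by linarith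
  qed
  have "P (mat a) (mat b)" unfolding P_def using ab S diagram_mat by simp
  moreover have "rk n (mat a) = q" "rk n (mat b) = q" using ab rank_eq S by simp_all
  moreover have "tail n n (mat a)" "tail n n (mat b)" by (simp_all add: tail_def)
  ultimately obtain f g m where fg: "P f g" "matching n f" "matching n g" "rk n f = q" "rk n g = q"
      "caps n f \<noteq> caps n g" "tail n m f" "tail n m g" "m = 3 \<and> q = 1 \<or> m = 4 \<and> q = 0"
    using tail_descent[of P n q "mat a" "mat b" n] hookP ns matching_mat[OF S(1)] matching_mat[OF S(2)] ne by blast
  have par: "even (n - q)" "q \<le> n" using rank_parity[OF S(1)] ab(2) by blast+
  \<comment> \<open>Ranks have the parity of \<open>n\<close>, so either exceptional case means
    minimal rank.\<close>
  have qz: "q = z" "m = 4 - z" using fg(9) par bar_parity z01 by auto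
  define c d where "c = diagram n f \<cdot> \<omega>" and "d = diagram n g \<cdot> \<omega>"
  have cd: "(c, d) \<in> \<xi>" unfolding c_def d_def using cong_right[OF \<xi>] fg(1) unfolding P_def by simp
  have mw: "mat \<omega> = bar n z" unfolding \<omega>_def using id_bar_eq[OF bar_parity(2,1)] matching_bar[OF bar_parity(2,1)] by simp
  have mk: "mat \<kappa> = hook (2 - z) (bar n z)" unfolding \<kappa>_def using mat_E_mult[OF omega_in two_minus_z(1,2)] mw by simp
  have cupk: "cup \<kappa> = cup \<omega>" unfolding \<kappa>_def by (rule cup_E_omega[OF two_minus_z(1,2)])
  have base: "diagram n h \<cdot> \<omega> = (if caps n h = cap \<omega> then \<omega> else \<kappa>)"
    if h: "matching n h" "rk n h = q" "tail n m h" for h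
  proof -
    have hS: "diagram n h \<in> S" using h by blast
    have r: "rank (diagram n h) = z" using h qz pt_rank_diagram by simp
    have rr: "rank (diagram n h \<cdot> \<omega>) = z" using rank_omega_mult(2)[OF hS] .
    have C: "cap (diagram n h \<cdot> \<omega>) = caps n h" using cap_mult[OF hS omega_in] r rr h by simp
    have U: "cup (diagram n h \<cdot> \<omega>) = cup \<omega>" using cup_mult[OF hS omega_in] rr by simp
    have "caps n h = cap \<omega> \<or> caps n h = cap \<kappa>"
      unfolding mw mk by (rule caps_base[OF h(1) z01 _ _ n3]) (use h qz in simp_all)
    then show ?thesis
      using eqI[of "diagram n h \<cdot> \<omega>" \<omega>] eqI[of "diagram n h \<cdot> \<omega>" \<kappa>] C U cupk hS by auto
  qed
  have "c = (if caps n f = cap \<omega> then \<omega> else \<kappa>)" "d = (if caps n g = cap \<omega> then \<omega> else \<kappa>)"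
    unfolding c_def d_def using base fg by blast+
  moreover have "caps n f = cap \<omega> \<or> caps n g = cap \<omega>"
  proof -
    have "caps n h = cap \<omega> \<or> caps n h = cap \<kappa>" if "matching n h" "rk n h = q" "tail n m h" for h
      unfolding mw mk by (rule caps_base[OF that(1) z01 _ _ n3]) (use that qz in simp_all)
    then show ?thesis using fg by metis
  qed
  ultimately have "(c = \<omega> \<and> d = \<kappa>) \<or> (c = \<kappa> \<and> d = \<omega>)" using fg(6) by auto
  then have "(\<omega>, \<kappa>) \<in> \<xi>" using cd cong_sym[OF \<xi>] by blast
  then show ?thesis using qz by blast
qed

text \<open>The words that compress \<open>c\<close> to the idempotent turn \<open>d\<close> into
  something of no larger rank; multiplying by the idempotent on both sides makes it a two-sided
  identity for the result.\<close>

lemma id_bar_collapse: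
  assumes \<xi>: "congruence (jones n) \<xi>" and cd: "(c, d) \<in> \<xi>" "rank c = q" "rank d < q"
  shows "\<exists>b. b \<in> S \<and> rank b < q \<and> id_bar n q \<cdot> b = b \<and> b \<cdot> id_bar n q = b \<and> (id_bar n q, b) \<in> \<xi>"
proof -
  have S: "c \<in> S" "d \<in> S" using cong_in[OF \<xi> cd(1)] by blast+
  have q: "q \<le> n" "even (n - q)" using rank_parity[OF S(1)] cd(2) by blast+
  let ?e = "id_bar n q"
  have e: "?e \<in> S" "?e \<cdot> ?e = ?e" using id_bar_in[OF q] id_bar_mult[OF order_refl q(1) q(2) q(2)] by blast+
  obtain us us' where u: "set us \<subseteq> {1..<n}" "set us' \<subseteq> {1..<n}" "word us \<cdot> c \<cdot> word us' = ?e"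
    using factor[OF S(1)] cd(2) by blast
  have w: "word us \<in> S" "word us' \<in> S" using word_in[OF u(1)] word_in[OF u(2)] by simp_all
  define y where "y = word us \<cdot> d \<cdot> word us'"
  have y: "y \<in> S" unfolding y_def using w S by simp
  have "rank y \<le> rank d"
    unfolding y_def using rank_mult_left[of "word us \<cdot> d" "word us'"] rank_mult_right[of "word us" d] w S by simp
  then have ry: "rank y < q" using cd by simp
  have "(?e, y) \<in> \<xi>" unfolding y_def u(3)[symmetric] by (intro cong_left[OF \<xi>] cong_right[OF \<xi>] cd w)
  then have "(?e \<cdot> ?e \<cdot> ?e, ?e \<cdot> y \<cdot> ?e) \<in> \<xi>" by (intro cong_left[OF \<xi>] cong_right[OF \<xi>] e)
  then have rel: "(?e, ?e \<cdot> y \<cdot> ?e) \<in> \<xi>" using e by simp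
  have "rank (?e \<cdot> y \<cdot> ?e) < q"
    using rank_mult_left[of "?e \<cdot> y" ?e] rank_mult_right[of ?e y] ry e y by simp
  moreover have "?e \<cdot> (?e \<cdot> y \<cdot> ?e) = ?e \<cdot> y \<cdot> ?e"
    using assoc[OF e(1) e(1), of "y \<cdot> ?e"] assoc[OF e(1) y e(1)] e y by simp
  moreover have "(?e \<cdot> y \<cdot> ?e) \<cdot> ?e = ?e \<cdot> y \<cdot> ?e"
    using assoc[of "?e \<cdot> y" ?e ?e] e y by simp
  moreover have "?e \<cdot> y \<cdot> ?e \<in> S" using e y by simp
  ultimately show ?thesis using rel by blast
qed

text \<open>
  If \<open>e = id_bar n q\<close> is identified with something of smaller rank then, all the elements \<open>E\<^sub>j e\<close> being
  identified with one another through \<open>E\<^sub>i E\<^sub>j E\<^sub>i = E\<^sub>i\<close>, it is identified with \<open>\<omega>\<close>.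
\<close>

lemma large_collapse:
  assumes \<xi>: "congruence (jones n) \<xi>" and cd: "(c, d) \<in> \<xi>" "rank c = q" "rank d < q" and q3: "3 \<le> q"
  shows "(id_bar n q, \<omega>) \<in> \<xi>" "(\<omega>, \<kappa>) \<in> \<xi>"
proof -
  have S: "c \<in> S" using cong_in[OF \<xi> cd(1)] by blast
  have q: "q \<le> n" "even (n - q)" using rank_parity[OF S] cd(2) by blast+
  define e where "e = id_bar n q"
  have e: "e \<in> S" "e \<cdot> e = e" unfolding e_def using id_bar_in[OF q] id_bar_mult[OF order_refl q(1) q(2) q(2)] by blast+
  obtain b where b: "b \<in> S" "rank b < q" "e \<cdot> b = b" "(e, b) \<in> \<xi>"
    using id_bar_collapse[OF \<xi> cd] unfolding e_def by blast
  have com: "e \<cdot> E j = E j \<cdot> e" if "1 \<le> j" "j < q" for j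
    unfolding e_def using id_bar_E_commute[OF that q] .
  have Ej: "E j \<in> S" if "1 \<le> j" "j < q" for j using E_in that q by simp
  have "tail n q (mat (e \<cdot> b))" unfolding e_def by (rule tail_id_bar_mult[OF b(1) q])
  then have tb: "tail n q (mat b)" using b(3) by simp
  have "rk n (mat b) < q" using b rank_eq by simp
  \<comment> \<open>Fixed by the idempotent, \<open>b\<close> has the standard tail, and its smaller
    rank forces a cap in front. The hook there fixes \<open>b\<close>, so
    \<open>e \<sim> b = E i \<cdot> b \<sim> E i \<cdot> e\<close>.\<close>
  then obtain i where i: "1 \<le> i" "i + 1 \<le> q" "mat b i = i + 1" using tail_simple_cap[OF matching_mat[OF b(1)] tb] by blast
  have "hook i (mat b) = mat b" by (rule hook_same[OF matching_pairing[OF matching_mat[OF b(1)]] i(3)])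
  then have Eb: "E i \<cdot> b = b" using E_mult[OF matching_mat[OF b(1)] i(1)] i q diagram_mat[OF b(1)] by simp
  have iq: "i < q" using i by simp
  have "(E i \<cdot> e, E i \<cdot> b) \<in> \<xi>" by (rule cong_left[OF \<xi> b(4) Ej[OF i(1) iq]])
  then have Fi: "(e, E i \<cdot> e) \<in> \<xi>" using Eb b(4) cong_sym[OF \<xi>] cong_trans[OF \<xi>] by metis
  \<comment> \<open>The hooks commute with \<open>e\<close>, so the relation \<open>br\<close>
    becomes \<open>(E j \<cdot> e) \<cdot> (E l \<cdot> e) \<cdot> (E j \<cdot> e) = E j \<cdot>
    e\<close>. Exchanging the two outer factors for \<open>e\<close> leaves
    \<open>E l \<cdot> e\<close>, which is therefore related to \<open>E j \<cdot> e\<close> and so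
    to \<open>e\<close>.\<close>
  have move: "(e, E l \<cdot> e) \<in> \<xi>"
    if rel: "(e, E j \<cdot> e) \<in> \<xi>" and j: "1 \<le> j" "j < q" and l: "1 \<le> l" "l < q"
      and br: "E j \<cdot> (E l \<cdot> E j) = E j" for j l
  proof -
    note Ej' = Ej[OF j] and El' = Ej[OF l]
    have "(E j \<cdot> e) \<cdot> ((E l \<cdot> e) \<cdot> (E j \<cdot> e)) = E j \<cdot> ((e \<cdot> E l) \<cdot> ((e \<cdot> E j) \<cdot> e))"
      using e Ej' El' by (simp add: assoc)
    also have "\<dots> = E j \<cdot> (E l \<cdot> ((e \<cdot> E j) \<cdot> e))"
      unfolding com[OF j] com[OF l] using e Ej' El' by (simp add: assoc) (metis assoc com[OF j] e mult_in)
    also have "\<dots> = (E j \<cdot> (E l \<cdot> E j)) \<cdot> e" unfolding com[OF j] using e Ej' El' by (simp add: assoc)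
    finally have t: "(E j \<cdot> e) \<cdot> ((E l \<cdot> e) \<cdot> (E j \<cdot> e)) = E j \<cdot> e" using br by simp
    have ele: "E l \<cdot> e \<in> S" "E j \<cdot> e \<in> S" using e El' Ej' by simp_all
    have "((E l \<cdot> e) \<cdot> e, (E l \<cdot> e) \<cdot> (E j \<cdot> e)) \<in> \<xi>" by (rule cong_left[OF \<xi> rel ele(1)])
    then have "(e \<cdot> ((E l \<cdot> e) \<cdot> e), e \<cdot> ((E l \<cdot> e) \<cdot> (E j \<cdot> e))) \<in> \<xi>" by (rule cong_left[OF \<xi> _ e(1)])
    moreover have "(e \<cdot> ((E l \<cdot> e) \<cdot> (E j \<cdot> e)), (E j \<cdot> e) \<cdot> ((E l \<cdot> e) \<cdot> (E j \<cdot> e))) \<in> \<xi>"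
      by (rule cong_right[OF \<xi> rel]) (use ele in simp)
    ultimately have "(e \<cdot> ((E l \<cdot> e) \<cdot> e), E j \<cdot> e) \<in> \<xi>" using t cong_trans[OF \<xi>] by metis
    moreover have "e \<cdot> ((E l \<cdot> e) \<cdot> e) = E l \<cdot> e"
      using assoc[OF El' e(1) e(1)] assoc[OF e(1) El' e(1)] assoc[OF El' e(1) e(1)] com[OF l] e by simp
    ultimately show ?thesis using rel cong_trans[OF \<xi>] cong_sym[OF \<xi>] by metis
  qed
  have up: "(e, E j \<cdot> e) \<in> \<xi>" if "i \<le> j" "j < q" for j
    using that
  proof (induction j rule: dec_induct)
    case base
    then show ?case using Fi by simp
  next
    case (step j)
    then have j: "(e, E j \<cdot> e) \<in> \<xi>" "1 \<le> j" "j < q" using i by auto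
    show ?case
      using move[OF j, of "j + 1"] E_braid_up[of j] step.prems j q by simp
  qed
  have down: "(e, E j \<cdot> e) \<in> \<xi>" if "j \<le> i" "1 \<le> j" for j
    using that
  proof (induction j rule: inc_induct)
    case base
    then show ?case using Fi by simp
  next
    case (step j)
    then have j: "(e, E (j + 1) \<cdot> e) \<in> \<xi>" "1 \<le> j + 1" "j + 1 < q" using i by auto
    show ?case
      using move[OF j, of j] E_braid_down[of j] step.prems step.hyps j q by simp
  qed
  have F: "(e, E j \<cdot> e) \<in> \<xi>" if "1 \<le> j" "j < q" for j
    using up[of j] down[of j] that by (cases "i \<le> j") auto
  \<comment> \<open>Multiplying \<open>e \<sim> E (p + 1) \<cdot> e\<close> by the idempotent of
    rank \<open>p + 2\<close>, on which \<open>e\<close> acts as the identity, leads to rank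
    \<open>p\<close>.\<close>
  have chain: "(e, id_bar n p) \<in> \<xi>" if "z \<le> p" "p \<le> q" "even (n - p)" for p
    using that
  proof (induction "q - p" arbitrary: p rule: less_induct)
    case less
    show ?case
    proof (cases "p = q")
      case True
      then show ?thesis using cong_refl[OF \<xi> e(1)] by (simp add: e_def)
    next
      case False
      then have p: "p + 2 \<le> q" "even (n - (p + 2))" using less.prems q by presburger+
      define h where "h = id_bar n (p + 2)"
      have h: "h \<in> S" "e \<cdot> h = h" unfolding h_def e_def
        using id_bar_in id_bar_mult[OF p(1) q(1) p(2) q(2)] p q by simp_all
      have IH: "(e, h) \<in> \<xi>" unfolding h_def by (rule less.hyps) (use p less.prems in simp_all)
      have Ep: "E (p + 1) \<in> S" using E_in p q by simp
      have "id_bar n p = E (p + 1) \<cdot> h" unfolding h_def using id_bar_step[of "p + 2"] p q by simp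
      also have "\<dots> = (E (p + 1) \<cdot> e) \<cdot> h" using assoc[OF Ep e(1) h(1)] h(2) by simp
      finally have 1: "id_bar n p = (E (p + 1) \<cdot> e) \<cdot> h" .
      have "(e \<cdot> h, (E (p + 1) \<cdot> e) \<cdot> h) \<in> \<xi>" by (rule cong_right[OF \<xi> F h(1)]) (use p in simp_all)
      then have "(h, id_bar n p) \<in> \<xi>" unfolding 1 h(2) .
      then show ?thesis using IH cong_trans[OF \<xi>] by blast
    qed
  qed
  have zq: "z \<le> q" using q3 z01 by auto
  have ew: "(e, \<omega>) \<in> \<xi>" unfolding \<omega>_def by (rule chain[OF order_refl zq bar_parity(1)])
  then show "(id_bar n q, \<omega>) \<in> \<xi>" by (simp add: e_def)
  have eo: "e \<cdot> \<omega> = \<omega>" unfolding e_def \<omega>_def by (rule id_bar_mult[OF zq q(1) bar_parity(1) q(2)])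
  have k: "1 \<le> 2 - z" "2 - z < q" using two_minus_z q3 by auto
  have "(e \<cdot> \<omega>, (E (2 - z) \<cdot> e) \<cdot> \<omega>) \<in> \<xi>" by (rule cong_right[OF \<xi> F[OF k] omega_in])
  then show "(\<omega>, \<kappa>) \<in> \<xi>" unfolding \<kappa>_def using eo assoc[OF Ej[OF k] e(1) omega_in] by simp
qed


lemma omega_id_bar:
  assumes q: "z \<le> q" "q \<le> n" "even (n - q)"
  shows "id_bar n q \<cdot> \<omega> = \<omega>" "\<omega> \<cdot> id_bar n q = \<omega>"
proof -
  show 1: "id_bar n q \<cdot> \<omega> = \<omega>" unfolding \<omega>_def by (rule id_bar_mult[OF q(1,2) bar_parity(1) q(3)])
  have "star (id_bar n q \<cdot> \<omega>) = \<omega> \<cdot> id_bar n q"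
    using star_mult[OF id_bar_in[OF q(2,3)] omega_in] star_id_bar[OF q(2,3)] by simp
  then show "\<omega> \<cdot> id_bar n q = \<omega>" using 1 by simp
qed

text \<open>Write \<open>x = V \<cdot> e \<cdot> V'\<close> with the idempotent \<open>e\<close> of
  its rank. Since \<open>e\<close> acts by constants on the minimal ideal,
  \<open>x \<cdot> \<omega> \<cdot> x = V \<cdot> \<omega> \<cdot> V'\<close>, which arises from
  \<open>x\<close> by exchanging \<open>e\<close> for \<open>\<omega>\<close>.\<close>

lemma retract_rel:
  assumes \<xi>: "congruence (jones n) \<xi>" and rel: "(id_bar n (rank x), \<omega>) \<in> \<xi>" and x: "x \<in> S" "rank x \<le> 2 - z"
  shows "(x, x \<cdot> (\<omega> \<cdot> x)) \<in> \<xi>"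
proof -
  note q = rank_parity[OF x(1)]
  define e where "e = id_bar n (rank x)"
  have e: "e \<in> S" "rank e \<le> 2 - z" "e \<cdot> \<omega> = \<omega>" "\<omega> \<cdot> e = \<omega>" "(e, \<omega>) \<in> \<xi>"
    unfolding e_def using id_bar_in[OF q(1,2)] rank_id_bar[OF q(1,2)] x omega_id_bar[OF q(3,1,2)] rel by simp_all
  obtain vs vs' where v: "set vs \<subseteq> {1..<n}" "set vs' \<subseteq> {1..<n}" "x = word vs \<cdot> (e \<cdot> word vs')"
    unfolding e_def using factor[OF x(1)] by blast
  define V V' where "V = word vs" and "V' = word vs'"
  have V: "V \<in> S" "V' \<in> S" unfolding V_def V'_def using word_in[OF v(1)] word_in[OF v(2)] by simp_all
  have xV: "x = V \<cdot> (e \<cdot> V')" using v(3) by (simp add: V_def V'_def)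
  have "V \<cdot> (e \<cdot> V') \<cdot> \<omega> = V \<cdot> (e \<cdot> (V' \<cdot> \<omega>))" using V e(1) by (simp add: assoc)
  also have "\<dots> = V \<cdot> \<omega>" using omega_collapse'[OF e(1,2) V(2)] e(3) by simp
  finally have 1: "V \<cdot> (e \<cdot> V') \<cdot> \<omega> = V \<cdot> \<omega>" .
  have "\<omega> \<cdot> (V \<cdot> (e \<cdot> V')) = (\<omega> \<cdot> (V \<cdot> e)) \<cdot> V'" using V e(1) by (simp add: assoc)
  also have "\<dots> = \<omega> \<cdot> V'" using omega_collapse[OF e(1,2) V(1)] e(4) by simp
  finally have 2: "\<omega> \<cdot> (V \<cdot> (e \<cdot> V')) = \<omega> \<cdot> V'" .
  have "x \<cdot> (\<omega> \<cdot> x) = (x \<cdot> \<omega>) \<cdot> (\<omega> \<cdot> x)" using x by (simp add: assoc)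
  also have "\<dots> = (V \<cdot> \<omega>) \<cdot> (\<omega> \<cdot> V')" unfolding xV 1 2 ..
  also have "\<dots> = V \<cdot> (\<omega> \<cdot> V')" using V by (simp add: assoc)
  finally have 3: "x \<cdot> (\<omega> \<cdot> x) = V \<cdot> (\<omega> \<cdot> V')" .
  have "(V \<cdot> (e \<cdot> V'), V \<cdot> (\<omega> \<cdot> V')) \<in> \<xi>" by (intro cong_left[OF \<xi>] cong_right[OF \<xi>] e V)
  then show ?thesis unfolding 3 xV[symmetric] .
qed

lemma retract_facts:
  assumes x: "x \<in> S"
  shows "x \<cdot> (\<omega> \<cdot> x) \<in> S" "rank (x \<cdot> (\<omega> \<cdot> x)) = z"
    "\<omega> \<cdot> (x \<cdot> (\<omega> \<cdot> x)) = \<omega> \<cdot> x" "x \<cdot> (\<omega> \<cdot> x) \<cdot> \<omega> = x \<cdot> \<omega>"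
proof -
  show "x \<cdot> (\<omega> \<cdot> x) \<in> S" using x by simp
  show "rank (x \<cdot> (\<omega> \<cdot> x)) = z"
    using rank_mult_right[of x "\<omega> \<cdot> x"] rank_omega_mult(1)[OF x] rank_min[of "x \<cdot> (\<omega> \<cdot> x)"] x by simp
  have "\<omega> \<cdot> (x \<cdot> (\<omega> \<cdot> x)) = (\<omega> \<cdot> (x \<cdot> \<omega>)) \<cdot> x" using x by (simp add: assoc del: omega_sandwich)
  then show "\<omega> \<cdot> (x \<cdot> (\<omega> \<cdot> x)) = \<omega> \<cdot> x" using x by simp
  show "x \<cdot> (\<omega> \<cdot> x) \<cdot> \<omega> = x \<cdot> \<omega>" using x by (simp add: assoc)
qed

text \<open>As \<open>mu i\<close> is contained in \<open>\<xi>\<close>, every element of the ideal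
  is related to its retract, so all is decided in a rectangular band by two questions: do related
  elements ever differ in the left coordinate, and do they ever differ in the right one? The four
  answers give the four congruences.\<close>

lemma cong_between:
  assumes \<xi>: "congruence (jones n) \<xi>" and i: "z \<le> i" "i \<le> 2 - z" and lo: "mu i \<subseteq> \<xi>" and hi: "\<xi> \<subseteq> R_cong n i"
  shows "\<xi> \<in> {mu i, lam i, rho i, R_cong n i}"
proof -
  \<comment> \<open>No rank lies below \<open>z\<close>, so \<open>separate\<close> applies to any
    two different left coordinates. It is stated for all congruences because the mirror image is
    needed for the right ones.\<close>
  have omega_sep: "(\<omega>, \<kappa>) \<in> \<zeta>" if \<zeta>: "congruence (jones n) \<zeta>" and xy: "(x, y) \<in> \<zeta>" "x \<cdot> \<omega> \<noteq> y \<cdot> \<omega>" for \<zeta> x y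
  proof -
    have S: "x \<in> S" "y \<in> S" using cong_in[OF \<zeta> xy(1)] by blast+
    have r: "rank (x \<cdot> \<omega>) = z" "rank (y \<cdot> \<omega>) = z" using rank_omega_mult S by blast+
    have "cup (x \<cdot> \<omega>) = cup \<omega>" "cup (y \<cdot> \<omega>) = cup \<omega>" using cup_mult[OF _ omega_in] r S by simp_all
    then have ne: "cap (x \<cdot> \<omega>) \<noteq> cap (y \<cdot> \<omega>)" using eqI[of "x \<cdot> \<omega>" "y \<cdot> \<omega>"] S xy(2) by auto
    have nosep: "\<not> rank d < z" if "(c, d) \<in> \<zeta>" for c d
      using cong_in[OF \<zeta> that] rank_parity(3)[of d] by simp
    show ?thesis
      using separate[OF \<zeta> cong_right[OF \<zeta> xy(1) omega_in] r ne] nosep by blast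
  qed
  have retr: "(x, x \<cdot> (\<omega> \<cdot> x)) \<in> \<xi>" if "x \<in> S" "rank x \<le> i" for x
    using lo retract_facts[OF that(1)] that i unfolding mu_iff subset_iff split_paired_All by simp
  have lift: "(x, y) \<in> \<xi>" if xy: "x \<in> S" "y \<in> S" "rank x \<le> i" "rank y \<le> i"
    "(x \<cdot> (\<omega> \<cdot> x), y \<cdot> (\<omega> \<cdot> y)) \<in> \<xi>" for x y
    using retr[OF xy(1,3)] retr[OF xy(2,4)] xy(5) cong_trans[OF \<xi>] cong_sym[OF \<xi>] by blast
  have A: "lam i \<subseteq> \<xi>" if "(x, y) \<in> \<xi>" "x \<cdot> \<omega> \<noteq> y \<cdot> \<omega>" for x y
  proof (rule subrelI)
    have l: "lam z \<subseteq> \<xi>" by (rule lam_z_sub[OF \<xi> omega_sep[OF \<xi> that]])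
    fix a b assume ab: "(a, b) \<in> lam i"
    show "(a, b) \<in> \<xi>"
    proof (cases "a = b")
      case False
      then have "a \<in> S" "b \<in> S" "rank a \<le> i" "rank b \<le> i" "\<omega> \<cdot> a = \<omega> \<cdot> b" using ab unfolding lam_iff by blast+
      moreover from this have "(a \<cdot> (\<omega> \<cdot> a), b \<cdot> (\<omega> \<cdot> b)) \<in> lam z"
        unfolding lam_iff using retract_facts[of a] retract_facts[of b] by simp
      ultimately show ?thesis using l lift by blast
    qed (use ab cong_refl[OF \<xi>] lam_iff in blast)
  qed
  have B: "rho i \<subseteq> \<xi>" if xy: "(x, y) \<in> \<xi>" "\<omega> \<cdot> x \<noteq> \<omega> \<cdot> y" for x y
  proof (rule subrelI)
    have S: "x \<in> S" "y \<in> S" using cong_in[OF \<xi> xy(1)] by blast+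
    have "(star x, star y) \<in> star_image \<xi>" "star x \<cdot> \<omega> \<noteq> star y \<cdot> \<omega>" using xy star_swap[OF S] by simp_all
    from omega_sep[OF congruence_star_image[OF \<xi>] this] have "(\<omega>, star \<kappa>) \<in> \<xi>" by simp
    then have r: "rho z \<subseteq> \<xi>" by (rule rho_z_sub[OF \<xi>])
    fix a b assume ab: "(a, b) \<in> rho i"
    show "(a, b) \<in> \<xi>"
    proof (cases "a = b")
      case False
      then have "a \<in> S" "b \<in> S" "rank a \<le> i" "rank b \<le> i" "a \<cdot> \<omega> = b \<cdot> \<omega>" using ab unfolding rho_iff by blast+
      moreover from this have "(a \<cdot> (\<omega> \<cdot> a), b \<cdot> (\<omega> \<cdot> b)) \<in> rho z"
        unfolding rho_iff using retract_facts[of a] retract_facts[of b] by simp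
      ultimately show ?thesis using r lift by blast
    qed (use ab cong_refl[OF \<xi>] rho_iff in blast)
  qed
  have inI: "x \<in> S \<and> y \<in> S \<and> (x = y \<or> rank x \<le> i \<and> rank y \<le> i)" if "(x, y) \<in> \<xi>" for x y
    using hi that R_cong_iff by blast
  consider (both) "\<exists>x y. (x, y) \<in> \<xi> \<and> x \<cdot> \<omega> \<noteq> y \<cdot> \<omega>" "\<exists>x y. (x, y) \<in> \<xi> \<and> \<omega> \<cdot> x \<noteq> \<omega> \<cdot> y"
    | (l) "\<exists>x y. (x, y) \<in> \<xi> \<and> x \<cdot> \<omega> \<noteq> y \<cdot> \<omega>" "\<And>x y. (x, y) \<in> \<xi> \<Longrightarrow> \<omega> \<cdot> x = \<omega> \<cdot> y"
    | (r) "\<And>x y. (x, y) \<in> \<xi> \<Longrightarrow> x \<cdot> \<omega> = y \<cdot> \<omega>" "\<exists>x y. (x, y) \<in> \<xi> \<and> \<omega> \<cdot> x \<noteq> \<omega> \<cdot> y"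
    | (none) "\<And>x y. (x, y) \<in> \<xi> \<Longrightarrow> x \<cdot> \<omega> = y \<cdot> \<omega>" "\<And>x y. (x, y) \<in> \<xi> \<Longrightarrow> \<omega> \<cdot> x = \<omega> \<cdot> y"
    by blast
  then show ?thesis
  proof cases
    case both
    then have lr: "lam i \<subseteq> \<xi>" "rho i \<subseteq> \<xi>" using A B by blast+
    have "R_cong n i \<subseteq> \<xi>"
    proof (rule subrelI)
      fix x y assume "(x, y) \<in> R_cong n i"
      then have S: "x \<in> S" "y \<in> S" and d: "x = y \<or> rank x \<le> i \<and> rank y \<le> i" unfolding R_cong_iff by blast+
      show "(x, y) \<in> \<xi>"
      proof (cases "x = y")
        case True
        then show ?thesis using cong_refl[OF \<xi>] S by simp
      next
        case False
        then have r: "rank x \<le> i" "rank y \<le> i" using d by blast+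
        \<comment> \<open>The product has the left coordinate of \<open>x\<close> and the right one
          of \<open>y\<close>, so \<open>rho i\<close> links it to \<open>x\<close> and
          \<open>lam i\<close> to \<open>y\<close>.\<close>
        have xy: "x \<cdot> y \<in> S" "rank (x \<cdot> y) \<le> i" using S r rank_mult_left[OF S] by simp_all
        have "(x \<cdot> y) \<cdot> \<omega> = x \<cdot> \<omega>" using omega_collapse'[of x y] S r i by (simp add: assoc)
        then have "(x, x \<cdot> y) \<in> rho i" unfolding rho_iff using S r xy by simp
        moreover have "\<omega> \<cdot> (x \<cdot> y) = \<omega> \<cdot> y" using omega_collapse[of y x] S r i by simp
        then have "(x \<cdot> y, y) \<in> lam i" unfolding lam_iff using S r xy by simp
        ultimately show ?thesis using lr cong_trans[OF \<xi>] by blast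
      qed
    qed
    then show ?thesis using hi by blast
  next
    case l
    then have "lam i \<subseteq> \<xi>" using A by blast
    moreover have "\<xi> \<subseteq> lam i"
    proof (rule subrelI)
      fix x y assume xy: "(x, y) \<in> \<xi>"
      show "(x, y) \<in> lam i" unfolding lam_iff using inI[OF xy] l(2)[OF xy] by blast
    qed
    ultimately show ?thesis by blast
  next
    case r
    then have "rho i \<subseteq> \<xi>" using B by blast
    moreover have "\<xi> \<subseteq> rho i"
    proof (rule subrelI)
      fix x y assume xy: "(x, y) \<in> \<xi>"
      show "(x, y) \<in> rho i" unfolding rho_iff using inI[OF xy] r(1)[OF xy] by blast
    qed
    ultimately show ?thesis by blast
  next
    case none
    have "\<xi> \<subseteq> mu i"
    proof (rule subrelI)
      fix x y assume xy: "(x, y) \<in> \<xi>"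
      show "(x, y) \<in> mu i" unfolding mu_iff using inI[OF xy] none(1)[OF xy] none(2)[OF xy] by blast
    qed
    then show ?thesis using lo by blast
  qed
qed

text \<open>Once the idempotent of rank \<open>q\<close> is related to \<open>\<omega>\<close>,
  every element of the ideal, factoring through it, sinks into the minimal ideal. There
  \<open>\<omega> \<sim> \<kappa>\<close> and its mirror image identify everything.\<close>

lemma R_cong_sub_large:
  assumes \<xi>: "congruence (jones n) \<xi>" and cd: "(c, d) \<in> \<xi>" "rank c = q" "rank d < q" and q3: "3 \<le> q"
  shows "R_cong n q \<subseteq> \<xi>"
proof (rule subrelI)
  have S: "c \<in> S" "d \<in> S" using cong_in[OF \<xi> cd(1)] by blast+
  have q: "q \<le> n" "even (n - q)" using rank_parity[OF S(1)] cd(2) by blast+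
  note col = large_collapse[OF \<xi> cd q3]
  have "(star c, star d) \<in> star_image \<xi>" "rank (star c) = q" "rank (star d) < q" using cd S rank_star by simp_all
  from large_collapse(2)[OF congruence_star_image[OF \<xi>] this q3] have "(\<omega>, star \<kappa>) \<in> \<xi>" by simp
  then have lr: "lam z \<subseteq> \<xi>" "rho z \<subseteq> \<xi>" using lam_z_sub[OF \<xi> col(2)] rho_z_sub[OF \<xi>] by blast+
  have low: "(x, y) \<in> \<xi>" if x: "x \<in> S" "rank x = z" and y: "y \<in> S" "rank y = z" for x y
  proof -
    have xy: "x \<cdot> y \<in> S" "rank (x \<cdot> y) \<le> z" using x y rank_mult_left[of x y] by simp_all
    have "(x \<cdot> y) \<cdot> \<omega> = x \<cdot> \<omega>" using omega_collapse'[of x y] x y z_le by (simp add: assoc)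
    then have "(x, x \<cdot> y) \<in> rho z" unfolding rho_iff using x y xy by simp
    moreover have "\<omega> \<cdot> (x \<cdot> y) = \<omega> \<cdot> y" using omega_collapse[of y x] x y z_le by simp
    then have "(x \<cdot> y, y) \<in> lam z" unfolding lam_iff using x y xy by simp
    ultimately show ?thesis using lr cong_trans[OF \<xi>] by blast
  qed
  have down: "\<exists>x'\<in>S. rank x' = z \<and> (x, x') \<in> \<xi>" if x: "x \<in> S" "rank x \<le> q" for x
  proof -
    obtain s t where st: "s \<in> S" "t \<in> S" "x = s \<cdot> id_bar n q \<cdot> t"
      using factor_through[OF id_bar_in[OF q] x(1)] x(2) rank_id_bar[OF q] by auto
    have "(s \<cdot> id_bar n q \<cdot> t, s \<cdot> \<omega> \<cdot> t) \<in> \<xi>" by (intro cong_left[OF \<xi>] cong_right[OF \<xi>] col st)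
    moreover have "s \<cdot> \<omega> \<cdot> t \<in> S" "rank (s \<cdot> \<omega> \<cdot> t) = z"
      using st rank_mult_left[of "s \<cdot> \<omega>" t] rank_omega_mult(2)[of s] rank_min[of "s \<cdot> \<omega> \<cdot> t"] by simp_all
    ultimately show ?thesis using st(3) by blast
  qed
  fix x y assume "(x, y) \<in> R_cong n q"
  then have xy: "x \<in> S" "y \<in> S" "x = y \<or> rank x \<le> q \<and> rank y \<le> q" unfolding R_cong_iff by blast+
  show "(x, y) \<in> \<xi>"
  proof (cases "x = y")
    case True
    then show ?thesis using cong_refl[OF \<xi>] xy by simp
  next
    case False
    then have r: "rank x \<le> q" "rank y \<le> q" using xy(3) by blast+
    obtain x' where x': "x' \<in> S" "rank x' = z" "(x, x') \<in> \<xi>" using down[OF xy(1) r(1)] by blast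
    obtain y' where y': "y' \<in> S" "rank y' = z" "(y, y') \<in> \<xi>" using down[OF xy(2) r(2)] by blast
    show ?thesis
      by (rule cong_trans[OF \<xi> cong_trans[OF \<xi> x'(3) low[OF x'(1,2) y'(1,2)]] cong_sym[OF \<xi> y'(3)]])
  qed
qed

text \<open>Below \<open>q\<close> the only possible rank is \<open>z\<close>, and an element of
  that rank fixed by the idempotent on both sides has the coordinates of \<open>\<omega>\<close>. So
  the idempotent is related to \<open>\<omega>\<close>, every element of the ideal to its retract,
  and elements with equal retracts to each other.\<close>

lemma mu_sub_small:
  assumes \<xi>: "congruence (jones n) \<xi>" and cd: "(c, d) \<in> \<xi>" "rank c = q" "rank d < q" and q2: "q \<le> 2 - z"
  shows "mu q \<subseteq> \<xi>"
proof (rule subrelI)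
  have S: "c \<in> S" "d \<in> S" using cong_in[OF \<xi> cd(1)] by blast+
  have q: "q \<le> n" "even (n - q)" "z \<le> q" using rank_parity[OF S(1)] cd(2) by blast+
  let ?e = "id_bar n q"
  have e: "?e \<in> S" "rank ?e \<le> 2 - z" "?e \<cdot> \<omega> = \<omega>" "\<omega> \<cdot> ?e = \<omega>"
    using id_bar_in[OF q(1,2)] rank_id_bar[OF q(1,2)] q2 omega_id_bar[OF q(3,1,2)] by simp_all
  obtain b where b: "b \<in> S" "rank b < q" "?e \<cdot> b = b" "b \<cdot> ?e = b" "(?e, b) \<in> \<xi>"
    using id_bar_collapse[OF \<xi> cd] by blast
  have small: "rank x = z" if "x \<in> S" "rank x < q" for x
    using rank_parity[OF that(1)] that(2) q q2 z01 bar_parity by (cases "rank x = 1") auto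
  have "b = \<omega>"
  proof (rule rank_z_eqI[OF b(1) small[OF b(1,2)] omega_in rank_omega])
    have "b \<cdot> \<omega> = ?e \<cdot> (b \<cdot> \<omega>)" using assoc[OF e(1) b(1) omega_in] b(3) by simp
    then show "b \<cdot> \<omega> = \<omega> \<cdot> \<omega>" using omega_collapse'[OF e(1,2) b(1)] e(3) by simp
    show "\<omega> \<cdot> b = \<omega> \<cdot> \<omega>" using omega_collapse[OF e(1,2) b(1)] b(4) e(4) by simp
  qed
  then have rel: "(?e, \<omega>) \<in> \<xi>" using b(5) by simp
  have retr: "(x, x \<cdot> (\<omega> \<cdot> x)) \<in> \<xi>" if x: "x \<in> S" "rank x \<le> q" for x
  proof (cases "rank x = q")
    case True
    then show ?thesis using retract_rel[OF \<xi> _ x(1)] rel q2 by simp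
  next
    case False
    then have "x \<cdot> (\<omega> \<cdot> x) = x" using omega_mult_cancel[OF x(1) small[OF x(1)]] x(2) by simp
    then show ?thesis using cong_refl[OF \<xi> x(1)] by simp
  qed
  fix x y assume "(x, y) \<in> mu q"
  then have xy: "x \<in> S" "y \<in> S" "x = y \<or> rank x \<le> q \<and> rank y \<le> q \<and> \<omega> \<cdot> x = \<omega> \<cdot> y \<and> x \<cdot> \<omega> = y \<cdot> \<omega>"
    unfolding mu_iff by blast+
  show "(x, y) \<in> \<xi>"
  proof (cases "x = y")
    case True
    then show ?thesis using cong_refl[OF \<xi>] xy by simp
  next
    case False
    then have d: "rank x \<le> q" "rank y \<le> q" "\<omega> \<cdot> x = \<omega> \<cdot> y" "x \<cdot> \<omega> = y \<cdot> \<omega>" using xy by blast+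
    have "x \<cdot> (\<omega> \<cdot> x) = y \<cdot> (\<omega> \<cdot> y)"
      by (rule rank_z_eqI) (use retract_facts[OF xy(1)] retract_facts[OF xy(2)] d in simp_all)
    then show ?thesis using retr[OF xy(1) d(1)] retr[OF xy(2) d(2)] cong_trans[OF \<xi>] cong_sym[OF \<xi>] by metis
  qed
qed

text \<open>The largest rank \<open>q\<close> in a non-diagonal pair bounds the congruence above by
  \<open>R_cong n q\<close>. Below it is bounded by what a pair of ranks \<open>q\<close> and less
  than \<open>q\<close> generates, or by the diagonal if \<open>q = z\<close>.\<close>

lemma classification:
  assumes \<xi>: "congruence (jones n) \<xi>"
  shows "(\<exists>q\<in>set (ranks_from z n). \<xi> = R_cong n q) \<or>
    (\<exists>i\<in>set (ranks_from z n). i \<le> 2 - z \<and> \<xi> \<in> {lam i, rho i, mu i})"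
proof (cases "\<xi> \<subseteq> Id_on S")
  case True
  moreover have "Id_on S \<subseteq> \<xi>" using cong_refl[OF \<xi>] by auto
  ultimately have "\<xi> = mu z" using mu_z by blast
  moreover have "z \<in> set (ranks_from z n)" unfolding ranks_set using bar_parity by simp
  ultimately show ?thesis using z_le by blast
next
  case False
  define D where "D = {rank a | a b. (a, b) \<in> \<xi> \<and> a \<noteq> b}"
  have "D \<subseteq> {..n}" unfolding D_def using cong_in[OF \<xi>] rank_parity(1) by fastforce
  then have fin: "finite D" by (rule finite_subset) simp
  have ne: "D \<noteq> {}" using False cong_in[OF \<xi>] unfolding D_def by fastforce
  define q where "q = Max D"
  have "q \<in> D" unfolding q_def by (rule Max_in[OF fin ne])
  then obtain a b where ab: "(a, b) \<in> \<xi>" "a \<noteq> b" "rank a = q" unfolding D_def by blast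
  have S: "a \<in> S" "b \<in> S" using cong_in[OF \<xi> ab(1)] by blast+
  have q: "q \<le> n" "even (n - q)" "z \<le> q" using rank_parity[OF S(1)] ab(3) by blast+
  have qr: "q \<in> set (ranks_from z n)" unfolding ranks_set using q by simp
  have bound: "rank x \<le> q \<and> rank y \<le> q" if "(x, y) \<in> \<xi>" "x \<noteq> y" for x y
  proof -
    have "rank x \<in> D" "rank y \<in> D" unfolding D_def using that cong_sym[OF \<xi> that(1)] by blast+
    then show ?thesis unfolding q_def using Max_ge[OF fin] by blast
  qed
  have hi: "\<xi> \<subseteq> R_cong n q"
    by (rule subrelI) (use bound cong_in[OF \<xi>] R_cong_iff in blast)
  \<comment> \<open>Different elements of rank \<open>q\<close> differ in caps or in cups. Without a
    pair of different ranks, \<open>separate\<close> would give \<open>q = z\<close> in the first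
    case, and its application to the mirror image in the second.\<close>
  have sep: "\<exists>c d. (c, d) \<in> \<xi> \<and> rank c = q \<and> rank d < q" if "q \<noteq> z"
  proof (rule ccontr)
    assume no: "\<not> ?thesis"
    then have "\<not> rank b < q" using ab by blast
    then have rb: "rank b = q" using bound[OF ab(1,2)] by simp
    have "cap a \<noteq> cap b \<or> cup a \<noteq> cup b" using eqI[OF S] ab(2) by blast
    then show False
    proof
      assume "cap a \<noteq> cap b"
      then show False using separate[OF \<xi> ab(1,3) rb] no \<open>q \<noteq> z\<close> by blast
    next
      assume "cup a \<noteq> cup b"
      then have c: "cap (star a) \<noteq> cap (star b)" using cup_eq_iff_cap_star[OF S] by blast
      have "\<not> rank d < q" if "(c, d) \<in> star_image \<xi>" "rank c = q" for c d
      proof -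
        have "star c \<in> S" "star d \<in> S" "(star c, star d) \<in> \<xi>" using that(1) cong_in[OF \<xi>] by auto
        then show ?thesis using no that(2) rank_star[of c] rank_star[of d] star_in_iff by metis
      qed
      then show False
        using separate[OF congruence_star_image[OF \<xi>], of "star a" "star b" q] ab rb S rank_star c \<open>q \<noteq> z\<close> by simp
    qed
  qed
  show ?thesis
  proof (cases "3 \<le> q")
    case True
    then have "q \<noteq> z" using z01 by auto
    then obtain c d where "(c, d) \<in> \<xi>" "rank c = q" "rank d < q" using sep by blast
    then have "R_cong n q \<subseteq> \<xi>" using R_cong_sub_large[OF \<xi> _ _ _ True] by blast
    then show ?thesis using hi qr by blast
  next
    case False
    have q2: "q \<le> 2 - z"
    proof (cases "z = 0")
      case False
      then have "z = 1" using z01 by simp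
      moreover from this have "q \<noteq> 2" using q bar_parity by auto
      ultimately show ?thesis using \<open>\<not> 3 \<le> q\<close> by simp
    qed (use False in simp)
    have "mu q \<subseteq> \<xi>"
    proof (cases "q = z")
      case True
      then show ?thesis using mu_z cong_refl[OF \<xi>] by auto
    next
      case False
      then show ?thesis using sep mu_sub_small[OF \<xi> _ _ _ q2] by blast
    qed
    then have "\<xi> \<in> {mu q, lam q, rho q, R_cong n q}" by (rule cong_between[OF \<xi> q(3) q2 _ hi])
    then show ?thesis using qr q2 by blast
  qed
qed

subsection \<open>Inclusions\<close>

text \<open>Two witnesses tell the four kinds apart: \<open>(\<omega>, \<kappa>)\<close> differs in
  the left coordinate only, and \<open>(\<omega>, star \<kappa>)\<close> in the right one
  only.\<close>

lemma kappa_mem: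
  assumes "z \<le> i"
  shows "(\<omega>, \<kappa>) \<in> lam i" "(\<omega>, \<kappa>) \<in> R_cong n i" "(\<omega>, \<kappa>) \<notin> rho i" "(\<omega>, \<kappa>) \<notin> mu i"
    "(\<omega>, star \<kappa>) \<in> rho i" "(\<omega>, star \<kappa>) \<in> R_cong n i" "(\<omega>, star \<kappa>) \<notin> lam i" "(\<omega>, star \<kappa>) \<notin> mu i"
  using assms kappa_neq[symmetric] star_kappa_neq[symmetric]
  by (simp_all add: lam_iff rho_iff mu_iff R_cong_iff star_in rank_star)

lemma cong_mono: "i \<le> j \<Longrightarrow> mu i \<subseteq> mu j" "i \<le> j \<Longrightarrow> lam i \<subseteq> lam j" "i \<le> j \<Longrightarrow> rho i \<subseteq> rho j"
    "i \<le> j \<Longrightarrow> R_cong n i \<subseteq> R_cong n j" "mu i \<subseteq> lam i" "mu i \<subseteq> rho i" "lam i \<subseteq> R_cong n i" "rho i \<subseteq> R_cong n i"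
  by (rule subrelI; auto simp: lam_iff rho_iff mu_iff R_cong_iff)+

text \<open>The witness between levels: this idempotent has the same products with
  \<open>\<omega>\<close> as \<open>\<omega>\<close> itself, but its rank keeps it out of every
  smaller ideal.\<close>

lemma id_bar_omega_mem:
  assumes q: "z \<le> p" "p < q" "q \<le> n" "even (n - q)"
  shows "(id_bar n q, \<omega>) \<in> mu q" "(id_bar n q, \<omega>) \<notin> R_cong n p"
proof -
  have zq: "z \<le> q" using q by simp
  note e = id_bar_in[OF q(3,4)] rank_id_bar[OF q(3,4)] omega_id_bar[OF zq q(3,4)]
  have "id_bar n q \<noteq> \<omega>" using e(2) rank_omega q by auto
  then show "(id_bar n q, \<omega>) \<in> mu q" "(id_bar n q, \<omega>) \<notin> R_cong n p"
    using e q zq by (simp_all add: mu_iff R_cong_iff)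
qed

lemma R_cong_strict:
  assumes "z \<le> p" "p < q" "q \<le> n" "even (n - q)"
  shows "R_cong n p \<subset> R_cong n q"
  using id_bar_omega_mem[OF assms] cong_mono(4)[of p q] cong_mono(5,7)[of q] assms by auto

lemma sorted_R: 
  assumes "z \<le> m" "even (n - m)"
  shows "sorted_wrt (\<subset>) (map (R_cong n) (ranks_from m n))"
proof -
  have "sorted_wrt (<) (ranks_from m n)"
    unfolding ranks_from_def by (rule sorted_wrt_filter[OF sorted_wrt_upt])
  moreover have "R_cong n p \<subset> R_cong n q" if "p \<in> set (ranks_from m n)" "q \<in> set (ranks_from m n)" "p < q" for p q
  proof -
    have "m \<le> p" "m \<le> q" "q \<le> n" "even (q - m)"
      using that unfolding ranks_from_def set_filter set_upt by auto
    then have "even (n - q)" using assms(2) by presburger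
    then show ?thesis using R_cong_strict[of p q] that assms \<open>m \<le> p\<close> \<open>q \<le> n\<close> by simp
  qed
  ultimately show ?thesis unfolding sorted_wrt_map by (rule sorted_wrt_mono_rel[rotated])
qed

lemma distinct_R: "distinct (map (R_cong n) (ranks_from z n))"
proof -
  have "R_cong n p \<noteq> R_cong n q" if "p \<in> set (ranks_from z n)" "q \<in> set (ranks_from z n)" "p < q" for p q
    using R_cong_strict[of p q] that unfolding ranks_set by blast
  then have "inj_on (R_cong n) (set (ranks_from z n))"
    by (intro inj_onI) (metis linorder_neqE_nat)
  then show ?thesis by (simp add: distinct_map ranks_from_def)
qed

lemma R_cong_top: "R_cong n n = S \<times> S"
  using rank_parity(1) by (intro equalityI subrelI) (auto simp: R_cong_iff)

lemma R_cong_neq: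
  assumes "q \<in> set (ranks_from z n)" "z \<le> i"
  shows "R_cong n q \<noteq> lam i" "R_cong n q \<noteq> rho i" "R_cong n q \<noteq> mu i"
  using assms kappa_mem[of i] kappa_mem[of q] unfolding ranks_set by blast+

lemma IN_pairs:
  "{(I, M). retractable_IN_pair (jones n) I M \<and> (\<exists>q\<in>set (ranks_from z n). M = {id_bar n q})} =
    C_pair n ` {p \<in> set (ranks_from z n). p \<le> 2 - z}"
proof (intro equalityI subsetI)
  fix P assume "P \<in> {(I, M). retractable_IN_pair (jones n) I M \<and> (\<exists>q\<in>set (ranks_from z n). M = {id_bar n q})}"
  then obtain I q where P: "P = (I, {id_bar n q})" "retractable_IN_pair (jones n) I {id_bar n q}" "q \<in> set (ranks_from z n)"
    by blast
  then show "P \<in> C_pair n ` {p \<in> set (ranks_from z n). p \<le> 2 - z}"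
    using retractable_IN_pair_iff[OF P(3)] unfolding C_pair_def by blast
next
  fix P assume "P \<in> C_pair n ` {p \<in> set (ranks_from z n). p \<le> 2 - z}"
  then obtain p where p: "p \<in> set (ranks_from z n)" "p \<le> 2 - z" "P = (rank_ideal n p, {id_bar n (p + 2)})"
    unfolding C_pair_def by blast
  \<comment> \<open>Here \<open>p + 2\<close> is 3 for odd \<open>n\<close>, and at most 4 for even
    \<open>n\<close>; an even \<open>n \<ge> 3\<close> is at least 4.\<close>
  have "p + 2 \<le> n" "even (n - (p + 2))"
    using p(1,2) n3 z01 bar_parity unfolding ranks_set by auto presburger+
  then have "p + 2 \<in> set (ranks_from z n)" using p(1) unfolding ranks_set by simp
  then show "P \<in> {(I, M). retractable_IN_pair (jones n) I M \<and> (\<exists>q\<in>set (ranks_from z n). M = {id_bar n q})}"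
    using retractable_IN_pair_iff p by blast
qed

lemma Cong_eq:
  "Cong (jones n) = R_cong n ` set (ranks_from z n) \<union>
    (\<Union>i\<in>{p \<in> set (ranks_from z n). p \<le> 2 - z}. {lam i, rho i, mu i})"
  using classification congruence_R congruence_lam congruence_rho congruence_mu
  unfolding Cong_def by blast

lemma star_congruence_iff: "star_congruence n \<xi> \<longleftrightarrow> congruence (jones n) \<xi> \<and> \<xi> \<subseteq> star_image \<xi>"
  unfolding star_congruence_def star_image_def by blast

lemma star_congruence_R: "star_congruence n (R_cong n q)"
  using congruence_R by (simp add: star_congruence_iff star_image_R)

lemma star_congruence_mu: "q \<le> 2 - z \<Longrightarrow> star_congruence n (mu q)"
  using congruence_mu by (simp add: star_congruence_iff star_image_mu)

lemma not_star_congruence: "z \<le> q \<Longrightarrow> \<not> star_congruence n (lam q)" "z \<le> q \<Longrightarrow> \<not> star_congruence n (rho q)"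
  using kappa_mem[of q] by (auto simp: star_congruence_iff star_image_lam star_image_rho)


lemma covered_inI:
  assumes "x \<in> P" "y \<in> P" "x \<subset> y" "\<And>w. w \<in> P \<Longrightarrow> x \<subset> w \<Longrightarrow> \<not> w \<subset> y"
  shows "covered_in P x y"
  using assms unfolding covered_in_def by blast

section \<open>The two parities\<close>

lemma theorem_odd:
  assumes z1: "z = 1"
  shows
    "{(I, M). retractable_IN_pair (jones n) I M \<and> (\<exists>q \<in> set (ranks_from z n). M = {id_bar n q})} = {C_pair n 1}"
    "congruence (jones n) (lambda_cong n 1)" "congruence (jones n) (rho_cong n 1)" "congruence (jones n) (mu_cong n 1)"
    "distinct (map (R_cong n) (ranks_from z n) @ [lambda_cong n 1, rho_cong n 1, mu_cong n 1])"
    "Cong (jones n) = set (map (R_cong n) (ranks_from z n)) \<union> {lambda_cong n 1, rho_cong n 1, mu_cong n 1}"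
    "mu_cong n 1 = Id_on S"
    "\<forall>\<xi> \<in> Cong (jones n). mu_cong n 1 \<subseteq> \<xi>"
    "covered_in (Cong (jones n)) (mu_cong n 1) (lambda_cong n 1)"
    "covered_in (Cong (jones n)) (mu_cong n 1) (rho_cong n 1)"
    "\<not> lambda_cong n 1 \<subseteq> rho_cong n 1" "\<not> rho_cong n 1 \<subseteq> lambda_cong n 1"
    "covered_in (Cong (jones n)) (lambda_cong n 1) (R_cong n 1)"
    "covered_in (Cong (jones n)) (rho_cong n 1) (R_cong n 1)"
    "sorted_wrt (\<subset>) (map (R_cong n) (ranks_from 1 n))"
    "{\<xi>. star_congruence n \<xi>} = Cong (jones n) - {lambda_cong n 1, rho_cong n 1}"
    "{\<xi>. star_congruence n \<xi>} = set (map (R_cong n) (ranks_from z n)) \<union> {mu_cong n 1}"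
proof -
  have le: "z \<le> 1" "1 \<le> 2 - z" using z1 by simp_all
  note L = IN_congs[OF le]
  have small: "{p \<in> set (ranks_from z n). p \<le> 2 - z} = {1}"
    unfolding ranks_set using z1 bar_parity by auto
  have r1: "1 \<in> set (ranks_from z n)" using small by blast
  show "{(I, M). retractable_IN_pair (jones n) I M \<and> (\<exists>q \<in> set (ranks_from z n). M = {id_bar n q})} = {C_pair n 1}"
    unfolding IN_pairs small by simp
  show "congruence (jones n) (lambda_cong n 1)" "congruence (jones n) (rho_cong n 1)" "congruence (jones n) (mu_cong n 1)"
    unfolding L using congruence_lam[OF le(2)] congruence_rho[OF le(2)] congruence_mu[OF le(2)] by blast+
  note k = kappa_mem[OF le(1)]
  have neq: "lam 1 \<noteq> rho 1" "lam 1 \<noteq> mu 1" "rho 1 \<noteq> mu 1" using k by blast+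
  have Rneq: "R_cong n q \<noteq> lam 1" "R_cong n q \<noteq> rho 1" "R_cong n q \<noteq> mu 1" if "q \<in> set (ranks_from z n)" for q
    using R_cong_neq[OF that le(1)] by blast+
  show "distinct (map (R_cong n) (ranks_from z n) @ [lambda_cong n 1, rho_cong n 1, mu_cong n 1])"
    unfolding L distinct_append using distinct_R neq Rneq by auto
  have C: "Cong (jones n) = set (map (R_cong n) (ranks_from z n)) \<union> {lam 1, rho 1, mu 1}"
    unfolding Cong_eq small by simp
  then show "Cong (jones n) = set (map (R_cong n) (ranks_from z n)) \<union> {lambda_cong n 1, rho_cong n 1, mu_cong n 1}"
    unfolding L .
  have mu1: "mu 1 = Id_on S" using mu_z z1 by simp
  then show "mu_cong n 1 = Id_on S" unfolding L .
  show "\<forall>\<xi> \<in> Cong (jones n). mu_cong n 1 \<subseteq> \<xi>"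
    unfolding L mu1 Cong_def using cong_refl by auto
  have ks: "(\<omega>, \<kappa>) \<in> R_cong n q" "(\<omega>, star \<kappa>) \<in> R_cong n q" if "q \<in> set (ranks_from z n)" for q
    using kappa_mem[of q] that unfolding ranks_set by blast+
  have inC: "lam 1 \<in> Cong (jones n)" "rho 1 \<in> Cong (jones n)" "mu 1 \<in> Cong (jones n)" "R_cong n 1 \<in> Cong (jones n)"
    unfolding C using r1 by auto
  have cases: "(\<exists>q\<in>set (ranks_from z n). w = R_cong n q) \<or> w = lam 1 \<or> w = rho 1 \<or> w = mu 1" if "w \<in> Cong (jones n)" for w
    using that unfolding C by auto
  have R1: "R_cong n 1 \<subseteq> R_cong n q" if "q \<in> set (ranks_from z n)" for q
    using that cong_mono(4)[of 1 q] z1 unfolding ranks_set by simp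
  show "covered_in (Cong (jones n)) (mu_cong n 1) (lambda_cong n 1)"
    unfolding L
  proof (rule covered_inI)
    show "mu 1 \<subset> lam 1" using cong_mono(5)[of 1] neq by blast
    \<comment> \<open>Apart from the two ends every congruence contains
      \<open>(\<omega>, star \<kappa>)\<close>, which \<open>lam 1\<close> does not.\<close>
    fix w assume w: "w \<in> Cong (jones n)" "mu 1 \<subset> w"
    show "\<not> w \<subset> lam 1"
      using cases[OF w(1)] w(2) ks k by (elim disjE bexE) blast+
  qed (rule inC)+
  show "covered_in (Cong (jones n)) (mu_cong n 1) (rho_cong n 1)"
    unfolding L
  proof (rule covered_inI)
    show "mu 1 \<subset> rho 1" using cong_mono(6)[of 1] neq by blast
    fix w assume w: "w \<in> Cong (jones n)" "mu 1 \<subset> w"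
    show "\<not> w \<subset> rho 1"
      using cases[OF w(1)] w(2) ks k by (elim disjE bexE) blast+
  qed (rule inC)+
  show "\<not> lambda_cong n 1 \<subseteq> rho_cong n 1" "\<not> rho_cong n 1 \<subseteq> lambda_cong n 1" unfolding L using k by blast+
  show "covered_in (Cong (jones n)) (lambda_cong n 1) (R_cong n 1)"
    unfolding L
  proof (rule covered_inI)
    show "lam 1 \<subset> R_cong n 1" using cong_mono(7)[of 1] Rneq[OF r1] by blast
    \<comment> \<open>Every \<open>R_cong n q\<close> contains \<open>R_cong n 1\<close>, while
      \<open>rho 1\<close> and \<open>mu 1\<close> lack \<open>(\<omega>, \<kappa>)\<close>.\<close>
    fix w assume w: "w \<in> Cong (jones n)" "lam 1 \<subset> w"
    show "\<not> w \<subset> R_cong n 1"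
      using cases[OF w(1)] w(2) R1 k by (elim disjE bexE) blast+
  qed (rule inC)+
  show "covered_in (Cong (jones n)) (rho_cong n 1) (R_cong n 1)"
    unfolding L
  proof (rule covered_inI)
    show "rho 1 \<subset> R_cong n 1" using cong_mono(8)[of 1] Rneq[OF r1] by blast
    fix w assume w: "w \<in> Cong (jones n)" "rho 1 \<subset> w"
    show "\<not> w \<subset> R_cong n 1"
      using cases[OF w(1)] w(2) R1 k by (elim disjE bexE) blast+
  qed (rule inC)+
  show "sorted_wrt (\<subset>) (map (R_cong n) (ranks_from 1 n))"
    using sorted_R[OF order_refl bar_parity(1)] unfolding z1 .
  have st: "{\<xi>. star_congruence n \<xi>} = set (map (R_cong n) (ranks_from z n)) \<union> {mu 1}"
  proof (intro equalityI subsetI)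
    fix \<xi> assume "\<xi> \<in> {\<xi>. star_congruence n \<xi>}"
    then have s: "star_congruence n \<xi>" by simp
    then have "\<xi> \<in> Cong (jones n)" by (simp add: star_congruence_def Cong_def)
    from cases[OF this] show "\<xi> \<in> set (map (R_cong n) (ranks_from z n)) \<union> {mu 1}"
      using s not_star_congruence[OF le(1)] by auto
  next
    fix \<xi> assume "\<xi> \<in> set (map (R_cong n) (ranks_from z n)) \<union> {mu 1}"
    then show "\<xi> \<in> {\<xi>. star_congruence n \<xi>}" using star_congruence_R star_congruence_mu[OF le(2)] by auto
  qed
  then show "{\<xi>. star_congruence n \<xi>} = set (map (R_cong n) (ranks_from z n)) \<union> {mu_cong n 1}" unfolding L .
  show "{\<xi>. star_congruence n \<xi>} = Cong (jones n) - {lambda_cong n 1, rho_cong n 1}"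
    unfolding st C L using Rneq neq by auto
qed

lemma theorem_even:
  assumes z0: "z = 0"
  shows
    "{(I, M). retractable_IN_pair (jones n) I M \<and> (\<exists>q \<in> set (ranks_from z n). M = {id_bar n q})} = {C_pair n 0, C_pair n 2}"
    "\<forall>i \<in> {0, 2}. congruence (jones n) (lambda_cong n i) \<and> congruence (jones n) (rho_cong n i) \<and>
      congruence (jones n) (mu_cong n i)"
    "distinct (map (R_cong n) (ranks_from z n) @
      [lambda_cong n 0, rho_cong n 0, mu_cong n 0, lambda_cong n 2, rho_cong n 2, mu_cong n 2])"
    "Cong (jones n) = set (map (R_cong n) (ranks_from z n)) \<union>
      {lambda_cong n 0, rho_cong n 0, mu_cong n 0, lambda_cong n 2, rho_cong n 2, mu_cong n 2}"
    "\<forall>\<xi> \<zeta>. \<forall>i \<in> {0, 2}. \<forall>j \<in> {0, 2}.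
      diamond_cong n \<xi> i \<subseteq> diamond_cong n \<zeta> j \<longleftrightarrow> diamond_le \<xi> \<zeta> \<and> i \<le> j"
    "mu_cong n 0 = Id_on S"
    "\<forall>\<xi> \<in> Cong (jones n). mu_cong n 0 \<subseteq> \<xi>"
    "\<forall>\<xi>. \<forall>i \<in> {0, 2}. diamond_cong n \<xi> i \<subseteq> R_cong n 2"
    "sorted_wrt (\<subset>) (map (R_cong n) (ranks_from 2 n))"
    "{\<xi>. star_congruence n \<xi>} =
      Cong (jones n) - {lambda_cong n 0, lambda_cong n 2, rho_cong n 0, rho_cong n 2}"
    "{\<xi>. star_congruence n \<xi>} = set (map (R_cong n) (ranks_from z n)) \<union> {mu_cong n 0, mu_cong n 2}"
proof -
  have le: "z \<le> 0" "0 \<le> 2 - z" "z \<le> 2" "2 \<le> 2 - z" using z0 by simp_all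
  note L = IN_congs[OF le(1,2)] IN_congs[OF le(3,4)]
  have even: "even n" using bar_parity z0 by simp
  have small: "{p \<in> set (ranks_from z n). p \<le> 2 - z} = {0, 2}"
  proof (intro equalityI subsetI)
    fix p assume "p \<in> {p \<in> set (ranks_from z n). p \<le> 2 - z}"
    then have p: "p \<le> 2" "even (n - p)" unfolding ranks_set using z0 by auto
    then have "p \<noteq> 1" using even n3 by auto
    then show "p \<in> {0, 2}" using p by auto
  next
    fix p :: nat assume "p \<in> {0, 2}"
    then show "p \<in> {p \<in> set (ranks_from z n). p \<le> 2 - z}" unfolding ranks_set using z0 n3 even by auto
  qed
  show "{(I, M). retractable_IN_pair (jones n) I M \<and> (\<exists>q \<in> set (ranks_from z n). M = {id_bar n q})} = {C_pair n 0, C_pair n 2}"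
    unfolding IN_pairs small by simp
  show "\<forall>i \<in> {0, 2}. congruence (jones n) (lambda_cong n i) \<and> congruence (jones n) (rho_cong n i) \<and>
      congruence (jones n) (mu_cong n i)"
    using congruence_lam[OF le(2)] congruence_rho[OF le(2)] congruence_mu[OF le(2)]
      congruence_lam[OF le(4)] congruence_rho[OF le(4)] congruence_mu[OF le(4)] L by simp
  note k0 = kappa_mem[OF le(1)] and k2 = kappa_mem[OF le(3)]
  have ks: "(\<omega>, \<kappa>) \<in> R_cong n q" "(\<omega>, star \<kappa>) \<in> R_cong n q" for q
    using kappa_mem[of q] z0 by simp_all
  have n2: "2 \<le> n" "even (n - 2)" using n3 even by simp_all
  \<comment> \<open>This pair lies in the smallest congruence of level 2 and outside the largest one
    of level 0.\<close>
  define e where "e = (id_bar n 2, \<omega>)"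
  have e: "e \<in> mu 2" "e \<notin> R_cong n 0"
    unfolding e_def using id_bar_omega_mem[of 0 2] z0 n2 by simp_all
  then have e2: "e \<in> lam 2" "e \<in> rho 2" "e \<in> R_cong n 2" "e \<notin> lam 0" "e \<notin> rho 0" "e \<notin> mu 0"
    using cong_mono(5-8)[of 2] cong_mono(5-8)[of 0] by (meson subsetD)+
  have neq: "lam 0 \<noteq> rho 0" "lam 0 \<noteq> mu 0" "rho 0 \<noteq> mu 0" "lam 2 \<noteq> rho 2" "lam 2 \<noteq> mu 2" "rho 2 \<noteq> mu 2"
    "lam 0 \<noteq> lam 2" "lam 0 \<noteq> rho 2" "lam 0 \<noteq> mu 2" "rho 0 \<noteq> lam 2" "rho 0 \<noteq> rho 2" "rho 0 \<noteq> mu 2"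
    "mu 0 \<noteq> lam 2" "mu 0 \<noteq> rho 2" "mu 0 \<noteq> mu 2"
    using k0 k2 e e2 by metis+
  have Rneq: "R_cong n q \<noteq> lam 0" "R_cong n q \<noteq> rho 0" "R_cong n q \<noteq> mu 0"
    "R_cong n q \<noteq> lam 2" "R_cong n q \<noteq> rho 2" "R_cong n q \<noteq> mu 2" for q
    using ks[of q] k0 k2 by metis+
  show "distinct (map (R_cong n) (ranks_from z n) @
      [lambda_cong n 0, rho_cong n 0, mu_cong n 0, lambda_cong n 2, rho_cong n 2, mu_cong n 2])"
    unfolding L distinct_append
  proof (intro conjI)
    show "distinct (map (R_cong n) (ranks_from z n))" by (rule distinct_R)
    show "distinct [lam 0, rho 0, mu 0, lam 2, rho 2, mu 2]" using neq by simp
    show "set (map (R_cong n) (ranks_from z n)) \<inter> set [lam 0, rho 0, mu 0, lam 2, rho 2, mu 2] = {}"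
    proof (rule equals0I)
      fix w assume "w \<in> set (map (R_cong n) (ranks_from z n)) \<inter> set [lam 0, rho 0, mu 0, lam 2, rho 2, mu 2]"
      then obtain q where q: "w = R_cong n q" and "w \<in> {lam 0, rho 0, mu 0, lam 2, rho 2, mu 2}" by auto
      then have "R_cong n q \<in> {lam 0, rho 0, mu 0, lam 2, rho 2, mu 2}" by simp
      then show False by (simp add: Rneq)
    qed
  qed
  have C: "Cong (jones n) = set (map (R_cong n) (ranks_from z n)) \<union> {lam 0, rho 0, mu 0, lam 2, rho 2, mu 2}"
    unfolding Cong_eq small by auto
  then show "Cong (jones n) = set (map (R_cong n) (ranks_from z n)) \<union>
      {lambda_cong n 0, rho_cong n 0, mu_cong n 0, lambda_cong n 2, rho_cong n 2, mu_cong n 2}"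
    unfolding L .
  have mu0: "mu 0 = Id_on S" using mu_z z0 by simp
  then show "mu_cong n 0 = Id_on S" unfolding L .
  show "\<forall>\<xi> \<in> Cong (jones n). mu_cong n 0 \<subseteq> \<xi>"
    unfolding L mu0 Cong_def using cong_refl by auto
  have D: "diamond_cong n Dmu i = mu i" "diamond_cong n Dlambda i = lam i" "diamond_cong n Drho i = rho i"
    "diamond_cong n DR i = R_cong n i" if "i \<in> {0, 2}" for i
    using that L by auto
  have mono2: "mu 0 \<subseteq> mu 2" "lam 0 \<subseteq> lam 2" "rho 0 \<subseteq> rho 2" "R_cong n 0 \<subseteq> R_cong n 2"
    using cong_mono(1-4)[of 0 2] by simp_all
  have lower: "mu i \<subseteq> diamond_cong n \<xi> i" "diamond_cong n \<xi> i \<subseteq> R_cong n i" if "i \<in> {0, 2}" for \<xi> i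
    using D[OF that] cong_mono(5-8)[of i] by (cases \<xi>; simp; blast)+
  have step: "diamond_cong n \<xi> 0 \<subseteq> diamond_cong n \<xi> 2" for \<xi>
    using D[of 0] D[of 2] mono2 by (cases \<xi>) simp_all
  have kd: "(\<omega>, \<kappa>) \<in> diamond_cong n \<xi> i \<longleftrightarrow> \<xi> \<in> {Dlambda, DR}"
    "(\<omega>, star \<kappa>) \<in> diamond_cong n \<xi> i \<longleftrightarrow> \<xi> \<in> {Drho, DR}" if "i \<in> {0, 2}" for \<xi> i
  proof -
    have "z \<le> i" using z0 by simp
    from kappa_mem[OF this]
    show "(\<omega>, \<kappa>) \<in> diamond_cong n \<xi> i \<longleftrightarrow> \<xi> \<in> {Dlambda, DR}"
      "(\<omega>, star \<kappa>) \<in> diamond_cong n \<xi> i \<longleftrightarrow> \<xi> \<in> {Drho, DR}"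
      using D[OF that] by (cases \<xi>; simp)+
  qed
  show "\<forall>\<xi> \<zeta>. \<forall>i \<in> {0, 2}. \<forall>j \<in> {0, 2}.
      diamond_cong n \<xi> i \<subseteq> diamond_cong n \<zeta> j \<longleftrightarrow> diamond_le \<xi> \<zeta> \<and> i \<le> j"
  proof (intro allI ballI iffI)
    fix \<xi> \<zeta> and i j :: nat assume ij: "i \<in> {0, 2}" "j \<in> {0, 2}" and sub: "diamond_cong n \<xi> i \<subseteq> diamond_cong n \<zeta> j"
    \<comment> \<open>A member of the diamond is characterised by which of the two witness pairs it
      contains, so inclusion implies the order of the diamond.\<close>
    have "\<xi> \<in> {Dlambda, DR} \<longrightarrow> \<zeta> \<in> {Dlambda, DR}" "\<xi> \<in> {Drho, DR} \<longrightarrow> \<zeta> \<in> {Drho, DR}"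
      using sub kd[OF ij(1), of \<xi>] kd[OF ij(2), of \<zeta>] by blast+
    then have "diamond_le \<xi> \<zeta>" unfolding diamond_le_def by (cases \<xi>; cases \<zeta>) simp_all
    moreover have "i \<le> j"
    proof (rule ccontr)
      assume "\<not> i \<le> j"
      then have "i = 2" "j = 0" using ij by auto
      then show False using sub e lower(1)[of 2 \<xi>] lower(2)[of 0 \<zeta>] by blast
    qed
    ultimately show "diamond_le \<xi> \<zeta> \<and> i \<le> j" by blast
  next
    fix \<xi> \<zeta> and i j :: nat assume ij: "i \<in> {0, 2}" "j \<in> {0, 2}" and le: "diamond_le \<xi> \<zeta> \<and> i \<le> j"
    have "diamond_cong n \<xi> i \<subseteq> diamond_cong n \<xi> j"
      using ij le step[of \<xi>] by auto
    also have "\<dots> \<subseteq> diamond_cong n \<zeta> j"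
      using le lower[OF ij(2), of \<xi>] lower[OF ij(2), of \<zeta>] D[OF ij(2)] unfolding diamond_le_def by auto
    finally show "diamond_cong n \<xi> i \<subseteq> diamond_cong n \<zeta> j" .
  qed
  show "\<forall>\<xi>. \<forall>i \<in> {0, 2}. diamond_cong n \<xi> i \<subseteq> R_cong n 2"
  proof (intro allI ballI)
    fix \<xi> and i :: nat assume "i \<in> {0, 2}"
    then show "diamond_cong n \<xi> i \<subseteq> R_cong n 2" using lower(2)[of i \<xi>] mono2(4) by auto
  qed
  show "sorted_wrt (\<subset>) (map (R_cong n) (ranks_from 2 n))" by (rule sorted_R[OF le(3) n2(2)])
  have cases: "(\<exists>q\<in>set (ranks_from z n). w = R_cong n q) \<or> w = lam 0 \<or> w = rho 0 \<or> w = mu 0 \<or> w = lam 2 \<or> w = rho 2 \<or> w = mu 2"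
    if "w \<in> Cong (jones n)" for w
    using that unfolding C by auto
  have st: "{\<xi>. star_congruence n \<xi>} = set (map (R_cong n) (ranks_from z n)) \<union> {mu 0, mu 2}"
  proof (intro equalityI subsetI)
    fix \<xi> assume "\<xi> \<in> {\<xi>. star_congruence n \<xi>}"
    then have s: "star_congruence n \<xi>" by simp
    then have "\<xi> \<in> Cong (jones n)" by (simp add: star_congruence_def Cong_def)
    from cases[OF this] show "\<xi> \<in> set (map (R_cong n) (ranks_from z n)) \<union> {mu 0, mu 2}"
      using s not_star_congruence[OF le(1)] not_star_congruence[OF le(3)] by auto
  next
    fix \<xi> assume "\<xi> \<in> set (map (R_cong n) (ranks_from z n)) \<union> {mu 0, mu 2}"
    then show "\<xi> \<in> {\<xi>. star_congruence n \<xi>}"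
      using star_congruence_R star_congruence_mu[OF le(2)] star_congruence_mu[OF le(4)] by auto
  qed
  then show "{\<xi>. star_congruence n \<xi>} = set (map (R_cong n) (ranks_from z n)) \<union> {mu_cong n 0, mu_cong n 2}" unfolding L .
  show "{\<xi>. star_congruence n \<xi>} =
      Cong (jones n) - {lambda_cong n 0, lambda_cong n 2, rho_cong n 0, rho_cong n 2}"
    unfolding st C L
  proof (intro equalityI subsetI)
    fix w assume w: "w \<in> set (map (R_cong n) (ranks_from z n)) \<union> {mu 0, mu 2}"
    have "w \<notin> {lam 0, lam 2, rho 0, rho 2}"
    proof (cases "w \<in> {mu 0, mu 2}")
      case True
      then consider "w = mu 0" | "w = mu 2" by blast
      then show ?thesis by cases (simp_all add: neq neq[symmetric])
    next
      case False
      then obtain q where q: "w = R_cong n q" using w by auto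
      show ?thesis unfolding q by (simp add: Rneq)
    qed
    then show "w \<in> set (map (R_cong n) (ranks_from z n)) \<union> {lam 0, rho 0, mu 0, lam 2, rho 2, mu 2} -
        {lam 0, lam 2, rho 0, rho 2}" using w by blast
  qed blast
qed

end

theorem theorem9p1:
  fixes n z :: nat
  assumes "n \<ge> 3" and "z \<in> {0, 1}" and "z mod 2 = n mod 2"
  shows
    \<comment> \<open>(i)\<close>
    "({I. semigroup_ideal (jones n) I} = rank_ideal n ` set (ranks_from z n) \<and>
      (\<forall>q \<in> set (ranks_from z n). congruence (jones n) (R_cong n q))) \<and>
     \<comment> \<open>(ii)\<close>
     (odd n \<longrightarrow>
        {(I, M). retractable_IN_pair (jones n) I M \<and> (\<exists>q \<in> set (ranks_from z n). M = {id_bar n q})}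
          = {C_pair n 1} \<and>
        congruence (jones n) (lambda_cong n 1) \<and>
        congruence (jones n) (rho_cong n 1) \<and>
        congruence (jones n) (mu_cong n 1)) \<and>
     \<comment> \<open>(iii)\<close>
     (even n \<longrightarrow>
        {(I, M). retractable_IN_pair (jones n) I M \<and> (\<exists>q \<in> set (ranks_from z n). M = {id_bar n q})}
          = {C_pair n 0, C_pair n 2} \<and>
        (\<forall>i \<in> {0, 2}. congruence (jones n) (lambda_cong n i) \<and>
           congruence (jones n) (rho_cong n i) \<and>
           congruence (jones n) (mu_cong n i))) \<and>
     \<comment> \<open>(iv)\<close>
     (odd n \<longrightarrow>
        distinct (map (R_cong n) (ranks_from z n) @
          [lambda_cong n 1, rho_cong n 1, mu_cong n 1]) \<and>
        Cong (jones n) = set (map (R_cong n) (ranks_from z n)) \<union>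
          {lambda_cong n 1, rho_cong n 1, mu_cong n 1}) \<and>
     (even n \<longrightarrow>
        distinct (map (R_cong n) (ranks_from z n) @
          [lambda_cong n 0, rho_cong n 0, mu_cong n 0, lambda_cong n 2, rho_cong n 2, mu_cong n 2]) \<and>
        Cong (jones n) = set (map (R_cong n) (ranks_from z n)) \<union>
          {lambda_cong n 0, rho_cong n 0, mu_cong n 0, lambda_cong n 2, rho_cong n 2, mu_cong n 2}) \<and>
     \<comment> \<open>(v)\<close>
     (odd n \<longrightarrow>
        mu_cong n 1 = Id_on (carrier (jones n)) \<and>
        (\<forall>\<xi> \<in> Cong (jones n). mu_cong n 1 \<subseteq> \<xi>) \<and>
        covered_in (Cong (jones n)) (mu_cong n 1) (lambda_cong n 1) \<and>
        covered_in (Cong (jones n)) (mu_cong n 1) (rho_cong n 1) \<and>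
        \<not> lambda_cong n 1 \<subseteq> rho_cong n 1 \<and> \<not> rho_cong n 1 \<subseteq> lambda_cong n 1 \<and>
        covered_in (Cong (jones n)) (lambda_cong n 1) (R_cong n 1) \<and>
        covered_in (Cong (jones n)) (rho_cong n 1) (R_cong n 1) \<and>
        sorted_wrt (\<subset>) (map (R_cong n) (ranks_from 1 n)) \<and>
        R_cong n n = carrier (jones n) \<times> carrier (jones n)) \<and>
     (even n \<longrightarrow>
        (\<forall>\<xi> \<zeta>. \<forall>i \<in> {0, 2}. \<forall>j \<in> {0, 2}.
           diamond_cong n \<xi> i \<subseteq> diamond_cong n \<zeta> j \<longleftrightarrow> diamond_le \<xi> \<zeta> \<and> i \<le> j) \<and>
        mu_cong n 0 = Id_on (carrier (jones n)) \<and>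
        (\<forall>\<xi> \<in> Cong (jones n). mu_cong n 0 \<subseteq> \<xi>) \<and>
        (\<forall>\<xi>. \<forall>i \<in> {0, 2}. diamond_cong n \<xi> i \<subseteq> R_cong n 2) \<and>
        sorted_wrt (\<subset>) (map (R_cong n) (ranks_from 2 n)) \<and>
        R_cong n n = carrier (jones n) \<times> carrier (jones n)) \<and>
     \<comment> \<open>(vi)\<close>
     (odd n \<longrightarrow>
        {\<xi>. star_congruence n \<xi>} = Cong (jones n) - {lambda_cong n 1, rho_cong n 1} \<and>
        {\<xi>. star_congruence n \<xi>} = set (map (R_cong n) (ranks_from z n)) \<union> {mu_cong n 1}) \<and>
     (even n \<longrightarrow>
        {\<xi>. star_congruence n \<xi>} =
          Cong (jones n) - {lambda_cong n 0, lambda_cong n 2, rho_cong n 0, rho_cong n 2} \<and>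
        {\<xi>. star_congruence n \<xi>} =
          set (map (R_cong n) (ranks_from z n)) \<union> {mu_cong n 0, mu_cong n 2})"
proof -
  interpret jones_degree n z by standard (rule assms)+
  have z1: "z = 1" if "odd n" using that assms(2,3) by (auto simp: odd_iff_mod_2_eq_one)
  have z0: "z = 0" if "even n" using that assms(2,3) by (auto simp: even_iff_mod_2_eq_zero)
  show ?thesis
  proof (cases "odd n")
    case True
    note T = theorem_odd[OF z1[OF True]]
    show ?thesis
      by (intro conjI impI;
          (erule notE[OF True] | rule ideals | rule ballI, rule congruence_R | rule R_cong_top | rule T))
  next
    case False
    then have even: "even n" by simp
    note T = theorem_even[OF z0[OF even]]
    show ?thesis
      by (intro conjI impI;
          (erule notE, rule even | rule ideals | rule ballI, rule congruence_R | rule R_cong_top | rule T))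
  qed
qed

end
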